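(* For every constant $\epsilon>0$ there is a distributed algorithm for the unit height throughput maximization problem on tree-networks which outputs a feasible solution $S$ with $p(S)\geq p(\mathrm{Opt})/(7+\epsilon)$, i.e. it has approximation ratio $(7+\epsilon)$. Its number of communication rounds is $O\!\left(T_{MIS}\cdot \log n\cdot \log(1/\epsilon)\cdot \log(p_{\max}/p_{\min})\right)$.
   Context: Unit height throughput maximization on tree-networks: $V$ is a set of $n$ vertices and $\mathcal{T}=\{T_1,\dots,T_r\}$ is a set of trees ("tree-networks"), each having vertex set $V$ (their edge sets may differ). There are $m$ processors. Each processor $P$ owns exactly one demand $a=(u,v)$ with $u,v\in V$ and profit $p(a)>0$, and it has a set $\mathrm{Acc}(P)\subseteq\mathcal{T}$ of accessible tree-networks. For each demand $a$ owned by $P$ and each $T\in\mathrm{Acc}(P)$ there is a demand instance $d$ of $a$ on $T$, with the same endpoints and profit; $\mathrm{path}(d)$ denotes the unique $u$–$v$ path in $T$. Two demand instances overlap if they lie on the same tree-network and their paths share an edge. They conflict if they belong to the same demand or overlap. A feasible solution is a set $S$ of pairwise non-conflicting demand instances, and its profit $p(S)$ is the sum of their profits. $\mathrm{Opt}$ is a feasible solution of maximum profit, and $p_{\max},p_{\min}$ are the maximum and minimum demand profits. Distributed model: synchronous message passing among processors. Two processors $P_1,P_2$ can communicate directly iff $\mathrm{Acc}(P_1)\cap\mathrm{Acc}(P_2)\neq\emptyset$. In each round every processor may exchange messages with all processors it can communicate with, and local computation is polynomial. $T_{MIS}$ denotes the number of rounds needed to compute a maximal independent set in an arbitrary graph on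 $N=mr$ vertices (e.g. $O(\log N)$ via Luby's randomized algorithm, or $O(2^{\sqrt{\log N}})$ deterministically). *)

theory Defs
  imports "HOL-Probability.Probability"
begin

definition simple_path :: "'v set set \<Rightarrow> 'v \<Rightarrow> 'v \<Rightarrow> 'v list \<Rightarrow> bool" where
  "simple_path E u v xs \<longleftrightarrow>
     xs \<noteq> [] \<and> hd xs = u \<and> last xs = v \<and> distinct xs \<and> successively (\<lambda>x y. {x, y} \<in> E) xs"

definition cycle_in :: "'v set set \<Rightarrow> 'v list \<Rightarrow> bool" where
  "cycle_in E xs \<longleftrightarrow>
     length xs \<ge> 3 \<and> distinct xs \<and> successively (\<lambda>x y. {x, y} \<in> E) xs \<and> {last xs, hd xs} \<in> E"

definition is_tree :: "'v set \<Rightarrow> 'v set set \<Rightarrow> bool" where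
  "is_tree V E \<longleftrightarrow>
     V \<noteq> {} \<and> E \<subseteq> {{u, v} | u v. u \<in> V \<and> v \<in> V \<and> u \<noteq> v} \<and>
     (\<forall>u\<in>V. \<forall>v\<in>V. \<exists>xs. simple_path E u v xs) \<and> (\<nexists>xs. cycle_in E xs)"

definition path_edges :: "'v list \<Rightarrow> 'v set set" where
  "path_edges xs = {{xs ! i, xs ! Suc i} | i. Suc i < length xs}"

text \<open>
  The vertex set is \<open>{..<num_vertices I}\<close>; tree-networks and processors are likewise named by
  the numbers below \<open>num_trees I\<close> and \<open>num_procs I\<close>. As every processor owns exactly one demand,
  processors and demands share their names.
\<close>

record throughput_problem =
  num_vertices :: nat
  num_procs :: nat
  num_trees :: nat
  tree_edges :: "nat \<Rightarrow> nat set set"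
  source :: "nat \<Rightarrow> nat"
  target :: "nat \<Rightarrow> nat"
  profit :: "nat \<Rightarrow> real"
  Acc :: "nat \<Rightarrow> nat set"

definition valid_problem :: "throughput_problem \<Rightarrow> bool" where
  "valid_problem I \<longleftrightarrow>
     num_procs I > 0 \<and>
     (\<forall>j<num_trees I. is_tree {..<num_vertices I} (tree_edges I j)) \<and>
     (\<forall>P<num_procs I. source I P < num_vertices I \<and> target I P < num_vertices I \<and>
        profit I P > 0 \<and> Acc I P \<subseteq> {..<num_trees I})"

text \<open>The pair \<open>(P, j)\<close> is the instance of the demand of processor \<open>P\<close> on tree-network \<open>j\<close>.\<close>

definition demand_instances :: "throughput_problem \<Rightarrow> (nat \<times> nat) set" where
  "demand_instances I = {(P, j). P < num_procs I \<and> j \<in> Acc I P}"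

definition demand_path :: "throughput_problem \<Rightarrow> nat \<times> nat \<Rightarrow> nat set set" where
  "demand_path I d = (case d of (P, j) \<Rightarrow>
     path_edges (THE xs. simple_path (tree_edges I j) (source I P) (target I P) xs))"

definition overlap :: "throughput_problem \<Rightarrow> nat \<times> nat \<Rightarrow> nat \<times> nat \<Rightarrow> bool" where
  "overlap I d d' \<longleftrightarrow> snd d = snd d' \<and> demand_path I d \<inter> demand_path I d' \<noteq> {}"

definition conflict :: "throughput_problem \<Rightarrow> nat \<times> nat \<Rightarrow> nat \<times> nat \<Rightarrow> bool" where
  "conflict I d d' \<longleftrightarrow> fst d = fst d' \<or> overlap I d d'"

definition feasible :: "throughput_problem \<Rightarrow> (nat \<times> nat) set \<Rightarrow> bool" where
  "feasible I S \<longleftrightarrow>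
     S \<subseteq> demand_instances I \<and> (\<forall>d\<in>S. \<forall>d'\<in>S. d \<noteq> d' \<longrightarrow> \<not> conflict I d d')"

definition total_profit :: "throughput_problem \<Rightarrow> (nat \<times> nat) set \<Rightarrow> real" where
  "total_profit I S = (\<Sum>d\<in>S. profit I (fst d))"

definition opt_profit :: "throughput_problem \<Rightarrow> real" where
  "opt_profit I = Max {total_profit I S | S. feasible I S}"

lemma opt_profit_attained:
  assumes "valid_problem I"
  shows "\<exists>Opt. feasible I Opt \<and> total_profit I Opt = opt_profit I"
    and "feasible I S \<Longrightarrow> total_profit I S \<le> opt_profit I"
proof -
  have "demand_instances I \<subseteq> {..<num_procs I} \<times> {..<num_trees I}"
    using assms by (auto simp: demand_instances_def valid_problem_def)
  then have "finite (demand_instances I)"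
    by (rule finite_subset) simp
  then have "finite {S. feasible I S}"
    by (rule finite_subset[rotated, OF finite_Pow_iff[THEN iffD2]]) (auto simp: feasible_def)
  then have fin: "finite {total_profit I S | S. feasible I S}"
    by (simp add: setcompr_eq_image)
  have "feasible I {}" by (simp add: feasible_def)
  then have "{total_profit I S | S. feasible I S} \<noteq> {}" by blast
  from Max_in[OF fin this] show "\<exists>Opt. feasible I Opt \<and> total_profit I Opt = opt_profit I"
    unfolding opt_profit_def by auto
  show "feasible I S \<Longrightarrow> total_profit I S \<le> opt_profit I"
    unfolding opt_profit_def using fin by (intro Max_ge) auto
qed

definition p_max :: "throughput_problem \<Rightarrow> real" where
  "p_max I = Max (profit I ` {..<num_procs I})"

definition p_min :: "throughput_problem \<Rightarrow> real" where
  "p_min I = Min (profit I ` {..<num_procs I})"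

text \<open>
  Local computations are programs of a small first-order functional language over nested lists
  of real numbers (with de Bruijn variables), where arithmetic on numbers has unit cost.
  The only recursion is iteration over a list. All programs therefore terminate, and no
  polynomial-time computation is lost: a computation with a polynomial time bound can be
  simulated by nested iteration over its input.
\<close>

datatype val = VNum real | VNil | VCons val val

primrec vsize :: "val \<Rightarrow> nat" where
  "vsize (VNum x) = 1"
| "vsize VNil = 1"
| "vsize (VCons a b) = 1 + vsize a + vsize b"

primrec vlist :: "val list \<Rightarrow> val" where
  "vlist [] = VNil"
| "vlist (x # xs) = VCons x (vlist xs)"

primrec velems :: "val \<Rightarrow> val list" where
  "velems (VNum x) = []"
| "velems VNil = []"
| "velems (VCons a b) = a # velems b"

abbreviation vnat :: "nat \<Rightarrow> val" where
  "vnat k \<equiv> VNum (real k)"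

abbreviation vbool :: "bool \<Rightarrow> val" where
  "vbool b \<equiv> (if b then VNum 1 else VNil)"

primrec vhd :: "val \<Rightarrow> val" where
  "vhd (VNum x) = VNil"
| "vhd VNil = VNil"
| "vhd (VCons a b) = a"

primrec vtl :: "val \<Rightarrow> val" where
  "vtl (VNum x) = VNil"
| "vtl VNil = VNil"
| "vtl (VCons a b) = b"

datatype arith_op = Plus | Minus | Times | Divide

primrec arith_fun :: "arith_op \<Rightarrow> real \<Rightarrow> real \<Rightarrow> real" where
  "arith_fun Plus = (+)"
| "arith_fun Minus = (-)"
| "arith_fun Times = (*)"
| "arith_fun Divide = (/)"

definition varith :: "arith_op \<Rightarrow> val \<Rightarrow> val \<Rightarrow> val" where
  "varith f a b = (case (a, b) of (VNum x, VNum y) \<Rightarrow> VNum (arith_fun f x y) | _ \<Rightarrow> VNil)"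

definition vless :: "val \<Rightarrow> val \<Rightarrow> val" where
  "vless a b = (case (a, b) of (VNum x, VNum y) \<Rightarrow> vbool (x < y) | _ \<Rightarrow> VNil)"

datatype prog =
    Var nat
  | Numeral rat
  | Empty
  | Pair prog prog
  | Head prog
  | Tail prog
  | Arith arith_op prog prog
  | Less prog prog
  | Equal prog prog
  | Cond prog prog prog
  | Bind prog prog  \<comment> \<open>the value of the first program is variable 0 of the second\<close>
  | Fold prog prog prog
      \<comment> \<open>list, initial accumulator, body with variable 0 the element and variable 1 the accumulator\<close>

primrec eval :: "prog \<Rightarrow> val list \<Rightarrow> val" where
  "eval (Var i) env = (if i < length env then env ! i else VNil)"
| "eval (Numeral q) env = VNum (of_rat q)"
| "eval Empty env = VNil"
| "eval (Pair a b) env = VCons (eval a env) (eval b env)"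
| "eval (Head a) env = vhd (eval a env)"
| "eval (Tail a) env = vtl (eval a env)"
| "eval (Arith f a b) env = varith f (eval a env) (eval b env)"
| "eval (Less a b) env = vless (eval a env) (eval b env)"
| "eval (Equal a b) env = vbool (eval a env = eval b env)"
| "eval (Cond c a b) env = (if eval c env \<noteq> VNil then eval a env else eval b env)"
| "eval (Bind a b) env = eval b (eval a env # env)"
| "eval (Fold l a b) env =
     foldl (\<lambda>acc x. eval b (x # acc # env)) (eval a env) (velems (eval l env))"

text \<open>
  Looking up, building and dismantling a value is charged its size, so that repeated sharing
  (\<open>Pair (Var 0) (Var 0)\<close>) cannot create exponentially large values in polynomial time.
\<close>

primrec cost :: "prog \<Rightarrow> val list \<Rightarrow> nat" where
  "cost (Var i) env = vsize (eval (Var i) env)"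
| "cost (Numeral q) env = 1"
| "cost Empty env = 1"
| "cost (Pair a b) env = cost a env + cost b env + vsize (eval (Pair a b) env)"
| "cost (Head a) env = cost a env + vsize (eval (Head a) env)"
| "cost (Tail a) env = cost a env + vsize (eval (Tail a) env)"
| "cost (Arith f a b) env = cost a env + cost b env + 1"
| "cost (Less a b) env = cost a env + cost b env + 1"
| "cost (Equal a b) env = cost a env + cost b env + 1"
| "cost (Cond c a b) env =
     cost c env + (if eval c env \<noteq> VNil then cost a env else cost b env) + 1"
| "cost (Bind a b) env = cost a env + cost b (eval a env # env) + 1"
| "cost (Fold l a b) env = cost l env + cost a env + 1 +
     snd (foldl (\<lambda>(acc, t) x. (eval b (x # acc # env), t + cost b (x # acc # env) + 1))
            (eval a env, 0) (velems (eval l env)))"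

lemma vsize_eval_le_cost: "vsize (eval e env) \<le> cost e env"
proof (induction e arbitrary: env)
  case (Arith f a b)
  then show ?case by (simp add: varith_def split: val.split)
next
  case (Less a b)
  then show ?case by (simp add: vless_def split: val.split)
next
  case (Cond c a b)
  show ?case using Cond.IH(2)[of env] Cond.IH(3)[of env] by simp
next
  case (Bind a b)
  show ?case using Bind.IH(2)[of "eval a env # env"] by simp
next
  case (Fold l a b)
  let ?f = "\<lambda>acc x. eval b (x # acc # env)"
  let ?g = "\<lambda>(acc, t) x. (eval b (x # acc # env), t + cost b (x # acc # env) + 1)"
  have fst_g: "fst (foldl ?g (v, t) xs) = foldl ?f v xs" for v t xs
    by (induction xs arbitrary: v t) auto
  have "vsize (foldl ?f (eval a env) xs) \<le> cost a env + snd (foldl ?g (eval a env, 0) xs)" for xs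
  proof (cases xs rule: rev_cases)
    case Nil
    then show ?thesis using Fold.IH(2)[of env] by simp
  next
    case (snoc ys y)
    then show ?thesis
      using Fold.IH(3)[of "y # foldl ?f (eval a env) ys # env"] fst_g[of "eval a env" 0 ys]
      by (simp add: case_prod_beta)
  qed
  from this[of "velems (eval l env)"] show ?case by simp
qed auto

text \<open>
  All nodes run the same programs, started on their local inputs. In each round a node with state
  \<open>s\<close> sends to every neighbour \<open>q\<close> the value of \<open>send\<close> on \<open>s, q\<close>, and computes its new state with
  \<open>recv\<close> from \<open>s\<close>, the list of received messages (each paired with its sender) and a list of fresh
  fair coin tosses, whose number is the length of the list computed by \<open>coins\<close>. A node halts as soon
  as \<open>decide\<close> yields a pair, whose head is then its irrevocable output.
\<close>

record dist_alg =
  start :: prog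
  coins :: prog
  send :: prog
  recv :: prog
  decide :: prog

text \<open>A network has nodes \<open>{..<k}\<close>, a symmetric relation \<open>adj\<close> and local inputs \<open>inp\<close>.\<close>

definition halted :: "dist_alg \<Rightarrow> val \<Rightarrow> bool" where
  "halted A s \<longleftrightarrow> (\<exists>a b. eval (decide A) [s] = VCons a b)"

definition output_of :: "dist_alg \<Rightarrow> val \<Rightarrow> val" where
  "output_of A s = vhd (eval (decide A) [s])"

definition inbox :: "nat \<Rightarrow> (nat \<Rightarrow> nat \<Rightarrow> bool) \<Rightarrow> dist_alg \<Rightarrow> (nat \<Rightarrow> val) \<Rightarrow> nat \<Rightarrow> val" where
  "inbox k adj A \<sigma> p =
     vlist (map (\<lambda>q. VCons (vnat q) (eval (send A) [\<sigma> q, vnat p]))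
              (filter (\<lambda>q. adj q p \<and> \<not> halted A (\<sigma> q)) [0..<k]))"

abbreviation vcoins :: "bool list \<Rightarrow> val" where
  "vcoins bs \<equiv> vlist (map vbool bs)"

definition advance ::
    "nat \<Rightarrow> (nat \<Rightarrow> nat \<Rightarrow> bool) \<Rightarrow> dist_alg \<Rightarrow> (nat \<Rightarrow> val) \<Rightarrow> (nat \<Rightarrow> bool list) \<Rightarrow> nat \<Rightarrow> val" where
  "advance k adj A \<sigma> \<omega> p =
     (if p < k \<and> \<not> halted A (\<sigma> p)
      then eval (recv A) [\<sigma> p, inbox k adj A \<sigma> p, vcoins (\<omega> p)] else \<sigma> p)"

definition toss :: "nat \<Rightarrow> dist_alg \<Rightarrow> (nat \<Rightarrow> val) \<Rightarrow> (nat \<Rightarrow> bool list) pmf" where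
  "toss k A \<sigma> = Pi_pmf {..<k} []
     (\<lambda>p. pmf_of_set {bs. length bs = length (velems (eval (coins A) [\<sigma> p]))})"

primrec run ::
    "nat \<Rightarrow> (nat \<Rightarrow> nat \<Rightarrow> bool) \<Rightarrow> (nat \<Rightarrow> val) \<Rightarrow> dist_alg \<Rightarrow> nat \<Rightarrow> (nat \<Rightarrow> val) pmf" where
  "run k adj inp A 0 = return_pmf (\<lambda>p. eval (start A) [inp p])"
| "run k adj inp A (Suc t) =
     bind_pmf (run k adj inp A t) (\<lambda>\<sigma>. map_pmf (advance k adj A \<sigma>) (toss k A \<sigma>))"

definition deterministic :: "dist_alg \<Rightarrow> bool" where
  "deterministic A \<longleftrightarrow> (\<forall>s. velems (eval (coins A) [s]) = [])"

text \<open>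
  In each of the first \<open>R\<close> rounds the local computations of every node cost at most \<open>B\<close>,
  whatever the outcome of the coin tosses.
\<close>

definition local_cost_bounded ::
    "nat \<Rightarrow> (nat \<Rightarrow> nat \<Rightarrow> bool) \<Rightarrow> (nat \<Rightarrow> val) \<Rightarrow> dist_alg \<Rightarrow> nat \<Rightarrow> nat \<Rightarrow> bool" where
  "local_cost_bounded k adj inp A R B \<longleftrightarrow>
     (\<forall>p<k. cost (start A) [inp p] \<le> B) \<and>
     (\<forall>t\<le>R. \<forall>\<sigma>\<in>set_pmf (run k adj inp A t). \<forall>p<k. cost (decide A) [\<sigma> p] \<le> B) \<and>
     (\<forall>t<R. \<forall>\<sigma>\<in>set_pmf (run k adj inp A t). \<forall>p<k. \<not> halted A (\<sigma> p) \<longrightarrow>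
        cost (coins A) [\<sigma> p] \<le> B \<and>
        (\<forall>q<k. adj p q \<longrightarrow> cost (send A) [\<sigma> p, vnat q] \<le> B) \<and>
        (\<forall>\<omega>\<in>set_pmf (toss k A \<sigma>).
           cost (recv A) [\<sigma> p, inbox k adj A \<sigma> p, vcoins (\<omega> p)] \<le> B))"

definition simple_graph :: "nat \<Rightarrow> (nat \<Rightarrow> nat \<Rightarrow> bool) \<Rightarrow> bool" where
  "simple_graph N adj \<longleftrightarrow> (\<forall>x<N. \<not> adj x x) \<and> (\<forall>x<N. \<forall>y<N. adj x y \<longrightarrow> adj y x)"

definition maximal_independent_set :: "nat \<Rightarrow> (nat \<Rightarrow> nat \<Rightarrow> bool) \<Rightarrow> nat set \<Rightarrow> bool" where
  "maximal_independent_set N adj X \<longleftrightarrow>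
     X \<subseteq> {..<N} \<and> (\<forall>x\<in>X. \<forall>y\<in>X. \<not> adj x y) \<and> (\<forall>y<N. y \<notin> X \<longrightarrow> (\<exists>x\<in>X. adj x y))"

text \<open>A vertex knows the number of vertices, its own name and the names of its neighbours.\<close>

definition mis_input :: "nat \<Rightarrow> (nat \<Rightarrow> nat \<Rightarrow> bool) \<Rightarrow> nat \<Rightarrow> val" where
  "mis_input N adj x =
     vlist [vnat N, vnat x, vlist (map vnat (filter (adj x) [0..<N]))]"

definition mis_success :: "nat \<Rightarrow> (nat \<Rightarrow> nat \<Rightarrow> bool) \<Rightarrow> dist_alg \<Rightarrow> (nat \<Rightarrow> val) \<Rightarrow> bool" where
  "mis_success N adj M \<sigma> \<longleftrightarrow>
     (\<forall>x<N. halted M (\<sigma> x)) \<and>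
     maximal_independent_set N adj {x. x < N \<and> output_of M (\<sigma> x) \<noteq> VNil}"

text \<open>
  \<open>M\<close> computes a maximal independent set of an arbitrary graph on \<open>N\<close> vertices in \<open>T N\<close> rounds with
  failure probability at most \<open>\<delta> N\<close>; for deterministic algorithms one takes \<open>\<delta> N = 0\<close>.
\<close>

definition mis_algorithm :: "dist_alg \<Rightarrow> (nat \<Rightarrow> nat) \<Rightarrow> (nat \<Rightarrow> real) \<Rightarrow> bool" where
  "mis_algorithm M T \<delta> \<longleftrightarrow>
     (\<forall>N adj. simple_graph N adj \<longrightarrow>
        measure_pmf.prob (run N adj (mis_input N adj) M (T N)) {\<sigma>. mis_success N adj M \<sigma>}
          \<ge> 1 - \<delta> N) \<and>
     (\<exists>c. \<forall>N adj. simple_graph N adj \<longrightarrow>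
        local_cost_bounded N adj (mis_input N adj) M (T N) (c * N ^ c + c))"

definition communicate :: "throughput_problem \<Rightarrow> nat \<Rightarrow> nat \<Rightarrow> bool" where
  "communicate I P Q \<longleftrightarrow> P \<noteq> Q \<and> Acc I P \<inter> Acc I Q \<noteq> {}"

definition vtree :: "throughput_problem \<Rightarrow> nat \<Rightarrow> val" where
  "vtree I j = vlist [VCons (vnat u) (vnat v).
     u \<leftarrow> [0..<num_vertices I], v \<leftarrow> [0..<num_vertices I], u < v \<and> {u, v} \<in> tree_edges I j]"

text \<open>
  Initially a processor knows the global parameters \<open>n\<close>, \<open>m\<close>, \<open>r\<close>, \<open>p\<^sub>m\<^sub>i\<^sub>n\<close>, \<open>p\<^sub>m\<^sub>a\<^sub>x\<close>, the number
  of rounds needed for a maximal independent set, its own name and demand, and its accessible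
  tree-networks.
\<close>

definition proc_input :: "throughput_problem \<Rightarrow> nat \<Rightarrow> nat \<Rightarrow> val" where
  "proc_input I t_mis P = vlist
     [vnat (num_vertices I), vnat (num_procs I), vnat (num_trees I),
      VNum (p_min I), VNum (p_max I), vnat t_mis,
      vnat P, vnat (source I P), vnat (target I P), VNum (profit I P),
      vlist (map (\<lambda>j. VCons (vnat j) (vtree I j))
               (filter (\<lambda>j. j \<in> Acc I P) [0..<num_trees I]))]"

text \<open>A processor outputs the list of the tree-networks on which its demand is scheduled.\<close>

definition solution_of :: "throughput_problem \<Rightarrow> dist_alg \<Rightarrow> (nat \<Rightarrow> val) \<Rightarrow> (nat \<times> nat) set" where
  "solution_of I A \<sigma> =
     {(P, j). P < num_procs I \<and> vnat j \<in> set (velems (output_of A (\<sigma> P)))}"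

abbreviation run_on ::
    "throughput_problem \<Rightarrow> nat \<Rightarrow> dist_alg \<Rightarrow> nat \<Rightarrow> (nat \<Rightarrow> val) pmf" where
  "run_on I t_mis A \<equiv> run (num_procs I) (communicate I) (proc_input I t_mis) A"

definition problem_size :: "throughput_problem \<Rightarrow> nat" where
  "problem_size I = num_vertices I + num_procs I + num_trees I"

text \<open>
  Logarithmic factors are truncated at 1, as usual inside an \<open>O\<close>-bound: for instance
  \<open>log (p_max / p_min)\<close> vanishes for uniform profits.
\<close>

definition log1 :: "real \<Rightarrow> real" where
  "log1 x = max 1 (log 2 x)"

definition num_phases :: "real \<Rightarrow> throughput_problem \<Rightarrow> real" where
  "num_phases \<epsilon> I =
     log1 (real (num_vertices I)) * log1 (1 / \<epsilon>) * log1 (p_max I / p_min I)"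

end

theory Submission
  imports Defs
begin

text \<open>
  The algorithm is a primal-dual scheme. Each tree is decomposed into heavy paths, and every vertex
  gets a rank such that along a heavy path two equal ranks have a higher rank in between. The layer
  of a demand instance is the largest power \<open>2 ^ rank \<le> n\<^sup>2\<close> on the heavy parts of its path; at most six
  edges of the path are critical, and if the path of an instance of smaller or equal layer meets the path of
  another one, then some critical edge of the former lies on the latter. There are \<open>O(log n)\<close> layers.

  The dual variables are raised layer by layer. Within a layer there are \<open>b = O(log (1 / \<epsilon>))\<close> stages, where
  stage \<open>j\<close> is over when all dual constraints of the layer are satisfied up to the factor
  \<open>1 - (14 / 15) ^ j\<close>. A step of a stage raises a maximal independent set of the violated instances. A neighbour
  that is still violated afterwards has more than twice the profit, so \<open>O(log (p_max / p_min))\<close> steps suffice.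
  Raising an instance contributes at most \<open>7\<close> times its dual increment to the dual objective, one for its demand and six for its
  critical edges, and selecting the raised instances greedily in reverse order collects all
  these increments.

  A processor holds the vertices of the conflict graph that belong to its own instances. As adjacent
  instances belong to the same or to communicating processors, a round of the given algorithm for maximal independent sets on
  \<open>N = m r\<close> vertices takes a single round of communication; names without an instance are isolated vertices.
\<close>

section \<open>Programs\<close>

text \<open>No processor can see whether a stage is over elsewhere, so all of them move in lockstep:
  the numbers of epochs, stages, steps and rounds are worst cases that each computes from the global
  parameters it is given.

  The ratio 14/15 is forced by 7. A stage lets the slack of a constraint shrink from 15/14 y p to y
  p, a loss of y p / 14, while raising a neighbour adds at least y p' / 7; the quotient 2 gives the
  doubling of profits.

  Squares of subtree sizes serve the ranks: below a light edge with lower subtree size s, all ranks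
  k satisfy \<open>2 ^ k\<close> <= s^2, and the interval of its upper end has length at least 2
  s^2, so the rank strictly drops. With plain sizes the interval would only be known to be longer
  than s, too little for the factor two.

  The algorithm for maximal independent sets is a black box, correct with a certain probability and
  cheap only on states that it really reaches. Hence its simulation must agree in distribution, not
  just in outcome, and costs are bounded along reachable configurations. Failure probabilities add
  up over the steps. The constant C is absolute, whereas the cost exponent may depend on \<epsilon>
  and on the black box.\<close>

primrec lift :: "nat \<Rightarrow> prog \<Rightarrow> prog" where
  "lift c (Var i) = Var (if i < c then i else Suc i)"
| "lift c (Numeral q) = Numeral q"
| "lift c Empty = Empty"
| "lift c (Pair a b) = Pair (lift c a) (lift c b)"
| "lift c (Head a) = Head (lift c a)"
| "lift c (Tail a) = Tail (lift c a)"
| "lift c (Arith f a b) = Arith f (lift c a) (lift c b)"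
| "lift c (Less a b) = Less (lift c a) (lift c b)"
| "lift c (Equal a b) = Equal (lift c a) (lift c b)"
| "lift c (Cond e a b) = Cond (lift c e) (lift c a) (lift c b)"
| "lift c (Bind a b) = Bind (lift c a) (lift (Suc c) b)"
| "lift c (Fold l a b) = Fold (lift c l) (lift c a) (lift (Suc (Suc c)) b)"

definition delete_at :: "nat \<Rightarrow> 'a list \<Rightarrow> 'a list" where
  "delete_at c xs = take c xs @ drop (Suc c) xs"

lemma delete_at_0 [simp]: "delete_at 0 (x # xs) = xs"
  and delete_at_Suc [simp]: "delete_at (Suc c) (x # xs) = x # delete_at c xs"
  by (auto simp: delete_at_def)

lemma eval_lift: "eval (lift c e) env = eval e (delete_at c env)"
proof (induction e arbitrary: c env)
  case (Var i)
  then show ?case by (auto simp: delete_at_def nth_append min_def)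
qed auto

lemma cost_lift: "cost (lift c e) env = cost e (delete_at c env)"
proof (induction e arbitrary: c env)
  case (Var i)
  then show ?case by (auto simp: delete_at_def nth_append min_def)
next
  case (Fold l a b)
  show ?case by (simp only: lift.simps cost.simps Fold.IH eval_lift delete_at_Suc)
qed (auto simp: eval_lift)

abbreviation up :: "prog \<Rightarrow> prog" where "up \<equiv> lift 0"

lemma eval_up [simp]: "eval (up e) (x # env) = eval e env"
  by (simp add: eval_lift)

lemma eval_lift_1 [simp]: "eval (lift (Suc 0) e) (x # y # env) = eval e (x # env)"
  by (simp add: eval_lift)

text \<open>
  A program called with \<open>k\<close> arguments may still refer to further variables, which have to evaluate to \<open>VNil\<close>
  as in an environment of length \<open>k\<close>.
\<close>

primrec clip :: "nat \<Rightarrow> prog \<Rightarrow> prog" where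
  "clip c (Var i) = (if i < c then Var i else Empty)"
| "clip c (Numeral q) = Numeral q"
| "clip c Empty = Empty"
| "clip c (Pair a b) = Pair (clip c a) (clip c b)"
| "clip c (Head a) = Head (clip c a)"
| "clip c (Tail a) = Tail (clip c a)"
| "clip c (Arith f a b) = Arith f (clip c a) (clip c b)"
| "clip c (Less a b) = Less (clip c a) (clip c b)"
| "clip c (Equal a b) = Equal (clip c a) (clip c b)"
| "clip c (Cond e a b) = Cond (clip c e) (clip c a) (clip c b)"
| "clip c (Bind a b) = Bind (clip c a) (clip (Suc c) b)"
| "clip c (Fold l a b) = Fold (clip c l) (clip c a) (clip (Suc (Suc c)) b)"

lemma eval_clip: "c \<le> length env \<Longrightarrow> eval (clip c e) env = eval e (take c env)"
  by (induction e arbitrary: c env) auto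

lemma cost_clip: "c \<le> length env \<Longrightarrow> cost (clip c e) env = cost e (take c env)"
proof (induction e arbitrary: c env)
  case (Fold l a b)
  have *: "Suc (Suc c) \<le> length (x # acc # env)" for x acc using Fold.prems by simp
  show ?case
    by (simp only: clip.simps cost.simps Fold.IH(1,2)[OF Fold.prems] Fold.IH(3)[OF *]
        eval_clip[OF Fold.prems] eval_clip[OF *] take_Suc_Cons)
qed (auto simp: eval_clip)

text \<open>In \<open>call2\<close> and \<open>call3\<close> the last argument is bound first, so
  that the first one becomes variable 0. The clipped body cannot see the caller's variables, hence a
  called program behaves exactly as in the short environments in which \<open>dist_alg\<close> runs
  it.\<close>

definition call1 :: "prog \<Rightarrow> prog \<Rightarrow> prog" where
  "call1 e a = Bind a (clip 1 e)"

definition call2 :: "prog \<Rightarrow> prog \<Rightarrow> prog \<Rightarrow> prog" where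
  "call2 e a b = Bind b (Bind (up a) (clip 2 e))"

definition call3 :: "prog \<Rightarrow> prog \<Rightarrow> prog \<Rightarrow> prog \<Rightarrow> prog" where
  "call3 e a b c = Bind c (Bind (up b) (Bind (up (up a)) (clip 3 e)))"

lemma eval_call [simp]:
  "eval (call1 e a) env = eval e [eval a env]"
  "eval (call2 e a b) env = eval e [eval a env, eval b env]"
  "eval (call3 e a b c) env = eval e [eval a env, eval b env, eval c env]"
  by (simp_all add: call1_def call2_def call3_def eval_clip numeral_eq_Suc)

lemma vsize_pos [simp]: "0 < vsize v" "Suc 0 \<le> vsize v"
proof -
  show "0 < vsize v" by (cases v) auto
  then show "Suc 0 \<le> vsize v" by simp
qed

lemma vbool_eq_VNil [simp]: "(vbool b = VNil) = (\<not> b)" "(VNil = vbool b) = (\<not> b)"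
  by auto

lemma velems_vlist [simp]: "velems (vlist xs) = xs"
  by (induction xs) auto

lemma vlist_eq_iff [simp]: "vlist xs = vlist ys \<longleftrightarrow> xs = ys"
  by (metis velems_vlist)

lemma vlist_eq_VNil [simp]: "vlist xs = VNil \<longleftrightarrow> xs = []" "VNil = vlist xs \<longleftrightarrow> xs = []"
  by (cases xs; simp)+

lemma vsize_vlist: "vsize (vlist xs) = 1 + (\<Sum>x\<leftarrow>xs. 1 + vsize x)"
  by (induction xs) auto

lemma vsize_velems: "x \<in> set (velems v) \<Longrightarrow> vsize x \<le> vsize v"
  by (induction v) auto

lemma length_velems: "length (velems v) \<le> vsize v"
  by (induction v) (auto simp: le_SucI trans_le_add2)

lemma vlist_velems_le: "vsize (vlist (velems v)) \<le> vsize v"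
  by (induction v) auto

section \<open>List processing by folds\<close>

definition REV :: "prog \<Rightarrow> prog" where
  "REV l = Fold l Empty (Pair (Var 0) (Var 1))"

text \<open>A fold conses in front of its accumulator, so the first list has to be reversed
  beforehand.\<close>

definition APP :: "prog \<Rightarrow> prog \<Rightarrow> prog" where
  "APP a b = Fold (REV a) b (Pair (Var 0) (Var 1))"

text \<open>Walking through the reversed list, each result is prepended to what comes after it, and
  the accumulator grows just by the size of that result. \<open>lift 1\<close> hides the
  accumulator, which \<open>Fold\<close> inserts between the element and the environment.\<close>

definition FLATMAP :: "prog \<Rightarrow> prog \<Rightarrow> prog" where
  "FLATMAP l f = Fold (REV l) Empty (APP (lift 1 f) (Var 1))"

definition MAP :: "prog \<Rightarrow> prog \<Rightarrow> prog" where
  "MAP l f = FLATMAP l (Pair f Empty)"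

definition FILTER :: "prog \<Rightarrow> prog \<Rightarrow> prog" where
  "FILTER l c = FLATMAP l (Cond c (Pair (Var 0) Empty) Empty)"

definition SUMP :: "prog \<Rightarrow> prog \<Rightarrow> prog" where
  "SUMP l f = Fold l (Numeral 0) (Arith Plus (Var 1) (lift 1 f))"

definition COUNT :: "prog \<Rightarrow> prog \<Rightarrow> prog" where
  "COUNT l c = SUMP l (Cond c (Numeral 1) (Numeral 0))"

definition EXISTS :: "prog \<Rightarrow> prog \<Rightarrow> prog" where
  "EXISTS l c = Fold l Empty (Cond (lift 1 c) (Numeral 1) (Var 1))"

definition AND :: "prog \<Rightarrow> prog \<Rightarrow> prog" where "AND a b = Cond a b Empty"
definition OR :: "prog \<Rightarrow> prog \<Rightarrow> prog" where "OR a b = Cond a (Numeral 1) b"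
definition NOT :: "prog \<Rightarrow> prog" where "NOT a = Cond a Empty (Numeral 1)"

definition MEM :: "prog \<Rightarrow> prog \<Rightarrow> prog" where
  "MEM x l = EXISTS l (Equal (Var 0) (up x))"

text \<open>The language has no test for pairs. Head and tail of a number or of \<open>VNil\<close>
  are \<open>VNil\<close>, so only a genuine pair equals the pair of its own head and tail.\<close>

definition IS_PAIR :: "prog \<Rightarrow> prog" where
  "IS_PAIR e = Bind e (Equal (Var 0) (Pair (Head (Var 0)) (Tail (Var 0))))"

text \<open>The accumulator pairs the part of the second list that is still to be consumed with the
  reversed result.\<close>

definition ZIP :: "prog \<Rightarrow> prog \<Rightarrow> prog" where
  "ZIP a b = REV (Tail (Fold a (Pair b Empty)
     (Pair (Tail (Head (Var 1))) (Pair (Pair (Var 0) (Head (Head (Var 1)))) (Tail (Var 1))))))"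

primrec FIELD :: "nat \<Rightarrow> prog \<Rightarrow> prog" where
  "FIELD 0 e = Head e"
| "FIELD (Suc i) e = FIELD i (Tail e)"

definition LIST :: "prog list \<Rightarrow> prog" where
  "LIST es = foldr Pair es Empty"

lemma foldl_VCons: "foldl (\<lambda>acc x. VCons x acc) (vlist ys) xs = vlist (rev xs @ ys)"
  by (induction xs arbitrary: ys) (auto simp flip: vlist.simps(2))

lemma foldl_VCons_Nil [simp]: "foldl (\<lambda>acc x. VCons x acc) VNil xs = vlist (rev xs)"
  using foldl_VCons[of "[]" xs] by simp

lemma eval_REV [simp]: "eval (REV l) env = vlist (rev (velems (eval l env)))"
  by (simp add: REV_def)

lemma eval_APP: "eval b env = vlist ys \<Longrightarrow> eval (APP a b) env = vlist (velems (eval a env) @ ys)"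
  by (simp add: APP_def foldl_VCons)

lemma eval_FLATMAP [simp]:
  "eval (FLATMAP l f) env = vlist (concat (map (\<lambda>x. velems (eval f (x # env))) (velems (eval l env))))"
proof -
  have "foldl (\<lambda>acc x. eval (APP (lift 1 f) (Var 1)) (x # acc # env)) (vlist ys) (rev xs)
      = vlist (concat (map (\<lambda>x. velems (eval f (x # env))) xs) @ ys)" for xs ys
  proof (induction xs arbitrary: ys rule: rev_induct)
    case (snoc x xs)
    have *: "eval (APP (lift 1 f) (Var 1)) (x # vlist ys # env) = vlist (velems (eval f (x # env)) @ ys)"
      by (subst eval_APP[where ys = ys]) auto
    show ?case unfolding rev_append by (simp only: rev.simps append.simps foldl.simps * snoc.IH) simp
  qed simp
  from this[of "[]"] show ?thesis by (simp add: FLATMAP_def)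
qed

lemma concat_map_single: "concat (map (\<lambda>x. [f x]) xs) = map f xs"
  by (induction xs) auto

lemma eval_MAP [simp]:
  "eval (MAP l f) env = vlist (map (\<lambda>x. eval f (x # env)) (velems (eval l env)))"
  by (simp add: MAP_def concat_map_single)

lemma eval_FILTER [simp]:
  "eval (FILTER l c) env = vlist (filter (\<lambda>x. eval c (x # env) \<noteq> VNil) (velems (eval l env)))"
proof -
  have "concat (map (\<lambda>x. velems (if P x then VCons x VNil else VNil)) xs) = filter P xs" for P xs
    by (induction xs) auto
  note this[of "\<lambda>x. eval c (x # env) \<noteq> VNil"]
  then show ?thesis by (simp add: FILTER_def cong: if_cong)
qed

lemma eval_EXISTS [simp]:
  "eval (EXISTS l c) env = vbool (\<exists>x\<in>set (velems (eval l env)). eval c (x # env) \<noteq> VNil)"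
proof -
  have "foldl (\<lambda>acc x. if eval c (x # env) \<noteq> VNil then VNum 1 else acc) (vbool b) xs
     = vbool (b \<or> (\<exists>x\<in>set xs. eval c (x # env) \<noteq> VNil))" for xs b
  proof (induction xs arbitrary: b)
    case (Cons x xs)
    show ?case using Cons.IH[of True] Cons.IH[of b] by (cases b) auto
  qed auto
  from this[of False] show ?thesis by (simp add: EXISTS_def cong: if_cong)
qed

lemma eval_SUMP:
  assumes "\<And>x. x \<in> set (velems (eval l env)) \<Longrightarrow> eval f (x # env) = VNum (g x)"
  shows "eval (SUMP l f) env = VNum (\<Sum>x\<leftarrow>velems (eval l env). g x)"
proof -
  have "foldl (\<lambda>acc x. varith Plus acc (eval f (x # env))) (VNum y) xs = VNum (y + (\<Sum>x\<leftarrow>xs. g x))"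
    if "\<forall>x\<in>set xs. eval f (x # env) = VNum (g x)" for xs y
    using that by (induction xs arbitrary: y) (auto simp: varith_def)
  from this[of _ 0] assms show ?thesis by (simp add: SUMP_def)
qed

lemma eval_COUNT [simp]:
  "eval (COUNT l c) env = vnat (length (filter (\<lambda>x. eval c (x # env) \<noteq> VNil) (velems (eval l env))))"
proof -
  have "(\<Sum>x\<leftarrow>xs. if P x then 1 else 0) = real (length (filter P xs))" for xs :: "val list" and P
    by (induction xs) auto
  then show ?thesis unfolding COUNT_def
    by (subst eval_SUMP[where g = "\<lambda>x. if eval c (x # env) \<noteq> VNil then 1 else 0"]) auto
qed

lemma eval_AND [simp]: "eval (AND a b) env = (if eval a env \<noteq> VNil then eval b env else VNil)"
  by (simp add: AND_def)
lemma eval_OR [simp]: "eval (OR a b) env = (if eval a env \<noteq> VNil then VNum 1 else eval b env)"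
  by (simp add: OR_def)
lemma eval_NOT [simp]: "eval (NOT a) env = vbool (eval a env = VNil)"
  by (simp add: NOT_def)
lemma eval_MEM [simp]: "eval (MEM x l) env = vbool (eval x env \<in> set (velems (eval l env)))"
  by (simp add: MEM_def)

lemma eval_IS_PAIR [simp]: "eval (IS_PAIR e) env = vbool (\<exists>a b. eval e env = VCons a b)"
  by (cases "eval e env") (simp_all add: IS_PAIR_def)

lemma eval_FIELD: "eval (FIELD i e) env = vhd ((vtl ^^ i) (eval e env))"
  by (induction i arbitrary: e) (simp_all add: funpow_swap1)

lemma vhd_vtl_vlist: "i < length xs \<Longrightarrow> vhd ((vtl ^^ i) (vlist xs)) = xs ! i"
proof (induction xs arbitrary: i)
  case (Cons x xs)
  then show ?case by (cases i) (simp_all add: funpow_swap1)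
qed simp

lemma eval_LIST [simp]: "eval (LIST es) env = vlist (map (\<lambda>e. eval e env) es)"
  by (induction es) (auto simp: LIST_def)

lemma eval_ZIP:
  assumes "length (velems (eval a env)) = length (velems (eval b env))"
  shows "eval (ZIP a b) env = vlist (map2 VCons (velems (eval a env)) (velems (eval b env)))"
proof -
  let ?f = "\<lambda>acc x. VCons (vtl (vhd acc)) (VCons (VCons x (vhd (vhd acc))) (vtl acc))"
  have "length xs = length (velems v) \<Longrightarrow>
      vtl (foldl ?f (VCons v (vlist zs)) xs) = vlist (rev (map2 VCons xs (velems v)) @ zs)" for xs v zs
  proof (induction xs arbitrary: v zs)
    case (Cons x xs)
    then obtain u v' where v: "v = VCons u v'" by (cases v) auto
    have "vtl (foldl ?f (VCons v (vlist zs)) (x # xs))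
        = vtl (foldl ?f (VCons v' (vlist (VCons x u # zs))) xs)"
      by (simp add: v)
    also have "\<dots> = vlist (rev (map2 VCons xs (velems v')) @ VCons x u # zs)"
      by (rule Cons.IH) (use Cons.prems v in simp)
    finally show ?case by (simp add: v)
  qed simp
  from this[of _ _ "[]"] assms show ?thesis by (simp add: ZIP_def)
qed

section \<open>Polynomial bounds\<close>

declare add_2_eq_Suc' [simp del]

text \<open>One exponent serves the whole set \<open>X\<close>, in which problems of all sizes occur
  together. The base is at least 2, so constants and sums are absorbed by a larger exponent.\<close>

definition pbd :: "(nat \<times> 'a) set \<Rightarrow> (nat \<times> 'a \<Rightarrow> nat) \<Rightarrow> bool" where
  "pbd X f \<longleftrightarrow> (\<exists>k. \<forall>x\<in>X. f x \<le> (fst x + 2) ^ k)"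

lemma pbd_le: "pbd X g \<Longrightarrow> (\<And>x. x \<in> X \<Longrightarrow> f x \<le> g x) \<Longrightarrow> pbd X f"
  unfolding pbd_def by (meson order_trans)

lemma pbd_mono: "pbd X f \<Longrightarrow> Y \<subseteq> X \<Longrightarrow> pbd Y f"
  unfolding pbd_def by blast

lemma pbd_const [intro, simp]: "pbd X (\<lambda>_. c)"
proof -
  have "c \<le> (a + 2) ^ c" for a :: nat
  proof -
    have "c \<le> 2 ^ c" using less_exp[of c] by simp
    also have "\<dots> \<le> (a + 2) ^ c" by (rule power_mono) auto
    finally show ?thesis .
  qed
  then show ?thesis unfolding pbd_def by blast
qed

lemma pbd_fst [intro, simp]: "pbd X fst"
  unfolding pbd_def by (rule exI[of _ 1]) auto

lemma pbd_mult [intro]: "pbd X f \<Longrightarrow> pbd X g \<Longrightarrow> pbd X (\<lambda>x. f x * g x)"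
  unfolding pbd_def by (metis mult_le_mono power_add)

lemma pbd_add [intro]:
  assumes "pbd X f" "pbd X g" shows "pbd X (\<lambda>x. f x + g x)"
proof -
  from pbd_mult[OF pbd_const[of X 2] pbd_mult[of X "\<lambda>x. Suc (f x)" "\<lambda>x. Suc (g x)"]]
  have *: "pbd X (\<lambda>x. 2 * (Suc (f x) * Suc (g x)))" if "pbd X (\<lambda>x. Suc (f x))" "pbd X (\<lambda>x. Suc (g x))"
    using that by blast
  have S: "pbd X (\<lambda>x. Suc (h x))" if hh: "pbd X h" for h
  proof -
    obtain k where k: "\<forall>x\<in>X. h x \<le> (fst x + 2) ^ k" using hh unfolding pbd_def by blast
    have "pbd X (\<lambda>x. 2 * (fst x + 2) ^ k)"
      by (rule pbd_mult[OF pbd_const]) (auto simp: pbd_def)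
    then show ?thesis
    proof (rule pbd_le)
      fix x assume "x \<in> X"
      then have "h x \<le> (fst x + 2) ^ k" "0 < (fst x + 2) ^ k" using k by auto
      then show "Suc (h x) \<le> 2 * (fst x + 2) ^ k" by linarith
    qed
  qed
  show ?thesis by (rule pbd_le[OF *[OF S S]]) (use assms in auto)
qed

lemma pbd_Suc [intro]: "pbd X f \<Longrightarrow> pbd X (\<lambda>x. Suc (f x))"
  using pbd_add[OF _ pbd_const[of X 1]] by simp

lemma pbd_power [intro]: "pbd X f \<Longrightarrow> pbd X (\<lambda>x. f x ^ k)"
  by (induction k) auto


text \<open>
  In a pair \<open>(s, env)\<close>, the number \<open>s\<close> is the size of the problem in which the environment \<open>env\<close> occurs.
\<close>

definition polyon :: "(nat \<times> val list) set \<Rightarrow> prog \<Rightarrow> bool" where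
  "polyon X e \<longleftrightarrow> pbd X (\<lambda>x. cost e (snd x))"

definition psz :: "(nat \<times> val list) set \<Rightarrow> bool" where
  "psz X \<longleftrightarrow> pbd X (\<lambda>x. sum_list (map vsize (snd x)))"

text \<open>Holds for programs that are cheap on arbitrary small environments, well-formed or not,
  and is closed under the combinators. Programs that call the black box only satisfy
  \<open>polyon\<close> on suitable sets, which is why both notions are kept.\<close>

definition polyp :: "prog \<Rightarrow> bool" where
  "polyp e \<longleftrightarrow> (\<forall>X. psz X \<longrightarrow> polyon X e)"

lemma polypD: "polyp e \<Longrightarrow> psz X \<Longrightarrow> polyon X e"
  by (auto simp: polyp_def)

lemma polyon_mono: "polyon X e \<Longrightarrow> Y \<subseteq> X \<Longrightarrow> polyon Y e"
  unfolding polyon_def by (rule pbd_mono)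

lemma psz_mono: "psz X \<Longrightarrow> Y \<subseteq> X \<Longrightarrow> psz Y"
  unfolding psz_def by (rule pbd_mono)

lemma polyon_size: "polyon X e \<Longrightarrow> pbd X (\<lambda>x. vsize (eval e (snd x)))"
  unfolding polyon_def by (erule pbd_le) (rule vsize_eval_le_cost)

text \<open>The environments inside a binder, where \<open>f\<close> gives the values that may be
  pushed.\<close>

definition extend :: "(nat \<times> val list) set \<Rightarrow> (val list \<Rightarrow> val set) \<Rightarrow> (nat \<times> val list) set" where
  "extend X f = {(s, v # env) | s v env. (s, env) \<in> X \<and> v \<in> f env}"

lemma psz_extend:
  assumes "psz X" "pbd X h" "\<And>s env v. (s, env) \<in> X \<Longrightarrow> v \<in> f env \<Longrightarrow> vsize v \<le> h (s, env)"
  shows "psz (extend X f)"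
proof -
  from pbd_add[OF assms(1)[unfolded psz_def] assms(2)]
  obtain k where k: "\<And>x. x \<in> X \<Longrightarrow> sum_list (map vsize (snd x)) + h x \<le> (fst x + 2) ^ k"
    by (auto simp: pbd_def)
  show ?thesis unfolding psz_def pbd_def extend_def
  proof (intro exI ballI, clarify)
    fix s v env assume "(s, env) \<in> X" "v \<in> f env"
    then show "sum_list (map vsize (snd (s, v # env))) \<le> (fst (s, v # env) + 2) ^ k"
      using k[of "(s, env)"] assms(3)[of s env v] by simp
  qed
qed

lemma psz_bind: "psz X \<Longrightarrow> polyon X a \<Longrightarrow> psz (extend X (\<lambda>env. {eval a env}))"
  by (rule psz_extend[OF _ polyon_size]) auto

lemma psz_elems: "psz X \<Longrightarrow> polyon X l \<Longrightarrow> psz (extend X (\<lambda>env. set (velems (eval l env))))"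
  by (rule psz_extend[OF _ polyon_size]) (auto intro: vsize_velems)

lemma polyon_Var: "psz X \<Longrightarrow> polyon X (Var i)"
  unfolding polyon_def psz_def
proof (erule pbd_le[OF pbd_Suc], goal_cases)
  case (1 x)
  show ?case
  proof (cases "i < length (snd x)")
    case True
    then have "vsize (snd x ! i) \<in> set (map vsize (snd x))" by auto
    from member_le_sum_list[OF this] True show ?thesis by simp
  qed auto
qed

lemma polyon_Numeral: "polyon X (Numeral q)"
  and polyon_Empty: "polyon X Empty"
  by (auto simp: polyon_def)

lemma polyon_Pair: "polyon X a \<Longrightarrow> polyon X b \<Longrightarrow> polyon X (Pair a b)"
proof -
  assume "polyon X a" "polyon X b"
  then have "pbd X (\<lambda>x. cost a (snd x) + cost b (snd x) + (1 + cost a (snd x) + cost b (snd x)))"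
    unfolding polyon_def by (intro pbd_add) auto
  then show ?thesis unfolding polyon_def
    by (rule pbd_le) (simp add: add_mono vsize_eval_le_cost)
qed

lemma vsize_vhd: "vsize (vhd v) \<le> vsize v" and vsize_vtl: "vsize (vtl v) \<le> vsize v"
  by (cases v; simp)+

lemma polyon_Head: "polyon X a \<Longrightarrow> polyon X (Head a)"
proof -
  assume "polyon X a"
  then have "pbd X (\<lambda>x. cost a (snd x) + cost a (snd x))"
    unfolding polyon_def by (intro pbd_add)
  then show ?thesis unfolding polyon_def
    by (rule pbd_le) (simp add: order_trans[OF vsize_vhd vsize_eval_le_cost])
qed

lemma polyon_Tail: "polyon X a \<Longrightarrow> polyon X (Tail a)"
proof -
  assume "polyon X a"
  then have "pbd X (\<lambda>x. cost a (snd x) + cost a (snd x))"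
    unfolding polyon_def by (intro pbd_add)
  then show ?thesis unfolding polyon_def
    by (rule pbd_le) (simp add: order_trans[OF vsize_vtl vsize_eval_le_cost])
qed

lemma polyon_Arith: "polyon X a \<Longrightarrow> polyon X b \<Longrightarrow> polyon X (Arith f a b)"
  and polyon_Less: "polyon X a \<Longrightarrow> polyon X b \<Longrightarrow> polyon X (Less a b)"
  and polyon_Equal: "polyon X a \<Longrightarrow> polyon X b \<Longrightarrow> polyon X (Equal a b)"
  unfolding polyon_def by (auto intro!: pbd_Suc pbd_add)

text \<open>Each branch is charged only where it is taken. This is what allows a call of the black
  box to be guarded by a test that the state is one of its running states.\<close>

lemma polyon_Cond:
  assumes "polyon X c" "polyon {x\<in>X. eval c (snd x) \<noteq> VNil} a" "polyon {x\<in>X. eval c (snd x) = VNil} b"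
  shows "polyon X (Cond c a b)"
proof -
  let ?h = "\<lambda>x. if eval c (snd x) \<noteq> VNil then cost a (snd x) else cost b (snd x)"
  obtain k l where kl: "\<And>x. x \<in> X \<Longrightarrow> eval c (snd x) \<noteq> VNil \<Longrightarrow> cost a (snd x) \<le> (fst x + 2) ^ k"
     "\<And>x. x \<in> X \<Longrightarrow> eval c (snd x) = VNil \<Longrightarrow> cost b (snd x) \<le> (fst x + 2) ^ l"
    using assms(2,3) unfolding polyon_def pbd_def by fastforce
  have "pbd X ?h"
  proof (rule pbd_le)
    show "pbd X (\<lambda>x. (fst x + 2) ^ k + (fst x + 2) ^ l)" by (intro pbd_add pbd_power pbd_fst pbd_const)
    show "?h x \<le> (fst x + 2) ^ k + (fst x + 2) ^ l" if "x \<in> X" for x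
      using kl(1)[OF that] kl(2)[OF that] by auto
  qed
  then have "pbd X (\<lambda>x. cost c (snd x) + Suc (?h x))"
    using assms(1) unfolding polyon_def by (intro pbd_add pbd_Suc)
  then show ?thesis unfolding polyon_def
  proof (rule pbd_le)
    show "cost (Cond c a b) (snd x) \<le> cost c (snd x) + Suc (?h x)" for x :: "nat \<times> val list"
      by simp
  qed
qed

lemma polyon_Bind:
  assumes "polyon X a" "polyon (extend X (\<lambda>env. {eval a env})) b"
  shows "polyon X (Bind a b)"
proof -
  obtain k where k: "\<And>y. y \<in> extend X (\<lambda>env. {eval a env}) \<Longrightarrow> cost b (snd y) \<le> (fst y + 2) ^ k"
    using assms(2) unfolding polyon_def pbd_def by blast
  have "pbd X (\<lambda>x. cost a (snd x) + (fst x + 2) ^ k + 1)"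
    using assms(1) unfolding polyon_def by (intro pbd_add pbd_power pbd_fst pbd_const)
  then show ?thesis unfolding polyon_def
  proof (rule pbd_le)
    fix x assume "x \<in> X"
    then have "(fst x, eval a (snd x) # snd x) \<in> extend X (\<lambda>env. {eval a env})"
      by (cases x) (auto simp: extend_def)
    from k[OF this] show "cost (Bind a b) (snd x) \<le> cost a (snd x) + (fst x + 2) ^ k + 1" by simp
  qed
qed

lemma Fold_cost_le:
  assumes "\<And>i. i < length xs \<Longrightarrow>
     cost b (xs ! i # foldl (\<lambda>acc x. eval b (x # acc # env)) v (take i xs) # env) \<le> B"
  shows "snd (foldl (\<lambda>(acc, t) x. (eval b (x # acc # env), t + cost b (x # acc # env) + 1)) (v, t) xs)
    \<le> t + length xs * (B + 1)"
  using assms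
proof (induction xs arbitrary: v t)
  case (Cons x xs)
  have *: "cost b (x # v # env) \<le> B" using Cons.prems[of 0] by simp
  have "snd (foldl (\<lambda>(acc, t) x. (eval b (x # acc # env), t + cost b (x # acc # env) + 1))
       (eval b (x # v # env), t + cost b (x # v # env) + 1) xs)
     \<le> t + cost b (x # v # env) + 1 + length xs * (B + 1)"
    by (rule Cons.IH) (use Cons.prems[of "Suc _"] in auto)
  then show ?case using * by simp
qed simp

text \<open>The crucial case: an accumulator that doubles in every iteration would become
  exponentially large. If an iteration adds at most \<open>g\<close> to its size, all intermediate
  environments stay polynomial, and so does the body on them. The body is required to be cheap on
  any small set of environments of this form, because the accumulators that occur can only be named
  inside the proof.\<close>

lemma polyon_Fold:
  assumes X: "psz X" "polyon X l" "polyon X a"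
    and grow: "pbd X g" "\<And>s env x acc. (s, env) \<in> X \<Longrightarrow> x \<in> set (velems (eval l env)) \<Longrightarrow>
       vsize (eval b (x # acc # env)) \<le> vsize acc + g (s, env)"
    and b: "\<And>Y. psz Y \<Longrightarrow> (\<exists>f. Y = extend (extend X f) (\<lambda>aenv. set (velems (eval l (tl aenv)))))
       \<Longrightarrow> polyon Y b"
  shows "polyon X (Fold l a b)"
proof -
  let ?h = "\<lambda>x. cost a (snd x) + cost l (snd x) * g x"
  have h: "pbd X ?h" using X grow(1) unfolding polyon_def by (intro pbd_add pbd_mult) auto
  then obtain k where k: "\<And>x. x \<in> X \<Longrightarrow> ?h x \<le> (fst x + 2) ^ k"
    by (auto simp: pbd_def)
  \<comment> \<open>All intermediate accumulators, one for each prefix of the list.\<close>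
  define F where "F env = {foldl (\<lambda>acc x. eval b (x # acc # env)) (eval a env) (take i (velems (eval l env))) |i.
      i \<le> length (velems (eval l env))}" for env
  have acc: "vsize (foldl (\<lambda>acc x. eval b (x # acc # env)) v xs) \<le> vsize v + length xs * g (s, env)"
    if "(s, env) \<in> X" "set xs \<subseteq> set (velems (eval l env))" for s env v xs
    using that(2)
  proof (induction xs arbitrary: v)
    case (Cons x xs)
    have "vsize (eval b (x # v # env)) \<le> vsize v + g (s, env)"
      using grow(2)[OF that(1)] Cons.prems by simp
    with Cons.IH[of "eval b (x # v # env)"] Cons.prems show ?case by simp
  qed simp
  have F: "vsize v \<le> ?h (s, env)" if "(s, env) \<in> X" "v \<in> F env" for s env v
  proof -
    from that(2) obtain i where i: "i \<le> length (velems (eval l env))"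
      and v: "v = foldl (\<lambda>acc x. eval b (x # acc # env)) (eval a env) (take i (velems (eval l env)))"
      by (auto simp: F_def)
    have "vsize v \<le> vsize (eval a env) + i * g (s, env)"
      unfolding v using acc[OF that(1), of "take i (velems (eval l env))" "eval a env"] i
      by (simp add: min.absorb2 set_take_subset)
    also have "\<dots> \<le> cost a env + cost l env * g (s, env)"
      using i length_velems[of "eval l env"] vsize_eval_le_cost[of l env]
      by (intro add_mono mult_right_mono vsize_eval_le_cost) auto
    finally show ?thesis by simp
  qed
  let ?Y = "extend (extend X F) (\<lambda>aenv. set (velems (eval l (tl aenv))))"
  have pF: "psz (extend X F)"
    by (rule psz_extend[OF X(1) h]) (use F in auto)
  have "psz ?Y"
  proof -
    obtain k' where k': "\<And>x. x \<in> X \<Longrightarrow> cost l (snd x) \<le> (fst x + 2) ^ k'"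
      using X(2) by (auto simp: polyon_def pbd_def)
    show ?thesis
    proof (rule psz_extend[OF pF, of "\<lambda>x. (fst x + 2) ^ k'"])
      show "pbd (extend X F) (\<lambda>x. (fst x + 2) ^ k')" by (intro pbd_power pbd_add pbd_fst) auto
      fix s aenv v assume "(s, aenv) \<in> extend X F" "v \<in> set (velems (eval l (tl aenv)))"
      then have "(s, tl aenv) \<in> X" "vsize v \<le> cost l (tl aenv)"
        using vsize_velems vsize_eval_le_cost order_trans by (fastforce simp: extend_def)+
      with k'[of "(s, tl aenv)"] show "vsize v \<le> (fst (s, aenv) + 2) ^ k'" by simp
    qed
  qed
  from b[OF this] obtain m where m: "\<And>y. y \<in> ?Y \<Longrightarrow> cost b (snd y) \<le> (fst y + 2) ^ m"
    by (auto simp: polyon_def pbd_def)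
  have "pbd X (\<lambda>x. cost l (snd x) + cost a (snd x) + 1 + cost l (snd x) * ((fst x + 2) ^ m + 1))"
    using X(2,3) unfolding polyon_def by (intro pbd_add pbd_mult pbd_power pbd_fst) auto
  then show ?thesis unfolding polyon_def
  proof (rule pbd_le, clarify)
    fix s env assume x: "(s, env) \<in> X"
    let ?xs = "velems (eval l env)"
    have "snd (foldl (\<lambda>(acc, t) x. (eval b (x # acc # env), t + cost b (x # acc # env) + 1)) (eval a env, 0) ?xs)
      \<le> 0 + length ?xs * ((s + 2) ^ m + 1)"
    proof (rule Fold_cost_le)
      fix i assume i: "i < length ?xs"
      have "(s, ?xs ! i # foldl (\<lambda>acc x. eval b (x # acc # env)) (eval a env) (take i ?xs) # env) \<in> ?Y"
        using x i by (fastforce simp: extend_def F_def)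
      from m[OF this] show "cost b (?xs ! i # foldl (\<lambda>acc x. eval b (x # acc # env)) (eval a env) (take i ?xs) # env)
         \<le> (s + 2) ^ m" by simp
    qed
    also have "\<dots> \<le> cost l env * ((s + 2) ^ m + 1)"
      using order_trans[OF length_velems vsize_eval_le_cost[of l env]] by (simp del: mult_Suc_right add_Suc_right)
    finally show "cost (Fold l a b) (snd (s, env)) \<le> cost l (snd (s, env)) + cost a (snd (s, env)) + 1
        + cost l (snd (s, env)) * ((fst (s, env) + 2) ^ m + 1)"
      by simp
  qed
qed

section \<open>Closure of polynomial cost under the program constructors\<close>

lemma polyp_Var [intro]: "polyp (Var i)"
  by (simp add: polyp_def polyon_Var)
lemma polyp_Numeral [intro]: "polyp (Numeral q)" and polyp_Empty [intro]: "polyp Empty"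
  by (simp_all add: polyp_def polyon_Numeral polyon_Empty)
lemma polyp_Pair [intro]: "polyp a \<Longrightarrow> polyp b \<Longrightarrow> polyp (Pair a b)"
  by (simp add: polyp_def polyon_Pair)
lemma polyp_Head [intro]: "polyp a \<Longrightarrow> polyp (Head a)"
  by (simp add: polyp_def polyon_Head)
lemma polyp_Tail [intro]: "polyp a \<Longrightarrow> polyp (Tail a)"
  by (simp add: polyp_def polyon_Tail)
lemma polyp_ops [intro]: "polyp a \<Longrightarrow> polyp b \<Longrightarrow> polyp (Arith f a b)"
  "polyp a \<Longrightarrow> polyp b \<Longrightarrow> polyp (Less a b)"
  "polyp a \<Longrightarrow> polyp b \<Longrightarrow> polyp (Equal a b)"
  by (simp_all add: polyp_def polyon_Arith polyon_Less polyon_Equal)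
lemma polyp_Cond [intro]: "polyp c \<Longrightarrow> polyp a \<Longrightarrow> polyp b \<Longrightarrow> polyp (Cond c a b)"
  unfolding polyp_def by (blast intro: polyon_Cond polyon_mono)
lemma polyp_Bind [intro]: "polyp a \<Longrightarrow> polyp b \<Longrightarrow> polyp (Bind a b)"
  unfolding polyp_def by (blast intro: polyon_Bind psz_bind)

lemma sum_list_delete_at: "sum_list (map vsize (delete_at c env)) \<le> sum_list (map vsize env)"
proof (induction env arbitrary: c)
  case (Cons x env)
  show ?case by (cases c) (auto simp: Cons.IH trans_le_add2)
qed (simp add: delete_at_def)

lemma polyon_lift_gen: "polyon ((\<lambda>x. (fst x, delete_at c (snd x))) ` X) e \<Longrightarrow> polyon X (lift c e)"
  unfolding polyon_def pbd_def by (auto simp: cost_lift)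

lemma polyp_lift [intro]: "polyp e \<Longrightarrow> polyp (lift c e)"
  unfolding polyp_def
proof (intro allI impI polyon_lift_gen)
  fix X assume "\<forall>X. psz X \<longrightarrow> polyon X e" "psz X"
  moreover from \<open>psz X\<close> have "psz ((\<lambda>x. (fst x, delete_at c (snd x))) ` X)"
    unfolding psz_def pbd_def by (auto intro: order_trans[OF sum_list_delete_at])
  ultimately show "polyon ((\<lambda>x. (fst x, delete_at c (snd x))) ` X) e" by blast
qed

text \<open>The lifted body does not see the accumulator, so a bound on the plain extension by
  elements carries over whatever accumulators \<open>h\<close> occur.\<close>

lemma polyon_lift1:
  assumes "polyon (extend X (\<lambda>env. set (velems (eval l env)))) f"
  shows "polyon (extend (extend X h) (\<lambda>aenv. set (velems (eval l (tl aenv))))) (lift 1 f)"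
proof (rule polyon_lift_gen[OF polyon_mono[OF assms]], rule subsetI)
  fix y assume "y \<in> (\<lambda>x. (fst x, delete_at 1 (snd x))) `
      extend (extend X h) (\<lambda>aenv. set (velems (eval l (tl aenv))))"
  then obtain s x acc env where "(s, env) \<in> X" "x \<in> set (velems (eval l env))"
      "y = (s, delete_at (Suc 0) (x # acc # env))"
    by (auto simp: extend_def)
  then show "y \<in> extend X (\<lambda>env. set (velems (eval l env)))"
    by (simp add: extend_def)
qed

lemma polyon_cons_Fold:
  assumes "psz X" "polyon X l" "polyon X a"
  shows "polyon X (Fold l a (Pair (Var 0) (Var 1)))"
proof (rule polyon_Fold[where g = "\<lambda>x. Suc (cost l (snd x))"])
  show "pbd X (\<lambda>x. Suc (cost l (snd x)))" using assms(2) by (auto simp: polyon_def)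
  fix s env x acc assume "(s, env) \<in> X" "x \<in> set (velems (eval l env))"
  then have "vsize x \<le> cost l env"
    using vsize_velems vsize_eval_le_cost order_trans by blast
  then show "vsize (eval (Pair (Var 0) (Var 1)) (x # acc # env)) \<le> vsize acc + Suc (cost l (snd (s, env)))"
    by simp
qed (use assms in \<open>auto intro: polyon_Pair polyon_Var\<close>)

lemma polyon_REV: "psz X \<Longrightarrow> polyon X l \<Longrightarrow> polyon X (REV l)"
  unfolding REV_def by (intro polyon_cons_Fold polyon_Empty)

lemma polyon_APP: "psz X \<Longrightarrow> polyon X a \<Longrightarrow> polyon X b \<Longrightarrow> polyon X (APP a b)"
  unfolding APP_def by (intro polyon_cons_Fold polyon_REV)

lemma vsize_foldl_VCons: "vsize (foldl (\<lambda>acc x. VCons x acc) v xs) = vsize v + (\<Sum>x\<leftarrow>xs. 1 + vsize x)"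
  by (induction xs arbitrary: v) auto

lemma vsize_eval_APP: "vsize (eval (APP a b) env) \<le> vsize (eval b env) + vsize (eval a env)"
proof -
  have "(\<Sum>x\<leftarrow>rev xs. 1 + vsize x) = (\<Sum>x\<leftarrow>xs. 1 + vsize x)" for xs
    by (induction xs) auto
  with vlist_velems_le[of "eval a env"] show ?thesis
    by (simp add: APP_def vsize_foldl_VCons vsize_vlist)
qed

lemma polyon_FLATMAP:
  assumes "psz X" "polyon X l" and f: "polyon (extend X (\<lambda>env. set (velems (eval l env)))) f"
  shows "polyon X (FLATMAP l f)"
proof -
  obtain k where k: "\<And>x. x \<in> extend X (\<lambda>env. set (velems (eval l env))) \<Longrightarrow> cost f (snd x) \<le> (fst x + 2) ^ k"
    using f by (auto simp: polyon_def pbd_def)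
  show ?thesis unfolding FLATMAP_def
  proof (rule polyon_Fold[where g = "\<lambda>x. (fst x + 2) ^ k"])
    show "pbd X (\<lambda>x. (fst x + 2) ^ k)" by (intro pbd_power pbd_add pbd_fst) auto
    fix s env x acc assume *: "(s, env) \<in> X" "x \<in> set (velems (eval (REV l) env))"
    then have "cost f (x # env) \<le> (s + 2) ^ k" using k[of "(s, x # env)"] by (auto simp: extend_def)
    then show "vsize (eval (APP (lift 1 f) (Var 1)) (x # acc # env)) \<le> vsize acc + (fst (s, env) + 2) ^ k"
      using vsize_eval_APP[of "lift 1 f" "Var 1" "x # acc # env"] vsize_eval_le_cost[of f "x # env"]
      by simp
  next
    fix Y assume Y: "psz Y" "\<exists>h. Y = extend (extend X h) (\<lambda>aenv. set (velems (eval (REV l) (tl aenv))))"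
    then have "polyon Y (lift 1 f)" using polyon_lift1[OF f] by auto
    with Y(1) show "polyon Y (APP (lift 1 f) (Var 1))" by (intro polyon_APP polyon_Var)
  qed (rule assms(1) polyon_REV[OF assms(1,2)] polyon_Empty)+
qed

lemma polyon_MAP:
  "psz X \<Longrightarrow> polyon X l \<Longrightarrow> polyon (extend X (\<lambda>env. set (velems (eval l env)))) f \<Longrightarrow> polyon X (MAP l f)"
  unfolding MAP_def by (intro polyon_FLATMAP polyon_Pair polyon_Empty)

lemma polyp_REV [intro]: "polyp l \<Longrightarrow> polyp (REV l)"
  by (simp add: polyp_def polyon_REV)
lemma polyp_APP [intro]: "polyp a \<Longrightarrow> polyp b \<Longrightarrow> polyp (APP a b)"
  by (simp add: polyp_def polyon_APP)
lemma polyp_FLATMAP [intro]: "polyp l \<Longrightarrow> polyp f \<Longrightarrow> polyp (FLATMAP l f)"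
  by (simp add: polyp_def polyon_FLATMAP psz_elems)
lemma polyp_MAP [intro]: "polyp l \<Longrightarrow> polyp f \<Longrightarrow> polyp (MAP l f)"
  unfolding MAP_def by blast
lemma polyp_FILTER [intro]: "polyp l \<Longrightarrow> polyp f \<Longrightarrow> polyp (FILTER l f)"
  unfolding FILTER_def by blast

lemma polyp_Fold:
  assumes "polyp l" "polyp a" "polyp b"
    and "\<And>x acc env. vsize (eval b (x # acc # env)) \<le> vsize acc + (vsize x + c)"
  shows "polyp (Fold l a b)"
  unfolding polyp_def
proof (intro allI impI)
  fix X assume X: "psz X"
  show "polyon X (Fold l a b)"
  proof (rule polyon_Fold[where g = "\<lambda>x. cost l (snd x) + c"])
    show "pbd X (\<lambda>x. cost l (snd x) + c)"
      using polypD[OF assms(1) X] by (intro pbd_add) (simp_all add: polyon_def)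
    fix s env x acc assume "(s, env) \<in> X" "x \<in> set (velems (eval l env))"
    then have "vsize x \<le> cost l env" using vsize_velems vsize_eval_le_cost order_trans by blast
    with assms(4)[of x acc env] show "vsize (eval b (x # acc # env)) \<le> vsize acc + (cost l (snd (s, env)) + c)"
      by simp
  qed (rule X polypD[OF assms(1) X] polypD[OF assms(2) X] | erule polypD[OF assms(3)])+
qed

lemma polyp_SUMP [intro]: "polyp l \<Longrightarrow> polyp f \<Longrightarrow> polyp (SUMP l f)"
  unfolding SUMP_def
  by (rule polyp_Fold[where c = 1]) (auto simp: varith_def split: val.split)
lemma polyp_COUNT [intro]: "polyp l \<Longrightarrow> polyp f \<Longrightarrow> polyp (COUNT l f)"
  unfolding COUNT_def by blast
lemma polyp_EXISTS [intro]: "polyp l \<Longrightarrow> polyp f \<Longrightarrow> polyp (EXISTS l f)"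
  unfolding EXISTS_def by (rule polyp_Fold[where c = 1]) auto
lemma polyp_bool [intro]: "polyp a \<Longrightarrow> polyp b \<Longrightarrow> polyp (AND a b)"
   "polyp a \<Longrightarrow> polyp b \<Longrightarrow> polyp (OR a b)" "polyp a \<Longrightarrow> polyp (NOT a)"
  by (auto simp: AND_def OR_def NOT_def)
lemma polyp_MEM [intro]: "polyp a \<Longrightarrow> polyp b \<Longrightarrow> polyp (MEM a b)"
  unfolding MEM_def by blast
lemma polyp_IS_PAIR [intro]: "polyp a \<Longrightarrow> polyp (IS_PAIR a)"
  unfolding IS_PAIR_def by blast
lemma polyp_FIELD [intro]: "polyp a \<Longrightarrow> polyp (FIELD i a)"
  by (induction i arbitrary: a) auto
lemma polyp_LIST: "(\<And>e. e \<in> set es \<Longrightarrow> polyp e) \<Longrightarrow> polyp (LIST es)"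
  by (induction es) (auto simp: LIST_def)
lemma polyp_LIST_Nil [intro]: "polyp (LIST [])"
  and polyp_LIST_Cons [intro]: "polyp e \<Longrightarrow> polyp (LIST es) \<Longrightarrow> polyp (LIST (e # es))"
  by (auto simp: LIST_def)
lemma polyon_ZIP:
  assumes "psz X" "polyon X a" "polyon X c" shows "polyon X (ZIP a c)"
  unfolding ZIP_def
proof (intro polyon_REV polyon_Tail polyon_Fold[where g = "\<lambda>x. cost a (snd x) + 5"] polyon_Pair polyon_Empty assms)
  show "pbd X (\<lambda>x. cost a (snd x) + 5)" using assms(2) by (intro pbd_add) (simp_all add: polyon_def)
  fix s env x acc assume "(s, env) \<in> X" "x \<in> set (velems (eval a env))"
  then have "vsize x \<le> cost a env" using vsize_velems vsize_eval_le_cost order_trans by blast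
  then show "vsize (eval (Pair (Tail (Head (Var 1))) (Pair (Pair (Var 0) (Head (Head (Var 1)))) (Tail (Var 1)))) (x # acc # env))
    \<le> vsize acc + (cost a (snd (s, env)) + 5)"
    by (cases acc; cases "vhd acc") auto
qed (intro polyon_Head polyon_Tail polyon_Var | assumption)+

lemma polyp_ZIP [intro]: "polyp a \<Longrightarrow> polyp b \<Longrightarrow> polyp (ZIP a b)"
  by (simp add: polyp_def polyon_ZIP)

lemma polyon_call1:
  assumes "polyon X a" "pbd X (\<lambda>x. cost e [eval a (snd x)])"
  shows "polyon X (call1 e a)"
proof -
  have "pbd X (\<lambda>x. cost a (snd x) + cost e [eval a (snd x)] + 1)"
    using assms by (intro pbd_add) (auto simp: polyon_def)
  then show ?thesis by (simp add: polyon_def call1_def cost_clip)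
qed

lemma polyon_call2:
  assumes "polyon X a" "polyon X b" "pbd X (\<lambda>x. cost e [eval a (snd x), eval b (snd x)])"
  shows "polyon X (call2 e a b)"
proof -
  have "pbd X (\<lambda>x. cost b (snd x) + cost a (snd x) + cost e [eval a (snd x), eval b (snd x)] + 2)"
    using assms by (intro pbd_add) (auto simp: polyon_def)
  then show ?thesis unfolding polyon_def
    by (rule pbd_le) (simp add: call2_def cost_clip cost_lift numeral_eq_Suc)
qed

lemma polyon_call3:
  assumes "polyon X a" "polyon X b" "polyon X c"
    "pbd X (\<lambda>x. cost e [eval a (snd x), eval b (snd x), eval c (snd x)])"
  shows "polyon X (call3 e a b c)"
proof -
  have "pbd X (\<lambda>x. cost c (snd x) + cost b (snd x) + cost a (snd x) +
      cost e [eval a (snd x), eval b (snd x), eval c (snd x)] + 3)"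
    using assms by (intro pbd_add) (auto simp: polyon_def)
  then show ?thesis unfolding polyon_def
    by (rule pbd_le) (simp add: call3_def cost_clip cost_lift numeral_eq_Suc)
qed

section \<open>The primal-dual scheme\<close>

text \<open>After \<open>n\<close> rounds the steps \<open>K - n\<close>, ..., \<open>K - 1\<close>
  have been treated. A set \<open>I s\<close> is independent in itself, so its members only have to
  be compared with those selected from later steps.\<close>

primrec select :: "('d \<Rightarrow> 'd \<Rightarrow> bool) \<Rightarrow> (nat \<Rightarrow> 'd set) \<Rightarrow> nat \<Rightarrow> nat \<Rightarrow> 'd set" where
  "select cf I K 0 = {}"
| "select cf I K (Suc n) = select cf I K n \<union> {d \<in> I (K - Suc n). \<forall>e\<in>select cf I K n. \<not> cf d e}"

text \<open>A step number has three digits: \<open>s mod L\<close> is the position within a stage,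
  \<open>s div L mod b\<close> the stage, and \<open>s div L div b\<close> the epoch. The exponent
  is one more than the stage because it describes the slack to be reached at the end of the
  stage.\<close>

definition threshold :: "nat \<Rightarrow> nat \<Rightarrow> nat \<Rightarrow> real" where
  "threshold b L s = (14 / 15) ^ Suc (s div L mod b)"

definition epoch :: "nat \<Rightarrow> nat \<Rightarrow> nat \<Rightarrow> nat" where
  "epoch b L s = 2 ^ (s div L div b)"

definition unsatisfied ::
    "'d set \<Rightarrow> ('d \<Rightarrow> nat) \<Rightarrow> ('d \<Rightarrow> real) \<Rightarrow> nat \<Rightarrow> real \<Rightarrow> ('d \<Rightarrow> real) \<Rightarrow> 'd set" where
  "unsatisfied D lay p k y lh = {d \<in> D. lay d = k \<and> lh d < (1 - y) * p d}"

definition raise :: "('d \<Rightarrow> real) \<Rightarrow> ('d \<Rightarrow> 'd \<Rightarrow> real) \<Rightarrow> 'd set \<Rightarrow> ('d \<Rightarrow> real) \<Rightarrow> 'd \<Rightarrow> real" where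
  "raise p co I lh d = lh d + (\<Sum>e\<in>I. (p e - lh e) / co e e * co e d)"

text \<open>
  \<open>co d e\<close> is the increase of the left-hand side of the dual constraint of \<open>e\<close> per unit of
  \<open>\<delta>(d)\<close>, when \<open>d\<close> is raised.
\<close>

locale primal_dual =
  fixes D :: "'d set" and p :: "'d \<Rightarrow> real" and cf :: "'d \<Rightarrow> 'd \<Rightarrow> bool"
    and co :: "'d \<Rightarrow> 'd \<Rightarrow> real" and lay :: "'d \<Rightarrow> nat"
  assumes finD: "finite D"
    and p_pos: "d \<in> D \<Longrightarrow> 0 < p d"
    and cf_refl: "cf d d"
    and cf_sym: "cf d e \<Longrightarrow> cf e d"
    and co_nonneg: "0 \<le> co d e"
    and co_self: "d \<in> D \<Longrightarrow> co d d \<le> 7"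
    and co_cf: "d \<in> D \<Longrightarrow> e \<in> D \<Longrightarrow> cf d e \<Longrightarrow> lay d \<le> lay e \<Longrightarrow> 1 \<le> co d e"
    and co_ncf: "d \<in> D \<Longrightarrow> e \<in> D \<Longrightarrow> \<not> cf d e \<Longrightarrow> co d e = 0"
    and co_opt: "S \<subseteq> D \<Longrightarrow> \<forall>d\<in>S. \<forall>e\<in>S. d \<noteq> e \<longrightarrow> \<not> cf d e \<Longrightarrow> d \<in> D \<Longrightarrow> (\<Sum>e\<in>S. co d e) \<le> 7"

text \<open>The history of a run in which every step succeeded in finding a maximal independent set.
  \<open>K\<close> is arbitrary here, so that a history can be prolonged step by step along the
  random process; that \<open>K\<close> covers all epochs is assumed only where it matters.\<close>

locale raising = primal_dual +
  fixes lhs :: "nat \<Rightarrow> 'a \<Rightarrow> real" and I :: "nat \<Rightarrow> 'a set" and b L K :: nat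
  assumes lhs_0: "lhs 0 d = 0"
    and lhs_Suc: "s < K \<Longrightarrow> d \<in> D \<Longrightarrow> lhs (Suc s) d = raise p co (I s) (lhs s) d"
    and I_sub: "s < K \<Longrightarrow> I s \<subseteq> unsatisfied D lay p (epoch b L s) (threshold b L s) (lhs s)"
    and I_indep: "s < K \<Longrightarrow> d \<in> I s \<Longrightarrow> e \<in> I s \<Longrightarrow> d \<noteq> e \<Longrightarrow> \<not> cf d e"
    and I_max: "s < K \<Longrightarrow> d \<in> unsatisfied D lay p (epoch b L s) (threshold b L s) (lhs s) \<Longrightarrow> d \<notin> I s \<Longrightarrow>
      \<exists>e\<in>I s. cf e d"
    and b_pos: "0 < b" and L_pos: "0 < L"
begin

text \<open>The amount by which the dual variables of \<open>e\<close> are raised. Each unit adds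
  \<open>co e e\<close> to the constraint of \<open>e\<close> itself, so this amount makes it
  tight.\<close>

definition "\<delta> s e = (p e - lhs s e) / co e e"

lemma I_D: "s < K \<Longrightarrow> d \<in> I s \<Longrightarrow> d \<in> D"
  using I_sub by (fastforce simp: unsatisfied_def)

lemma finI: "s < K \<Longrightarrow> finite (I s)"
  using I_D finD by (meson finite_subset subsetI)

lemma threshold_pos: "0 < threshold b L s"
  by (simp add: threshold_def)

lemma I_lhs: "s < K \<Longrightarrow> d \<in> I s \<Longrightarrow> lhs s d < (1 - threshold b L s) * p d"
  using I_sub by (fastforce simp: unsatisfied_def)

lemma slack: assumes "s < K" "e \<in> I s" shows "threshold b L s * p e < p e - lhs s e"
  using I_lhs[OF assms] by (simp add: algebra_simps)

lemma co_self_ge: "d \<in> D \<Longrightarrow> 1 \<le> co d d"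
  using co_cf[of d d] cf_refl by blast

lemma \<delta>_lower: assumes "s < K" "e \<in> I s" shows "threshold b L s * p e / 7 \<le> \<delta> s e"
proof -
  have "e \<in> D" using I_D assms by blast
  then have "threshold b L s * p e / 7 \<le> threshold b L s * p e / co e e"
    using co_self[of e] co_self_ge[of e] p_pos[of e] threshold_pos[of s]
    by (intro divide_left_mono) auto
  also have "\<dots> \<le> \<delta> s e"
    unfolding \<delta>_def using slack[OF assms] co_self_ge[OF \<open>e \<in> D\<close>] by (intro divide_right_mono) auto
  finally show ?thesis .
qed

lemma \<delta>_nonneg: assumes "s < K" "e \<in> I s" shows "0 \<le> \<delta> s e"
proof -
  have "0 \<le> threshold b L s * p e / 7"
    using threshold_pos[of s] p_pos[OF I_D[OF assms]] by simp
  with \<delta>_lower[OF assms] show ?thesis by linarith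
qed

lemma lhs_step: "s < K \<Longrightarrow> d \<in> D \<Longrightarrow> lhs (Suc s) d = lhs s d + (\<Sum>e\<in>I s. \<delta> s e * co e d)"
  by (simp add: lhs_Suc raise_def \<delta>_def)

lemma lhs_step_mono: "s < K \<Longrightarrow> d \<in> D \<Longrightarrow> lhs s d \<le> lhs (Suc s) d"
  by (simp add: lhs_step sum_nonneg \<delta>_nonneg co_nonneg)

lemma lhs_mono: "s \<le> t \<Longrightarrow> t \<le> K \<Longrightarrow> d \<in> D \<Longrightarrow> lhs s d \<le> lhs t d"
proof (induction t rule: dec_induct)
  case (step t)
  then show ?case using lhs_step_mono[of t d] by simp
qed simp

lemma lhs_nonneg: "s \<le> K \<Longrightarrow> d \<in> D \<Longrightarrow> 0 \<le> lhs s d"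
  using lhs_mono[of 0 s d] by (simp add: lhs_0)

text \<open>The other instances raised in the same step do not conflict with \<open>d\<close> and
  contribute nothing to its constraint, which therefore becomes exactly tight.\<close>

lemma lhs_raised: assumes "s < K" "d \<in> I s" shows "lhs (Suc s) d = p d"
proof -
  have "(\<Sum>e\<in>I s. \<delta> s e * co e d) = (\<Sum>e\<in>I s. if e = d then \<delta> s d * co d d else 0)"
  proof (rule sum.cong)
    fix e assume e: "e \<in> I s"
    then have "e \<noteq> d \<Longrightarrow> co e d = 0" using co_ncf I_indep I_D assms by metis
    then show "\<delta> s e * co e d = (if e = d then \<delta> s d * co d d else 0)" by simp
  qed simp
  also have "\<dots> = \<delta> s d * co d d" using assms finI by simp
  also have "\<dots> = p d - lhs s d" using co_self_ge[OF I_D[OF assms]] by (simp add: \<delta>_def)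
  finally show ?thesis using lhs_step[OF assms(1) I_D[OF assms]] by simp
qed

text \<open>A tight constraint stays satisfied, as left-hand sides never decrease. Hence a single
  number per instance can record the step in which it was raised.\<close>

lemma raised_once: assumes "s < t" "t < K" "d \<in> I s" shows "d \<notin> I t"
proof
  assume d: "d \<in> I t"
  have D: "d \<in> D" using I_D assms d by blast
  have "p d \<le> lhs t d"
    using lhs_raised[of s d] lhs_mono[of "Suc s" t d] assms D by simp
  moreover have "0 < threshold b L t * p d" using threshold_pos p_pos D by simp
  ultimately show False using slack[OF assms(2) d] by linarith
qed

text \<open>The order of layers enters here: it guarantees a critical edge of \<open>e\<close> on
  the path of \<open>d\<close> when the two overlap, hence a coefficient of at least 1.\<close>

lemma increase: assumes "s < K" "e \<in> I s" "d \<in> D" "cf e d" "lay e \<le> lay d"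
  shows "lhs s d + \<delta> s e \<le> lhs (Suc s) d"
proof -
  have "\<delta> s e \<le> \<delta> s e * co e d"
    using mult_left_mono[of 1 "co e d" "\<delta> s e"] co_cf[of e d] I_D[OF assms(1,2)] assms \<delta>_nonneg[of s e]
    by simp
  also have "\<dots> \<le> (\<Sum>e\<in>I s. \<delta> s e * co e d)"
    using assms finI by (intro member_le_sum) (auto intro!: mult_nonneg_nonneg \<delta>_nonneg co_nonneg)
  finally show ?thesis using lhs_step[OF assms(1,3)] by simp
qed

text \<open>
  If \<open>d\<close> stays unsatisfied although its neighbour \<open>e\<close> is raised, then \<open>p d > 2 * p e\<close>; so profits
  double along the steps of a stage. Indeed, \<open>d\<close> lacks at most \<open>15 / 14 * y * p d\<close> at the beginning of the
  stage and still more than \<open>y * p d\<close> afterwards, while raising \<open>e\<close> adds more than \<open>y * p e / 7\<close>.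
\<close>

lemma stage:
  assumes "s + L \<le> K" and ep: "\<And>i. i < L \<Longrightarrow> epoch b L (s + i) = k"
    and th: "\<And>i. i < L \<Longrightarrow> threshold b L (s + i) = y"
    and start: "\<And>d. d \<in> D \<Longrightarrow> lay d = k \<Longrightarrow> (1 - 15 / 14 * y) * p d \<le> lhs s d"
    and pm: "\<And>d. d \<in> D \<Longrightarrow> pm \<le> p d" "\<And>d. d \<in> D \<Longrightarrow> p d < pm * 2 ^ L"
    and d: "d \<in> D" "lay d = k"
  shows "(1 - y) * p d \<le> lhs (s + L) d"
proof (rule ccontr)
  \<comment> \<open>Surviving \<open>i\<close> steps unsatisfied requires a profit of at least
    \<open>pm * 2 ^ i\<close>; for \<open>i = L\<close> this exceeds every profit.\<close>
  have *: "pm * 2 ^ i \<le> p d"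
    if "i \<le> L" "d \<in> D" "lay d = k" "lhs (s + i) d < (1 - y) * p d" for i d
    using that
  proof (induction i arbitrary: d)
    case 0
    then show ?case using pm(1) by simp
  next
    case (Suc i)
    have i: "i < L" "s + i < K" using Suc.prems assms(1) by auto
    have lt: "lhs (s + i) d < (1 - y) * p d"
      using Suc.prems lhs_step_mono[of "s + i" d] i by simp
    have "d \<notin> I (s + i)"
    proof
      assume "d \<in> I (s + i)"
      then have "lhs (s + Suc i) d = p d" using lhs_raised i by simp
      moreover have "0 < y * p d" using threshold_pos[of "s + i"] th[OF i(1)] p_pos Suc.prems by simp
      ultimately show False using Suc.prems by (simp add: algebra_simps)
    qed
    moreover have "d \<in> unsatisfied D lay p (epoch b L (s + i)) (threshold b L (s + i)) (lhs (s + i))"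
      using Suc.prems lt ep[OF i(1)] th[OF i(1)] by (simp add: unsatisfied_def)
    ultimately obtain e where e: "e \<in> I (s + i)" "cf e d" using I_max[OF i(2)] by blast
    have eU: "e \<in> D" "lay e = k" "lhs (s + i) e < (1 - y) * p e"
      using I_sub[OF i(2)] e(1) ep[OF i(1)] th[OF i(1)] by (auto simp: unsatisfied_def)
    have "pm * 2 ^ i \<le> p e" by (rule Suc.IH) (use eU i in auto)
    have "lhs (s + i) d + y * p e / 7 \<le> lhs (s + Suc i) d"
      using increase[OF i(2) e(1) Suc.prems(2) e(2)] \<delta>_lower[OF i(2) e(1)] eU Suc.prems th[OF i(1)] by simp
    moreover have "(1 - 15 / 14 * y) * p d \<le> lhs (s + i) d"
      using start[OF Suc.prems(2,3)] lhs_mono[of s "s + i" d] i Suc.prems by simp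
    ultimately have "y * (2 * p e) < y * p d"
      using Suc.prems(4) by (simp add: algebra_simps)
    then have "2 * p e < p d" using threshold_pos[of "s + i"] th[OF i(1)] by simp
    with \<open>pm * 2 ^ i \<le> p e\<close> show ?case by simp
  qed
  assume "\<not> ?thesis"
  with *[of L d] d pm(2)[of d] show False by simp
qed

text \<open>The stages of the epoch of \<open>d\<close> are chained, each starting from the slack at
  which the previous one ended. What follows that epoch does no harm, since left-hand sides only
  grow.\<close>

lemma satisfied:
  assumes K: "K = E * b * L" and lay: "\<And>d. d \<in> D \<Longrightarrow> \<exists>k<E. lay d = 2 ^ k"
    and pm: "\<And>d. d \<in> D \<Longrightarrow> pm \<le> p d" "\<And>d. d \<in> D \<Longrightarrow> p d < pm * 2 ^ L"
    and d: "d \<in> D"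
  shows "(1 - (14 / 15) ^ b) * p d \<le> lhs K d"
proof -
  obtain k where k: "k < E" "lay d = 2 ^ k" using lay d by blast
  have "(1 - (14 / 15) ^ j) * p d \<le> lhs ((k * b + j) * L) d"
    if "j \<le> b" "d \<in> D" "lay d = 2 ^ k" for j d
    using that
  proof (induction j arbitrary: d)
    case 0
    have "k * b * L \<le> K" unfolding K using k by simp
    then show ?case using lhs_nonneg 0 by simp
  next
    case (Suc j)
    have "k * b + Suc j \<le> k * b + b" using Suc.prems by simp
    also have "\<dots> \<le> E * b" using k mult_le_mono1[of "Suc k" E b] by simp
    finally have "(k * b + Suc j) * L \<le> K" unfolding K by (intro mult_le_mono1)
    then have "(k * b + j) * L + L \<le> K" by simp
    moreover have "((k * b + j) * L + i) div L = k * b + j" if "i < L" for i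
      using that by simp
    moreover have "(k * b + j) div b = k" "(k * b + j) mod b = j"
      using Suc.prems by simp_all
    \<comment> \<open>The initial slack asked for by \<open>stage\<close> is the one reached by
      stage \<open>j\<close>, as 15/14 times \<open>(14 / 15) ^ Suc j\<close> is
      \<open>(14 / 15) ^ j\<close>.\<close>
    ultimately have "(1 - (14 / 15) ^ Suc j) * p d \<le> lhs ((k * b + j) * L + L) d"
      using Suc.prems by (intro stage[where k = "2 ^ k" and pm = pm] pm)
        (auto simp: epoch_def threshold_def intro!: Suc.IH)
    then show ?case by (simp add: algebra_simps)
  qed
  from this[of b d] d k have "(1 - (14 / 15) ^ b) * p d \<le> lhs ((k * b + b) * L) d" by simp
  also have "\<dots> \<le> lhs K d"
  proof (rule lhs_mono)
    have "k * b + b \<le> E * b" using k mult_le_mono1[of "Suc k" E b] by simp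
    then show "(k * b + b) * L \<le> K" unfolding K by (rule mult_le_mono1)
  qed (use d in auto)
  finally show ?thesis .
qed

text \<open>Weak duality without an explicit dual solution: the left-hand sides of the constraints
  of \<open>S\<close> are summed and regrouped by raised instance. By \<open>co_opt\<close>, raising
  \<open>e\<close> by \<open>\<delta>\<close> contributes at most seven times
  \<open>\<delta>\<close> to all members of an independent set together.\<close>

lemma opt_bound:
  assumes S: "S \<subseteq> D" "\<forall>d\<in>S. \<forall>e\<in>S. d \<noteq> e \<longrightarrow> \<not> cf d e"
    and "n \<le> K"
  shows "(\<Sum>d\<in>S. lhs n d) \<le> 7 * (\<Sum>s<n. \<Sum>e\<in>I s. \<delta> s e)"
  using \<open>n \<le> K\<close>
proof (induction n)
  case (Suc n)
  then have n: "n < K" by simp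
  have "(\<Sum>d\<in>S. lhs (Suc n) d) = (\<Sum>d\<in>S. lhs n d + (\<Sum>e\<in>I n. \<delta> n e * co e d))"
    using S(1) n by (intro sum.cong) (auto simp: lhs_step)
  also have "\<dots> = (\<Sum>d\<in>S. lhs n d) + (\<Sum>e\<in>I n. \<delta> n e * (\<Sum>d\<in>S. co e d))"
    unfolding sum.distrib sum_distrib_left by (subst sum.swap) simp
  also have "(\<Sum>e\<in>I n. \<delta> n e * (\<Sum>d\<in>S. co e d)) \<le> (\<Sum>e\<in>I n. \<delta> n e * 7)"
    using n S by (intro sum_mono mult_left_mono co_opt \<delta>_nonneg I_D) auto
  finally show ?case using Suc.IH n by (simp add: sum_distrib_right[symmetric])
qed (simp add: lhs_0)

lemma select_sub: "n \<le> K \<Longrightarrow> select cf I K n \<subseteq> (\<Union>s\<in>{K - n..<K}. I s)"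
proof (induction n)
  case (Suc n)
  then have "{K - Suc n..<K} = insert (K - Suc n) {K - n..<K}" by auto
  with Suc show ?case by auto
qed simp

lemma select_D: "n \<le> K \<Longrightarrow> select cf I K n \<subseteq> D"
  using select_sub I_D by fastforce

lemma select_indep: "n \<le> K \<Longrightarrow> d \<in> select cf I K n \<Longrightarrow> e \<in> select cf I K n \<Longrightarrow> d \<noteq> e \<Longrightarrow> \<not> cf d e"
proof (induction n arbitrary: d e)
  case (Suc n)
  have "K - Suc n < K" using Suc.prems by simp
  note ind = I_indep[OF this]
  from Suc.prems have n: "n \<le> K" by simp
  have "d \<in> select cf I K n \<or> d \<in> I (K - Suc n) \<and> (\<forall>e\<in>select cf I K n. \<not> cf d e)"
    "e \<in> select cf I K n \<or> e \<in> I (K - Suc n) \<and> (\<forall>d\<in>select cf I K n. \<not> cf e d)"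
    using Suc.prems by auto
  then show ?case using ind[of d e] Suc.IH[OF n, of d e] Suc.prems(4) cf_sym[of d e] by blast
qed simp

text \<open>The additional term with \<open>lhs (K - n)\<close> makes the induction work: it keeps
  in reserve the part of the profits of selected instances that was built up before step
  \<open>K - n\<close>. Going one step further back, every increment of that step is paid from this
  reserve or by a newly selected instance.\<close>

lemma select_profit: "n \<le> K \<Longrightarrow>
  (\<Sum>s\<in>{K - n..<K}. \<Sum>e\<in>I s. \<delta> s e) + (\<Sum>d\<in>select cf I K n. lhs (K - n) d) \<le> (\<Sum>d\<in>select cf I K n. p d)"
proof (induction n)
  case (Suc n)
  let ?s = "K - Suc n" and ?S = "select cf I K n"
  let ?N = "{d \<in> I ?s. \<forall>e\<in>?S. \<not> cf d e}"
  have s: "?s < K" "Suc ?s = K - n" using Suc.prems by auto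
  have fin: "finite ?S" "finite ?N"
    using select_D[of n] Suc.prems finD finite_subset finI[OF s(1)] by auto
  have disj: "?S \<inter> ?N = {}" using cf_refl by blast
  have SD: "?S \<subseteq> D" using select_D Suc.prems by simp
  \<comment> \<open>An instance that is not selected is blocked by some selected \<open>d\<close>
    raised in a later step. Epochs increase with steps, so \<open>d\<close> has at least the same
    layer, and raising \<open>e\<close> has increased the left-hand side of \<open>d\<close> by at
    least the increment of \<open>e\<close>.\<close>
  have one: "\<delta> ?s e \<le> (\<Sum>d\<in>?S. \<delta> ?s e * co e d)" if e: "e \<in> I ?s - ?N" for e
  proof -
    obtain d where d: "d \<in> ?S" "cf e d" using e by blast
    then obtain t where t: "t \<in> {K - n..<K}" "d \<in> I t" using select_sub[of n] Suc.prems by auto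
    have "lay e = epoch b L ?s" "lay d = epoch b L t"
      using I_sub[OF s(1)] I_sub[of t] t e by (auto simp: unsatisfied_def)
    moreover have "epoch b L ?s \<le> epoch b L t"
      unfolding epoch_def using t by (intro power_increasing div_le_mono) auto
    ultimately have "1 \<le> co e d"
      using co_cf[OF I_D[OF s(1)] _ d(2)] e d SD by auto
    moreover have "0 \<le> \<delta> ?s e" using \<delta>_nonneg[OF s(1)] e by simp
    ultimately have "\<delta> ?s e \<le> \<delta> ?s e * co e d"
      using mult_left_mono[of 1 "co e d" "\<delta> ?s e"] by simp
    also have "\<dots> \<le> (\<Sum>d\<in>?S. \<delta> ?s e * co e d)"
      using \<open>0 \<le> \<delta> ?s e\<close> co_nonneg fin d
      by (intro member_le_sum mult_nonneg_nonneg) auto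
    finally show ?thesis .
  qed
  have "(\<Sum>e\<in>I ?s - ?N. \<delta> ?s e) \<le> (\<Sum>e\<in>I ?s - ?N. \<Sum>d\<in>?S. \<delta> ?s e * co e d)"
    by (intro sum_mono one)
  also have "\<dots> \<le> (\<Sum>e\<in>I ?s. \<Sum>d\<in>?S. \<delta> ?s e * co e d)"
    using finI[OF s(1)]
    by (intro sum_mono2) (auto intro!: sum_nonneg mult_nonneg_nonneg \<delta>_nonneg s co_nonneg)
  also have "\<dots> = (\<Sum>d\<in>?S. \<Sum>e\<in>I ?s. \<delta> ?s e * co e d)" by (rule sum.swap)
  also have "\<dots> = (\<Sum>d\<in>?S. lhs (K - n) d - lhs ?s d)"
    using SD lhs_step[OF s(1)] s(2) by (intro sum.cong) auto
  finally have A: "(\<Sum>e\<in>I ?s - ?N. \<delta> ?s e) + (\<Sum>d\<in>?S. lhs ?s d) \<le> (\<Sum>d\<in>?S. lhs (K - n) d)"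
    by (simp add: sum_subtractf)
  \<comment> \<open>A newly selected instance becomes tight in this step, so its profit covers its
    own increment and its earlier left-hand side.\<close>
  have B: "(\<Sum>e\<in>?N. \<delta> ?s e) + (\<Sum>d\<in>?N. lhs ?s d) \<le> (\<Sum>d\<in>?N. p d)"
    unfolding sum.distrib[symmetric]
  proof (rule sum_mono)
    fix d assume "d \<in> ?N"
    then have d: "d \<in> I ?s" by simp
    have "d \<in> D" using I_D[OF s(1) d] .
    from increase[OF s(1) d this cf_refl] lhs_raised[OF s(1) d]
    show "\<delta> ?s d + lhs ?s d \<le> p d" by simp
  qed
  have C: "(\<Sum>e\<in>I ?s. \<delta> ?s e) = (\<Sum>e\<in>I ?s - ?N. \<delta> ?s e) + (\<Sum>e\<in>?N. \<delta> ?s e)"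
    by (rule sum.subset_diff) (use finI[OF s(1)] in auto)
  have "{K - Suc n..<K} = insert ?s {K - n..<K}" using Suc.prems by auto
  moreover have "?s \<notin> {K - n..<K}" using Suc.prems by auto
  ultimately have E: "(\<Sum>s\<in>{K - Suc n..<K}. \<Sum>e\<in>I s. \<delta> s e)
      = (\<Sum>e\<in>I ?s. \<delta> ?s e) + (\<Sum>s\<in>{K - n..<K}. \<Sum>e\<in>I s. \<delta> s e)" by simp
  have "(\<Sum>s\<in>{K - n..<K}. \<Sum>e\<in>I s. \<delta> s e) + (\<Sum>d\<in>?S. lhs (K - n) d) \<le> (\<Sum>d\<in>?S. p d)"
    using Suc by simp
  with A B C E show ?case
    by (simp add: sum.union_disjoint[OF fin disj])
qed simp

theorem approximation:
  assumes K: "K = E * b * L" and lay: "\<And>d. d \<in> D \<Longrightarrow> \<exists>k<E. lay d = 2 ^ k"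
    and pm: "\<And>d. d \<in> D \<Longrightarrow> pm \<le> p d" "\<And>d. d \<in> D \<Longrightarrow> p d < pm * 2 ^ L"
    and S: "S \<subseteq> D" "\<forall>d\<in>S. \<forall>e\<in>S. d \<noteq> e \<longrightarrow> \<not> cf d e"
  shows "(1 - (14 / 15) ^ b) * (\<Sum>d\<in>S. p d) \<le> 7 * (\<Sum>d\<in>select cf I K K. p d)"
proof -
  have "(1 - (14 / 15) ^ b) * (\<Sum>d\<in>S. p d) \<le> (\<Sum>d\<in>S. lhs K d)"
    unfolding sum_distrib_left using satisfied[OF K lay pm] S by (intro sum_mono) auto
  also have "\<dots> \<le> 7 * (\<Sum>s<K. \<Sum>e\<in>I s. \<delta> s e)" by (rule opt_bound[OF S order_refl])
  also have "(\<Sum>s<K. \<Sum>e\<in>I s. \<delta> s e) \<le> (\<Sum>d\<in>select cf I K K. p d)"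
    using select_profit[of K] by (simp add: lhs_0 lessThan_atLeast0)
  finally show ?thesis by simp
qed

end

section \<open>Layered decomposition of trees\<close>

text \<open>
  A rooted tree is given by its list of pairs of a vertex and its parent, in which every vertex
  occurs before its parent. The root is \<open>0\<close>.
\<close>

primrec parent_table :: "(nat \<times> nat) list \<Rightarrow> bool" where
  "parent_table [] = True"
| "parent_table (e # T) \<longleftrightarrow> parent_table T \<and> fst e \<noteq> 0 \<and> fst e \<notin> fst ` set T \<and> snd e \<in> insert 0 (fst ` set T)"

text \<open>One pass is enough, as the entries behind that of \<open>y\<close> contain the rest of
  its way to the root. The vertex itself counts as an ancestor.\<close>

primrec ancestors :: "(nat \<times> nat) list \<Rightarrow> nat \<Rightarrow> nat list" where
  "ancestors [] y = [y]"
| "ancestors (e # T) y = (if fst e = y then y # ancestors T (snd e) else ancestors T y)"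

definition tree_vertices :: "(nat \<times> nat) list \<Rightarrow> nat list" where
  "tree_vertices T = 0 # map fst T"

definition subtree_size :: "(nat \<times> nat) list \<Rightarrow> nat \<Rightarrow> nat" where
  "subtree_size T y = length (filter (\<lambda>v. y \<in> set (ancestors T v)) (tree_vertices T))"

definition heavy_child :: "(nat \<times> nat) list \<Rightarrow> nat \<Rightarrow> nat option" where
  "heavy_child T v = foldl (\<lambda>acc e. if snd e = v \<and>
       (case acc of None \<Rightarrow> True | Some c \<Rightarrow> subtree_size T c < subtree_size T (fst e))
     then Some (fst e) else acc) None T"

definition heavy_size :: "(nat \<times> nat) list \<Rightarrow> nat \<Rightarrow> nat" where
  "heavy_size T v = (case heavy_child T v of None \<Rightarrow> 0 | Some c \<Rightarrow> subtree_size T c)"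

text \<open>
  The intervals from \<open>(heavy_size T v)\<^sup>2\<close> to \<open>(subtree_size T v)\<^sup>2\<close> of consecutive vertices of a heavy path
  are adjacent, and a multiple of \<open>2 ^ Suc k\<close> lies between two consecutive multiples of \<open>2 ^ k\<close> or is one of them.
  Hence there is a vertex of higher rank between two vertices of equal rank.
\<close>

definition dyadic :: "(nat \<times> nat) list \<Rightarrow> nat \<Rightarrow> nat \<Rightarrow> bool" where
  "dyadic T v k \<longleftrightarrow> (\<exists>m. (heavy_size T v)\<^sup>2 < m * 2 ^ k \<and> m * 2 ^ k \<le> (subtree_size T v)\<^sup>2)"

definition vertex_rank :: "(nat \<times> nat) list \<Rightarrow> nat \<Rightarrow> nat" where
  "vertex_rank T v = Max {k. dyadic T v k}"

text \<open>An edge is identified with its lower vertex. It lies on the path from \<open>u\<close>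
  to \<open>v\<close> iff this vertex is above exactly one of the two ends, so no lowest common
  ancestor has to be computed.\<close>

definition route :: "(nat \<times> nat) list \<Rightarrow> nat \<Rightarrow> nat \<Rightarrow> (nat \<times> nat) list" where
  "route T u v = filter (\<lambda>e. (fst e \<in> set (ancestors T u)) \<noteq> (fst e \<in> set (ancestors T v))) T"

text \<open>The edges from which the apex of the path is reached without crossing a light edge. A
  vertex has a single heavy child, so they all lie in one branch, on the heavy path through the
  apex.\<close>

definition heavy_part :: "(nat \<times> nat) list \<Rightarrow> (nat \<times> nat) list \<Rightarrow> (nat \<times> nat) list" where
  "heavy_part T X = filter (\<lambda>e. \<forall>e'\<in>set X. fst e' \<in> set (ancestors T (fst e)) \<longrightarrow>
     heavy_child T (snd e') = Some (fst e')) X"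

text \<open>The apex is the upper end of an edge that is not the lower end of another one. The
  inserted 1 only serves as a value for the empty path.\<close>

definition layer_of :: "(nat \<times> nat) list \<Rightarrow> (nat \<times> nat) list \<Rightarrow> nat" where
  "layer_of T X = Max (insert 1 ((\<lambda>v. 2 ^ vertex_rank T v) `
     (snd ` {e \<in> set X. snd e \<notin> fst ` set X} \<union> fst ` set (heavy_part T X))))"

text \<open>The at most six edges are the two at the apex, those above and below the heavy vertex of
  maximal rank, the one above the lowest heavy vertex, and the one by which the path leaves its
  heavy part.\<close>

definition critical :: "(nat \<times> nat) list \<Rightarrow> (nat \<times> nat) list \<Rightarrow> (nat \<times> nat) list" where
  "critical T X = (let H = heavy_part T X; k = layer_of T X in filter (\<lambda>e.
     snd e \<notin> fst ` set X \<or>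
     fst e \<in> fst ` set H \<and> (2 ^ vertex_rank T (fst e) = k \<or> fst e \<notin> snd ` set H) \<or>
     snd e \<in> fst ` set H \<and> (2 ^ vertex_rank T (snd e) = k \<or> fst e \<notin> fst ` set H)) X)"

lemma foldl_argmax:
  fixes f :: "'a \<Rightarrow> nat" and P :: "'b \<Rightarrow> bool" and g :: "'b \<Rightarrow> 'a"
  defines "step \<equiv> \<lambda>acc e. if P e \<and> (case acc of None \<Rightarrow> True | Some c \<Rightarrow> f c < f (g e)) then Some (g e) else acc"
  shows "case foldl step None xs of None \<Rightarrow> \<forall>e\<in>set xs. \<not> P e
     | Some c \<Rightarrow> c \<in> g ` {e \<in> set xs. P e} \<and> (\<forall>e\<in>set xs. P e \<longrightarrow> f (g e) \<le> f c)"
proof (induction xs rule: rev_induct)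
  case (snoc x xs)
  then show ?case
    by (cases "foldl step None xs") (auto simp: step_def less_imp_le split: if_splits intro: order_trans)
qed simp

section \<open>Ancestors, subtree sizes and heavy children\<close>

locale rooted_tree =
  fixes T :: "(nat \<times> nat) list"
  assumes table: "parent_table T"
begin

abbreviation "V \<equiv> insert 0 (fst ` set T)"

abbreviation anc :: "nat \<Rightarrow> nat \<Rightarrow> bool" (infix "\<sqsubseteq>" 50) where
  "x \<sqsubseteq> y \<equiv> x \<in> set (ancestors T y)"

lemma distinct_table: "parent_table S \<Longrightarrow> distinct (map fst S) \<and> 0 \<notin> fst ` set S"
  by (induction S) auto

lemma parent_vertex: "parent_table S \<Longrightarrow> (c, p) \<in> set S \<Longrightarrow> p \<in> insert 0 (fst ` set S)"
  by (induction S) (auto intro: rev_image_eqI)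

lemma anc_step_gen: "parent_table S \<Longrightarrow> (c, p) \<in> set S \<Longrightarrow>
    set (ancestors S c) = insert c (set (ancestors S p))"
proof (induction S)
  case (Cons e S)
  show ?case
  proof (cases "e = (c, p)")
    case True
    then have "c \<noteq> p" using Cons.prems by auto
    with True show ?thesis by simp
  next
    case False
    then have S: "(c, p) \<in> set S" using Cons.prems by simp
    moreover have "c \<in> fst ` set S" using S by force
    moreover have "p \<in> insert 0 (fst ` set S)" using parent_vertex[OF _ S] Cons.prems(1) by simp
    ultimately show ?thesis using Cons by auto
  qed
qed simp

lemma anc_subset_gen: "parent_table S \<Longrightarrow> y \<in> insert 0 (fst ` set S) \<Longrightarrow>
    set (ancestors S y) \<subseteq> insert 0 (fst ` set S)"
  by (induction S arbitrary: y) auto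

lemma anc_parent_gen: "parent_table S \<Longrightarrow> (c, p) \<in> set S \<Longrightarrow> c \<notin> set (ancestors S p)"
proof (induction S)
  case (Cons e S)
  show ?case
  proof (cases "e = (c, p)")
    case True
    then have "p \<in> insert 0 (fst ` set S)" "c \<notin> insert 0 (fst ` set S)" using Cons.prems by auto
    with True show ?thesis using anc_subset_gen[of S p] Cons.prems(1) by auto
  next
    case False
    then have "(c, p) \<in> set S" using Cons.prems by simp
    with parent_vertex[of S c p] Cons show ?thesis by auto
  qed
qed simp

lemma anc_zero_gen: "parent_table S \<Longrightarrow> ancestors S 0 = [0]"
  by (induction S) auto

lemma anc_self_gen: "y \<in> set (ancestors S y)"
  by (induction S arbitrary: y) auto

lemma anc_root_gen: "parent_table S \<Longrightarrow> y \<in> insert 0 (fst ` set S) \<Longrightarrow> 0 \<in> set (ancestors S y)"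
  by (induction S arbitrary: y) auto

lemmas anc_step = anc_step_gen[OF table] and anc_subset = anc_subset_gen[OF table]
  and anc_parent = anc_parent_gen[OF table] and anc_zero = anc_zero_gen[OF table]
  and anc_root = anc_root_gen[OF table] and parent_V = parent_vertex[OF table]

lemma anc_refl [simp]: "x \<sqsubseteq> x" by (rule anc_self_gen)

text \<open>Induction downwards from the root. It follows the list from its end, where parents
  precede their children.\<close>

lemma tree_induct [consumes 1, case_names root child]:
  assumes "v \<in> V" "P 0" "\<And>c p. (c, p) \<in> set T \<Longrightarrow> p \<in> V \<Longrightarrow> P p \<Longrightarrow> P c"
  shows "P v"
proof -
  have "\<forall>v \<in> insert 0 (fst ` set S). P v" if "parent_table S" "set S \<subseteq> set T" for S
    using that
  proof (induction S)
    case (Cons e S)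
    then have IH: "\<forall>v \<in> insert 0 (fst ` set S). P v" by simp
    moreover have "P (fst e)"
      using assms(3)[of "fst e" "snd e"] Cons.prems IH parent_V[of "fst e" "snd e"] by auto
    ultimately show ?case by auto
  qed (simp add: assms)
  with table assms(1) show ?thesis by blast
qed

lemma anc_V: "x \<sqsubseteq> y \<Longrightarrow> y \<in> V \<Longrightarrow> x \<in> V"
  using anc_subset by blast

lemma anc_trans: assumes "x \<sqsubseteq> y" "y \<sqsubseteq> z" "z \<in> V" shows "x \<sqsubseteq> z"
  using assms(3,1,2) by (induction z rule: tree_induct) (auto simp: anc_zero anc_step)

lemma anc_chain: assumes "x \<sqsubseteq> z" "y \<sqsubseteq> z" "z \<in> V" shows "x \<sqsubseteq> y \<or> y \<sqsubseteq> x"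
  using assms(3,1,2) by (induction z rule: tree_induct) (auto simp: anc_zero anc_step)

lemma anc_antisym: assumes "x \<sqsubseteq> y" "y \<sqsubseteq> x" "y \<in> V" shows "x = y"
proof -
  have "x \<sqsubseteq> y \<longrightarrow> y \<sqsubseteq> x \<longrightarrow> x = y"
    using assms(3)
  proof (induction y rule: tree_induct)
    case (child c p)
    show ?case
    proof (intro impI, rule ccontr)
      assume *: "x \<sqsubseteq> c" "c \<sqsubseteq> x" "x \<noteq> c"
      then have "x \<sqsubseteq> p" using anc_step child.hyps by auto
      with * child.hyps have "c \<sqsubseteq> p" using anc_trans by blast
      with anc_parent child.hyps show False by blast
    qed
  qed (auto simp: anc_zero)
  with assms show ?thesis by blast
qed

definition par :: "nat \<Rightarrow> nat" where "par c = the (map_of T c)"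

lemma par_eq [simp]: "(c, p) \<in> set T \<Longrightarrow> par c = p"
  using distinct_table[OF table] by (simp add: par_def map_of_is_SomeI)

lemma par_mem: "c \<in> V \<Longrightarrow> c \<noteq> 0 \<Longrightarrow> (c, par c) \<in> set T"
  by auto

lemma in_T: "(c, p) \<in> set T \<longleftrightarrow> c \<in> V \<and> c \<noteq> 0 \<and> par c = p"
proof
  assume "(c, p) \<in> set T"
  moreover from this have "c \<in> fst ` set T" by force
  moreover from this have "c \<noteq> 0" using distinct_table[OF table] by metis
  ultimately show "c \<in> V \<and> c \<noteq> 0 \<and> par c = p" by simp
qed (use par_mem in blast)

lemma child_facts:
  assumes "(c, p) \<in> set T"
  shows "c \<in> V" "c \<noteq> 0" "p \<in> V" "p \<sqsubseteq> c" "p \<noteq> c" "\<not> c \<sqsubseteq> p"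
proof -
  show "c \<in> V" "c \<noteq> 0" using in_T assms by blast+
  show "p \<in> V" using parent_V[OF assms] .
  show "p \<sqsubseteq> c" using anc_step[OF assms] anc_refl[of p] by blast
  show "\<not> c \<sqsubseteq> p" using anc_parent[OF assms] .
  then show "p \<noteq> c" using anc_refl[of p] by blast
qed

lemma anc_strict: "x \<sqsubseteq> c \<Longrightarrow> x \<noteq> c \<Longrightarrow> (c, p) \<in> set T \<Longrightarrow> x \<sqsubseteq> p"
  using anc_step by auto

lemma child_towards: assumes "x \<sqsubseteq> y" "x \<noteq> y" "y \<in> V" shows "\<exists>c. (c, x) \<in> set T \<and> c \<sqsubseteq> y"
  using assms(3,1,2)
proof (induction y rule: tree_induct)
  case (child c p)
  show ?case
  proof (cases "x = p")
    case True
    with child show ?thesis by auto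
  next
    case False
    with child anc_strict obtain c' where "(c', x) \<in> set T" "c' \<sqsubseteq> p" by blast
    with child show ?thesis using anc_trans[of c' p c] child_facts by blast
  qed
qed (simp add: anc_zero)

abbreviation "sz \<equiv> subtree_size T"

lemma size_card: "sz y = card {v \<in> V. y \<sqsubseteq> v}"
proof -
  have "distinct (tree_vertices T)" using distinct_table[OF table] by (auto simp: tree_vertices_def)
  then have "sz y = card (set (filter (\<lambda>v. y \<sqsubseteq> v) (tree_vertices T)))"
    unfolding subtree_size_def by (metis distinct_card distinct_filter)
  also have "set (filter (\<lambda>v. y \<sqsubseteq> v) (tree_vertices T)) = {v \<in> V. y \<sqsubseteq> v}"
    by (auto simp: tree_vertices_def)
  finally show ?thesis .
qed

lemma finV: "finite {v \<in> V. P v}" by simp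

lemma size_mono: "x \<sqsubseteq> y \<Longrightarrow> sz y \<le> sz x"
  unfolding size_card by (intro card_mono finV) (auto intro: anc_trans simp: anc_zero)

lemma size_le: "sz y \<le> Suc (length T)"
  unfolding subtree_size_def tree_vertices_def by (rule order_trans[OF length_filter_le]) simp

lemma size_child: assumes "(c, v) \<in> set T" shows "sz c < sz v"
  unfolding size_card
proof (intro psubset_card_mono finV psubsetI)
  show "{w \<in> V. c \<sqsubseteq> w} \<subseteq> {w \<in> V. v \<sqsubseteq> w}"
    using anc_trans[of v c] child_facts(4)[OF assms] by blast
  have "v \<in> {w \<in> V. v \<sqsubseteq> w}" "v \<notin> {w \<in> V. c \<sqsubseteq> w}" using child_facts[OF assms] by auto
  then show "{w \<in> V. c \<sqsubseteq> w} \<noteq> {w \<in> V. v \<sqsubseteq> w}" by blast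
qed

lemma size_two_children:
  assumes c: "(c, v) \<in> set T" and d: "(d, v) \<in> set T" and "c \<noteq> d"
  shows "sz c + sz d < sz v"
proof -
  let ?S = "\<lambda>x. {w \<in> V. x \<sqsubseteq> w}"
  have "?S c \<inter> ?S d = {}"
  proof (rule ccontr)
    assume "?S c \<inter> ?S d \<noteq> {}"
    then obtain w where w: "w \<in> V" "c \<sqsubseteq> w" "d \<sqsubseteq> w" by blast
    with anc_chain have "c \<sqsubseteq> d \<or> d \<sqsubseteq> c" by blast
    then show False
      using anc_strict[of c d v] anc_strict[of d c v] assms child_facts(6)[OF c] child_facts(6)[OF d] by auto
  qed
  then have "sz c + sz d = card (?S c \<union> ?S d)"
    unfolding size_card by (intro card_Un_disjoint[symmetric] finV)
  also have "\<dots> < sz v"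
    unfolding size_card
  proof (intro psubset_card_mono finV psubsetI)
    show "?S c \<union> ?S d \<subseteq> ?S v"
      using anc_trans[of v c] anc_trans[of v d] child_facts(4)[OF c] child_facts(4)[OF d] by blast
    have "v \<in> ?S v" "v \<notin> ?S c \<union> ?S d" using child_facts[OF c] child_facts[OF d] by auto
    then show "?S c \<union> ?S d \<noteq> ?S v" by blast
  qed
  finally show ?thesis .
qed

lemma heavy_child_spec:
  "case heavy_child T v of None \<Rightarrow> \<forall>c. (c, v) \<notin> set T
   | Some h \<Rightarrow> (h, v) \<in> set T \<and> (\<forall>c. (c, v) \<in> set T \<longrightarrow> sz c \<le> sz h)"
  using foldl_argmax[where P = "\<lambda>e. snd e = v" and f = sz and g = fst and xs = T]
  unfolding heavy_child_def[symmetric]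
  by (fastforce split: option.splits)

lemma heavy_size_less: "v \<in> V \<Longrightarrow> heavy_size T v < sz v"
proof -
  assume "v \<in> V"
  then have "0 < sz v" unfolding size_card card_gt_0_iff by (auto intro: exI[of _ v])
  with heavy_child_spec[of v] size_child show ?thesis
    by (auto simp: heavy_size_def split: option.splits)
qed

section \<open>Dyadic ranks along heavy paths\<close>

lemma dyadic_bound: "dyadic T v k \<Longrightarrow> 2 ^ k \<le> (sz v)\<^sup>2"
proof -
  assume "dyadic T v k"
  then obtain m where m: "(heavy_size T v)\<^sup>2 < m * 2 ^ k" "m * 2 ^ k \<le> (sz v)\<^sup>2"
    by (auto simp: dyadic_def)
  have "m \<noteq> 0" using m(1) by (cases m) auto
  then have "1 * 2 ^ k \<le> m * 2 ^ k" by (intro mult_le_mono1) simp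
  with m(2) show ?thesis by linarith
qed

lemma finite_dyadic: "finite {k. dyadic T v k}"
proof (rule finite_subset)
  have "k \<le> (sz v)\<^sup>2" if "dyadic T v k" for k
    using dyadic_bound[OF that] less_exp[of k] by linarith
  then show "{k. dyadic T v k} \<subseteq> {..(sz v)\<^sup>2}" by auto
qed simp

lemma dyadic_0: "v \<in> V \<Longrightarrow> dyadic T v 0"
  unfolding dyadic_def using heavy_size_less[of v] by (intro exI[of _ "(sz v)\<^sup>2"]) (simp add: power_strict_mono)

lemma dyadic_rank: "v \<in> V \<Longrightarrow> dyadic T v (vertex_rank T v)"
  using Max_in[OF finite_dyadic] dyadic_0 unfolding vertex_rank_def by blast

lemma rank_ge: "dyadic T v k \<Longrightarrow> k \<le> vertex_rank T v"
  unfolding vertex_rank_def by (intro Max_ge finite_dyadic) simp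

text \<open>
  The interval of \<open>v\<close> has length at least \<open>2 * (sz c)\<^sup>2\<close>, as \<open>sz v > heavy_size T v + sz c\<close>
  and \<open>sz c \<le> heavy_size T v\<close>.
\<close>

lemma light_rank_less:
  assumes c: "(c, v) \<in> set T" and light: "heavy_child T v \<noteq> Some c" and u: "c \<sqsubseteq> u" "u \<in> V"
  shows "vertex_rank T u < vertex_rank T v"
proof -
  obtain h where h: "heavy_child T v = Some h" "(h, v) \<in> set T" "sz c \<le> sz h"
    using heavy_child_spec[of v] c by (auto split: option.splits)
  with light have "h \<noteq> c" by auto
  let ?a = "sz h" and ?s = "sz c" and ?k = "vertex_rank T u"
  have k: "2 ^ ?k \<le> ?s\<^sup>2"
    using dyadic_bound[OF dyadic_rank[OF u(2)]] power_mono[OF size_mono[OF u(1)], of 2] by linarith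
  have "?a\<^sup>2 + 2 * ?s\<^sup>2 \<le> ?a\<^sup>2 + 2 * (?a * ?s) + ?s\<^sup>2"
    using h(3) by (simp add: power2_eq_square)
  also have "\<dots> = (?a + ?s)\<^sup>2" by (simp add: power2_eq_square algebra_simps)
  also have "\<dots> \<le> (sz v)\<^sup>2"
    using size_two_children[OF h(2) c \<open>h \<noteq> c\<close>] by (intro power_mono) auto
  finally have len: "?a\<^sup>2 + 2 ^ Suc ?k \<le> (sz v)\<^sup>2" using k by simp
  let ?m = "?a\<^sup>2 div 2 ^ Suc ?k + 1"
  have *: "?a\<^sup>2 div 2 ^ Suc ?k * 2 ^ Suc ?k + ?a\<^sup>2 mod 2 ^ Suc ?k = ?a\<^sup>2" by (rule div_mult_mod_eq)
  have "?a\<^sup>2 mod 2 ^ Suc ?k < 2 ^ Suc ?k" by (rule mod_less_divisor) simp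
  with * have "?a\<^sup>2 < ?m * 2 ^ Suc ?k" unfolding distrib_right by linarith
  moreover have "?m * 2 ^ Suc ?k \<le> (sz v)\<^sup>2" using * len unfolding distrib_right by linarith
  ultimately have "dyadic T v (Suc ?k)"
    unfolding dyadic_def heavy_size_def h(1) option.case by blast
  from rank_ge[OF this] show ?thesis by simp
qed

abbreviation heavy :: "nat \<Rightarrow> bool" where
  "heavy y \<equiv> heavy_child T (par y) = Some y"

text \<open>Down a heavy path the heavy size of a vertex is the subtree size of the next one. The
  intervals therefore fit together without gaps, and each \<open>q\<close> in the range falls into
  one of them.\<close>

lemma heavy_chain_cover:
  assumes "y \<in> V" "x \<sqsubseteq> y" "x \<noteq> y" and "\<And>w. x \<sqsubseteq> w \<Longrightarrow> w \<sqsubseteq> y \<Longrightarrow> w \<noteq> x \<Longrightarrow> heavy w"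
    and "(sz y)\<^sup>2 < q" "q \<le> (sz x)\<^sup>2"
  shows "\<exists>w. x \<sqsubseteq> w \<and> w \<sqsubseteq> y \<and> w \<noteq> y \<and> (heavy_size T w)\<^sup>2 < q \<and> q \<le> (sz w)\<^sup>2"
  using assms
proof (induction y rule: tree_induct)
  case (child c p)
  note cp = child_facts[OF child.hyps(1)]
  have xp: "x \<sqsubseteq> p" using anc_strict child.prems child.hyps by blast
  have "heavy_child T p = Some c" using child.prems(3)[of c] child.prems(1,2) child.hyps(1) by auto
  then have hs: "heavy_size T p = sz c" by (simp add: heavy_size_def)
  show ?case
  proof (cases "q \<le> (sz p)\<^sup>2")
    case True
    with xp cp hs child.prems show ?thesis by (intro exI[of _ p]) auto
  next
    case False
    then have "x \<noteq> p" using child.prems by auto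
    moreover have "heavy w" if "x \<sqsubseteq> w" "w \<sqsubseteq> p" "w \<noteq> x" for w
      using child.prems(3)[of w] that anc_trans[of w p c] cp by blast
    moreover have "(sz p)\<^sup>2 < q" using False by simp
    ultimately obtain w where "x \<sqsubseteq> w" "w \<sqsubseteq> p" "(heavy_size T w)\<^sup>2 < q \<and> q \<le> (sz w)\<^sup>2"
      using child.IH[OF xp _ _ _ child.prems(5)] by blast
    moreover from this have "w \<sqsubseteq> c" "w \<noteq> c" using anc_trans[of w p c] cp by blast+
    ultimately show ?thesis by blast
  qed
qed (simp add: anc_zero)

text \<open>With \<open>k\<close> the common rank, the interval of \<open>y\<close> contains a
  multiple of \<open>2 ^ k\<close> but none of \<open>2 ^ Suc k\<close>. The next multiple of
  \<open>2 ^ Suc k\<close> above it is still within the interval of \<open>x\<close> or below it, so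
  it belongs to a vertex in between.\<close>

lemma heavy_chain_rank:
  assumes "y \<in> V" "x \<sqsubseteq> y" "x \<noteq> y" and hv: "\<And>w. x \<sqsubseteq> w \<Longrightarrow> w \<sqsubseteq> y \<Longrightarrow> w \<noteq> x \<Longrightarrow> heavy w"
    and eq: "vertex_rank T x = vertex_rank T y"
  shows "\<exists>w. x \<sqsubseteq> w \<and> w \<sqsubseteq> y \<and> vertex_rank T y < vertex_rank T w"
proof -
  let ?k = "vertex_rank T y"
  have "x \<in> V" using assms anc_V by blast
  obtain c where c: "(c, x) \<in> set T" "c \<sqsubseteq> y" using child_towards assms by blast
  then have "heavy c" using hv[of c] child_facts[OF c(1)] by auto
  then have "heavy_size T x = sz c" using c by (simp add: heavy_size_def)
  with size_mono[OF c(2)] have sz: "(sz y)\<^sup>2 \<le> (heavy_size T x)\<^sup>2" by (simp add: power_mono)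
  obtain m where m: "(heavy_size T y)\<^sup>2 < m * 2 ^ ?k" "m * 2 ^ ?k \<le> (sz y)\<^sup>2"
    using dyadic_rank[OF \<open>y \<in> V\<close>] by (auto simp: dyadic_def)
  obtain m' where m': "(heavy_size T x)\<^sup>2 < m' * 2 ^ ?k" "m' * 2 ^ ?k \<le> (sz x)\<^sup>2"
    using dyadic_rank[OF \<open>x \<in> V\<close>] eq by (auto simp: dyadic_def)
  have nd: "\<not> ((heavy_size T y)\<^sup>2 < j * 2 ^ Suc ?k \<and> j * 2 ^ Suc ?k \<le> (sz y)\<^sup>2)" for j
    using rank_ge[of y "Suc ?k"] unfolding dyadic_def by force
  have "m * 2 ^ ?k < m' * 2 ^ ?k" using m(2) sz m'(1) by linarith
  then have "m < m'" by simp
  \<comment> \<open>An even multiple would be a multiple of \<open>2 ^ Suc ?k\<close> in the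
    interval of \<open>y\<close>, against the maximality of its rank. So the successor of
    \<open>m\<close> is even.\<close>
  have "odd m"
  proof
    assume "even m"
    then obtain j where "m = 2 * j" by blast
    with m nd[of j] show False by (simp add: algebra_simps)
  qed
  then obtain j where j: "Suc m = 2 * j" by (metis even_Suc evenE)
  have jq: "j * 2 ^ Suc ?k = Suc m * 2 ^ ?k" unfolding j by simp
  have "j * 2 ^ Suc ?k \<le> m' * 2 ^ ?k" unfolding jq using \<open>m < m'\<close> by (intro mult_le_mono1) simp
  then have up: "j * 2 ^ Suc ?k \<le> (sz x)\<^sup>2" using m'(2) by linarith
  have "m * 2 ^ ?k < j * 2 ^ Suc ?k" unfolding jq by simp
  then have "(sz y)\<^sup>2 < j * 2 ^ Suc ?k" using nd[of j] m(1) by linarith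
  from heavy_chain_cover[OF assms(1-3) hv this up]
  obtain w where w: "x \<sqsubseteq> w" "w \<sqsubseteq> y" "(heavy_size T w)\<^sup>2 < j * 2 ^ Suc ?k" "j * 2 ^ Suc ?k \<le> (sz w)\<^sup>2"
    by blast
  then have "dyadic T w (Suc ?k)" unfolding dyadic_def by blast
  from rank_ge[OF this] w show ?thesis by auto
qed

text \<open>Two descending heavy chains with a common start cannot separate, because a vertex has
  only one heavy child.\<close>

lemma heavy_comparable:
  assumes "a \<in> V" "x \<sqsubseteq> a" "\<And>w. x \<sqsubseteq> w \<Longrightarrow> w \<sqsubseteq> a \<Longrightarrow> heavy w"
    and "b \<in> V" "x \<sqsubseteq> b" "\<And>w. x \<sqsubseteq> w \<Longrightarrow> w \<sqsubseteq> b \<Longrightarrow> heavy w"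
  shows "a \<sqsubseteq> b \<or> b \<sqsubseteq> a"
  using assms(1-3)
proof (induction a rule: tree_induct)
  case root
  then show ?case using anc_root assms by blast
next
  case (child c p)
  note cp = child_facts[OF child.hyps(1)]
  show ?case
  proof (cases "x = c")
    case True
    then show ?thesis using assms by simp
  next
    case False
    then have xp: "x \<sqsubseteq> p" using anc_strict child by blast
    have "p \<sqsubseteq> b \<or> b \<sqsubseteq> p"
      using child.IH[OF xp] child.prems(2) anc_trans[of _ p c] cp by blast
    then show ?thesis
    proof
      assume "b \<sqsubseteq> p" then show ?thesis using anc_trans[of b p c] cp by blast
    next
      assume pb: "p \<sqsubseteq> b"
      show ?thesis
      proof (cases "p = b")
        case True then show ?thesis using cp by blast
      next
        case False
        then obtain c' where c': "(c', p) \<in> set T" "c' \<sqsubseteq> b" using child_towards pb assms by blast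
        have "x \<sqsubseteq> c'" using anc_trans[of x p c'] xp child_facts[OF c'(1)] by blast
        then have "heavy c'" using assms(6) c' by blast
        moreover have "heavy c" using child.prems by auto
        ultimately have "c = c'" using c' child.hyps by simp
        with c' show ?thesis by blast
      qed
    qed
  qed
qed

section \<open>Routes between two vertices, their heavy parts and critical vertices\<close>

definition XV :: "nat \<Rightarrow> nat \<Rightarrow> nat set" where
  "XV u v = {x. (x \<sqsubseteq> u) \<noteq> (x \<sqsubseteq> v)}"

definition HV :: "nat \<Rightarrow> nat \<Rightarrow> nat set" where
  "HV u v = {x \<in> XV u v. \<forall>y\<in>XV u v. y \<sqsubseteq> x \<longrightarrow> heavy y}"

definition tops :: "nat \<Rightarrow> nat \<Rightarrow> nat set" where
  "tops u v = {x \<in> XV u v. par x \<notin> XV u v}"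

definition lay :: "nat \<Rightarrow> nat \<Rightarrow> nat" where
  "lay u v = Max (insert 1 ((\<lambda>x. 2 ^ vertex_rank T x) ` (par ` tops u v \<union> HV u v)))"

definition CV :: "nat \<Rightarrow> nat \<Rightarrow> nat set" where
  "CV u v = {x \<in> XV u v. x \<in> tops u v \<or>
     x \<in> HV u v \<and> (2 ^ vertex_rank T x = lay u v \<or> (\<forall>y\<in>HV u v. par y \<noteq> x)) \<or>
     par x \<in> HV u v \<and> (2 ^ vertex_rank T (par x) = lay u v \<or> x \<notin> HV u v)}"

context
  fixes u v assumes uv: "u \<in> V" "v \<in> V"
begin

lemma XV_V: "x \<in> XV u v \<Longrightarrow> x \<in> V"
  using uv anc_V unfolding XV_def by blast

lemma XV_nonzero: "x \<in> XV u v \<Longrightarrow> x \<noteq> 0"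
  using anc_root[OF uv(1)] anc_root[OF uv(2)] by (cases "x = 0") (auto simp: XV_def)

lemma XV_T: "x \<in> XV u v \<Longrightarrow> (x, par x) \<in> set T"
  by (rule par_mem[OF XV_V XV_nonzero])

lemma finite_XV: "finite (XV u v)"
  by (rule finite_subset[of _ V]) (use XV_V in auto)

lemma XV_anc: assumes "x \<in> XV u v" "y \<sqsubseteq> x" shows "y \<in> XV u v \<or> y \<sqsubseteq> u \<and> y \<sqsubseteq> v"
  using assms anc_trans[OF _ _ uv(1), of y x] anc_trans[OF _ _ uv(2), of y x] by (auto simp: XV_def)

lemma XV_convex: assumes "z \<in> XV u v" "x \<in> XV u v" "z \<sqsubseteq> y" "y \<sqsubseteq> x" shows "y \<in> XV u v"
  using XV_anc[OF assms(2,4)] assms(1,3) anc_trans[OF _ _ uv(1), of z y] anc_trans[OF _ _ uv(2), of z y]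
  by (auto simp: XV_def)

lemma HV_XV: "x \<in> HV u v \<Longrightarrow> x \<in> XV u v" by (simp add: HV_def)

lemma HV_heavy: "x \<in> HV u v \<Longrightarrow> heavy x" by (simp add: HV_def)

lemma HV_up: "x \<in> HV u v \<Longrightarrow> y \<in> XV u v \<Longrightarrow> y \<sqsubseteq> x \<Longrightarrow> y \<in> HV u v"
  unfolding HV_def using anc_trans[of _ y x] XV_V by blast

text \<open>A vertex of the route is above only one of the two ends, so two of its children on the
  route would both be above that same end.\<close>

lemma child_unique:
  assumes "x \<in> XV u v" "y \<in> XV u v" "par x = par y" "par x \<in> XV u v"
  shows "x = y"
proof (rule ccontr)
  assume "x \<noteq> y"
  note x = child_facts[OF XV_T[OF assms(1)]] and y = child_facts[OF XV_T[OF assms(2)]]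
  have "par x \<sqsubseteq> w" if "x \<sqsubseteq> w \<or> y \<sqsubseteq> w" "w \<in> V" for w
    using that x(4) y(4) assms(3) anc_trans[of "par x" x w] anc_trans[of "par x" y w] by metis
  from this[OF _ uv(1)] this[OF _ uv(2)] obtain w where "w \<in> V" "x \<sqsubseteq> w" "y \<sqsubseteq> w"
    using assms(1,2,4) uv by (auto simp: XV_def)
  then have "x \<sqsubseteq> y \<or> y \<sqsubseteq> x" using anc_chain by metis
  then show False
    using anc_strict[OF _ _ XV_T[OF assms(1)], of y] anc_strict[OF _ _ XV_T[OF assms(2)], of x]
      x(6) y(6) assms(3) \<open>x \<noteq> y\<close> by auto
qed

lemma top_exists: assumes "x \<in> XV u v" shows "\<exists>t\<in>tops u v. t \<sqsubseteq> x"
proof -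
  have "x \<in> XV u v \<longrightarrow> (\<exists>t\<in>tops u v. t \<sqsubseteq> x)" using XV_V[OF assms]
  proof (induction x rule: tree_induct)
    case root then show ?case using XV_nonzero by blast
  next
    case (child c p)
    note cp = child_facts[OF child.hyps(1)]
    show ?case
    proof (cases "p \<in> XV u v")
      case True
      with child obtain t where "t \<in> tops u v" "t \<sqsubseteq> p" by blast
      then show ?thesis using anc_trans[of t p c] cp by blast
    next
      case False
      then show ?thesis using child.hyps by (auto simp: tops_def intro!: bexI[of _ c])
    qed
  qed
  with assms show ?thesis by blast
qed

lemma tops_par: "t \<in> tops u v \<Longrightarrow> par t \<sqsubseteq> u \<and> par t \<sqsubseteq> v"
  using XV_anc[of t "par t"] child_facts(4)[OF XV_T] by (auto simp: tops_def)

text \<open>The parent of a top vertex is a common ancestor of both ends, and the top vertex itself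
  is not. So this parent is the lowest common ancestor, the same for all top vertices.\<close>

lemma tops_below: assumes "t \<in> tops u v" "s \<in> tops u v" shows "par s \<sqsubseteq> par t"
proof -
  have tX: "t \<in> XV u v" using assms by (simp add: tops_def)
  obtain w where w: "w \<in> V" "t \<sqsubseteq> w" "w = u \<or> w = v" using tX uv by (auto simp: XV_def)
  have "par s \<sqsubseteq> w" using tops_par[OF assms(2)] w by blast
  then consider "t \<sqsubseteq> par s" | "par s \<sqsubseteq> t" using anc_chain[OF w(2) _ w(1)] by metis
  then show ?thesis
  proof cases
    case 1
    then have "t \<sqsubseteq> u" "t \<sqsubseteq> v" using tops_par[OF assms(2)] anc_trans[OF 1] uv by metis+
    then show ?thesis using tX by (simp add: XV_def)
  next
    case 2
    moreover have "par s \<noteq> t" using tops_par[OF assms(2)] tX unfolding XV_def by blast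
    ultimately show ?thesis using anc_strict XV_T[OF tX] by blast
  qed
qed

lemma tops_par_eq: assumes "t \<in> tops u v" "s \<in> tops u v" shows "par s = par t"
  using anc_antisym[OF tops_below[OF assms] tops_below[OF assms(2,1)]]
    anc_V[OF conjunct1[OF tops_par[OF assms(1)]] uv(1)] by metis

lemma tops_anc: assumes "t \<in> tops u v" "x \<in> XV u v" shows "par t \<sqsubseteq> x"
proof -
  obtain s where s: "s \<in> tops u v" "s \<sqsubseteq> x" using top_exists assms by blast
  have "par s \<sqsubseteq> s" using s child_facts(4)[OF XV_T] by (auto simp: tops_def)
  from anc_trans[OF this s(2) XV_V[OF assms(2)]] have "par s \<sqsubseteq> x" .
  with tops_par_eq[OF s(1) assms(1)] show ?thesis by simp
qed

lemma HV_chain_heavy: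
  assumes "t \<in> XV u v" "x \<in> HV u v" "t \<sqsubseteq> w" "w \<sqsubseteq> x" shows "heavy w" "w \<in> HV u v"
  using HV_up[OF assms(2) XV_convex[OF assms(1) HV_XV[OF assms(2)] assms(3,4)] assms(4)] HV_heavy
  by blast+

text \<open>The tops above \<open>x\<close> and \<open>y\<close> are heavy children of the same
  apex, hence equal.\<close>

lemma HV_comparable: assumes "x \<in> HV u v" "y \<in> HV u v" shows "x \<sqsubseteq> y \<or> y \<sqsubseteq> x"
proof -
  obtain s t where st: "s \<in> tops u v" "s \<sqsubseteq> x" "t \<in> tops u v" "t \<sqsubseteq> y"
    using top_exists assms HV_XV by meson
  then have X: "s \<in> XV u v" "t \<in> XV u v" by (auto simp: tops_def)
  with st have "heavy s" "heavy t" using HV_chain_heavy(1) assms by force+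
  with tops_par_eq[OF st(1,3)] have "s = t" by simp
  with st X show ?thesis
    by (intro heavy_comparable[of x s y])
      (use assms HV_chain_heavy(1)[OF X(1)] XV_V HV_XV in blast)+
qed

lemma lay_fin: "finite (insert 1 ((\<lambda>x. 2 ^ vertex_rank T x) ` (par ` tops u v \<union> HV u v)))"
  by (rule finite_subset[of _ "insert 1 ((\<lambda>x. 2 ^ vertex_rank T x) ` (par ` XV u v \<union> XV u v))"])
    (use finite_XV in \<open>auto simp: tops_def HV_def\<close>)

lemma lay_ge: "x \<in> par ` tops u v \<union> HV u v \<Longrightarrow> 2 ^ vertex_rank T x \<le> lay u v"
  unfolding lay_def by (intro Max_ge lay_fin) blast

lemma seg_V: "x \<in> par ` tops u v \<union> HV u v \<Longrightarrow> x \<in> V"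
  using child_facts(3)[OF XV_T] XV_V by (auto simp: tops_def HV_def)

lemma lay_attained: assumes "XV u v \<noteq> {}"
  shows "\<exists>x \<in> par ` tops u v \<union> HV u v. 2 ^ vertex_rank T x = lay u v"
proof -
  obtain t where t: "t \<in> tops u v" using assms top_exists by blast
  have "lay u v \<in> insert 1 ((\<lambda>x. 2 ^ vertex_rank T x) ` (par ` tops u v \<union> HV u v))"
    unfolding lay_def by (intro Max_in lay_fin) simp
  moreover have "1 \<in> (\<lambda>x. 2 ^ vertex_rank T x) ` (par ` tops u v \<union> HV u v)" if "lay u v = 1"
  proof -
    have "2 ^ vertex_rank T (par t) = (1 :: nat)"
      using lay_ge[of "par t"] t that one_le_power[of "2 :: nat" "vertex_rank T (par t)"]
      by (intro antisym) auto
    then show ?thesis using t by (intro image_eqI[of _ _ "par t"]) auto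
  qed
  ultimately show ?thesis by (metis (no_types, lifting) imageE insertE)
qed

lemma lay_power: "\<exists>k. lay u v = 2 ^ k" and lay_bound: "lay u v \<le> (Suc (length T))\<^sup>2"
proof -
  have *: "lay u v \<in> insert 1 ((\<lambda>x. 2 ^ vertex_rank T x) ` (par ` tops u v \<union> HV u v))"
    unfolding lay_def by (intro Max_in lay_fin) simp
  then show "\<exists>k. lay u v = 2 ^ k" by (metis (no_types, lifting) imageE insertE power_0)
  show "lay u v \<le> (Suc (length T))\<^sup>2"
  proof (cases "lay u v = 1")
    case False
    with * obtain x where x: "x \<in> V" "lay u v = 2 ^ vertex_rank T x" using seg_V by auto
    then have "lay u v \<le> (sz x)\<^sup>2" using dyadic_bound[OF dyadic_rank] by simp
    also have "\<dots> \<le> (Suc (length T))\<^sup>2" by (intro power_mono size_le) simp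
    finally show ?thesis .
  qed simp
qed

text \<open>Between two vertices of equal rank on a heavy path there is one of higher rank, and it
  would still lie in the heavy part.\<close>

lemma HV_max_unique:
  assumes "x \<in> HV u v" "y \<in> HV u v" "2 ^ vertex_rank T x = lay u v" "2 ^ vertex_rank T y = lay u v"
  shows "x = y"
proof -
  have *: "x = y" if xy: "x \<in> HV u v" "y \<in> HV u v" "2 ^ vertex_rank T x = lay u v" "2 ^ vertex_rank T y = lay u v"
      "x \<sqsubseteq> y" for x y
  proof (rule ccontr)
    assume "x \<noteq> y"
    moreover have "(2 :: nat) ^ vertex_rank T x = 2 ^ vertex_rank T y" using xy by simp
    then have "vertex_rank T x = vertex_rank T y" by simp
    moreover have "heavy w" "w \<in> HV u v" if "x \<sqsubseteq> w" "w \<sqsubseteq> y" for w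
      using HV_chain_heavy[OF HV_XV[OF xy(1)] xy(2) that] by blast+
    ultimately obtain w where "w \<in> HV u v" "vertex_rank T y < vertex_rank T w"
      using heavy_chain_rank[of y x] xy XV_V[OF HV_XV[OF xy(2)]] by blast
    then have "(2 :: nat) ^ vertex_rank T y < 2 ^ vertex_rank T w" "2 ^ vertex_rank T w \<le> lay u v"
      using lay_ge[of w] by auto
    with xy show False by simp
  qed
  from HV_comparable[OF assms(1,2)] *[of x y] *[of y x] assms show ?thesis by blast
qed

lemma HV_bottom_unique:
  assumes "x \<in> HV u v" "y \<in> HV u v" "\<forall>z\<in>HV u v. par z \<noteq> x" "\<forall>z\<in>HV u v. par z \<noteq> y"
  shows "x = y"
proof -
  have *: "x = y" if xy: "x \<in> HV u v" "y \<in> HV u v" "\<forall>z\<in>HV u v. par z \<noteq> x" "x \<sqsubseteq> y" for x y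
  proof (rule ccontr)
    assume "x \<noteq> y"
    then obtain c where c: "(c, x) \<in> set T" "c \<sqsubseteq> y"
      using child_towards xy XV_V[OF HV_XV[OF xy(2)]] by blast
    from HV_chain_heavy(2)[OF HV_XV[OF xy(1)] xy(2) child_facts(4)[OF c(1)] c(2)] have "c \<in> HV u v" .
    with xy(3) par_eq[OF c(1)] show False by blast
  qed
  from HV_comparable[OF assms(1,2)] *[of x y] *[of y x] assms show ?thesis by blast
qed

text \<open>Six sets with at most one element each: one top above either end, the heavy vertex of
  maximal rank, the lowest heavy vertex, and the children on the route of these last two, as far as
  they exist.\<close>

lemma card_CV: "card (CV u v) \<le> 6"
proof -
  let ?A = "\<lambda>w. {x \<in> tops u v. x \<sqsubseteq> w}"
  let ?B = "{x \<in> HV u v. 2 ^ vertex_rank T x = lay u v}"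
  let ?C = "{x \<in> HV u v. \<forall>y\<in>HV u v. par y \<noteq> x}"
  let ?D = "{x \<in> XV u v. par x \<in> HV u v \<and> 2 ^ vertex_rank T (par x) = lay u v}"
  let ?E = "{x \<in> XV u v. par x \<in> HV u v \<and> x \<notin> HV u v}"
  have A: "card (?A w) \<le> Suc 0" if w: "w \<in> V" for w
  proof (rule card_le_Suc0_iff_eq[THEN iffD2, rule_format])
    show "finite (?A w)" by (rule finite_subset[OF _ finite_XV]) (auto simp: tops_def)
    fix s t assume st: "s \<in> ?A w" "t \<in> ?A w"
    then have T: "(s, par s) \<in> set T" "(t, par t) \<in> set T" using XV_T by (auto simp: tops_def)
    have "s \<sqsubseteq> t \<or> t \<sqsubseteq> s" "par s = par t" using st w anc_chain tops_par_eq by auto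
    then show "s = t" using anc_strict[OF _ _ T(2), of s] anc_strict[OF _ _ T(1), of t]
        child_facts(6)[OF T(1)] child_facts(6)[OF T(2)] by auto
  qed
  have B: "card ?B \<le> Suc 0" and C: "card ?C \<le> Suc 0"
    by (rule card_le_Suc0_iff_eq[THEN iffD2]; use HV_max_unique HV_bottom_unique HV_XV
      in \<open>auto intro!: finite_subset[OF _ finite_XV]\<close>)+
  have D: "card ?D \<le> Suc 0"
  proof (rule card_le_Suc0_iff_eq[THEN iffD2, rule_format])
    show "finite ?D" by (rule finite_subset[OF _ finite_XV]) auto
    show "x = y" if "x \<in> ?D" "y \<in> ?D" for x y
      using that HV_max_unique[of "par x" "par y"] child_unique[of x y] HV_XV by auto
  qed
  have E: "card ?E \<le> Suc 0"
  proof (rule card_le_Suc0_iff_eq[THEN iffD2, rule_format])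
    show "finite ?E" by (rule finite_subset[OF _ finite_XV]) auto
    have bot: "\<forall>z\<in>HV u v. par z \<noteq> par x" if "x \<in> ?E" for x
    proof (intro ballI notI)
      fix z assume z: "z \<in> HV u v" "par z = par x"
      have "x = z" by (rule child_unique) (use that z HV_XV in auto)
      with z that show False by simp
    qed
    show "x = y" if "x \<in> ?E" "y \<in> ?E" for x y
      using that bot[OF that(1)] bot[OF that(2)] HV_bottom_unique[of "par x" "par y"]
        child_unique[of x y] HV_XV by auto
  qed
  have "CV u v \<subseteq> ?A u \<union> ?A v \<union> ?B \<union> ?C \<union> ?D \<union> ?E"
    by (auto simp: CV_def XV_def tops_def)
  moreover have "finite (?A u \<union> ?A v \<union> ?B \<union> ?C \<union> ?D \<union> ?E)"
    by (rule finite_subset[OF _ finite_XV]) (auto simp: tops_def HV_def)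
  ultimately have "card (CV u v) \<le> card (?A u \<union> ?A v \<union> ?B \<union> ?C \<union> ?D \<union> ?E)"
    by (intro card_mono)
  also have "\<dots> \<le> card (?A u) + card (?A v) + card ?B + card ?C + card ?D + card ?E"
    by (intro order_trans[OF card_Un_le] add_mono order_refl)
  also have "\<dots> \<le> 6" using A[OF uv(1)] A[OF uv(2)] B C D E by linarith
  finally show ?thesis .
qed

text \<open>Climbing from a light edge leads to a light edge whose upper end is the apex or in the
  heavy part, so that the rank of this end counts for the layer. The recursion terminates since
  subtrees grow on the way up.\<close>

lemma light_top:
  assumes "y \<in> XV u v" "\<not> heavy y"
  shows "\<exists>z\<in>XV u v. z \<sqsubseteq> y \<and> \<not> heavy z \<and> par z \<in> par ` tops u v \<union> HV u v"
  using assms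
proof (induction "Suc (length T) - sz y" arbitrary: y rule: less_induct)
    case (less y)
    note y = less.prems and IH = less.hyps
    note yf = child_facts[OF XV_T[OF y(1)]]
    show ?case
    proof (cases "par y \<in> XV u v \<and> par y \<notin> HV u v")
      case True
      then obtain x where x: "x \<in> XV u v" "x \<sqsubseteq> par y" "\<not> heavy x" by (auto simp: HV_def)
      have "sz y < sz x"
        using size_child[OF XV_T[OF y(1)]] size_mono[OF x(2)] by simp
      then have "Suc (length T) - sz x < Suc (length T) - sz y" using size_le[of x] by simp
      from IH[OF this x(1,3)] obtain z where z: "z\<in>XV u v" "z \<sqsubseteq> x" "\<not> heavy z"
        "par z \<in> par ` tops u v \<union> HV u v" by blast
      moreover have "z \<sqsubseteq> y" using z x yf anc_trans by blast
      ultimately show ?thesis by blast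
    next
      case False
      with y show ?thesis by (intro bexI[of _ y]) (auto simp: tops_def)
    qed
qed

lemma bottom_exists:
  assumes "x \<in> HV u v" shows "\<exists>h\<in>HV u v. x \<sqsubseteq> h \<and> (\<forall>y\<in>HV u v. par y \<noteq> h)"
proof -
  obtain h where h: "h \<in> HV u v \<and> x \<sqsubseteq> h" "\<And>y. y \<in> HV u v \<and> x \<sqsubseteq> y \<Longrightarrow> sz h \<le> sz y"
    using ex_has_least_nat[of "\<lambda>h. h \<in> HV u v \<and> x \<sqsubseteq> h" x sz] assms by auto
  have "par y \<noteq> h" if "y \<in> HV u v" for y
  proof
    assume "par y = h"
    then have "sz y < sz h" "x \<sqsubseteq> y"
      using size_child[OF XV_T[OF HV_XV[OF that]]] h(1) anc_trans[of x h y]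
        child_facts[OF XV_T[OF HV_XV[OF that]]] by auto
    with h(2)[of y] that show False by simp
  qed
  with h(1) show ?thesis by blast
qed

end

text \<open>Start from a common edge \<open>x\<close> whose parent edge is not common. If
  \<open>x\<close> is a top of the first route, it is critical there. Otherwise its upper end
  \<open>q\<close> is the apex of the second route, and the vertex \<open>z\<close> attaining the
  second layer has to be located relative to the first heavy part; the order of the layers excludes
  the bad positions.\<close>

lemma layered_key:
  assumes uv1: "u1 \<in> V" "v1 \<in> V" and uv2: "u2 \<in> V" "v2 \<in> V"
    and meet: "XV u1 v1 \<inter> XV u2 v2 \<noteq> {}" and le: "lay u1 v1 \<le> lay u2 v2"
  shows "CV u1 v1 \<inter> XV u2 v2 \<noteq> {}"
proof -
  let ?X1 = "XV u1 v1" and ?X2 = "XV u2 v2" and ?H1 = "HV u1 v1" and ?H2 = "HV u2 v2"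
  obtain x0 where x0: "x0 \<in> ?X1 \<inter> ?X2" using meet by blast
  have "x0 \<in> V" using XV_V[OF uv1] x0 by blast
  then have "x0 \<in> ?X1 \<inter> ?X2 \<longrightarrow> (\<exists>x\<in>?X1 \<inter> ?X2. par x \<notin> ?X1 \<inter> ?X2)"
  proof (induction x0 rule: tree_induct)
    case root
    then show ?case using XV_nonzero[OF uv1] by blast
  next
    case (child c p)
    then show ?case using par_eq[OF child.hyps(1)] by metis
  qed
  then obtain x where x: "x \<in> ?X1" "x \<in> ?X2" "par x \<notin> ?X1 \<or> par x \<notin> ?X2" using x0 by blast
  note xT = child_facts[OF XV_T[OF uv1 x(1)]]
  define q where "q = par x"
  show ?thesis
  proof (cases "q \<in> ?X1")
    case False
    then have "x \<in> CV u1 v1" using x q_def by (auto simp: CV_def tops_def)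
    with x show ?thesis by blast
  next
    case q1: True
    then have xt: "x \<in> tops u2 v2" using x q_def by (auto simp: tops_def)
    have below: "q \<sqsubseteq> y" if "y \<in> ?X2" for y
      using tops_anc[OF uv2 xt that] q_def by simp
    obtain z where z: "z \<in> par ` tops u2 v2 \<union> ?H2" "2 ^ vertex_rank T z = lay u2 v2"
      using lay_attained[OF uv2] x by blast
    have zq: "z = q \<or> z \<in> ?H2" using z tops_par_eq[OF uv2 xt] q_def by auto
    show ?thesis
    proof (cases "q \<in> ?H1")
      \<comment> \<open>Here \<open>z\<close> lies below a light edge of the first route whose upper
        end counts for the first layer. By \<open>light_rank_less\<close> the first layer would
        exceed the second.\<close>
      case False
      then obtain y where y: "y \<in> ?X1" "y \<sqsubseteq> q" "\<not> heavy y" using q1 by (auto simp: HV_def)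
      obtain w where w: "w \<in> ?X1" "w \<sqsubseteq> y" "\<not> heavy w" "par w \<in> par ` tops u1 v1 \<union> ?H1"
        using light_top[OF uv1 y(1,3)] by blast
      have zV: "z \<in> V" by (rule seg_V[OF uv2 z(1)])
      have "q \<sqsubseteq> z" using zq below HV_XV[OF uv2] by auto
      from anc_trans[OF w(2) anc_trans[OF y(2) this zV] zV] have "w \<sqsubseteq> z" .
      from light_rank_less[OF XV_T[OF uv1 w(1)] w(3) this zV]
      have "vertex_rank T z < vertex_rank T (par w)" .
      then have "(2 :: nat) ^ vertex_rank T z < 2 ^ vertex_rank T (par w)" by simp
      also have "\<dots> \<le> lay u1 v1" using lay_ge[OF uv1 w(4)] .
      finally show ?thesis using z le by simp
    next
      case qH: True
      show ?thesis
      proof (cases "2 ^ vertex_rank T q = lay u1 v1 \<or> x \<notin> ?H1")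
        case True
        then have "x \<in> CV u1 v1" using x qH q_def by (auto simp: CV_def)
        with x show ?thesis by blast
      next
        \<comment> \<open>As \<open>q\<close> is not of maximal rank in the first heavy part,
          \<open>z\<close> differs from \<open>q\<close> and is in the second heavy part. Both heavy
          parts contain \<open>x\<close> and thus run down the same heavy path. Depending on which
          of them ends first, the lowest vertex \<open>h\<close> of the first one or
          \<open>z\<close> itself is the common critical vertex.\<close>
        case False
        then have xH: "x \<in> ?H1" and "2 ^ vertex_rank T q < lay u1 v1"
          using lay_ge[OF uv1, of q] qH by (auto simp: order_less_le)
        then have zH: "z \<in> ?H2" using z zq le by auto
        obtain t where t: "t \<in> tops u2 v2" "t \<sqsubseteq> z" using top_exists[OF uv2] HV_XV[OF uv2 zH] by blast
        then have "t \<in> ?X2" by (simp add: tops_def)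
        then have "heavy t" using HV_chain_heavy(1)[OF uv2 _ zH] t by auto
        moreover have "heavy x" using HV_heavy[OF uv1 xH] .
        ultimately have "t = x" using tops_par_eq[OF uv2 t(1) xt] by simp
        with t have xz: "x \<sqsubseteq> z" by simp
        obtain h where h: "h \<in> ?H1" "x \<sqsubseteq> h" "\<forall>y\<in>?H1. par y \<noteq> h" using bottom_exists[OF uv1 xH] by blast
        have "h \<sqsubseteq> z \<or> z \<sqsubseteq> h"
          by (rule heavy_comparable[OF XV_V[OF uv1 HV_XV[OF uv1 h(1)]] h(2)
                HV_chain_heavy(1)[OF uv1 x(1) h(1)] XV_V[OF uv2 HV_XV[OF uv2 zH]] xz
                HV_chain_heavy(1)[OF uv2 x(2) zH]])
        then show ?thesis
        proof
          assume "h \<sqsubseteq> z"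
          then have "h \<in> ?X2" using XV_convex[OF uv2 x(2) HV_XV[OF uv2 zH] h(2)] by blast
          moreover have "h \<in> CV u1 v1" using h HV_XV[OF uv1 h(1)] by (auto simp: CV_def)
          ultimately show ?thesis by blast
        next
          assume "z \<sqsubseteq> h"
          then have z1: "z \<in> ?H1" using HV_chain_heavy(2)[OF uv1 x(1) h(1) xz] by blast
          then have "2 ^ vertex_rank T z = lay u1 v1" using lay_ge[OF uv1, of z] z le by simp
          then have "z \<in> CV u1 v1" using z1 HV_XV[OF uv1 z1] by (auto simp: CV_def)
          with HV_XV[OF uv2 zH] show ?thesis by blast
        qed
      qed
    qed
  qed
qed

end

section \<open>Agreement of the list functions with the vertex sets\<close>

context rooted_tree
begin

lemma V_tree_vertices: "set (tree_vertices T) = V"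
  by (simp add: tree_vertices_def)

context
  fixes u v assumes uv: "u \<in> V" "v \<in> V"
begin

lemma route_iff: "e \<in> set (route T u v) \<longleftrightarrow> fst e \<in> XV u v \<and> snd e = par (fst e)"
proof
  assume e: "e \<in> set (route T u v)"
  then have "(fst e, snd e) \<in> set T" by (simp add: route_def)
  from par_eq[OF this, symmetric] show "fst e \<in> XV u v \<and> snd e = par (fst e)"
    by (rule conjI[rotated]) (use e in \<open>auto simp: route_def XV_def\<close>)
next
  assume e: "fst e \<in> XV u v \<and> snd e = par (fst e)"
  with XV_T[OF uv, of "fst e"] have "e \<in> set T" by (metis prod.collapse)
  with e show "e \<in> set (route T u v)" by (auto simp: route_def XV_def)
qed

lemma fst_route: "fst ` set (route T u v) = XV u v"
proof -
  have "x \<in> fst ` set (route T u v)" if "x \<in> XV u v" for x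
    using that route_iff[of "(x, par x)"] by (metis fst_conv image_eqI snd_conv)
  then show ?thesis using route_iff by blast
qed

lemma heavy_part_iff: "e \<in> set (heavy_part T (route T u v)) \<longleftrightarrow> fst e \<in> HV u v \<and> snd e = par (fst e)"
proof -
  have "(\<forall>e'\<in>set (route T u v). P (fst e') (snd e')) \<longleftrightarrow> (\<forall>y\<in>XV u v. P y (par y))" for P
    unfolding fst_route[symmetric] using route_iff by fastforce
  from this[of "\<lambda>a b. a \<sqsubseteq> fst e \<longrightarrow> heavy_child T b = Some a"]
  show ?thesis by (auto simp: heavy_part_def HV_def route_iff)
qed

lemma fst_heavy_part: "fst ` set (heavy_part T (route T u v)) = HV u v"
  and snd_heavy_part: "snd ` set (heavy_part T (route T u v)) = par ` HV u v"
proof -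
  have *: "set (heavy_part T (route T u v)) = (\<lambda>x. (x, par x)) ` HV u v"
    using heavy_part_iff by (auto simp: image_iff) 
  show "fst ` set (heavy_part T (route T u v)) = HV u v"
    "snd ` set (heavy_part T (route T u v)) = par ` HV u v"
    unfolding * by (auto simp: image_image)
qed

lemma layer_of_route: "layer_of T (route T u v) = lay u v"
proof -
  have "snd ` {e \<in> set (route T u v). snd e \<notin> XV u v} = par ` tops u v"
  proof (intro equalityI subsetI)
    fix x assume "x \<in> par ` tops u v"
    then obtain t where "t \<in> tops u v" "x = par t" by blast
    then show "x \<in> snd ` {e \<in> set (route T u v). snd e \<notin> XV u v}"
      using route_iff[of "(t, x)"] by (intro image_eqI[of _ _ "(t, x)"]) (auto simp: tops_def)
  qed (auto simp: route_iff tops_def)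
  then show ?thesis unfolding layer_of_def fst_route fst_heavy_part lay_def by simp
qed

lemma critical_iff: "e \<in> set (critical T (route T u v)) \<longleftrightarrow> fst e \<in> CV u v \<and> snd e = par (fst e)"
proof -
  have "(\<forall>y\<in>HV u v. par y \<noteq> x) \<longleftrightarrow> x \<notin> par ` HV u v" for x by blast
  then show ?thesis
  unfolding critical_def Let_def set_filter mem_Collect_eq fst_route fst_heavy_part
    layer_of_route route_iff snd_heavy_part CV_def tops_def
  by auto
qed

lemma distinct_fst_route: "distinct (map fst (route T u v))"
  using distinct_table[OF table] unfolding route_def by (simp add: distinct_map_filter)

lemma length_critical: "length (critical T (route T u v)) \<le> 6"
proof -
  have "distinct (map fst (critical T (route T u v)))"
    using distinct_fst_route unfolding critical_def Let_def by (rule distinct_map_filter)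
  then have "length (critical T (route T u v)) = card (fst ` set (critical T (route T u v)))"
    by (metis distinct_card length_map set_map)
  also have "fst ` set (critical T (route T u v)) \<subseteq> CV u v" using critical_iff by blast
  then have "card (fst ` set (critical T (route T u v))) \<le> card (CV u v)"
    by (rule card_mono[rotated]) (rule finite_subset[OF _ finite_XV[OF uv]], auto simp: CV_def)
  also note card_CV[OF uv]
  finally show ?thesis by simp
qed

end

lemma critical_meets:
  assumes "u1 \<in> V" "v1 \<in> V" "u2 \<in> V" "v2 \<in> V"
    and "set (route T u1 v1) \<inter> set (route T u2 v2) \<noteq> {}"
    and "layer_of T (route T u1 v1) \<le> layer_of T (route T u2 v2)"
  shows "set (critical T (route T u1 v1)) \<inter> set (route T u2 v2) \<noteq> {}"
proof -
  have "XV u1 v1 \<inter> XV u2 v2 \<noteq> {}"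
    using assms(5) route_iff[OF assms(1,2)] route_iff[OF assms(3,4)] by blast
  from layered_key[OF assms(1-4) this] assms(6) obtain x where x: "x \<in> CV u1 v1" "x \<in> XV u2 v2"
    unfolding layer_of_route[OF assms(1,2)] layer_of_route[OF assms(3,4)] by blast
  then have "(x, par x) \<in> set (critical T (route T u1 v1)) \<inter> set (route T u2 v2)"
    using critical_iff[OF assms(1,2)] route_iff[OF assms(3,4)] by simp
  then show ?thesis by blast
qed

end

section \<open>Rooting a tree given by its edges\<close>

definition attach :: "(nat \<times> nat) list \<Rightarrow> nat \<times> nat \<Rightarrow> (nat \<times> nat) list" where
  "attach T e =
     (if fst e \<in> set (tree_vertices T) \<and> snd e \<notin> set (tree_vertices T) then (snd e, fst e) # T
      else if snd e \<in> set (tree_vertices T) \<and> fst e \<notin> set (tree_vertices T) then e # T else T)"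

text \<open>Each pass over the edges reaches at least the next distance from the root. A simple path
  has at most as many edges as there are in the list, so this number of passes reaches all vertices.
  New vertices are put in front, which yields the order required of a parent table.\<close>

definition build :: "(nat \<times> nat) list \<Rightarrow> (nat \<times> nat) list" where
  "build es = foldl (\<lambda>T _. foldl attach T es) [] es"

lemma parent_table_attach: "parent_table T \<Longrightarrow> parent_table (attach T e)"
  by (auto simp: attach_def tree_vertices_def)

lemma parent_table_build: "parent_table (build es)"
proof -
  have *: "parent_table (foldl attach T xs)" if "parent_table T" for T xs
    using that by (induction xs arbitrary: T) (auto simp: parent_table_attach)
  have "parent_table (foldl (\<lambda>T _. foldl attach T es) T xs)" if "parent_table T" for T and xs :: "(nat \<times> nat) list"
    using that by (induction xs arbitrary: T) (auto simp: *)
  then show ?thesis by (simp add: build_def)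
qed

definition ends :: "nat \<times> nat \<Rightarrow> nat set" where "ends e = {fst e, snd e}"

lemma attach_edges: "ends ` set (attach T e) \<subseteq> insert (ends e) (ends ` set T)"
  by (auto simp: attach_def ends_def)

lemma build_edges: "ends ` set (build es) \<subseteq> ends ` set es"
proof -
  have *: "ends ` set (foldl attach T xs) \<subseteq> ends ` set es"
    if "ends ` set T \<subseteq> ends ` set es" "set xs \<subseteq> set es" for T xs
    using that
  proof (induction xs arbitrary: T)
    case (Cons x xs)
    have "ends ` set (attach T x) \<subseteq> ends ` set es"
      by (rule order_trans[OF attach_edges]) (use Cons.prems in auto)
    with Cons show ?case by simp
  qed simp
  have "ends ` set (foldl (\<lambda>T _. foldl attach T es) T xs) \<subseteq> ends ` set es"
    if "ends ` set T \<subseteq> ends ` set es" for T and xs :: "(nat \<times> nat) list"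
    using that by (induction xs arbitrary: T) (auto simp: *)
  then show ?thesis by (simp add: build_def)
qed

lemma attach_vertices: "set (tree_vertices T) \<subseteq> set (tree_vertices (attach T e))"
  by (auto simp: attach_def tree_vertices_def)

lemma pass_vertices: "set (tree_vertices T) \<subseteq> set (tree_vertices (foldl attach T xs))"
  by (induction xs arbitrary: T) (use attach_vertices in fastforce)+

lemma pass_closed:
  assumes "e \<in> set xs" "fst e \<in> set (tree_vertices T) \<or> snd e \<in> set (tree_vertices T)"
  shows "fst e \<in> set (tree_vertices (foldl attach T xs)) \<and> snd e \<in> set (tree_vertices (foldl attach T xs))"
  using assms
proof (induction xs arbitrary: T)
  case (Cons x xs)
  show ?case
  proof (cases "e = x")
    case True
    then have "fst e \<in> set (tree_vertices (attach T x)) \<and> snd e \<in> set (tree_vertices (attach T x))"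
      using Cons.prems by (auto simp: attach_def tree_vertices_def)
    then show ?thesis using pass_vertices[of "attach T x" xs] by auto
  next
    case False
    then show ?thesis using Cons attach_vertices[of T x] by auto
  qed
qed simp

section \<open>Simple paths and their edges\<close>

lemma path_edges_Cons: "path_edges (x # y # xs) = insert {x, y} (path_edges (y # xs))"
proof (intro equalityI subsetI)
  fix e assume "e \<in> path_edges (x # y # xs)"
  then obtain i where i: "e = {(x # y # xs) ! i, (x # y # xs) ! Suc i}" "Suc i < length (x # y # xs)"
    by (auto simp: path_edges_def)
  then show "e \<in> insert {x, y} (path_edges (y # xs))"
    by (cases i) (auto simp: path_edges_def)
next
  fix e assume "e \<in> insert {x, y} (path_edges (y # xs))"
  then consider "e = {x, y}" | i where "e = {(y # xs) ! i, (y # xs) ! Suc i}" "Suc i < length (y # xs)"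
    by (auto simp: path_edges_def)
  then show "e \<in> path_edges (x # y # xs)"
  proof cases
    case 1 then show ?thesis unfolding path_edges_def by (auto intro!: exI[of _ 0])
  next
    case (2 i) then show ?thesis unfolding path_edges_def by (auto intro!: exI[of _ "Suc i"])
  qed
qed

lemma path_edges_single [simp]: "path_edges [x] = {}" "path_edges [] = {}"
  by (auto simp: path_edges_def)

lemma path_edges_vertices: "e \<in> path_edges xs \<Longrightarrow> e \<subseteq> set xs"
  by (auto simp: path_edges_def)

lemma card_path_edges: "distinct xs \<Longrightarrow> card (path_edges xs) = length xs - 1"
proof (induction xs rule: induct_list012)
  case (3 x y xs)
  then have "{x, y} \<notin> path_edges (y # xs)" using path_edges_vertices[of "{x, y}" "y # xs"] by auto
  moreover have "finite (path_edges (y # xs))"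
    by (rule finite_subset[of _ "Pow (set (y # xs))"], use path_edges_vertices in fast, simp)
  ultimately show ?case using 3 by (simp add: path_edges_Cons)
qed auto

lemma path_edges_sub: "successively (\<lambda>x y. {x, y} \<in> E) xs \<Longrightarrow> path_edges xs \<subseteq> E"
  by (induction xs rule: induct_list012) (auto simp: path_edges_Cons)

text \<open>The first edge is the only one that contains the starting vertex, so the set of edges
  determines the path.\<close>

lemma path_edges_inj:
  assumes "distinct (u # xs)" "distinct (u # ys)" "path_edges (u # xs) = path_edges (u # ys)"
  shows "xs = ys"
  using assms
proof (induction xs arbitrary: u ys)
  case Nil
  then show ?case by (cases ys) (auto simp: path_edges_Cons)
next
  case (Cons x xs)
  then obtain y zs where ys: "ys = y # zs" by (cases ys) (auto simp: path_edges_Cons)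
  have nin: "{u, a} \<notin> path_edges (x # xs)" "{u, a} \<notin> path_edges (y # zs)" for a
    using path_edges_vertices[of "{u, a}"] Cons.prems ys by fastforce+
  have eq: "insert {u, x} (path_edges (x # xs)) = insert {u, y} (path_edges (y # zs))"
    using Cons.prems(3) ys by (simp add: path_edges_Cons)
  then have "{u, x} = {u, y}" using nin by blast
  then have "x = y" by (metis doubleton_eq_iff)
  have "path_edges (x # xs) = path_edges (x # zs)"
    using eq insert_ident[OF nin(1)[of x], of "path_edges (y # zs)"] nin(2)[of x] \<open>x = y\<close> by simp
  with Cons.IH[of x zs] Cons.prems ys \<open>x = y\<close> show ?case by simp
qed

lemma simple_path_exists:
  assumes "rtranclp (\<lambda>x y. {x, y} \<in> E) a b" shows "\<exists>xs. simple_path E a b xs"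
  using assms
proof (induction rule: rtranclp_induct)
  case base
  show ?case by (rule exI[of _ "[a]"]) (simp add: simple_path_def)
next
  case (step b c)
  then obtain xs where xs: "simple_path E a b xs" by blast
  show ?case
  proof (cases "c \<in> set xs")
    case False
    with xs step(2) have "simple_path E a c (xs @ [c])"
      by (auto simp: simple_path_def successively_append_iff)
    then show ?thesis by blast
  next
    case True
    then obtain ys zs where "xs = ys @ c # zs" by (meson split_list)
    with xs have "simple_path E a c (ys @ [c])"
      by (auto simp: simple_path_def successively_append_iff hd_append)
    then show ?thesis by blast
  qed
qed

lemma (in rooted_tree) ends_inj: "inj_on ends (set T)"
proof (rule inj_onI)
  fix e f assume e: "e \<in> set T" and f: "f \<in> set T" and eq: "ends e = ends f"
  have "(fst e, snd e) \<in> set T" "(fst f, snd f) \<in> set T" using e f by simp_all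
  note cf = child_facts[OF this(1)] child_facts[OF this(2)] and p = par_eq[OF this(1)] par_eq[OF this(2)]
  from eq have "fst e = fst f \<and> snd e = snd f \<or> fst e = snd f \<and> snd e = fst f"
    unfolding ends_def by (metis doubleton_eq_iff)
  then show "e = f"
    using cf(4,6,10,12) by (auto intro: prod_eqI)
qed

text \<open>An edge of a simple path separates its end vertices, as no edge is used twice.\<close>

lemma (in rooted_tree) path_edge_iff:
  assumes "successively (\<lambda>x y. {x, y} \<in> ends ` set T) (x # xs)" "distinct (x # xs)" "e \<in> set T"
  shows "ends e \<in> path_edges (x # xs) \<longleftrightarrow> (fst e \<sqsubseteq> x) \<noteq> (fst e \<sqsubseteq> last (x # xs))"
  using assms
proof (induction xs arbitrary: x)
  case (Cons y ys)
  then obtain f where f: "f \<in> set T" "ends f = {x, y}" by auto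
  have IH: "ends e \<in> path_edges (y # ys) \<longleftrightarrow> (fst e \<sqsubseteq> y) \<noteq> (fst e \<sqsubseteq> last (y # ys))"
    using Cons by auto
  have fT: "(fst f, snd f) \<in> set T" using f by simp
  have xy: "x = fst f \<and> y = snd f \<or> x = snd f \<and> y = fst f"
    using f(2) unfolding ends_def by (metis doubleton_eq_iff)
  have sep: "(z \<sqsubseteq> x) \<noteq> (z \<sqsubseteq> y) \<longleftrightarrow> z = fst f" for z
    using xy anc_step[OF fT] child_facts(6)[OF fT] by auto
  have ef: "ends e = {x, y} \<longleftrightarrow> e = f"
    using inj_onD[OF ends_inj, of e f] f Cons.prems(3) by metis
  have e_f: "fst e = fst f \<longleftrightarrow> e = f"
    using Cons.prems(3) f(1) by (metis par_eq prod.collapse)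
  have nin: "{x, y} \<notin> path_edges (y # ys)"
    using path_edges_vertices[of "{x, y}" "y # ys"] Cons.prems(2) by auto
  have last: "last (x # y # ys) = last (y # ys)" by simp
  show ?case
  proof (cases "e = f")
    case True
    then have "ends e \<in> path_edges (x # y # ys)" using ef by (simp add: path_edges_Cons)
    moreover have "(fst e \<sqsubseteq> y) = (fst e \<sqsubseteq> last (y # ys))" using IH nin True ef by auto
    moreover have "(fst e \<sqsubseteq> x) \<noteq> (fst e \<sqsubseteq> y)" using sep[of "fst e"] True by simp
    ultimately show ?thesis unfolding last by blast
  next
    case False
    then have "(fst e \<sqsubseteq> x) = (fst e \<sqsubseteq> y)" using sep[of "fst e"] e_f by blast
    then show ?thesis unfolding last using IH False ef by (simp add: path_edges_Cons)
  qed
qed simp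

lemma (in rooted_tree) root_reachable:
  assumes "v \<in> V" shows "rtranclp (\<lambda>x y. {x, y} \<in> ends ` set T) v 0"
  using assms
proof (induction v rule: tree_induct)
  case (child c p)
  have "{c, p} \<in> ends ` set T" using child.hyps(1) by (auto simp: ends_def intro!: image_eqI[of _ _ "(c, p)"])
  then show ?case using child.IH by (rule converse_rtranclp_into_rtranclp)
qed simp

section \<open>A tree-network and its rooted table\<close>

locale tree_network =
  fixes n :: nat and E :: "nat set set" and es :: "(nat \<times> nat) list"
  assumes tree: "is_tree {..<n} E" and n_pos: "0 < n"
    and es: "set es = {(u, v). u < v \<and> v < n \<and> {u, v} \<in> E}"
begin

lemma E_vertices: "e \<in> E \<Longrightarrow> \<exists>u v. e = {u, v} \<and> u < n \<and> v < n \<and> u \<noteq> v"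
proof -
  have "E \<subseteq> {{u, v} |u v. u < n \<and> v < n \<and> u \<noteq> v}" using tree by (simp add: is_tree_def)
  then show "e \<in> E \<Longrightarrow> ?thesis" by blast
qed

lemma path_exists: "u < n \<Longrightarrow> v < n \<Longrightarrow> \<exists>xs. simple_path E u v xs"
  using tree by (simp add: is_tree_def)

lemma E_es: "E = ends ` set es"
proof (intro equalityI subsetI)
  fix e assume e: "e \<in> E"
  then obtain u v where uv: "e = {u, v}" "u < n" "v < n" "u \<noteq> v" using E_vertices by blast
  show "e \<in> ends ` set es"
  proof (cases "u < v")
    case True
    with uv e es show ?thesis by (intro image_eqI[of _ _ "(u, v)"]) (auto simp: ends_def)
  next
    case False
    with uv e es show ?thesis by (intro image_eqI[of _ _ "(v, u)"]) (auto simp: ends_def insert_commute)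
  qed
qed (use es in \<open>auto simp: ends_def\<close>)

abbreviation "T \<equiv> build es"

sublocale rooted_tree T by unfold_locales (rule parent_table_build)

lemma es_vertices: "e \<in> set es \<Longrightarrow> fst e < n \<and> snd e < n"
  unfolding es by (auto intro: less_trans)

lemma V_sub: "V \<subseteq> {..<n}"
proof -
  have "fst e < n" if "e \<in> set T" for e
  proof -
    have "ends e \<in> ends ` set es" by (rule subsetD[OF build_edges imageI[OF that]])
    then obtain f where f: "f \<in> set es" "ends e = ends f" by (rule imageE)
    then have "fst e \<in> {fst f, snd f}" by (auto simp: ends_def)
    with es_vertices[OF f(1)] show ?thesis by auto
  qed
  then show ?thesis using n_pos by auto
qed

lemma V_eq: "V = {..<n}"
proof -
  let ?pass = "\<lambda>T. foldl attach T es"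
  have it: "build es = (?pass ^^ length es) []"
  proof -
    have "foldl (\<lambda>T _. ?pass T) T xs = (?pass ^^ length xs) T" for T and xs :: "(nat \<times> nat) list"
      by (induction xs arbitrary: T) (simp_all add: funpow_Suc_right del: funpow.simps(2))
    then show ?thesis by (simp add: build_def)
  qed
  have grow: "set (tree_vertices ((?pass ^^ i) [])) \<subseteq> set (tree_vertices ((?pass ^^ (i + j)) []))" for i j
    by (induction j) (use pass_vertices in fastforce)+
  have reach: "last xs \<in> set (tree_vertices ((?pass ^^ (length xs - 1)) []))"
    if "xs \<noteq> []" "hd xs = 0" "successively (\<lambda>x y. {x, y} \<in> E) xs" for xs
    using that
  proof (induction xs rule: rev_nonempty_induct)
    case (single x)
    then show ?case by (simp add: tree_vertices_def)
  next
    case (snoc x xs)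
    then have IH: "last xs \<in> set (tree_vertices ((?pass ^^ (length xs - 1)) []))" and e: "{last xs, x} \<in> E"
      by (auto simp: successively_append_iff)
    then obtain e where e: "e \<in> set es" "ends e = {last xs, x}" using E_es by auto
    have l: "length (xs @ [x]) - 1 = Suc (length xs - 1)" using snoc(1) by (cases xs) auto
    have "last xs \<in> {fst e, snd e}" "x \<in> {fst e, snd e}" using e(2) unfolding ends_def by auto
    with pass_closed[OF e(1), of "(?pass ^^ (length xs - 1)) []"] IH
    show ?case unfolding l by auto
  qed
  have "v \<in> V" if v: "v < n" for v
  proof -
    obtain xs where xs: "simple_path E 0 v xs" using path_exists n_pos v by blast
    then have "path_edges xs \<subseteq> E" "distinct xs" by (auto simp: simple_path_def intro: path_edges_sub[THEN subsetD])
    then have "length xs - 1 \<le> card E"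
      using card_path_edges[of xs] card_mono[of E "path_edges xs"] E_es by simp
    also have "card E \<le> length es" unfolding E_es by (meson card_image_le card_length finite_set order_trans)
    finally obtain j where j: "length es = length xs - 1 + j" using le_Suc_ex by blast
    have "v \<in> set (tree_vertices ((?pass ^^ (length xs - 1)) []))"
      using reach[of xs] xs by (auto simp: simple_path_def)
    with grow[of "length xs - 1" j] it j have "v \<in> set (tree_vertices T)" by auto
    then show ?thesis using V_tree_vertices by simp
  qed
  with V_sub show ?thesis by blast
qed

text \<open>The table already connects all vertices, so an edge missing from it would close a cycle
  together with a path of table edges.\<close>

lemma E_T: "E = ends ` set T"
proof (intro equalityI subsetI)
  let ?R = "\<lambda>x y. {x, y} \<in> ends ` set T"
  fix e assume e: "e \<in> E"
  show "e \<in> ends ` set T"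
  proof (rule ccontr)
    assume ne: "e \<notin> ends ` set T"
    obtain a b where ab: "e = {a, b}" "a < n" "b < n" "a \<noteq> b" using E_vertices e by blast
    have a0: "?R\<^sup>*\<^sup>* a 0" and b0: "?R\<^sup>*\<^sup>* b 0" using root_reachable V_eq ab by auto
    have "symp ?R" by (simp add: symp_def insert_commute)
    then have "?R\<^sup>*\<^sup>* 0 b" using b0 by (metis symp_rtranclp sympD)
    with a0 have "?R\<^sup>*\<^sup>* a b" by (rule rtranclp_trans)
    from simple_path_exists[OF this] obtain xs where xs: "simple_path (ends ` set T) a b xs" by blast
    have TE: "ends ` set T \<subseteq> E" using build_edges[of es] E_es by simp
    have "length xs \<ge> 3"
    proof (rule ccontr)
      assume "\<not> length xs \<ge> 3"
      then consider "xs = []" | x where "xs = [x]" | x y where "xs = [x, y]"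
        by (cases xs; cases "tl xs"; cases "tl (tl xs)") auto
      then show False using xs ab ne by cases (auto simp: simple_path_def)
    qed
    moreover have "successively (\<lambda>x y. {x, y} \<in> E) xs"
      using xs TE by (auto simp: simple_path_def elim!: successively_mono)
    ultimately have "cycle_in E xs"
      using xs e ab by (auto simp: simple_path_def cycle_in_def insert_commute)
    then show False using tree by (auto simp: is_tree_def)
  qed
next
  fix e assume "e \<in> ends ` set T" then show "e \<in> E" using build_edges[of es] E_es by auto
qed

text \<open>By \<open>path_edge_iff\<close> every simple path between the two vertices has the edges
  of the route. Hence there is just one such path, and the definite description denotes it.\<close>

lemma demand_route:
  assumes "u < n" "v < n"
  shows "path_edges (THE xs. simple_path E u v xs) = ends ` set (route T u v)"
proof -
  have edges: "path_edges xs = ends ` set (route T u v)" if sp: "simple_path E u v xs" for xs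
  proof -
    obtain ys where xs: "xs = u # ys" "last xs = v" "distinct xs" "successively (\<lambda>x y. {x, y} \<in> E) xs"
      using sp by (cases xs) (simp_all add: simple_path_def)
    have iff: "ends e \<in> path_edges xs \<longleftrightarrow>
        (fst e \<in> set (ancestors T u)) \<noteq> (fst e \<in> set (ancestors T v))" if "e \<in> set T" for e
      using path_edge_iff[of u ys e] xs that E_T by simp
    have "path_edges xs \<subseteq> ends ` set T" using path_edges_sub xs E_T by blast
    with iff show ?thesis by (auto simp: route_def)
  qed
  obtain xs where xs: "simple_path E u v xs" using path_exists assms by blast
  have "(THE xs. simple_path E u v xs) = xs"
  proof (rule the_equality)
    show "simple_path E u v xs" by (rule xs)
    fix ys assume ys: "simple_path E u v ys"
    obtain xs' ys' where "xs = u # xs'" "ys = u # ys'"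
      using xs ys by (cases xs; cases ys) (auto simp: simple_path_def)
    with path_edges_inj[of u ys' xs'] edges[OF xs] edges[OF ys] xs ys show "ys = xs"
      by (auto simp: simple_path_def)
  qed
  with edges[OF xs] show ?thesis by simp
qed

end

section \<open>Computing the layered decomposition\<close>

definition vpair :: "nat \<times> nat \<Rightarrow> val" where
  "vpair e = VCons (vnat (fst e)) (vnat (snd e))"

abbreviation vpairs :: "(nat \<times> nat) list \<Rightarrow> val" where "vpairs T \<equiv> vlist (map vpair T)"
abbreviation vnats :: "nat list \<Rightarrow> val" where "vnats xs \<equiv> vlist (map vnat xs)"

lemma vhd_vpair [simp]: "vhd (vpair e) = vnat (fst e)" "vtl (vpair e) = vnat (snd e)"
  by (simp_all add: vpair_def)

lemma vpair_inj [simp]: "vpair e = vpair f \<longleftrightarrow> e = f"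
  by (auto simp: vpair_def prod_eq_iff)

lemma vnat_image [simp]: "vnat x \<in> vnat ` A \<longleftrightarrow> x \<in> A" "vpair e \<in> vpair ` B \<longleftrightarrow> e \<in> B"
  "vnat x \<in> (\<lambda>e. vnat (f e)) ` C \<longleftrightarrow> x \<in> f ` C"
  by auto

section \<open>Programs for the decomposition\<close>

definition VERTICES :: "prog \<Rightarrow> prog" where
  "VERTICES T = Pair (Numeral 0) (MAP T (Head (Var 0)))"

text \<open>The list is built from the root end: its head is always the ancestor whose entry is
  looked for next, so the result is reversed.\<close>

definition ANCESTORS :: "prog \<Rightarrow> prog \<Rightarrow> prog" where
  "ANCESTORS T y = Fold T (Pair y Empty)
     (Cond (Equal (Head (Var 0)) (Head (Var 1))) (Pair (Tail (Var 0)) (Var 1)) (Var 1))"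

definition SIZE :: "prog \<Rightarrow> prog \<Rightarrow> prog" where
  "SIZE T y = COUNT (VERTICES T) (MEM (up y) (ANCESTORS (up T) (Var 0)))"

definition HEAVY :: "prog \<Rightarrow> prog \<Rightarrow> prog" where
  "HEAVY T v = Fold T Empty (Cond
     (AND (Equal (Tail (Var 0)) (up (up v)))
       (OR (NOT (Var 1)) (Less (SIZE (up (up T)) (Var 1)) (SIZE (up (up T)) (Head (Var 0))))))
     (Head (Var 0)) (Var 1))"

definition HEAVY_SIZE :: "prog \<Rightarrow> prog \<Rightarrow> prog" where
  "HEAVY_SIZE T v = Bind (HEAVY T v) (Cond (Var 0) (SIZE (up T) (Var 0)) (Numeral 0))"

text \<open>Two powers per vertex reach up to 4^n, which is at least n^2 and so suffices for all
  ranks. The list is decreasing, and therefore the maximum defining the rank is the head of a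
  filtered list.\<close>

definition POWERS :: "prog \<Rightarrow> prog" where
  "POWERS T = Fold (VERTICES T) (Pair (Numeral 1) Empty)
     (Pair (Arith Times (Numeral 4) (Head (Var 1))) (Pair (Arith Times (Numeral 2) (Head (Var 1))) (Var 1)))"

definition SQUARE :: "prog \<Rightarrow> prog" where "SQUARE a = Arith Times a a"

text \<open>
  The multipliers \<open>u * n + w + 1\<close> with \<open>u, w < n\<close> range over \<open>{1..n\<^sup>2}\<close>.
\<close>

definition RANK :: "prog \<Rightarrow> prog \<Rightarrow> prog" where
  "RANK T v = Head (FILTER (POWERS T) (EXISTS (VERTICES (up T)) (EXISTS (VERTICES (up (up T)))
     (Bind (Arith Times (Arith Plus (Arith Plus
        (Arith Times (Var 1) (COUNT (VERTICES (up (up (up T)))) (Numeral 1))) (Var 0)) (Numeral 1)) (Var 2))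
       (AND (Less (SQUARE (HEAVY_SIZE (up (up (up (up T)))) (up (up (up (up v)))))) (Var 0))
         (NOT (Less (SQUARE (SIZE (up (up (up (up T)))) (up (up (up (up v)))))) (Var 0))))))))"

definition ROUTE :: "prog \<Rightarrow> prog \<Rightarrow> prog \<Rightarrow> prog" where
  "ROUTE T u v = FILTER T (Cond (MEM (Head (Var 0)) (ANCESTORS (up T) (up u)))
     (NOT (MEM (Head (Var 0)) (ANCESTORS (up T) (up v)))) (MEM (Head (Var 0)) (ANCESTORS (up T) (up v))))"

definition HEAVY_PART :: "prog \<Rightarrow> prog \<Rightarrow> prog" where
  "HEAVY_PART T X = FILTER X (NOT (EXISTS (up X)
     (AND (MEM (Head (Var 0)) (ANCESTORS (up (up T)) (Head (Var 1))))
       (NOT (Equal (HEAVY (up (up T)) (Tail (Var 0))) (Head (Var 0)))))))"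

definition HEADS :: "prog \<Rightarrow> prog" where "HEADS X = MAP X (Head (Var 0))"
definition TAILS :: "prog \<Rightarrow> prog" where "TAILS X = MAP X (Tail (Var 0))"

definition LAYER :: "prog \<Rightarrow> prog \<Rightarrow> prog" where
  "LAYER T X = Fold (APP (TAILS (FILTER X (NOT (MEM (Tail (Var 0)) (HEADS (up X))))))
       (HEADS (HEAVY_PART T X))) (Numeral 1)
     (Cond (Less (Var 1) (RANK (up (up T)) (Var 0))) (RANK (up (up T)) (Var 0)) (Var 1))"

definition CRITICAL :: "prog \<Rightarrow> prog \<Rightarrow> prog" where
  "CRITICAL T X = FILTER X (OR (NOT (MEM (Tail (Var 0)) (HEADS (up X))))
     (OR (AND (MEM (Head (Var 0)) (HEADS (HEAVY_PART (up T) (up X))))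
        (OR (Equal (RANK (up T) (Head (Var 0))) (LAYER (up T) (up X)))
          (NOT (MEM (Head (Var 0)) (TAILS (HEAVY_PART (up T) (up X)))))))
     (AND (MEM (Tail (Var 0)) (HEADS (HEAVY_PART (up T) (up X))))
        (OR (Equal (RANK (up T) (Tail (Var 0))) (LAYER (up T) (up X)))
          (NOT (MEM (Head (Var 0)) (HEADS (HEAVY_PART (up T) (up X)))))))))"

definition ATTACH :: "prog \<Rightarrow> prog \<Rightarrow> prog" where
  "ATTACH T e = Cond (AND (MEM (Head e) (VERTICES T)) (NOT (MEM (Tail e) (VERTICES T))))
     (Pair (Pair (Tail e) (Head e)) T)
     (Cond (AND (MEM (Tail e) (VERTICES T)) (NOT (MEM (Head e) (VERTICES T)))) (Pair e T) T)"

definition BUILD :: "prog \<Rightarrow> prog" where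
  "BUILD es = Fold es Empty (Fold (up (up es)) (Var 1) (ATTACH (Var 1) (Var 0)))"

section \<open>Correctness of the decomposition programs\<close>

lemma eval_VERTICES: "eval T env = vpairs t \<Longrightarrow> eval (VERTICES T) env = vnats (tree_vertices t)"
  by (simp add: VERTICES_def tree_vertices_def comp_def)

lemma eval_ANCESTORS:
  assumes "eval T env = vpairs t" "eval y env = vnat a"
  shows "eval (ANCESTORS T y) env = vnats (rev (ancestors t a))"
proof -
  let ?f = "\<lambda>acc x. if vhd x = vhd acc then VCons (vtl x) acc else acc"
  have "foldl ?f (vnats (a # as)) (map vpair t) = vnats (rev (ancestors t a) @ as)" for a as
  proof (induction t arbitrary: a as)
    case (Cons e t)
    show ?case
    proof (cases "fst e = a")
      case True
      then show ?thesis using Cons.IH[of "snd e" "a # as"] by simp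
    next
      case False
      then show ?thesis using Cons.IH[of a as] by simp
    qed
  qed simp
  from this[of a "[]"] assms show ?thesis by (simp add: ANCESTORS_def cong: if_cong)
qed

lemma eval_SIZE:
  assumes "eval T env = vpairs t" "eval y env = vnat a"
  shows "eval (SIZE T y) env = vnat (subtree_size t a)"
proof -
  have *: "eval (VERTICES T) env = vnats (tree_vertices t)" using assms by (rule_tac eval_VERTICES)
  have "eval (ANCESTORS (up T) (Var 0)) (vnat v # env) = vnats (rev (ancestors t v))" for v
    by (rule eval_ANCESTORS) (simp_all add: assms)
  then show ?thesis
    by (simp add: SIZE_def subtree_size_def * assms filter_map comp_def)
qed

definition vopt :: "nat option \<Rightarrow> val" where
  "vopt c = (case c of None \<Rightarrow> VNil | Some c \<Rightarrow> vnat c)"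

lemma vopt_simps [simp]: "vopt None = VNil" "vopt (Some c) = vnat c" "vopt x = VNil \<longleftrightarrow> x = None"
  "vopt x = vnat c \<longleftrightarrow> x = Some c"
  by (auto simp: vopt_def split: option.splits)

lemma eval_HEAVY:
  assumes "eval T env = vpairs t" "eval v env = vnat a"
  shows "eval (HEAVY T v) env = vopt (heavy_child t a)"
proof -
  let ?B = "Cond (AND (Equal (Tail (Var 0)) (up (up v)))
       (OR (NOT (Var 1)) (Less (SIZE (up (up T)) (Var 1)) (SIZE (up (up T)) (Head (Var 0))))))
     (Head (Var 0)) (Var 1)"
  let ?step = "\<lambda>acc e. if snd e = a \<and>
       (case acc of None \<Rightarrow> True | Some c \<Rightarrow> subtree_size t c < subtree_size t (fst e))
     then Some (fst e) else acc"
  have step: "eval ?B (vpair e # vopt acc # env) = vopt (?step acc e)" for e acc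
  proof (cases acc)
    case None
    then show ?thesis by (simp add: assms)
  next
    case (Some c)
    have 1: "eval (SIZE (up (up T)) (Var 1)) (vpair e # vnat c # env) = vnat (subtree_size t c)"
      by (rule eval_SIZE) (simp_all add: assms)
    have 2: "eval (SIZE (up (up T)) (Head (Var 0))) (vpair e # vnat c # env) = vnat (subtree_size t (fst e))"
      by (rule eval_SIZE) (simp_all add: assms)
    show ?thesis using 1 2 Some by (simp add: assms vless_def)
  qed
  have "foldl (\<lambda>acc x. eval ?B (x # acc # env)) (vopt acc) (map vpair xs) = vopt (foldl ?step acc xs)" for acc xs
  proof (induction xs arbitrary: acc)
    case (Cons x xs)
    show ?case using Cons.IH[of "?step acc x"] by (simp only: list.map foldl.simps step)
  qed simp
  from this[of None t] show ?thesis
    by (simp only: HEAVY_def eval.simps(12) assms velems_vlist vopt_simps heavy_child_def eval.simps(3))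
qed

lemma eval_HEAVY_SIZE:
  assumes "eval T env = vpairs t" "eval v env = vnat a"
  shows "eval (HEAVY_SIZE T v) env = vnat (heavy_size t a)"
proof (cases "heavy_child t a")
  case None
  then show ?thesis using eval_HEAVY[OF assms] by (simp add: HEAVY_SIZE_def heavy_size_def)
next
  case (Some c)
  have "eval (SIZE (up T) (Var 0)) (vnat c # env) = vnat (subtree_size t c)"
    by (rule eval_SIZE) (simp_all add: assms)
  with Some show ?thesis using eval_HEAVY[OF assms] by (simp add: HEAVY_SIZE_def heavy_size_def)
qed

lemma eval_POWERS:
  assumes "eval T env = vpairs t"
  shows "eval (POWERS T) env = vnats (map (\<lambda>i. 2 ^ i) (rev [0..<Suc (2 * length (tree_vertices t))]))"
proof -
  let ?B = "Pair (Arith Times (Numeral 4) (Head (Var 1))) (Pair (Arith Times (Numeral 2) (Head (Var 1))) (Var 1))"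
  have *: "foldl (\<lambda>acc x. eval ?B (x # acc # env)) (vnats (map (\<lambda>i. 2 ^ i) (rev [0..<Suc k]))) xs
     = vnats (map (\<lambda>i. 2 ^ i) (rev [0..<Suc (k + 2 * length xs)]))" for k xs
  proof (induction xs arbitrary: k)
    case (Cons x xs)
    have "eval ?B (x # vnats (map (\<lambda>i. 2 ^ i) (rev [0..<Suc k])) # env)
      = vnats (map (\<lambda>i. 2 ^ i) (rev [0..<Suc (Suc (Suc k))]))"
      by (simp add: varith_def)
    with Cons.IH[of "Suc (Suc k)"] show ?case by (simp only: foldl.simps length_Cons) simp
  qed simp
  from *[of 0 "map vnat (tree_vertices t)"] show ?thesis
    by (simp add: POWERS_def eval_VERTICES[OF assms])
qed

locale tree_table = rooted_tree +
  fixes n :: nat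
  assumes vertices: "V = {..<n}"
begin

lemma n_eq: "length (tree_vertices T) = n"
proof -
  have "distinct (tree_vertices T)" using distinct_table[OF table] by (auto simp: tree_vertices_def)
  then have "length (tree_vertices T) = card (set (tree_vertices T))" by (simp add: distinct_card)
  with vertices V_tree_vertices show ?thesis by simp
qed

lemma multipliers: "(\<exists>u<n. \<exists>w<n. P (u * n + w + 1)) \<longleftrightarrow> (\<exists>m. 0 < m \<and> m \<le> n\<^sup>2 \<and> P m)"
proof
  assume "\<exists>m. 0 < m \<and> m \<le> n\<^sup>2 \<and> P m"
  then obtain m where m: "0 < m" "m \<le> n\<^sup>2" "P m" by blast
  then have "0 < n" by (cases n) auto
  have "(m - 1) div n < n" using m by (intro less_mult_imp_div_less) (auto simp: power2_eq_square)
  moreover have "(m - 1) mod n < n" using \<open>0 < n\<close> by simp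
  moreover have "(m - 1) div n * n + (m - 1) mod n + 1 = m" using m(1) by (simp add: div_mult_mod_eq)
  ultimately show "\<exists>u<n. \<exists>w<n. P (u * n + w + 1)" using m(3) by metis
next
  assume "\<exists>u<n. \<exists>w<n. P (u * n + w + 1)"
  then obtain u w where uw: "u < n" "w < n" "P (u * n + w + 1)" by blast
  have "u * n + w + 1 \<le> u * n + n" using uw by simp
  also have "\<dots> = Suc u * n" by simp
  also have "\<dots> \<le> n * n" using uw by (intro mult_le_mono1) simp
  finally show "\<exists>m. 0 < m \<and> m \<le> n\<^sup>2 \<and> P m" using uw
    by (intro exI[of _ "u * n + w + 1"]) (simp add: power2_eq_square)
qed

lemma size_n: "sz a \<le> n"
  unfolding subtree_size_def n_eq[symmetric] by (rule length_filter_le)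

lemma dyadic_iff: "dyadic T a k \<longleftrightarrow> (\<exists>u<n. \<exists>w<n. (heavy_size T a)\<^sup>2 < (u * n + w + 1) * 2 ^ k \<and>
    (u * n + w + 1) * 2 ^ k \<le> (sz a)\<^sup>2)"
  unfolding multipliers[where P = "\<lambda>m. (heavy_size T a)\<^sup>2 < m * 2 ^ k \<and> m * 2 ^ k \<le> (sz a)\<^sup>2"] dyadic_def
proof (intro ex_cong1 iffI)
  fix m assume m: "(heavy_size T a)\<^sup>2 < m * 2 ^ k \<and> m * 2 ^ k \<le> (sz a)\<^sup>2"
  have "m \<noteq> 0" using m by (cases m) auto
  moreover have "m * 1 \<le> m * 2 ^ k" by (intro mult_le_mono2) simp
  moreover have "(sz a)\<^sup>2 \<le> n\<^sup>2" by (intro power_mono size_n) simp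
  ultimately show "0 < m \<and> m \<le> n\<^sup>2 \<and> (heavy_size T a)\<^sup>2 < m * 2 ^ k \<and> m * 2 ^ k \<le> (sz a)\<^sup>2"
    using m by linarith
qed simp

lemma rank_bound: assumes "a \<in> V" shows "vertex_rank T a < Suc (2 * n)"
proof -
  have "2 ^ vertex_rank T a \<le> (sz a)\<^sup>2" using dyadic_bound[OF dyadic_rank[OF assms]] .
  also have "\<dots> \<le> n\<^sup>2" by (intro power_mono size_n) simp
  also have "\<dots> \<le> (2 ^ n)\<^sup>2" using less_exp[of n] by (intro power_mono) auto
  finally have "(2 :: nat) ^ vertex_rank T a \<le> 2 ^ (n * 2)" by (simp add: power_mult)
  then show ?thesis by simp
qed

lemma hd_filter_rank:
  assumes "a \<in> V"
  shows "\<exists>xs. filter (dyadic T a) (rev [0..<Suc (2 * n)]) = vertex_rank T a # xs"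
proof -
  let ?k = "vertex_rank T a"
  have k: "?k < Suc (2 * n)" by (rule rank_bound[OF assms])
  then have "[0..<Suc (2 * n)] = [0..<?k] @ [?k] @ [Suc ?k..<Suc (2 * n)]"
    by (metis append_Cons append_Nil less_imp_add_positive less_imp_le_nat upt_add_eq_append upt_conv_Cons zero_le plus_nat.add_0)
  moreover have "filter (dyadic T a) (rev [Suc ?k..<Suc (2 * n)]) = []"
  proof -
    have "\<not> dyadic T a i" if "Suc ?k \<le> i" for i using rank_ge[of a i] that by auto
    then show ?thesis by (auto simp: filter_empty_conv)
  qed
  ultimately show ?thesis using dyadic_rank[OF assms] by simp
qed

lemma eval_RANK:
  assumes "eval P env = vpairs T" "eval v env = vnat a" "a \<in> V"
  shows "eval (RANK P v) env = vnat (2 ^ vertex_rank T a)"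
proof -
  have V: "set (tree_vertices T) = {..<n}" using V_tree_vertices vertices by simp
  have up3: "eval (VERTICES (up (up (up P)))) (w # u # pw # env) = vnats (tree_vertices T)"
    "eval (VERTICES (up (up P))) (u # pw # env) = vnats (tree_vertices T)"
    "eval (VERTICES (up P)) (pw # env) = vnats (tree_vertices T)" for w u pw
    by (rule eval_VERTICES, simp add: assms)+
  have hs: "eval (HEAVY_SIZE (up (up (up (up P)))) (up (up (up (up v))))) (x # w # u # pw # env) = vnat (heavy_size T a)"
    for x w u pw by (rule eval_HEAVY_SIZE) (simp_all add: assms)
  have sz: "eval (SIZE (up (up (up (up P)))) (up (up (up (up v))))) (x # w # u # pw # env) = vnat (sz a)"
    for x w u pw by (rule eval_SIZE) (simp_all add: assms)
  let ?B = "Bind (Arith Times (Arith Plus (Arith Plus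
        (Arith Times (Var 1) (COUNT (VERTICES (up (up (up P)))) (Numeral 1))) (Var 0)) (Numeral 1)) (Var 2))
       (AND (Less (SQUARE (HEAVY_SIZE (up (up (up (up P)))) (up (up (up (up v)))))) (Var 0))
         (NOT (Less (SQUARE (SIZE (up (up (up (up P)))) (up (up (up (up v)))))) (Var 0))))"
  let ?C = "EXISTS (VERTICES (up P)) (EXISTS (VERTICES (up (up P))) ?B)"
  have B: "eval ?B (vnat w # vnat u # vnat (2 ^ k) # env) \<noteq> VNil \<longleftrightarrow>
     (heavy_size T a)\<^sup>2 < (u * n + w + 1) * 2 ^ k \<and> (u * n + w + 1) * 2 ^ k \<le> (sz a)\<^sup>2" for w u k
  proof -
    have "eval ?B (vnat w # vnat u # vnat (2 ^ k) # env) \<noteq> VNil \<longleftrightarrow>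
       real ((heavy_size T a)\<^sup>2) < real ((u * n + w + 1) * 2 ^ k) \<and>
        \<not> real ((sz a)\<^sup>2) < real ((u * n + w + 1) * 2 ^ k)"
      by (simp add: up3 hs sz SQUARE_def varith_def vless_def n_eq power2_eq_square algebra_simps)
    then show ?thesis unfolding of_nat_less_iff not_less .
  qed
  have C: "eval ?C (vnat (2 ^ k) # env) \<noteq> VNil \<longleftrightarrow> dyadic T a k" for k
    unfolding dyadic_iff eval_EXISTS up3 velems_vlist set_map V vbool_eq_VNil Set.bex_simps(7) B not_not
    by auto
  have "eval (FILTER (POWERS P) ?C) env
     = vnats (map (\<lambda>i. 2 ^ i) (filter (dyadic T a) (rev [0..<Suc (2 * n)])))"
    using C by (simp add: eval_POWERS[OF assms(1)] n_eq filter_map comp_def del: upt_Suc)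
  with hd_filter_rank[OF assms(3)] show ?thesis
    unfolding RANK_def by auto
qed

lemma eval_ROUTE:
  assumes "eval P env = vpairs T" "eval u env = vnat a" "eval v env = vnat b"
  shows "eval (ROUTE P u v) env = vpairs (route T a b)"
proof -
  have "eval (ANCESTORS (up P) (up u)) (e # env) = vnats (rev (ancestors T a))"
    "eval (ANCESTORS (up P) (up v)) (e # env) = vnats (rev (ancestors T b))" for e
    by (rule eval_ANCESTORS; simp add: assms)+
  then show ?thesis
    by (simp add: ROUTE_def assms route_def filter_map comp_def cong: if_cong)
      (auto intro!: arg_cong[of _ _ "\<lambda>P. map vpair (filter P T)"])
qed

lemma eval_HEADS: "eval X env = vpairs xs \<Longrightarrow> eval (HEADS X) env = vnats (map fst xs)"
  and eval_TAILS: "eval X env = vpairs xs \<Longrightarrow> eval (TAILS X) env = vnats (map snd xs)"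
  by (simp_all add: HEADS_def TAILS_def comp_def)

lemma eval_HEAVY_PART:
  assumes "eval P env = vpairs T" "eval X env = vpairs xs"
  shows "eval (HEAVY_PART P X) env = vpairs (heavy_part T xs)"
proof -
  have "eval (ANCESTORS (up (up P)) (Head (Var 1))) (f # vpair e # env) = vnats (rev (ancestors T (fst e)))" for f e
    by (rule eval_ANCESTORS; simp add: assms)+
  moreover have "eval (HEAVY (up (up P)) (Tail (Var 0))) (vpair f # e # env) = vopt (heavy_child T (snd f))" for f e
    by (rule eval_HEAVY; simp add: assms)+
  ultimately show ?thesis
    by (simp add: HEAVY_PART_def assms heavy_part_def filter_map comp_def)
qed

lemma foldl_max: "foldl (\<lambda>acc x. if acc < f x then f x else acc) (a :: nat) xs = Max (insert a (f ` set xs))"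
proof (induction xs arbitrary: a)
  case (Cons x xs)
  have m: "(if a < f x then f x else a) = max a (f x)" by simp
  have "Max (insert (max a (f x)) S) = Max (insert a (insert (f x) S))" if "finite S" for S
    using that by (cases "S = {}") (simp_all add: max.assoc)
  then show ?case unfolding foldl.simps m Cons.IH list.set image_insert by simp
qed simp

lemma eval_LAYER:
  assumes "eval P env = vpairs T" "eval X env = vpairs xs" "set xs \<subseteq> set T"
  shows "eval (LAYER P X) env = vnat (layer_of T xs)"
proof -
  let ?ys = "map snd (filter (\<lambda>e. snd e \<notin> fst ` set xs) xs) @ map fst (heavy_part T xs)"
  have X: "eval (HEADS (up X)) (e # env) = vnats (map fst xs)" for e
    by (rule eval_HEADS) (simp add: assms)
  have f: "eval (FILTER X (NOT (MEM (Tail (Var 0)) (HEADS (up X))))) env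
      = vpairs (filter (\<lambda>e. snd e \<notin> fst ` set xs) xs)"
    by (simp add: assms X filter_map comp_def)
  have seg: "eval (APP (TAILS (FILTER X (NOT (MEM (Tail (Var 0)) (HEADS (up X))))))
       (HEADS (HEAVY_PART P X))) env = vnats ?ys"
    by (subst eval_APP[OF eval_HEADS[OF eval_HEAVY_PART[OF assms(1,2)]]])
      (simp add: eval_TAILS[OF f])
  have ysV: "set ?ys \<subseteq> V"
    using assms(3) child_facts(1,3) by (fastforce simp: heavy_part_def)
  let ?B = "Cond (Less (Var 1) (RANK (up (up P)) (Var 0))) (RANK (up (up P)) (Var 0)) (Var 1)"
  have step: "eval ?B (vnat y # vnat a # env) = vnat (if a < 2 ^ vertex_rank T y then 2 ^ vertex_rank T y else a)"
    if "y \<in> V" for y a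
  proof -
    have "eval (RANK (up (up P)) (Var 0)) (vnat y # vnat a # env) = vnat (2 ^ vertex_rank T y)"
      by (rule eval_RANK[OF _ _ that]) (simp_all add: assms)
    then show ?thesis by (simp add: vless_def del: of_nat_power)
  qed
  have "foldl (\<lambda>acc x. eval ?B (x # acc # env)) (vnat a) (map vnat ys)
     = vnat (foldl (\<lambda>acc x. if acc < 2 ^ vertex_rank T x then 2 ^ vertex_rank T x else acc) a ys)"
    if "set ys \<subseteq> V" for a ys
    using that
  proof (induction ys arbitrary: a)
    case (Cons y ys)
    then have y: "y \<in> V" by simp
    show ?case unfolding list.map foldl.simps step[OF y] by (rule Cons.IH) (use Cons.prems in simp)
  qed simp
  from this[OF ysV, of 1]
  have "eval (LAYER P X) env = vnat (Max (insert 1 ((\<lambda>x. 2 ^ vertex_rank T x) ` set ?ys)))"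
    unfolding LAYER_def foldl_max by (simp only: eval.simps(12) eval.simps(2) seg velems_vlist) simp
  also have "set ?ys = snd ` {e \<in> set xs. snd e \<notin> fst ` set xs} \<union> fst ` set (heavy_part T xs)" by auto
  finally show ?thesis unfolding layer_of_def .
qed

lemma eval_CRITICAL:
  assumes "eval P env = vpairs T" "eval X env = vpairs xs" "set xs \<subseteq> set T"
  shows "eval (CRITICAL P X) env = vpairs (critical T xs)"
proof -
  have X: "eval (HEADS (up X)) (e # env) = vnats (map fst xs)" for e
    by (rule eval_HEADS) (simp add: assms)
  have H: "eval (HEAVY_PART (up P) (up X)) (e # env) = vpairs (heavy_part T xs)" for e
    by (rule eval_HEAVY_PART) (simp_all add: assms)
  have L: "eval (LAYER (up P) (up X)) (e # env) = vnat (layer_of T xs)" for e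
    by (rule eval_LAYER) (simp_all add: assms)
  have R: "eval (RANK (up P) (Head (Var 0))) (vpair e # env) = vnat (2 ^ vertex_rank T (fst e))"
    "eval (RANK (up P) (Tail (Var 0))) (vpair e # env) = vnat (2 ^ vertex_rank T (snd e))" if "e \<in> set xs" for e
    by (rule eval_RANK; use that assms child_facts[of "fst e" "snd e"] in auto)+
  have real: "VNum (real x) = VNum (real y) \<longleftrightarrow> x = y" for x y by simp
  show ?thesis
    unfolding CRITICAL_def eval_FILTER assms(2) velems_vlist filter_map comp_def critical_def Let_def
    by (intro arg_cong[of _ _ vlist] arg_cong[of _ _ "map vpair"] filter_cong refl)
      (simp add: X eval_HEADS[OF H] eval_TAILS[OF H] L R real del: of_nat_power)
qed

end

lemma eval_ATTACH:
  assumes "eval T env = vpairs t" "eval e env = vpair x"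
  shows "eval (ATTACH T e) env = vpairs (attach t x)"
  using eval_VERTICES[OF assms(1)] assms
  by (simp add: ATTACH_def attach_def vpair_def)

lemma eval_BUILD:
  assumes "eval es env = vpairs xs"
  shows "eval (BUILD es) env = vpairs (build xs)"
proof -
  have 1: "foldl (\<lambda>acc x. eval (ATTACH (Var 1) (Var 0)) (x # acc # env)) (vpairs t) (map vpair ys)
     = vpairs (foldl attach t ys)" for t ys env
  proof (induction ys arbitrary: t)
    case (Cons y ys)
    have "eval (ATTACH (Var 1) (Var 0)) (vpair y # vpairs t # env) = vpairs (attach t y)"
      by (rule eval_ATTACH) simp_all
    with Cons show ?case by (simp only: list.map foldl.simps)
  qed simp
  have "foldl (\<lambda>acc x. eval (Fold (up (up es)) (Var 1) (ATTACH (Var 1) (Var 0))) (x # acc # env)) (vpairs t) ys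
     = vpairs (foldl (\<lambda>t _. foldl attach t xs) t ys)" for t ys
  proof (induction ys arbitrary: t)
    case (Cons y ys)
    have "eval (Fold (up (up es)) (Var 1) (ATTACH (Var 1) (Var 0))) (y # vpairs t # env)
      = vpairs (foldl attach t xs)"
      using 1[of "y # vpairs t # env" t xs] assms by simp
    with Cons show ?case by (simp only: foldl.simps)
  qed simp
  from this[of "[]" "map vpair xs"] show ?thesis
    unfolding BUILD_def build_def by (simp add: assms foldl_map)
qed

section \<open>Cost of the decomposition programs\<close>

lemma polyp_VERTICES [intro]: "polyp T \<Longrightarrow> polyp (VERTICES T)"
  unfolding VERTICES_def by (intro polyp_Pair polyp_Numeral polyp_MAP polyp_Head polyp_Var)

lemma polyp_ANCESTORS [intro]: "polyp T \<Longrightarrow> polyp y \<Longrightarrow> polyp (ANCESTORS T y)"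
  unfolding ANCESTORS_def
proof (rule polyp_Fold[where c = 1])
  fix x acc env
  show "vsize (eval (Cond (Equal (Head (Var 0)) (Head (Var 1))) (Pair (Tail (Var 0)) (Var 1)) (Var 1)) (x # acc # env))
     \<le> vsize acc + (vsize x + 1)"
    using vsize_vtl[of x] by simp
qed blast+

lemma polyp_SIZE [intro]: "polyp T \<Longrightarrow> polyp y \<Longrightarrow> polyp (SIZE T y)"
  unfolding SIZE_def by blast

lemma polyp_HEAVY [intro]: "polyp T \<Longrightarrow> polyp v \<Longrightarrow> polyp (HEAVY T v)"
  unfolding HEAVY_def
proof (rule polyp_Fold[where c = 0], goal_cases)
  case (4 x acc env)
  show ?case using vsize_vhd[of x] by (simp cong: if_cong)
qed blast+

lemma polyp_HEAVY_SIZE [intro]: "polyp T \<Longrightarrow> polyp v \<Longrightarrow> polyp (HEAVY_SIZE T v)"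
  unfolding HEAVY_SIZE_def by blast

lemma polyp_POWERS [intro]: "polyp T \<Longrightarrow> polyp (POWERS T)"
  unfolding POWERS_def
  by (rule polyp_Fold[where c = 4]) (blast | simp add: varith_def split: val.split)+

lemma polyp_SQUARE [intro]: "polyp a \<Longrightarrow> polyp (SQUARE a)"
  unfolding SQUARE_def by blast

lemma polyp_RANK [intro]: "polyp T \<Longrightarrow> polyp v \<Longrightarrow> polyp (RANK T v)"
  unfolding RANK_def
  by (intro polyp_Head polyp_FILTER polyp_POWERS polyp_EXISTS polyp_VERTICES polyp_lift polyp_Bind polyp_ops
      polyp_COUNT polyp_Numeral polyp_Var polyp_bool polyp_SQUARE polyp_HEAVY_SIZE polyp_SIZE)

lemma polyp_ROUTE [intro]: "polyp T \<Longrightarrow> polyp u \<Longrightarrow> polyp v \<Longrightarrow> polyp (ROUTE T u v)"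
  unfolding ROUTE_def by (intro polyp_Head polyp_FILTER polyp_Cond polyp_MEM polyp_lift polyp_Var
      polyp_bool polyp_ANCESTORS)

lemma polyp_HEAVY_PART [intro]: "polyp T \<Longrightarrow> polyp X \<Longrightarrow> polyp (HEAVY_PART T X)"
  unfolding HEAVY_PART_def by (intro polyp_Head polyp_Tail polyp_FILTER polyp_MEM polyp_lift polyp_Var
      polyp_bool polyp_ANCESTORS polyp_EXISTS polyp_ops polyp_HEAVY)

lemma polyp_HEADS [intro]: "polyp X \<Longrightarrow> polyp (HEADS X)" and polyp_TAILS [intro]: "polyp X \<Longrightarrow> polyp (TAILS X)"
  unfolding HEADS_def TAILS_def by (intro polyp_MAP polyp_Head polyp_Tail polyp_Var | assumption)+

text \<open>The accumulator of \<open>LAYER\<close> is replaced by computed ranks. For its growth to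
  be bounded, a rank must be of size 1 in every environment, also in one that encodes no
  tree.\<close>

lemma vsize_RANK: "vsize (eval (RANK T v) env) \<le> 1"
proof -
  let ?B = "Pair (Arith Times (Numeral 4) (Head (Var 1))) (Pair (Arith Times (Numeral 2) (Head (Var 1))) (Var 1))"
  have "\<forall>y\<in>set (velems (foldl (\<lambda>acc x. eval ?B (x # acc # env)) a xs)). vsize y \<le> 1"
    if "\<forall>y\<in>set (velems a). vsize y \<le> 1" for a xs
    using that
  proof (induction xs arbitrary: a)
    case (Cons x xs)
    show ?case unfolding foldl.simps
      by (rule Cons.IH) (use Cons.prems in \<open>auto simp: varith_def split: val.split\<close>)
  qed simp
  from this[of "VCons (VNum 1) VNil" "velems (eval (VERTICES T) env)"]
  have *: "\<forall>y\<in>set (velems (eval (POWERS T) env)). vsize y \<le> 1" by (simp add: POWERS_def)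
  have "vsize (vhd (vlist xs)) \<le> 1" if "\<forall>y\<in>set xs. vsize y \<le> 1" for xs
    using that by (cases xs) auto
  with * show ?thesis unfolding RANK_def by simp
qed

lemma polyp_LAYER [intro]: "polyp T \<Longrightarrow> polyp X \<Longrightarrow> polyp (LAYER T X)"
  unfolding LAYER_def
proof (rule polyp_Fold[where c = 1], goal_cases)
  case (4 x acc env)
  show ?case using vsize_RANK[of "up (up T)" "Var 0" "x # acc # env"] by (simp cong: if_cong)
qed (intro polyp_APP polyp_TAILS polyp_HEADS polyp_FILTER polyp_bool polyp_MEM polyp_Tail polyp_Var polyp_lift
    polyp_HEAVY_PART polyp_Numeral polyp_Cond polyp_ops polyp_RANK | assumption)+

lemma polyp_CRITICAL [intro]: "polyp T \<Longrightarrow> polyp X \<Longrightarrow> polyp (CRITICAL T X)"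
  unfolding CRITICAL_def
  by (intro polyp_FILTER polyp_bool polyp_MEM polyp_Head polyp_Tail polyp_Var polyp_lift polyp_HEADS polyp_TAILS
      polyp_HEAVY_PART polyp_ops polyp_RANK polyp_LAYER)

lemma polyp_ATTACH [intro]: "polyp T \<Longrightarrow> polyp e \<Longrightarrow> polyp (ATTACH T e)"
  unfolding ATTACH_def by (intro polyp_Cond polyp_bool polyp_MEM polyp_Head polyp_Tail polyp_VERTICES polyp_Pair)

lemma vsize_ATTACH: "vsize (eval (ATTACH (Var 1) (Var 0)) (x # acc # env)) \<le> vsize acc + (vsize x + 3)"
  using vsize_vhd[of x] vsize_vtl[of x] by (cases x) (simp_all add: ATTACH_def cong: if_cong)

text \<open>One iteration of the outer fold may enlarge the table by the whole edge list and not
  just by its own element, so \<open>polyp_Fold\<close> does not apply. The growth is measured by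
  the cost of the list instead.\<close>

lemma polyp_BUILD [intro]:
  assumes "polyp es" shows "polyp (BUILD es)"
  unfolding polyp_def BUILD_def
proof (intro allI impI)
  fix X assume X: "psz X"
  let ?inner = "Fold (up (up es)) (Var 1) (ATTACH (Var 1) (Var 0))"
  have inner: "polyp ?inner"
    by (rule polyp_Fold[where c = 3, OF _ _ _ vsize_ATTACH]) (use assms in blast)+
  have vs: "vsize (foldl (\<lambda>acc x. eval (ATTACH (Var 1) (Var 0)) (x # acc # env)) a xs)
      \<le> vsize a + (\<Sum>x\<leftarrow>xs. vsize x + 3)" for a xs env
  proof (induction xs arbitrary: a)
    case (Cons x xs)
    show ?case using Cons.IH[of "eval (ATTACH (Var 1) (Var 0)) (x # a # env)"] vsize_ATTACH[of x a env] by simp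
  qed simp
  have sum: "(\<Sum>x\<leftarrow>velems v. vsize x + 3) \<le> 3 * vsize v" for v
    by (induction v) auto
  have c: "polyon X es" using polypD assms X by blast
  show "polyon X (Fold es Empty ?inner)"
  proof (rule polyon_Fold[where g = "\<lambda>x. 3 * cost es (snd x)"])
    show "pbd X (\<lambda>x. 3 * cost es (snd x))" using c unfolding polyon_def by (intro pbd_mult pbd_const)
    fix s env x acc assume "(s, env) \<in> X" "x \<in> set (velems (eval es env))"
    show "vsize (eval ?inner (x # acc # env)) \<le> vsize acc + 3 * cost es (snd (s, env))"
      using vs[of "x # acc # env" acc "velems (eval es env)"] sum[of "eval es env"]
        vsize_eval_le_cost[of es env] by simp
  qed (rule X c polyon_Empty polypD[OF inner] | assumption)+
qed

section \<open>The distributed algorithm\<close>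

definition field_of :: "nat \<Rightarrow> val \<Rightarrow> val" where
  "field_of i v = vhd ((vtl ^^ i) v)"

lemma eval_FIELD_of [simp]: "eval (FIELD i e) env = field_of i (eval e env)"
  by (simp add: eval_FIELD field_of_def)

lemma field_of_vlist: "i < length xs \<Longrightarrow> field_of i (vlist xs) = xs ! i"
  unfolding field_of_def by (rule vhd_vtl_vlist)

definition PROC :: "prog \<Rightarrow> prog" where "PROC S = Head S"
definition REGS :: "prog \<Rightarrow> prog" where "REGS S = Head (Tail S)"
definition RECS :: "prog \<Rightarrow> prog" where "RECS S = Tail (Tail S)"

definition UPDATE :: "prog \<Rightarrow> (nat \<Rightarrow> prog option) \<Rightarrow> prog" where
  "UPDATE r f = LIST (map (\<lambda>k. case f k of None \<Rightarrow> FIELD k r | Some e \<Rightarrow> e) [0..<11])"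

text \<open>
  The state of a processor consists of its name, registers common to all processors, and one record
  for each of its demand instances. Fields of a record: name of the instance as a vertex of the
  conflict graph, processor, tree-network, profit, layer, path, critical edges, left-hand side of
  the dual constraint, state of the simulated vertex, step in which the instance was raised, and
  whether it is selected. Registers: phase (0: raising, 1: selection, 2: finished), round of the
  current step, number of the step, layer of the current epoch, stage, threshold, doubling
  counter of the step within the stage, number of rounds for a maximal independent set,
  \<open>p\<^sub>m\<^sub>i\<^sub>n\<close>, \<open>p\<^sub>m\<^sub>a\<^sub>x\<close>, \<open>n\<^sup>2\<close> and \<open>N\<close>.
\<close>

definition START :: prog where
  "START = Pair (FIELD 6 (Var 0)) (Pair
    (LIST [Numeral 0, Numeral 0, Numeral 0, Numeral 1, Numeral 1, Numeral (14 / 15), FIELD 3 (Var 0),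
       FIELD 5 (Var 0), FIELD 3 (Var 0), FIELD 4 (Var 0), SQUARE (FIELD 0 (Var 0)),
       Arith Times (FIELD 1 (Var 0)) (FIELD 2 (Var 0))])
    (MAP (FIELD 10 (Var 0)) (Bind (BUILD (Tail (Var 0))) (Bind (ROUTE (Var 0) (FIELD 7 (Var 2)) (FIELD 8 (Var 2)))
      (LIST [Arith Plus (Arith Times (FIELD 6 (Var 3)) (FIELD 2 (Var 3))) (Head (Var 2)),
        FIELD 6 (Var 3), Head (Var 2), FIELD 9 (Var 3), LAYER (Var 1) (Var 0), Var 0, CRITICAL (Var 1) (Var 0),
        Numeral 0, Empty, Empty, Empty])))))"

text \<open>No logarithms are computed. A stage ends when the next doubling of the counter would
  exceed \<open>p_max\<close>, an epoch after \<open>b\<close> stages, and raising when the next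
  layer exceeds n^2.\<close>

definition NEXT_STEP :: "nat \<Rightarrow> prog \<Rightarrow> prog" where
  "NEXT_STEP b R = (let
     wrap = Less (FIELD 9 R) (Arith Times (Numeral 2) (FIELD 6 R));
     wrap2 = AND wrap (NOT (Less (FIELD 4 R) (Numeral (of_nat b))));
     kp = Cond wrap2 (Arith Times (Numeral 2) (FIELD 3 R)) (FIELD 3 R) in
   LIST [Cond (Less (FIELD 10 R) kp) (Numeral 1) (Numeral 0), Numeral 0, Arith Plus (FIELD 2 R) (Numeral 1), kp,
     Cond wrap2 (Numeral 1) (Cond wrap (Arith Plus (FIELD 4 R) (Numeral 1)) (FIELD 4 R)),
     Cond wrap2 (Numeral (14 / 15)) (Cond wrap (Arith Times (Numeral (14 / 15)) (FIELD 5 R)) (FIELD 5 R)),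
     Cond wrap (FIELD 8 R) (Arith Times (Numeral 2) (FIELD 6 R)),
     FIELD 7 R, FIELD 8 R, FIELD 9 R, FIELD 10 R, FIELD 11 R])"

definition NEXT_ROUND :: "prog \<Rightarrow> prog" where
  "NEXT_ROUND R = Pair (Head R) (Pair (Arith Plus (FIELD 1 R) (Numeral 1)) (Tail (Tail R)))"

definition NEXT_SELECT :: "prog \<Rightarrow> prog" where
  "NEXT_SELECT R = Bind (Arith Minus (FIELD 2 R) (Numeral 1))
     (Pair (Cond (Equal (Var 0) (Numeral 0)) (Numeral 2) (Numeral 1))
       (Pair (FIELD 1 (up R)) (Pair (Var 0) (Tail (Tail (Tail (up R)))))))"

definition UNSAT :: "prog \<Rightarrow> prog \<Rightarrow> prog" where
  "UNSAT R r = AND (Equal (FIELD 4 r) (FIELD 3 R))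
     (Less (FIELD 7 r) (Arith Times (Arith Minus (Numeral 1) (FIELD 5 R)) (FIELD 3 r)))"

definition CONFLICT :: "prog \<Rightarrow> prog \<Rightarrow> prog" where
  "CONFLICT a b = OR (Equal (FIELD 1 a) (FIELD 1 b))
     (AND (Equal (FIELD 2 a) (FIELD 2 b)) (EXISTS (FIELD 5 a) (MEM (Var 0) (FIELD 5 (up b)))))"

definition ADJACENT :: "prog \<Rightarrow> prog \<Rightarrow> prog \<Rightarrow> prog" where
  "ADJACENT R a b = AND (NOT (Equal (FIELD 0 a) (FIELD 0 b))) (AND (UNSAT R a) (AND (UNSAT R b) (CONFLICT a b)))"

text \<open>The processor inserts its own state among the received ones according to its name. The
  records then appear in increasing order of the simulated vertices, the order that
  \<open>mis_input\<close> and \<open>inbox\<close> prescribe for neighbours and messages.\<close>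

definition VISIBLE :: prog where
  "VISIBLE = FLATMAP (APP (FILTER (Var 1) (Less (Head (Var 0)) (PROC (Var 1))))
       (Pair (Pair (PROC (Var 0)) (Var 0)) (FILTER (Var 1) (Less (PROC (Var 1)) (Head (Var 0))))))
     (RECS (Tail (Var 0)))"

definition DECIDED :: "dist_alg \<Rightarrow> prog \<Rightarrow> prog" where
  "DECIDED M l = MAP l (Pair (call1 (decide M) (FIELD 8 (Var 0))) (Var 0))"

text \<open>
  \<open>SETUP\<close>, \<open>SIMULATE\<close>, \<open>RAISE\<close> and \<open>SELECT\<close> run in the environment consisting of the visible records,
  the state, the inbox and the coin tosses.
\<close>

abbreviation "SETUP_INPUT \<equiv> LIST [FIELD 11 (REGS (Var 2)), FIELD 0 (Var 0),
     MAP (FILTER (Var 1) (ADJACENT (REGS (Var 3)) (Var 1) (Var 0))) (FIELD 0 (Var 0))]"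

definition SETUP :: "dist_alg \<Rightarrow> prog" where
  "SETUP M = MAP (RECS (Var 1)) (UPDATE (Var 0) [8 \<mapsto> call1 (start M) SETUP_INPUT])"

text \<open>One copy of the vertex name for each coin that a simulated vertex requests. The length
  of the list requests the coins of all own vertices at once, and its entries later tell to whom
  each coin belongs.\<close>

definition TAGS :: "dist_alg \<Rightarrow> prog \<Rightarrow> prog" where
  "TAGS M l = FLATMAP l (Cond (IS_PAIR (Head (Var 0))) Empty
     (MAP (call1 (coins M) (FIELD 8 (Tail (Var 0)))) (FIELD 0 (Tail (Var 1)))))"

text \<open>Processors exchange their whole states, so the receiver itself computes what the
  simulated neighbours would have sent.\<close>

definition INBOX :: "dist_alg \<Rightarrow> prog \<Rightarrow> prog \<Rightarrow> prog \<Rightarrow> prog" where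
  "INBOX M R l r = FLATMAP l (Cond (AND (NOT (IS_PAIR (Head (Var 0)))) (ADJACENT (up R) (Tail (Var 0)) (up r)))
     (Pair (Pair (FIELD 0 (Tail (Var 0))) (call2 (send M) (FIELD 8 (Tail (Var 0))) (FIELD 0 (up r)))) Empty)
     Empty)"

definition CHUNK :: "prog \<Rightarrow> prog \<Rightarrow> prog" where
  "CHUNK z r = MAP (FILTER z (Equal (Head (Var 0)) (FIELD 0 (up r)))) (Tail (Var 0))"

definition SIMULATE :: "dist_alg \<Rightarrow> prog" where
  "SIMULATE M = Bind (DECIDED M (Var 0)) (Bind (DECIDED M (RECS (Var 2)))
     (Bind (ZIP (TAGS M (Var 0)) (Var 5)) (MAP (Var 1)
       (Cond (IS_PAIR (Head (Var 0))) (Tail (Var 0))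
         (UPDATE (Tail (Var 0)) [8 \<mapsto> call3 (recv M) (FIELD 8 (Tail (Var 0)))
            (INBOX M (REGS (Var 5)) (Var 3) (Tail (Var 0))) (CHUNK (Var 1) (Tail (Var 0)))])))))"

definition CHOSEN :: "prog \<Rightarrow> prog \<Rightarrow> prog" where
  "CHOSEN R d = AND (UNSAT R (Tail d)) (AND (IS_PAIR (Head d)) (Head (Head d)))"

definition WEIGHT :: "prog \<Rightarrow> prog \<Rightarrow> prog" where
  "WEIGHT a b = Arith Plus (Cond (Equal (FIELD 1 a) (FIELD 1 b)) (Numeral 1) (Numeral 0))
     (Cond (Equal (FIELD 2 a) (FIELD 2 b)) (COUNT (FIELD 6 a) (MEM (Var 0) (FIELD 5 (up b)))) (Numeral 0))"

definition RAISE :: "dist_alg \<Rightarrow> prog" where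
  "RAISE M = Bind (DECIDED M (Var 0)) (MAP (DECIDED M (RECS (Var 2))) (UPDATE (Tail (Var 0)) [
     7 \<mapsto> Arith Plus (FIELD 7 (Tail (Var 0))) (SUMP (Var 1) (Cond (CHOSEN (REGS (Var 4)) (Var 0))
        (Arith Times (Arith Divide (Arith Minus (FIELD 3 (Tail (Var 0))) (FIELD 7 (Tail (Var 0))))
              (Arith Plus (Numeral 1) (COUNT (FIELD 6 (Tail (Var 0))) (Numeral 1))))
           (WEIGHT (Tail (Var 0)) (Tail (Var 1)))) (Numeral 0))),
     8 \<mapsto> Empty,
     9 \<mapsto> Cond (CHOSEN (REGS (Var 3)) (Var 0)) (FIELD 2 (REGS (Var 3))) (FIELD 9 (Tail (Var 0)))]))"

text \<open>The step counter runs backwards in this phase and is one ahead: it holds s + 1 while the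
  instances raised in step s are treated.\<close>

definition SELECT :: prog where
  "SELECT = MAP (RECS (Var 1)) (UPDATE (Var 0) [10 \<mapsto>
     Cond (AND (Equal (FIELD 9 (Var 0)) (Arith Minus (FIELD 2 (REGS (Var 2))) (Numeral 1)))
         (NOT (EXISTS (Var 1) (AND (FIELD 10 (Var 0)) (CONFLICT (Var 1) (Var 0))))))
       (Numeral 1) (FIELD 10 (Var 0))])"

text \<open>With t rounds for a maximal independent set, a step takes t + 2 rounds: round 0 sets up
  the conflict graph, rounds 1 to t simulate, and round t + 1 raises.\<close>

definition RECV :: "dist_alg \<Rightarrow> nat \<Rightarrow> prog" where
  "RECV M b = Bind VISIBLE (Pair (PROC (Var 1))
     (Cond (Equal (FIELD 0 (REGS (Var 1))) (Numeral 0))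
       (Cond (Equal (FIELD 1 (REGS (Var 1))) (Numeral 0)) (Pair (NEXT_ROUND (REGS (Var 1))) (SETUP M))
         (Cond (Less (FIELD 7 (REGS (Var 1))) (FIELD 1 (REGS (Var 1))))
           (Pair (NEXT_STEP b (REGS (Var 1))) (RAISE M))
           (Pair (NEXT_ROUND (REGS (Var 1))) (SIMULATE M))))
       (Pair (NEXT_SELECT (REGS (Var 1))) SELECT)))"

abbreviation "SIMULATING \<equiv> AND (Equal (FIELD 0 (REGS (Var 0))) (Numeral 0)) (AND
  (NOT (Equal (FIELD 1 (REGS (Var 0))) (Numeral 0)))
  (NOT (Less (FIELD 7 (REGS (Var 0))) (FIELD 1 (REGS (Var 0))))))"

definition COINS :: "dist_alg \<Rightarrow> prog" where
  "COINS M = Cond SIMULATING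
     (TAGS M (DECIDED M (RECS (Var 0)))) Empty"

definition DECIDE :: prog where
  "DECIDE = Cond (Equal (FIELD 0 (REGS (Var 0))) (Numeral 2))
     (Pair (MAP (FILTER (RECS (Var 0)) (FIELD 10 (Var 0))) (FIELD 2 (Var 0))) Empty) Empty"

definition scheduler :: "dist_alg \<Rightarrow> nat \<Rightarrow> dist_alg" where
  "scheduler M b = \<lparr>start = START, coins = COINS M, send = Var 0, recv = RECV M b, decide = DECIDE\<rparr>"

lemma deterministic_scheduler: assumes "deterministic M" shows "deterministic (scheduler M b)"
proof -
  have "velems (eval (TAGS M l) env) = []" for l env
    using assms by (auto simp: TAGS_def deterministic_def cong: if_cong)
  then show ?thesis by (simp add: deterministic_def scheduler_def COINS_def cong: if_cong)
qed

subsection \<open>Instances\<close>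

definition edge_list :: "throughput_problem \<Rightarrow> nat \<Rightarrow> (nat \<times> nat) list" where
  "edge_list I j = [(u, v). u \<leftarrow> [0..<num_vertices I], v \<leftarrow> [0..<num_vertices I],
     u < v \<and> {u, v} \<in> tree_edges I j]"

definition itable :: "throughput_problem \<Rightarrow> nat \<Rightarrow> (nat \<times> nat) list" where
  "itable I j = build (edge_list I j)"

definition iroute :: "throughput_problem \<Rightarrow> nat \<times> nat \<Rightarrow> (nat \<times> nat) list" where
  "iroute I d = route (itable I (snd d)) (source I (fst d)) (target I (fst d))"

definition ilayer :: "throughput_problem \<Rightarrow> nat \<times> nat \<Rightarrow> nat" where
  "ilayer I d = layer_of (itable I (snd d)) (iroute I d)"

definition icritical :: "throughput_problem \<Rightarrow> nat \<times> nat \<Rightarrow> (nat \<times> nat) list" where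
  "icritical I d = critical (itable I (snd d)) (iroute I d)"

definition iprofit :: "throughput_problem \<Rightarrow> nat \<times> nat \<Rightarrow> real" where
  "iprofit I d = profit I (fst d)"

definition iconflict :: "throughput_problem \<Rightarrow> nat \<times> nat \<Rightarrow> nat \<times> nat \<Rightarrow> bool" where
  "iconflict I d d' \<longleftrightarrow> fst d = fst d' \<or> snd d = snd d' \<and> set (iroute I d) \<inter> set (iroute I d') \<noteq> {}"

definition iweight :: "throughput_problem \<Rightarrow> nat \<times> nat \<Rightarrow> nat \<times> nat \<Rightarrow> real" where
  "iweight I d d' = (if fst d = fst d' then 1 else 0) +
     (if snd d = snd d' then real (length (filter (\<lambda>e. e \<in> set (iroute I d')) (icritical I d))) else 0)"

text \<open>Mixed radix: names lie below m r and can be decoded. The names of one processor form an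
  interval, so ordering processors orders the vertices.\<close>

definition iname :: "throughput_problem \<Rightarrow> nat \<times> nat \<Rightarrow> nat" where
  "iname I d = fst d * num_trees I + snd d"

definition accessible :: "throughput_problem \<Rightarrow> nat \<Rightarrow> nat list" where
  "accessible I P = filter (\<lambda>j. j \<in> Acc I P) [0..<num_trees I]"

definition own :: "throughput_problem \<Rightarrow> nat \<Rightarrow> (nat \<times> nat) list" where
  "own I P = map (\<lambda>j. (P, j)) (accessible I P)"

definition visible :: "throughput_problem \<Rightarrow> nat \<Rightarrow> (nat \<times> nat) list" where
  "visible I P = concat (map (own I) (filter (\<lambda>Q. Q = P \<or> communicate I Q P) [0..<num_procs I]))"

lemma vtree_eq: "vtree I j = vpairs (edge_list I j)"
proof -
  have *: "map vpair (concat (map f xs)) = concat (map (\<lambda>x. map vpair (f x)) xs)" for f :: "nat \<Rightarrow> _" and xs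
    by (induction xs) auto
  have **: "map vpair (if c then xs else ys) = (if c then map vpair xs else map vpair ys)" for c xs ys by simp
  show ?thesis unfolding vtree_def edge_list_def by (simp add: * ** vpair_def cong: if_cong)
qed

lemma set_edge_list: "set (edge_list I j) = {(u, v). u < v \<and> v < num_vertices I \<and> {u, v} \<in> tree_edges I j}"
  by (auto simp: edge_list_def)

locale setting =
  fixes I :: throughput_problem and b :: nat
  assumes valid: "valid_problem I" and b_pos: "0 < b"
begin

abbreviation "m \<equiv> num_procs I"
abbreviation "r \<equiv> num_trees I"
abbreviation "n \<equiv> num_vertices I"
abbreviation "D \<equiv> demand_instances I"
abbreviation "nm \<equiv> iname I"

lemma m_pos: "0 < m" using valid by (simp add: valid_problem_def)

lemma proc: assumes "P < m" shows "source I P < n" "target I P < n" "0 < profit I P" "Acc I P \<subseteq> {..<r}"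
  using valid assms by (auto simp: valid_problem_def)

lemma n_pos: "0 < n" using proc(1)[OF m_pos] by simp

lemma D_iff: "d \<in> D \<longleftrightarrow> fst d < m \<and> snd d \<in> Acc I (fst d)"
  by (cases d) (simp add: demand_instances_def)

lemma D_bounds: "d \<in> D \<Longrightarrow> fst d < m \<and> snd d < r"
  using D_iff proc(4) by blast

lemma finite_D: "finite D"
  by (rule finite_subset[of _ "{..<m} \<times> {..<r}"]) (use D_bounds in fastforce)+

lemma set_accessible: "P < m \<Longrightarrow> set (accessible I P) = Acc I P"
  using proc(4) by (auto simp: accessible_def)

lemma set_own: "P < m \<Longrightarrow> set (own I P) = {d \<in> D. fst d = P}"
  by (auto simp: own_def set_accessible D_iff)

lemma set_visible: "set (visible I P) = {d \<in> D. fst d = P \<or> communicate I (fst d) P}"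
  by (auto simp: visible_def set_own D_iff)

lemma nm_less: "d \<in> D \<Longrightarrow> nm d < m * r"
proof -
  assume "d \<in> D"
  then have "fst d < m" "snd d < r" using D_bounds by auto
  then have "nm d < fst d * r + r" by (simp add: iname_def)
  also have "\<dots> = Suc (fst d) * r" by simp
  also have "\<dots> \<le> m * r" using \<open>fst d < m\<close> by (intro mult_le_mono1) simp
  finally show ?thesis .
qed

lemma nm_div_mod: "d \<in> D \<Longrightarrow> nm d div r = fst d \<and> nm d mod r = snd d"
  using D_bounds[of d] by (simp add: iname_def)

lemma nm_inj: "d \<in> D \<Longrightarrow> d' \<in> D \<Longrightarrow> nm d = nm d' \<longleftrightarrow> d = d'"
  using nm_div_mod[of d] nm_div_mod[of d'] by (metis prod_eqI)

lemma nm_mono: "d \<in> D \<Longrightarrow> fst d < fst d' \<Longrightarrow> nm d < nm d'"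
proof -
  assume d: "d \<in> D" "fst d < fst d'"
  have "nm d < fst d * r + r" using D_bounds d(1) by (simp add: iname_def)
  also have "\<dots> = Suc (fst d) * r" by simp
  also have "\<dots> \<le> fst d' * r" using d(2) by (intro mult_le_mono1) simp
  finally show ?thesis by (simp add: iname_def)
qed

lemma sorted_concat_own:
  assumes "sorted_wrt (<) Ps" "set Ps \<subseteq> {..<m}"
  shows "sorted_wrt (<) (map nm (concat (map (own I) Ps)))"
  using assms
proof (induction Ps)
  case (Cons P Ps)
  have "sorted_wrt (<) (accessible I P)" unfolding accessible_def by (intro sorted_wrt_filter) simp
  then have "sorted_wrt (<) (map nm (own I P))"
    unfolding own_def by (simp add: sorted_wrt_map iname_def)
  moreover have *: "nm d < nm d'" if "d \<in> set (own I P)" "d' \<in> set (concat (map (own I) Ps))" for d d'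
    using that Cons.prems set_own by (intro nm_mono) fastforce+
  have "\<forall>x\<in>set (map nm (own I P)). \<forall>y\<in>set (map nm (concat (map (own I) Ps))). x < y"
  proof (intro ballI)
    fix x y assume "x \<in> set (map nm (own I P))" "y \<in> set (map nm (concat (map (own I) Ps)))"
    then obtain d d' where "x = nm d" "d \<in> set (own I P)" "y = nm d'" "d' \<in> set (concat (map (own I) Ps))"
      unfolding set_map by blast
    with *[of d d'] show "x < y" by simp
  qed
  ultimately show ?case using Cons by (simp only: list.map concat.simps map_append sorted_wrt_append) simp
qed simp

lemma sorted_visible: "sorted_wrt (<) (map nm (visible I P))"
  unfolding visible_def by (rule sorted_concat_own) (auto intro: sorted_wrt_filter)

lemma distinct_visible: "distinct (visible I P)"
  using sorted_visible[of P] by (metis distinct_map strict_sorted_iff)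

text \<open>Visible instances are sorted by name. If they comprise all names with property
  \<open>Q\<close>, filtering them agrees, including the order, with filtering all names below m r.
  So local knowledge reproduces the inputs and inboxes of the simulated algorithm.\<close>

lemma filter_visible:
  assumes "\<And>q. q < m * r \<Longrightarrow> Q q \<Longrightarrow> \<exists>d\<in>set (visible I P). nm d = q"
  shows "map nm (filter (\<lambda>d. Q (nm d)) (visible I P)) = filter Q [0..<m * r]"
proof (rule sorted_distinct_set_unique)
  have s: "sorted_wrt (<) (map nm (filter (\<lambda>d. Q (nm d)) (visible I P)))"
    using sorted_wrt_filter[OF sorted_visible[of P], of Q] by (simp add: filter_map comp_def)
  then show "sorted (map nm (filter (\<lambda>d. Q (nm d)) (visible I P)))"
    "distinct (map nm (filter (\<lambda>d. Q (nm d)) (visible I P)))" by (simp_all add: strict_sorted_iff)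
  show "set (map nm (filter (\<lambda>d. Q (nm d)) (visible I P))) = set (filter Q [0..<m * r])"
    using assms nm_less set_visible by (auto simp: image_iff) blast
  show "sorted (filter Q [0..<m * r])" by (rule sorted_wrt_filter) simp
qed auto

lemma tree_network: "j < r \<Longrightarrow> tree_network n (tree_edges I j) (edge_list I j)"
  using valid n_pos by (unfold_locales) (auto simp: valid_problem_def set_edge_list)

lemma tree_table: "j < r \<Longrightarrow> tree_table (itable I j) n"
  unfolding itable_def
proof -
  assume "j < r"
  interpret tree_network n "tree_edges I j" "edge_list I j" by (rule tree_network) fact
  show "tree_table (build (edge_list I j)) n" by unfold_locales (rule V_eq)
qed

lemma rooted: assumes "j < r"
  shows "rooted_tree (itable I j)" "insert 0 (fst ` set (itable I j)) = {..<n}"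
proof -
  interpret tree_table "itable I j" n by (rule tree_table) fact
  show "rooted_tree (itable I j)" by unfold_locales
  show "insert 0 (fst ` set (itable I j)) = {..<n}" by (rule vertices)
qed

text \<open>Paths consist of undirected edges, routes of table entries. As \<open>ends\<close> is
  injective on a table, sharing an edge means the same for both.\<close>

lemma overlap_iff:
  assumes "d \<in> D" "d' \<in> D"
  shows "conflict I d d' \<longleftrightarrow> iconflict I d d'"
proof -
  have dp: "demand_path I d = ends ` set (iroute I d)" if "d \<in> D" for d
  proof -
    interpret tree_network n "tree_edges I (snd d)" "edge_list I (snd d)"
      using tree_network D_bounds that by blast
    show ?thesis using demand_route[of "source I (fst d)" "target I (fst d)"] proc D_bounds[OF that]
      by (simp add: demand_path_def iroute_def itable_def split_beta)
  qed
  have "ends ` set (iroute I d) \<inter> ends ` set (iroute I d') = ends ` (set (iroute I d) \<inter> set (iroute I d'))"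
    if "snd d = snd d'"
  proof -
    interpret rooted_tree "itable I (snd d)" using rooted D_bounds assms by blast
    show ?thesis
      by (rule inj_on_image_Int[symmetric, OF ends_inj]) (auto simp: iroute_def route_def that)
  qed
  note eq = this
  have "overlap I d d' \<longleftrightarrow> snd d = snd d' \<and> set (iroute I d) \<inter> set (iroute I d') \<noteq> {}"
  proof (cases "snd d = snd d'")
    case True
    show ?thesis unfolding overlap_def dp[OF assms(1)] dp[OF assms(2)] eq[OF True] by simp
  qed (simp add: overlap_def)
  then show ?thesis by (simp add: conflict_def iconflict_def)
qed

end

declare FIELD.simps [simp del] lift.simps [simp del]

section \<open>Encoding of processor states\<close>

definition num_steps :: "throughput_problem \<Rightarrow> nat" where
  "num_steps I = (LEAST L. p_max I < p_min I * 2 ^ L)"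

text \<open>Layers are powers of two of size at most n^2, so their exponents lie below this number.
  Both numbers are least ones because the processors find them by doubling until a bound is
  passed.\<close>

definition num_epochs :: "throughput_problem \<Rightarrow> nat" where
  "num_epochs I = (LEAST E. (num_vertices I)\<^sup>2 < 2 ^ E)"

text \<open>All registers that drive the raising phase are functions of the step \<open>e\<close>.
  The counter \<open>s\<close> is separate because it runs backwards during selection, while
  \<open>e\<close> stays at its final value.\<close>

definition registers :: "throughput_problem \<Rightarrow> nat \<Rightarrow> nat \<Rightarrow> nat \<Rightarrow> nat \<Rightarrow> nat \<Rightarrow> nat \<Rightarrow> val" where
  "registers I b tm ph t s e = vlist [vnat ph, vnat t, vnat s, vnat (epoch b (num_steps I) e),
     vnat (Suc (e div num_steps I mod b)), VNum (threshold b (num_steps I) e),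
     VNum (p_min I * 2 ^ (e mod num_steps I)), vnat tm, VNum (p_min I), VNum (p_max I),
     vnat ((num_vertices I)\<^sup>2), vnat (num_procs I * num_trees I)]"

definition irecord :: "throughput_problem \<Rightarrow> real \<Rightarrow> val \<Rightarrow> val \<Rightarrow> val \<Rightarrow> nat \<times> nat \<Rightarrow> val" where
  "irecord I lh ms rd sl d = vlist [vnat (iname I d), vnat (fst d), vnat (snd d), VNum (iprofit I d),
     vnat (ilayer I d), vpairs (iroute I d), vpairs (icritical I d), VNum lh, ms, rd, sl]"

lemma field_of_registers [simp]:
  "field_of 0 (registers I b tm ph t s e) = vnat ph"
  "field_of (Suc 0) (registers I b tm ph t s e) = vnat t"
  "field_of 2 (registers I b tm ph t s e) = vnat s"
  "field_of 3 (registers I b tm ph t s e) = vnat (epoch b (num_steps I) e)"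
  "field_of 4 (registers I b tm ph t s e) = vnat (Suc (e div num_steps I mod b))"
  "field_of 5 (registers I b tm ph t s e) = VNum (threshold b (num_steps I) e)"
  "field_of 6 (registers I b tm ph t s e) = VNum (p_min I * 2 ^ (e mod num_steps I))"
  "field_of 7 (registers I b tm ph t s e) = vnat tm"
  "field_of 8 (registers I b tm ph t s e) = VNum (p_min I)"
  "field_of 9 (registers I b tm ph t s e) = VNum (p_max I)"
  "field_of 10 (registers I b tm ph t s e) = vnat ((num_vertices I)\<^sup>2)"
  "field_of 11 (registers I b tm ph t s e) = vnat (num_procs I * num_trees I)"
  unfolding registers_def by (subst field_of_vlist; simp)+

lemma field_of_irecord [simp]:
  "field_of 0 (irecord I lh ms rd sl d) = vnat (iname I d)"
  "field_of (Suc 0) (irecord I lh ms rd sl d) = vnat (fst d)"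
  "field_of 2 (irecord I lh ms rd sl d) = vnat (snd d)"
  "field_of 3 (irecord I lh ms rd sl d) = VNum (iprofit I d)"
  "field_of 4 (irecord I lh ms rd sl d) = vnat (ilayer I d)"
  "field_of 5 (irecord I lh ms rd sl d) = vpairs (iroute I d)"
  "field_of 6 (irecord I lh ms rd sl d) = vpairs (icritical I d)"
  "field_of 7 (irecord I lh ms rd sl d) = VNum lh"
  "field_of 8 (irecord I lh ms rd sl d) = ms"
  "field_of 9 (irecord I lh ms rd sl d) = rd"
  "field_of 10 (irecord I lh ms rd sl d) = sl"
  unfolding irecord_def by (subst field_of_vlist; simp)+

lemma fields_11: "[0..<11] = [0, Suc 0, 2, 3, 4, 5, 6, 7, 8, 9, 10 :: nat]"
  by (simp add: upt_rec)

lemma eval_UPDATE: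
  assumes "eval a env = irecord I lh ms rd sl d"
  shows "eval (UPDATE a [8 \<mapsto> e]) env = irecord I lh (eval e env) rd sl d"
    "eval (UPDATE a [10 \<mapsto> e]) env = irecord I lh ms rd (eval e env) d"
    "eval e1 env = VNum x \<Longrightarrow>
      eval (UPDATE a [7 \<mapsto> e1, 8 \<mapsto> e2, 9 \<mapsto> e3]) env = irecord I x (eval e2 env) (eval e3 env) sl d"
  unfolding UPDATE_def fields_11 by (simp_all add: assms) (simp_all add: irecord_def)

definition pstate ::
    "throughput_problem \<Rightarrow> val \<Rightarrow> (nat \<times> nat \<Rightarrow> real) \<Rightarrow> (nat \<times> nat \<Rightarrow> val) \<Rightarrow> (nat \<times> nat \<Rightarrow> val)
      \<Rightarrow> (nat \<times> nat \<Rightarrow> val) \<Rightarrow> nat \<Rightarrow> val" where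
  "pstate I rg lh ms rd sl P = VCons (vnat P) (VCons rg
     (vlist (map (\<lambda>d. irecord I (lh d) (ms d) (rd d) (sl d) d) (own I P))))"

lemma PROC_pstate [simp]: "eval S env = pstate I rg lh ms rd sl P \<Longrightarrow> eval (PROC S) env = vnat P"
  and REGS_pstate [simp]: "eval S env = pstate I rg lh ms rd sl P \<Longrightarrow> eval (REGS S) env = rg"
  and RECS_pstate [simp]: "eval S env = pstate I rg lh ms rd sl P \<Longrightarrow>
    eval (RECS S) env = vlist (map (\<lambda>d. irecord I (lh d) (ms d) (rd d) (sl d) d) (own I P))"
  by (simp_all add: PROC_def REGS_def RECS_def pstate_def)

definition vertex_coins :: "dist_alg \<Rightarrow> (nat \<Rightarrow> val) \<Rightarrow> nat \<Rightarrow> nat" where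
  "vertex_coins M \<sigma> x = (if halted M (\<sigma> x) then 0 else length (velems (eval (coins M) [\<sigma> x])))"

definition tags :: "throughput_problem \<Rightarrow> dist_alg \<Rightarrow> (nat \<Rightarrow> val) \<Rightarrow> nat \<Rightarrow> nat list" where
  "tags I M \<sigma> P = concat (map (\<lambda>d. replicate (vertex_coins M \<sigma> (iname I d)) (iname I d)) (own I P))"

definition chunk :: "nat list \<Rightarrow> bool list \<Rightarrow> nat \<Rightarrow> bool list" where
  "chunk ts bs x = map snd (filter (\<lambda>a. fst a = x) (zip ts bs))"

context setting
begin

abbreviation "L \<equiv> num_steps I"
abbreviation "E \<equiv> num_epochs I"

definition "K = E * b * L"

definition U :: "nat \<Rightarrow> (nat \<times> nat \<Rightarrow> real) \<Rightarrow> (nat \<times> nat) set" where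
  "U e lh = unsatisfied D (ilayer I) (iprofit I) (epoch b L e) (threshold b L e) lh"

text \<open>A graph on all names below m r, as the given algorithm expects. Names without an
  unsatisfied instance are isolated, and \<open>chosen\<close> ignores whatever is decided for
  them.\<close>

definition cgraph :: "nat \<Rightarrow> (nat \<times> nat \<Rightarrow> real) \<Rightarrow> nat \<Rightarrow> nat \<Rightarrow> bool" where
  "cgraph e lh x y \<longleftrightarrow> (\<exists>d\<in>U e lh. \<exists>d'\<in>U e lh. d \<noteq> d' \<and> nm d = x \<and> nm d' = y \<and> iconflict I d d')"

definition chosen :: "dist_alg \<Rightarrow> nat \<Rightarrow> (nat \<times> nat \<Rightarrow> real) \<Rightarrow> (nat \<Rightarrow> val) \<Rightarrow> (nat \<times> nat) set" where
  "chosen M e lh \<sigma> = {d \<in> U e lh. halted M (\<sigma> (nm d)) \<and> output_of M (\<sigma> (nm d)) \<noteq> VNil}"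

lemma p_min: "P < m \<Longrightarrow> p_min I \<le> profit I P" "P < m \<Longrightarrow> profit I P \<le> p_max I"
  by (simp_all add: p_min_def p_max_def)

lemma p_min_pos: "0 < p_min I"
proof -
  have "p_min I \<in> profit I ` {..<m}" unfolding p_min_def using m_pos by (intro Min_in) auto
  then show ?thesis using proc(3) by auto
qed

lemma p_min_le_max: "p_min I \<le> p_max I"
  using p_min m_pos order_trans by blast

lemma L_spec: "p_max I < p_min I * 2 ^ L"
proof -
  obtain k where "p_max I / p_min I < 2 ^ k" using real_arch_pow[of 2] by auto
  then have "p_max I < p_min I * 2 ^ k" using p_min_pos by (simp add: field_simps)
  then show ?thesis unfolding num_steps_def by (rule LeastI)
qed

lemma L_least: "i < L \<Longrightarrow> p_min I * 2 ^ i \<le> p_max I"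
  unfolding num_steps_def using not_less_Least by force

lemma L_pos: "0 < L"
  using L_spec p_min_le_max by (cases L) auto

lemma E_spec: "n\<^sup>2 < 2 ^ E"
  unfolding num_epochs_def by (rule LeastI[of _ "n\<^sup>2"]) (rule less_exp)

lemma E_least: "i < E \<Longrightarrow> 2 ^ i \<le> n\<^sup>2"
  unfolding num_epochs_def using not_less_Least by force

lemma E_pos: "0 < E"
  using E_spec n_pos by (cases E) auto

lemma K_pos: "0 < K"
  unfolding K_def using E_pos b_pos L_pos by simp

lemma U_D: "U e lh \<subseteq> D" by (auto simp: U_def unsatisfied_def)

lemma chosen_U: "chosen M e lh \<sigma> \<subseteq> U e lh" by (auto simp: chosen_def)

lemma cgraph_iff: "d \<in> D \<Longrightarrow> d' \<in> D \<Longrightarrow>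
    cgraph e lh (nm d) (nm d') \<longleftrightarrow> d \<noteq> d' \<and> d \<in> U e lh \<and> d' \<in> U e lh \<and> iconflict I d d'"
proof -
  assume "d \<in> D" "d' \<in> D"
  then have "nm x = nm d \<longleftrightarrow> x = d" "nm x = nm d' \<longleftrightarrow> x = d'" if "x \<in> U e lh" for x
    using nm_inj that U_D by blast+
  then show ?thesis unfolding cgraph_def by blast
qed

lemma iconflict_sym: "iconflict I d d' \<longleftrightarrow> iconflict I d' d"
  by (auto simp: iconflict_def)

lemma cgraph_simple: "simple_graph (m * r) (cgraph e lh)"
proof -
  have "\<not> cgraph e lh x x" for x
    unfolding cgraph_def using nm_inj U_D by blast
  moreover have "cgraph e lh x y \<Longrightarrow> cgraph e lh y x" for x y
    unfolding cgraph_def using iconflict_sym by metis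
  ultimately show ?thesis by (simp add: simple_graph_def)
qed

section \<open>Correctness of the processor programs\<close>

lemma eval_UNSAT:
  assumes "eval R env = registers I b tm ph t s e" "eval a env = irecord I (lh d) ms rd sl d" "d \<in> D"
  shows "eval (UNSAT R a) env = vbool (d \<in> U e lh)"
  using assms by (simp add: UNSAT_def U_def unsatisfied_def vless_def varith_def)

lemma eval_CONFLICT:
  assumes "eval a1 env = irecord I l1 m1 e1 s1 d1" "eval a2 env = irecord I l2 m2 e2 s2 d2"
  shows "eval (CONFLICT a1 a2) env = vbool (iconflict I d1 d2)"
  using assms by (auto simp: CONFLICT_def iconflict_def)

lemma eval_ADJACENT:
  assumes "eval R env = registers I b tm ph t s e" "eval a1 env = irecord I (lh d1) m1 e1 s1 d1"
    "eval a2 env = irecord I (lh d2) m2 e2 s2 d2" "d1 \<in> D" "d2 \<in> D"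
  shows "eval (ADJACENT R a1 a2) env = vbool (cgraph e lh (nm d1) (nm d2))"
proof -
  have "eval (UNSAT R a1) env = vbool (d1 \<in> U e lh)" "eval (UNSAT R a2) env = vbool (d2 \<in> U e lh)"
    by (rule eval_UNSAT[where lh = lh]; use assms in simp)+
  then show ?thesis
    unfolding ADJACENT_def eval_AND eval_NOT eval.simps(9) eval_FIELD_of assms(2,3) field_of_irecord
      eval_CONFLICT[OF assms(2,3)] cgraph_iff[OF assms(4,5)]
    using nm_inj[OF assms(4,5)] by auto
qed

lemma cgraph_D: "cgraph e lh x y \<Longrightarrow> \<exists>d\<in>D. x = nm d" "cgraph e lh x y \<Longrightarrow> \<exists>d\<in>D. y = nm d"
  unfolding cgraph_def using U_D by blast+

lemma eval_NEXT_STEP: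
  assumes "eval R env = registers I b tm ph t s e" "e < K"
  shows "eval (NEXT_STEP b R) env = registers I b tm (if Suc e = K then 1 else 0) 0 (Suc s) (Suc e)"
proof -
  have w: "p_max I < 2 * (p_min I * 2 ^ (e mod L)) \<longleftrightarrow> Suc (e mod L) = L"
  proof
    assume *: "p_max I < 2 * (p_min I * 2 ^ (e mod L))"
    show "Suc (e mod L) = L"
    proof (rule ccontr)
      assume "Suc (e mod L) \<noteq> L"
      then have "Suc (e mod L) < L" using L_pos mod_less_divisor[of L e] by linarith
      from L_least[OF this] * show False by simp
    qed
  next
    assume "Suc (e mod L) = L"
    with L_spec show "p_max I < 2 * (p_min I * 2 ^ (e mod L))" by (metis mult.left_commute power_Suc)
  qed
  let ?q = "e div L"
  have j: "\<not> real (Suc (?q mod b)) < real b \<longleftrightarrow> Suc (?q mod b) = b"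
    using mod_less_divisor[OF b_pos, of ?q] by linarith
  have nxt: "Suc e mod L = (if Suc (e mod L) = L then 0 else Suc (e mod L))"
    "Suc e div L = (if Suc (e mod L) = L then Suc ?q else ?q)"
    "Suc ?q mod b = (if Suc (?q mod b) = b then 0 else Suc (?q mod b))"
    "Suc ?q div b = (if Suc (?q mod b) = b then Suc (?q div b) else ?q div b)"
    by (auto simp: mod_Suc div_Suc)
  \<comment> \<open>By minimality of \<open>E\<close>, the next layer exceeds n^2 exactly when all
    epochs are over. Since \<open>e < K\<close>, this means that the last step has been
    made.\<close>
  have fin: "real (n\<^sup>2) < real (epoch b L (Suc e)) \<longleftrightarrow> Suc e = K"
  proof -
    have "n\<^sup>2 < 2 ^ (Suc e div L div b) \<longleftrightarrow> E \<le> Suc e div L div b"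
      using E_least[of "Suc e div L div b"] E_spec power_increasing[of E "Suc e div L div b" "2 :: nat"]
      by (meson not_le one_le_numeral order_less_le_trans)
    also have "\<dots> \<longleftrightarrow> K \<le> Suc e"
      using L_pos b_pos by (simp add: less_eq_div_iff_mult_less_eq K_def)
    finally show ?thesis using assms(2) unfolding epoch_def of_nat_less_iff by auto
  qed
  have kp: "epoch b L (Suc e) = (if Suc (e mod L) = L \<and> Suc (?q mod b) = b then 2 * epoch b L e else epoch b L e)"
    by (auto simp: epoch_def nxt)
  have y: "threshold b L (Suc e) = (if Suc (e mod L) = L \<and> Suc (?q mod b) = b then 14 / 15
      else if Suc (e mod L) = L then 14 / 15 * threshold b L e else threshold b L e)"
    by (auto simp: threshold_def nxt)
  have jj: "Suc (Suc e div L mod b) = (if Suc (e mod L) = L \<and> Suc (?q mod b) = b then 1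
      else if Suc (e mod L) = L then Suc (?q mod b) + 1 else Suc (?q mod b))"
    by (auto simp: nxt)
  have ww: "p_min I * 2 ^ (Suc e mod L) = (if Suc (e mod L) = L then p_min I else 2 * (p_min I * 2 ^ (e mod L)))"
    by (auto simp: nxt)
  have rat: "of_rat (14 / 15) = (14 / 15 :: real)" by (simp add: of_rat_divide)
  let ?W = "Less (FIELD 9 R) (Arith Times (Numeral 2) (FIELD 6 R))"
  let ?W2 = "AND ?W (NOT (Less (FIELD 4 R) (Numeral (of_nat b))))"
  let ?KP = "Cond ?W2 (Arith Times (Numeral 2) (FIELD 3 R)) (FIELD 3 R)"
  have W: "eval ?W env = vbool (Suc (e mod L) = L)"
    by (simp add: assms(1) vless_def varith_def w)
  have W2: "eval ?W2 env = vbool (Suc (e mod L) = L \<and> Suc (?q mod b) = b)"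
    by (simp only: eval_AND W vbool_eq_VNil) (use j in \<open>simp add: assms(1) vless_def\<close>)
  have KP: "eval ?KP env = vnat (epoch b L (Suc e))"
    by (simp only: eval.simps W2 vbool_eq_VNil kp) (simp add: assms(1) varith_def)
  have PH: "eval (Cond (Less (FIELD 10 R) ?KP) (Numeral 1) (Numeral 0)) env = vnat (if Suc e = K then 1 else 0)"
  proof -
    have "eval (Less (FIELD 10 R) ?KP) env = vbool (Suc e = K)"
      unfolding eval.simps(8) KP eval_FIELD_of assms(1) field_of_registers vless_def prod.case val.case fin ..
    then show ?thesis by (simp only: eval.simps(2,10) vbool_eq_VNil) simp
  qed
  have JJ: "eval (Cond ?W2 (Numeral 1) (Cond ?W (Arith Plus (FIELD 4 R) (Numeral 1)) (FIELD 4 R))) env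
      = vnat (Suc (Suc e div L mod b))"
    unfolding eval.simps(10) W W2 vbool_eq_VNil jj by (simp add: assms(1) varith_def)
  have Y: "eval (Cond ?W2 (Numeral (14 / 15)) (Cond ?W (Arith Times (Numeral (14 / 15)) (FIELD 5 R)) (FIELD 5 R))) env
      = VNum (threshold b L (Suc e))"
    unfolding eval.simps(10) W W2 vbool_eq_VNil y by (simp add: rat assms(1) varith_def)
  have WW: "eval (Cond ?W (FIELD 8 R) (Arith Times (Numeral 2) (FIELD 6 R))) env = VNum (p_min I * 2 ^ (Suc e mod L))"
    unfolding eval.simps(10) W vbool_eq_VNil ww by (simp add: assms(1) varith_def)
  show ?thesis
    unfolding NEXT_STEP_def Let_def eval_LIST list.map PH KP JJ Y WW registers_def
    by (simp add: assms(1) varith_def) 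
qed

lemma eval_NEXT_ROUND:
  assumes "eval R env = registers I b tm ph t s e"
  shows "eval (NEXT_ROUND R) env = registers I b tm ph (Suc t) s e"
  by (simp add: NEXT_ROUND_def assms) (simp add: registers_def varith_def)

lemma eval_NEXT_SELECT:
  assumes "eval R env = registers I b tm ph t (Suc s) e"
  shows "eval (NEXT_SELECT R) env = registers I b tm (if s = 0 then 2 else 1) t s e"
  by (simp add: NEXT_SELECT_def assms varith_def) (simp add: registers_def)

text \<open>Instances of one demand are held by one processor, and two instances on the same
  tree-network have owners with a common accessible network, which can communicate.\<close>

lemma neighbour_visible:
  assumes "d \<in> D" "fst d = P" "d' \<in> D" "fst d = fst d' \<or> snd d = snd d'"
  shows "d' \<in> set (visible I P)"
  using assms unfolding set_visible communicate_def D_iff by auto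

definition vstates :: "(nat \<times> nat \<Rightarrow> real) \<Rightarrow> (nat \<times> nat \<Rightarrow> val) \<Rightarrow> (nat \<times> nat \<Rightarrow> val)
      \<Rightarrow> (nat \<times> nat \<Rightarrow> val) \<Rightarrow> (nat \<times> nat) list \<Rightarrow> val" where
  "vstates lh ms rd sl ds = vlist (map (\<lambda>d. irecord I (lh d) (ms d) (rd d) (sl d) d) ds)"

lemma RECS_vstates: "eval S env = pstate I rg lh ms rd sl P \<Longrightarrow> eval (RECS S) env = vstates lh ms rd sl (own I P)"
  by (simp add: vstates_def)

definition messages :: "val \<Rightarrow> (nat \<times> nat \<Rightarrow> real) \<Rightarrow> (nat \<times> nat \<Rightarrow> val) \<Rightarrow> (nat \<times> nat \<Rightarrow> val)
      \<Rightarrow> (nat \<times> nat \<Rightarrow> val) \<Rightarrow> nat \<Rightarrow> val" where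
  "messages rg lh ms rd sl P =
     vlist (map (\<lambda>q. VCons (vnat q) (pstate I rg lh ms rd sl q)) (filter (\<lambda>q. communicate I q P) [0..<m]))"

lemma eval_VISIBLE:
  assumes "P < m"
  shows "eval VISIBLE (pstate I rg lh ms rd sl P # messages rg lh ms rd sl P # env) = vstates lh ms rd sl (visible I P)"
proof -
  let ?c = "\<lambda>q. communicate I q P" and ?st = "\<lambda>q. VCons (vnat q) (pstate I rg lh ms rd sl q)"
  have split: "[0..<m] = [0..<P] @ [P] @ [Suc P..<m]"
    using assms by (metis append_Cons append_Nil less_imp_add_positive less_imp_le_nat upt_add_eq_append
        upt_conv_Cons zero_le plus_nat.add_0)
  have lo: "filter (\<lambda>q. ?c q \<and> q < P) [0..<m] = filter (\<lambda>q. q = P \<or> ?c q) [0..<P]"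
    and hi: "filter (\<lambda>q. ?c q \<and> P < q) [0..<m] = filter (\<lambda>q. q = P \<or> ?c q) [Suc P..<m]"
    unfolding split filter_append
    by (auto simp: filter_empty_conv communicate_def intro!: filter_cong)
  have mid: "filter (\<lambda>q. q = P \<or> ?c q) [P] = [P]" by simp
  let ?env = "pstate I rg lh ms rd sl P # messages rg lh ms rd sl P # env"
  have "eval (APP (FILTER (Var 1) (Less (Head (Var 0)) (PROC (Var 1))))
       (Pair (Pair (PROC (Var 0)) (Var 0)) (FILTER (Var 1) (Less (PROC (Var 1)) (Head (Var 0)))))) ?env
    = vlist (map ?st (filter (\<lambda>q. q = P \<or> ?c q) [0..<m]))"
  proof (subst eval_APP)
    show "eval (Pair (Pair (PROC (Var 0)) (Var 0)) (FILTER (Var 1) (Less (PROC (Var 1)) (Head (Var 0))))) ?env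
      = vlist (map ?st (P # filter (\<lambda>q. q = P \<or> ?c q) [Suc P..<m]))"
      by (simp add: messages_def filter_map comp_def vless_def hi)
    show "vlist (velems (eval (FILTER (Var 1) (Less (Head (Var 0)) (PROC (Var 1)))) ?env) @
        map ?st (P # filter (\<lambda>q. q = P \<or> ?c q) [Suc P..<m])) = vlist (map ?st (filter (\<lambda>q. q = P \<or> ?c q) [0..<m]))"
      unfolding split filter_append mid
      by (simp add: messages_def filter_map comp_def vless_def lo)
  qed
  then show ?thesis
    by (simp add: VISIBLE_def visible_def vstates_def map_concat comp_def RECS_def pstate_def)
qed

lemma setup_input:
  assumes "P < m" and d: "d \<in> set (own I P)"
  shows "eval SETUP_INPUT (irecord I (lh d) (ms d) (rd d) (sl d) d # vstates lh ms rd sl (visible I P) #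
      pstate I (registers I b tm ph t s e) lh ms rd sl P # env) = mis_input (m * r) (cgraph e lh) (nm d)"
proof -
  let ?env = "vstates lh ms rd sl (visible I P) # pstate I (registers I b tm ph t s e) lh ms rd sl P # env"
  let ?rec = "\<lambda>d. irecord I (lh d) (ms d) (rd d) (sl d) d"
  have dD: "d \<in> D" "fst d = P" using d set_own assms by auto
  have adj: "eval (ADJACENT (REGS (Var 3)) (Var 1) (Var 0)) (?rec d' # ?rec d # ?env)
     = vbool (cgraph e lh (nm d) (nm d'))" if "d' \<in> set (visible I P)" for d'
    by (rule eval_ADJACENT) (use that dD set_visible in auto)
  have A: "map nm (filter (\<lambda>d'. cgraph e lh (nm d) (nm d')) (visible I P)) = filter (cgraph e lh (nm d)) [0..<m * r]"
  proof (rule filter_visible)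
    fix q assume "cgraph e lh (nm d) q"
    then obtain d' where d': "d' \<in> D" "q = nm d'" using cgraph_D by blast
    with \<open>cgraph e lh (nm d) q\<close> have "iconflict I d d'" using cgraph_iff dD by blast
    with d' dD show "\<exists>d'\<in>set (visible I P). nm d' = q"
      using neighbour_visible[OF dD d'(1)] by (auto simp: iconflict_def)
  qed
  have B: "filter (\<lambda>x. eval (ADJACENT (REGS (Var 3)) (Var 1) (Var 0)) (x # ?rec d # ?env) \<noteq> VNil)
      (map ?rec (visible I P)) = map ?rec (filter (\<lambda>d'. cgraph e lh (nm d) (nm d')) (visible I P))"
    unfolding filter_map comp_def by (intro arg_cong[of _ _ "map _"] filter_cong) (simp_all add: adj[unfolded One_nat_def])
  have "velems (eval (Var 1) (?rec d # ?env)) = map ?rec (visible I P)" by (simp add: vstates_def)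
  then have "eval (MAP (FILTER (Var 1) (ADJACENT (REGS (Var 3)) (Var 1) (Var 0))) (FIELD 0 (Var 0))) (?rec d # ?env)
    = vnats (filter (cgraph e lh (nm d)) [0..<m * r])"
    unfolding eval_MAP eval_FILTER velems_vlist A[symmetric] by (simp only: B) simp
  then show ?thesis by (auto simp: mis_input_def)
qed

lemma eval_SETUP:
  assumes "P < m"
  shows "eval (SETUP M) (vstates lh ms rd sl (visible I P) # pstate I (registers I b tm ph t s e) lh ms rd sl P # env)
    = vstates lh (\<lambda>d. eval (start M) [mis_input (m * r) (cgraph e lh) (nm d)]) rd sl (own I P)"
proof -
  let ?env = "vstates lh ms rd sl (visible I P) # pstate I (registers I b tm ph t s e) lh ms rd sl P # env"
  let ?rec = "\<lambda>d. irecord I (lh d) (ms d) (rd d) (sl d) d"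
  have "eval (UPDATE (Var 0) [8 \<mapsto> call1 (start M) SETUP_INPUT]) (?rec d # ?env)
    = irecord I (lh d) (eval (start M) [mis_input (m * r) (cgraph e lh) (nm d)]) (rd d) (sl d) d"
    if d: "d \<in> set (own I P)" for d
    by (subst eval_UPDATE(1)[where lh = "lh d" and ms = "ms d" and rd = "rd d" and sl = "sl d" and d = d], simp)
      (simp only: eval_call setup_input[OF assms d])
  then show ?thesis by (simp add: SETUP_def vstates_def)
qed

lemma eval_DECIDED:
  "eval l env = vstates lh ms rd sl ds \<Longrightarrow> eval (DECIDED M l) env
     = vlist (map (\<lambda>d. VCons (eval (decide M) [ms d]) (irecord I (lh d) (ms d) (rd d) (sl d) d)) ds)"
  by (simp add: DECIDED_def vstates_def comp_def)

lemma eval_TAGS: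
  assumes "eval l env = vlist (map (\<lambda>d. VCons (eval (decide M) [\<sigma> (nm d)]) (irecord I (lh d) (\<sigma> (nm d)) (rd d) (sl d) d)) (own I P))"
  shows "eval (TAGS M l) env = vnats (tags I M \<sigma> P)"
  by (auto simp: TAGS_def assms tags_def map_concat comp_def vertex_coins_def halted_def map_replicate_const
      map_replicate intro!: arg_cong[of _ _ concat])

lemma eval_COINS:
  assumes "1 \<le> t" "t \<le> tm"
  shows "eval (COINS M) [pstate I (registers I b tm 0 t s e) lh (\<lambda>d. \<sigma> (nm d)) rd sl P] = vnats (tags I M \<sigma> P)"
proof -
  have "eval (TAGS M (DECIDED M (RECS (Var 0)))) [pstate I (registers I b tm 0 t s e) lh (\<lambda>d. \<sigma> (nm d)) rd sl P]
    = vnats (tags I M \<sigma> P)"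
    by (rule eval_TAGS[where lh = lh and rd = rd and sl = sl], rule eval_DECIDED[OF RECS_vstates]) simp
  then show ?thesis using assms by (simp add: COINS_def vless_def)
qed

lemma eval_COINS_Nil:
  assumes "ph \<noteq> 0 \<or> t = 0 \<or> tm < t"
  shows "velems (eval (COINS M) [pstate I (registers I b tm ph t s e) lh ms rd sl P]) = []"
  using assms by (auto simp: COINS_def vless_def)

lemma eval_CHUNK:
  assumes "eval z env = vlist (map2 VCons (map vnat ts) (map vbool bs))" "field_of 0 (eval a env) = vnat x"
  shows "eval (CHUNK z a) env = vcoins (chunk ts bs x)"
proof -
  have "map vtl (filter (\<lambda>a. vhd a = vnat x) (map2 VCons (map vnat ts) (map vbool cs)))
      = map vbool (map snd (filter (\<lambda>a. fst a = x) (zip ts cs)))" for cs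
  proof (induction ts arbitrary: cs)
    case (Cons t ts)
    then show ?case by (cases cs) auto
  qed simp
  then show ?thesis by (simp add: CHUNK_def chunk_def assms)
qed

lemma inbox_message:
  assumes P: "P < m" and d: "d \<in> set (own I P)"
    and R: "eval R env = registers I b tm ph t s e" and a: "eval a env = irecord I (lh d) ms' rd' sl' d"
    and d': "d' \<in> set (visible I P)"
  shows "eval (ADJACENT (up R) (Tail (Var 0)) (up a)) (VCons v (irecord I (lh d') ms'' rd'' sl'' d') # env)
    = vbool (cgraph e lh (nm d') (nm d))"
  by (rule eval_ADJACENT) (use assms d' set_visible set_own in auto)

lemma eval_INBOX:
  assumes P: "P < m" and d: "d \<in> set (own I P)"
    and R: "eval R env = registers I b tm ph t s e" and a: "eval a env = irecord I (lh d) ms' rd' sl' d"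
    and l: "velems (eval l env) = map (\<lambda>d. VCons (eval (decide M) [\<sigma> (nm d)])
      (irecord I (lh d) (\<sigma> (nm d)) (rd d) (sl d) d)) (visible I P)"
  shows "eval (INBOX M R l a) env = inbox (m * r) (cgraph e lh) M \<sigma> (nm d)"
proof -
  let ?dec = "\<lambda>d. VCons (eval (decide M) [\<sigma> (nm d)]) (irecord I (lh d) (\<sigma> (nm d)) (rd d) (sl d) d)"
  have dD: "d \<in> D" "fst d = P" using d set_own P by auto
  let ?f = "Cond (AND (NOT (IS_PAIR (Head (Var 0)))) (ADJACENT (up R) (Tail (Var 0)) (up a)))
   (Pair (Pair (FIELD 0 (Tail (Var 0))) (call2 (send M) (FIELD 8 (Tail (Var 0))) (FIELD 0 (up a)))) Empty)
   Empty"
  let ?g = "\<lambda>q. VCons (vnat q) (eval (send M) [\<sigma> q, vnat (nm d)])"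
  have f: "velems (eval ?f (?dec d' # env)) =
      (if cgraph e lh (nm d') (nm d) \<and> \<not> halted M (\<sigma> (nm d')) then [?g (nm d')] else [])"
    if "d' \<in> set (visible I P)" for d'
    by (simp add: inbox_message[where lh = lh, OF P d R a that] halted_def a cong: if_cong)
  have cm: "concat (map (\<lambda>d'. if Q d' then [h d'] else []) xs) = map h (filter Q xs)"
    for Q :: "'x \<Rightarrow> bool" and h :: "'x \<Rightarrow> 'y" and xs by (induction xs) auto
  have nb: "map nm (filter (\<lambda>d'. cgraph e lh (nm d') (nm d) \<and> \<not> halted M (\<sigma> (nm d'))) (visible I P))
    = filter (\<lambda>q. cgraph e lh q (nm d) \<and> \<not> halted M (\<sigma> q)) [0..<m * r]"
  proof (rule filter_visible[where Q = "\<lambda>q. cgraph e lh q (nm d) \<and> \<not> halted M (\<sigma> q)"])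
    fix q assume "cgraph e lh q (nm d) \<and> \<not> halted M (\<sigma> q)"
    then have c: "cgraph e lh q (nm d)" by simp
    then obtain d' where d': "d' \<in> D" "q = nm d'" using cgraph_D by blast
    with c have "iconflict I d' d" using cgraph_iff dD by blast
    with d' dD show "\<exists>d'\<in>set (visible I P). nm d' = q"
      using neighbour_visible[OF dD d'(1)] by (auto simp: iconflict_def)
  qed
  have "map (\<lambda>x. velems (eval ?f (x # env))) (map ?dec (visible I P))
    = map (\<lambda>d'. if cgraph e lh (nm d') (nm d) \<and> \<not> halted M (\<sigma> (nm d')) then [?g (nm d')] else []) (visible I P)"
    unfolding map_map comp_def by (rule map_cong[OF refl f])
  then have "eval (INBOX M R l a) env
     = vlist (map ?g (map nm (filter (\<lambda>d'. cgraph e lh (nm d') (nm d) \<and> \<not> halted M (\<sigma> (nm d'))) (visible I P))))"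
    unfolding INBOX_def eval_FLATMAP by (simp only: l cm map_map comp_def)
  then show ?thesis unfolding nb inbox_def .
qed

lemma eval_SIMULATE:
  assumes P: "P < m" and bs: "length bs = length (tags I M \<sigma> P)"
  shows "eval (SIMULATE M) [vstates lh (\<lambda>d. \<sigma> (nm d)) rd sl (visible I P),
      pstate I (registers I b tm ph t s e) lh (\<lambda>d. \<sigma> (nm d)) rd sl P, inb, vcoins bs]
    = vstates lh (\<lambda>d. if halted M (\<sigma> (nm d)) then \<sigma> (nm d) else eval (recv M)
        [\<sigma> (nm d), inbox (m * r) (cgraph e lh) M \<sigma> (nm d), vcoins (chunk (tags I M \<sigma> P) bs (nm d))]) rd sl (own I P)"
proof -
  let ?rec = "\<lambda>d. irecord I (lh d) (\<sigma> (nm d)) (rd d) (sl d) d"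
  let ?dec = "\<lambda>d. VCons (eval (decide M) [\<sigma> (nm d)]) (?rec d)"
  let ?V = "vstates lh (\<lambda>d. \<sigma> (nm d)) rd sl (visible I P)"
  let ?S = "pstate I (registers I b tm ph t s e) lh (\<lambda>d. \<sigma> (nm d)) rd sl P"
  let ?env = "[?V, ?S, inb, vcoins bs]"
  let ?DV = "vlist (map ?dec (visible I P))" and ?DO = "vlist (map ?dec (own I P))"
  let ?Z = "vlist (map2 VCons (map vnat (tags I M \<sigma> P)) (map vbool bs))"
  have 1: "eval (DECIDED M (Var 0)) ?env = ?DV" by (rule eval_DECIDED) simp
  have 2: "eval (DECIDED M (RECS (Var 2))) (?DV # ?env) = ?DO" by (rule eval_DECIDED[OF RECS_vstates]) simp
  have 3: "eval (ZIP (TAGS M (Var 0)) (Var 5)) (?DO # ?DV # ?env) = ?Z"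
  proof -
    have t: "eval (TAGS M (Var 0)) (?DO # ?DV # ?env) = vnats (tags I M \<sigma> P)"
      by (rule eval_TAGS[where lh = lh and rd = rd and sl = sl]) simp
    show ?thesis by (subst eval_ZIP) (simp_all add: t bs)
  qed
  let ?env2 = "?Z # ?DO # ?DV # ?env"
  have ch: "eval (CHUNK (Var 1) (Tail (Var 0))) (?dec d # ?env2) = vcoins (chunk (tags I M \<sigma> P) bs (nm d))" for d
    by (rule eval_CHUNK) simp_all
  have inb: "eval (INBOX M (REGS (Var 5)) (Var 3) (Tail (Var 0))) (?dec d # ?env2) = inbox (m * r) (cgraph e lh) M \<sigma> (nm d)"
    if d: "d \<in> set (own I P)" for d
    by (rule eval_INBOX[where lh = lh and rd = rd and sl = sl, OF P d]) simp_all
  have "eval (Cond (IS_PAIR (Head (Var 0))) (Tail (Var 0))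
         (UPDATE (Tail (Var 0)) [8 \<mapsto> call3 (recv M) (FIELD 8 (Tail (Var 0)))
            (INBOX M (REGS (Var 5)) (Var 3) (Tail (Var 0))) (CHUNK (Var 1) (Tail (Var 0)))])) (?dec d # ?env2)
    = irecord I (lh d) (if halted M (\<sigma> (nm d)) then \<sigma> (nm d) else eval (recv M)
        [\<sigma> (nm d), inbox (m * r) (cgraph e lh) M \<sigma> (nm d), vcoins (chunk (tags I M \<sigma> P) bs (nm d))]) (rd d) (sl d) d"
    if "d \<in> set (own I P)" for d
  proof (cases "halted M (\<sigma> (nm d))")
    case True
    then show ?thesis by (simp add: halted_def cong: if_cong)
  next
    case False
    have "eval (UPDATE (Tail (Var 0)) [8 \<mapsto> call3 (recv M) (FIELD 8 (Tail (Var 0)))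
            (INBOX M (REGS (Var 5)) (Var 3) (Tail (Var 0))) (CHUNK (Var 1) (Tail (Var 0)))]) (?dec d # ?env2)
       = irecord I (lh d) (eval (recv M)
        [\<sigma> (nm d), inbox (m * r) (cgraph e lh) M \<sigma> (nm d), vcoins (chunk (tags I M \<sigma> P) bs (nm d))]) (rd d) (sl d) d"
      by (subst eval_UPDATE) (auto simp: ch[unfolded One_nat_def] inb[OF that])
    with False show ?thesis by (simp add: halted_def cong: if_cong)
  qed
  note body = this
  have "velems (eval (Var 1) ?env2) = map ?dec (own I P)" by simp
  then show ?thesis
    unfolding SIMULATE_def eval.simps(11) 1 2 3 unfolding eval_MAP
    by (simp only: map_map comp_def vstates_def[where ds = "own I P"])
      (intro arg_cong[of _ _ vlist] map_cong[OF refl] body)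
qed

lemma iweight_self: "iweight I d d = 1 + real (length (icritical I d))"
proof -
  have "set (icritical I d) \<subseteq> set (iroute I d)" by (auto simp: icritical_def critical_def Let_def)
  then have "filter (\<lambda>e. e \<in> set (iroute I d)) (icritical I d) = icritical I d"
    by (auto simp: filter_id_conv)
  then show ?thesis by (simp add: iweight_def)
qed

lemma eval_CHOSEN:
  assumes "eval R env = registers I b tm ph t s e" "d \<in> D"
    and "eval a env = VCons (eval (decide M) [\<sigma> (nm d)]) (irecord I (lh d) ms rd sl d)"
  shows "eval (CHOSEN R a) env \<noteq> VNil \<longleftrightarrow> d \<in> chosen M e lh \<sigma>"
proof -
  have "eval (UNSAT R (Tail a)) env = vbool (d \<in> U e lh)"
    by (rule eval_UNSAT) (simp_all add: assms)
  then show ?thesis by (auto simp: CHOSEN_def assms(3) chosen_def halted_def output_of_def)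
qed

lemma eval_RAISE:
  assumes P: "P < m"
  shows "eval (RAISE M) [vstates lh (\<lambda>d. \<sigma> (nm d)) rd sl (visible I P),
      pstate I (registers I b tm ph t s e) lh (\<lambda>d. \<sigma> (nm d)) rd sl P, inb, cs]
    = vstates (raise (iprofit I) (iweight I) (chosen M e lh \<sigma>) lh) (\<lambda>_. VNil)
        (\<lambda>d. if d \<in> chosen M e lh \<sigma> then vnat s else rd d) sl (own I P)"
proof -
  let ?rec = "\<lambda>d. irecord I (lh d) (\<sigma> (nm d)) (rd d) (sl d) d"
  let ?dec = "\<lambda>d. VCons (eval (decide M) [\<sigma> (nm d)]) (?rec d)"
  let ?V = "vstates lh (\<lambda>d. \<sigma> (nm d)) rd sl (visible I P)"
  let ?S = "pstate I (registers I b tm ph t s e) lh (\<lambda>d. \<sigma> (nm d)) rd sl P"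
  let ?env = "[?V, ?S, inb, cs]"
  let ?DV = "vlist (map ?dec (visible I P))"
  let ?C = "chosen M e lh \<sigma>"
  have 1: "eval (DECIDED M (Var 0)) ?env = ?DV" by (rule eval_DECIDED) simp
  have 2: "eval (DECIDED M (RECS (Var 2))) (?DV # ?env) = vlist (map ?dec (own I P))"
    by (rule eval_DECIDED[OF RECS_vstates]) simp
  let ?t = "Cond (CHOSEN (REGS (Var 4)) (Var 0))
        (Arith Times (Arith Divide (Arith Minus (FIELD 3 (Tail (Var 0))) (FIELD 7 (Tail (Var 0))))
              (Arith Plus (Numeral 1) (COUNT (FIELD 6 (Tail (Var 0))) (Numeral 1))))
           (WEIGHT (Tail (Var 0)) (Tail (Var 1)))) (Numeral 0)"
  let ?w = "\<lambda>d d'. if d' \<in> ?C then (iprofit I d' - lh d') / iweight I d' d' * iweight I d' d else 0"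
  have sum: "eval (SUMP (Var 1) ?t) (?dec d # ?DV # ?env) = VNum (\<Sum>d'\<in>?C. (iprofit I d' - lh d') / iweight I d' d' * iweight I d' d)"
    if d: "d \<in> set (own I P)" for d
  proof -
    have dD: "d \<in> D" "fst d = P" using d set_own P by auto
    have t: "eval ?t (?dec d' # ?dec d # ?DV # ?env) = VNum (?w d d')" if d': "d' \<in> set (visible I P)" for d'
    proof -
      have c: "eval (CHOSEN (REGS (Var 4)) (Var 0)) (?dec d' # ?dec d # ?DV # ?env) \<noteq> VNil \<longleftrightarrow> d' \<in> ?C"
        by (rule eval_CHOSEN) (use d' set_visible in auto)
      have w: "eval (WEIGHT (Tail (Var 0)) (Tail (Var 1))) (?dec d' # ?dec d # ?DV # ?env) = VNum (iweight I d' d)"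
        by (simp add: WEIGHT_def iweight_def varith_def filter_map comp_def)
      show ?thesis
      proof (cases "d' \<in> ?C")
        case True
        then show ?thesis by (simp add: c w[unfolded One_nat_def] varith_def iweight_self)
      next
        case False
        then show ?thesis by (simp add: c)
      qed
    qed
    \<comment> \<open>\<open>eval_SUMP\<close> asks for summands that depend on list elements, that
      is on values. The instance behind a record is recovered by a definite description, which is
      justified because a record contains processor and tree-network.\<close>
    have "eval (SUMP (Var 1) ?t) (?dec d # ?DV # ?env) = VNum (\<Sum>x\<leftarrow>map ?dec (visible I P). case x of VCons _ v \<Rightarrow>
         ?w d (THE d'. d' \<in> set (visible I P) \<and> ?rec d' = v))"
    proof (subst eval_SUMP[where g = "\<lambda>x. case x of VCons _ v \<Rightarrow> ?w d (THE d'. d' \<in> set (visible I P) \<and> ?rec d' = v)"])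
      fix x assume "x \<in> set (velems (eval (Var 1) (?dec d # ?DV # ?env)))"
      then obtain d' where d': "d' \<in> set (visible I P)" "x = ?dec d'" by auto
      have "(THE d''. d'' \<in> set (visible I P) \<and> ?rec d'' = ?rec d') = d'"
        by (rule the_equality) (use d' in \<open>auto simp: irecord_def prod_eq_iff\<close>)
      with t[OF d'(1)] d' show "eval ?t (x # ?dec d # ?DV # ?env) =
          VNum (case x of VCons _ v \<Rightarrow> ?w d (THE d'. d' \<in> set (visible I P) \<and> ?rec d' = v))" by simp
    qed simp
    also have "map (\<lambda>x. case x of VCons _ v \<Rightarrow> ?w d (THE d'. d' \<in> set (visible I P) \<and> ?rec d' = v)) (map ?dec (visible I P))
       = map (?w d) (visible I P)"
    proof -
      have "(THE d''. d'' \<in> set (visible I P) \<and> ?rec d'' = ?rec d') = d'" if "d' \<in> set (visible I P)" for d'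
        by (rule the_equality) (use that in \<open>auto simp: irecord_def prod_eq_iff\<close>)
      then show ?thesis by simp
    qed
    also have "(\<Sum>d'\<leftarrow>visible I P. ?w d d') = (\<Sum>d'\<in>set (visible I P). ?w d d')"
      using distinct_visible by (simp add: sum_list_distinct_conv_sum_set)
    \<comment> \<open>Invisible instances share neither demand nor tree-network with
      \<open>d\<close> and have weight 0.\<close>
    also have "\<dots> = (\<Sum>d'\<in>D. ?w d d')"
    proof (rule sum.mono_neutral_left)
      show "\<forall>d'\<in>D - set (visible I P). ?w d d' = 0"
        using neighbour_visible[OF dD] by (auto simp: iweight_def)
    qed (use finite_D set_visible in auto)
    also have "\<dots> = (\<Sum>d'\<in>?C. (iprofit I d' - lh d') / iweight I d' d' * iweight I d' d)"
    proof -
      have "?C \<subseteq> D" using chosen_U U_D by blast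
      then show ?thesis using finite_D by (simp add: sum.If_cases Int_absorb1)
    qed
    finally show ?thesis .
  qed
  have "eval (UPDATE (Tail (Var 0)) [
     7 \<mapsto> Arith Plus (FIELD 7 (Tail (Var 0))) (SUMP (Var 1) ?t), 8 \<mapsto> Empty,
     9 \<mapsto> Cond (CHOSEN (REGS (Var 3)) (Var 0)) (FIELD 2 (REGS (Var 3))) (FIELD 9 (Tail (Var 0)))]) (?dec d # ?DV # ?env)
    = irecord I (raise (iprofit I) (iweight I) ?C lh d) VNil (if d \<in> ?C then vnat s else rd d) (sl d) d"
    if d: "d \<in> set (own I P)" for d
  proof -
    have c: "eval (CHOSEN (REGS (Var 3)) (Var 0)) (?dec d # ?DV # ?env) \<noteq> VNil \<longleftrightarrow> d \<in> ?C"
      by (rule eval_CHOSEN) (use d set_own P in auto)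
    have a: "eval (Arith Plus (FIELD 7 (Tail (Var 0))) (SUMP (Var 1) ?t)) (?dec d # ?DV # ?env)
       = VNum (raise (iprofit I) (iweight I) ?C lh d)"
      by (simp only: eval.simps(7) sum[OF d]) (simp add: varith_def raise_def)
    show ?thesis
      by (subst eval_UPDATE(3)[OF _ a]) (simp_all add: c cong: if_cong)
  qed
  note body = this
  show ?thesis unfolding RAISE_def eval.simps(11) 1
    unfolding eval_MAP 2 velems_vlist map_map comp_def vstates_def[where ds = "own I P"]
    by (intro arg_cong[of _ _ vlist] map_cong[OF refl] body)
qed

lemma eval_SELECT:
  assumes P: "P < m" and S: "S \<subseteq> D"
  shows "eval SELECT [vstates lh ms rd (\<lambda>d. vbool (d \<in> S)) (visible I P),
      pstate I (registers I b tm ph t (Suc s) e) lh ms rd (\<lambda>d. vbool (d \<in> S)) P, inb, cs]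
    = vstates lh ms rd (\<lambda>d. vbool (d \<in> S \<union> {d \<in> D. rd d = vnat s \<and> (\<forall>d'\<in>S. \<not> iconflict I d d')})) (own I P)"
proof -
  let ?rec = "\<lambda>d. irecord I (lh d) (ms d) (rd d) (vbool (d \<in> S)) d"
  let ?V = "vstates lh ms rd (\<lambda>d. vbool (d \<in> S)) (visible I P)"
  let ?st = "pstate I (registers I b tm ph t (Suc s) e) lh ms rd (\<lambda>d. vbool (d \<in> S)) P"
  let ?env = "[?V, ?st, inb, cs]"
  have "eval (UPDATE (Var 0) [10 \<mapsto>
     Cond (AND (Equal (FIELD 9 (Var 0)) (Arith Minus (FIELD 2 (REGS (Var 2))) (Numeral 1)))
         (NOT (EXISTS (Var 1) (AND (FIELD 10 (Var 0)) (CONFLICT (Var 1) (Var 0))))))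
       (Numeral 1) (FIELD 10 (Var 0))]) (?rec d # ?env)
    = irecord I (lh d) (ms d) (rd d) (vbool (d \<in> S \<union> {d \<in> D. rd d = vnat s \<and> (\<forall>d'\<in>S. \<not> iconflict I d d')})) d"
    if d: "d \<in> set (own I P)" for d
  proof -
    have dD: "d \<in> D" "fst d = P" using d set_own P by auto
    have cf: "eval (CONFLICT (Var 1) (Var 0)) (?rec d' # ?rec d # ?env) = vbool (iconflict I d d')" for d'
      by (rule eval_CONFLICT) simp_all
    have ex0: "(\<exists>d'\<in>set (visible I P). d' \<in> S \<and> iconflict I d d') \<longleftrightarrow> (\<exists>d'\<in>S. iconflict I d d')"
    proof
      assume "\<exists>d'\<in>S. iconflict I d d'"
      then obtain d' where d': "d' \<in> S" "iconflict I d d'" by blast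
      then have "d' \<in> set (visible I P)"
        using neighbour_visible[OF dD, of d'] S by (auto simp: iconflict_def)
      with d' show "\<exists>d'\<in>set (visible I P). d' \<in> S \<and> iconflict I d d'" by blast
    qed blast
    have ex: "eval (EXISTS (Var 1) (AND (FIELD 10 (Var 0)) (CONFLICT (Var 1) (Var 0)))) (?rec d # ?env)
       = vbool (\<exists>d'\<in>S. iconflict I d d')"
    proof -
      have "velems (eval (Var 1) (?rec d # ?env)) = map ?rec (visible I P)" by (simp add: vstates_def)
      moreover have "eval (AND (FIELD 10 (Var 0)) (CONFLICT (Var 1) (Var 0))) (?rec d' # ?rec d # ?env) \<noteq> VNil
          \<longleftrightarrow> d' \<in> S \<and> iconflict I d d'" for d'
        by (simp only: eval_AND cf) simp
      ultimately show ?thesis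
        unfolding eval_EXISTS by (simp only: set_map Set.bex_simps(7)) (simp only: ex0[symmetric])
    qed
    have c: "eval (Cond (AND (Equal (FIELD 9 (Var 0)) (Arith Minus (FIELD 2 (REGS (Var 2))) (Numeral 1)))
         (NOT (EXISTS (Var 1) (AND (FIELD 10 (Var 0)) (CONFLICT (Var 1) (Var 0))))))
       (Numeral 1) (FIELD 10 (Var 0))) (?rec d # ?env)
       = vbool (d \<in> S \<union> {d \<in> D. rd d = vnat s \<and> (\<forall>d'\<in>S. \<not> iconflict I d d')})"
      unfolding eval.simps(10) eval_AND eval_NOT ex using dD by (simp add: varith_def)
    show ?thesis
      by (subst eval_UPDATE(2)[where lh = "lh d" and ms = "ms d" and rd = "rd d" and sl = "vbool (d \<in> S)" and d = d])
        (simp, simp only: c)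
  qed
  then show ?thesis by (simp add: SELECT_def vstates_def)
qed

end

section \<open>Simulation\<close>

lemma chunk_append:
  assumes "length ts = length bs" shows "chunk (ts @ ts') (bs @ bs') x = chunk ts bs x @ chunk ts' bs' x"
  using assms by (simp add: chunk_def)

lemma chunk_replicate: "length bs = k \<Longrightarrow> chunk (replicate k y) bs x = (if x = y then bs else [])"
proof (induction bs arbitrary: k)
  case (Cons c bs)
  then show ?case by (cases k) (auto simp: chunk_def)
qed (simp add: chunk_def)

lemma chunk_notin: "x \<notin> set ts \<Longrightarrow> chunk ts bs x = []"
  unfolding chunk_def by (auto simp: filter_empty_conv dest: set_zip_leftD)

lemma chunk_concat:
  assumes "distinct xs" "\<And>x. x \<in> set xs \<Longrightarrow> length (f x) = l x" "x \<in> set xs"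
  shows "chunk (concat (map (\<lambda>x. replicate (l x) x) xs)) (concat (map f xs)) x = f x"
  using assms
proof (induction xs)
  case (Cons y ys)
  have "chunk (concat (map (\<lambda>x. replicate (l x) x) (y # ys))) (concat (map f (y # ys))) x
    = chunk (replicate (l y) y) (f y) x @ chunk (concat (map (\<lambda>x. replicate (l x) x) ys)) (concat (map f ys)) x"
    using Cons.prems(2)[of y] by (simp add: chunk_append)
  also have "\<dots> = f x"
  proof (cases "x = y")
    case True
    then have "x \<notin> set (concat (map (\<lambda>x. replicate (l x) x) ys))" using Cons.prems(1) by auto
    then show ?thesis using chunk_replicate[of "f y" "l y" y x] Cons.prems(2)[of y] True by (simp add: chunk_notin)
  next
    case False
    then show ?thesis using chunk_replicate[of "f y" "l y" y x] Cons by simp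
  qed
  finally show ?case .
qed simp

lemma concat_chunk:
  assumes "distinct xs" "length bs = length (concat (map (\<lambda>x. replicate (l x) x) xs))"
  shows "concat (map (chunk (concat (map (\<lambda>x. replicate (l x) x) xs)) bs) xs) = bs"
  using assms
proof (induction xs arbitrary: bs)
  case (Cons y ys)
  let ?t = "concat (map (\<lambda>x. replicate (l x) x) ys)"
  define c d where "c = take (l y) bs" and "d = drop (l y) bs"
  have bs: "bs = c @ d" "length c = l y" "length d = length ?t"
    using Cons.prems(2) by (auto simp: c_def d_def)
  have ch: "chunk (replicate (l y) y @ ?t) bs x = (if x = y then c else []) @ chunk ?t d x" for x
    unfolding bs(1) using bs(2) by (simp add: chunk_append chunk_replicate)
  have "y \<notin> set ?t" using Cons.prems(1) by auto
  then have A: "chunk ?t d y = []" by (rule chunk_notin)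
  have B: "map (chunk (replicate (l y) y @ ?t) bs) ys = map (chunk ?t d) ys"
    unfolding ch using Cons.prems(1) by (intro map_cong) auto
  have C: "concat (map (chunk ?t d) ys) = d" using Cons.IH[of d] Cons.prems(1) bs(3) by simp
  show ?case unfolding list.map concat.simps B C ch[of y] A by (simp add: bs(1))
qed simp

lemma length_chunk:
  assumes "distinct xs" "x \<in> set xs" "length bs = length (concat (map (\<lambda>x. replicate (l x) x) xs))"
  shows "length (chunk (concat (map (\<lambda>x. replicate (l x) x) xs)) bs x) = l x"
  using assms
proof (induction xs arbitrary: bs)
  case (Cons y ys)
  let ?t = "concat (map (\<lambda>x. replicate (l x) x) ys)"
  define c d where "c = take (l y) bs" and "d = drop (l y) bs"
  have bs: "bs = c @ d" "length c = l y" "length d = length ?t"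
    using Cons.prems(3) by (auto simp: c_def d_def)
  have ch: "chunk (replicate (l y) y @ ?t) bs x = (if x = y then c else []) @ chunk ?t d x"
    unfolding bs(1) using bs(2) by (simp add: chunk_append chunk_replicate)
  show ?case
  proof (cases "x = y")
    case True
    then have "x \<notin> set ?t" using Cons.prems(1) by auto
    with True ch bs show ?thesis by (simp add: chunk_notin)
  next
    case False
    with ch Cons bs show ?thesis by simp
  qed
qed simp

lemma finite_bool_lists: "finite {bs :: bool list. length bs = k}" "{bs :: bool list. length bs = k} \<noteq> {}"
proof -
  show "finite {bs :: bool list. length bs = k}" using finite_lists_length_eq[of "UNIV :: bool set" k] by simp
  have "replicate k True \<in> {bs. length bs = k}" by simp
  then show "{bs :: bool list. length bs = k} \<noteq> {}" by blast
qed

context setting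
begin

text \<open>Turns coin lists of processors into coin lists of vertices; \<open>merge_coins\<close>
  is its inverse on outcomes of the right lengths.\<close>

definition split_coins :: "dist_alg \<Rightarrow> (nat \<Rightarrow> val) \<Rightarrow> (nat \<Rightarrow> bool list) \<Rightarrow> nat \<Rightarrow> bool list" where
  "split_coins M \<sigma> \<omega> x = (if x \<in> nm ` D \<and> \<not> halted M (\<sigma> x) then chunk (tags I M \<sigma> (x div r)) (\<omega> (x div r)) x else [])"

definition merge_coins :: "(nat \<Rightarrow> bool list) \<Rightarrow> nat \<Rightarrow> bool list" where
  "merge_coins \<omega> P = (if P < m then concat (map \<omega> (map nm (own I P))) else [])"

lemma tags_eq: "tags I M \<sigma> P = concat (map (\<lambda>x. replicate (vertex_coins M \<sigma> x) x) (map nm (own I P)))"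
  by (simp add: tags_def comp_def)

lemma distinct_own: "P < m \<Longrightarrow> distinct (map nm (own I P))"
  using sorted_concat_own[of "[P]"] by (simp add: strict_sorted_iff)

text \<open>Both sides are uniform on finite sets of outcomes, and cutting up the coin lists is a
  bijection between these sets.\<close>

lemma toss_split:
  "map_pmf (split_coins M \<sigma>) (Pi_pmf {..<m} [] (\<lambda>P. pmf_of_set {bs. length bs = length (tags I M \<sigma> P)}))
   = Pi_pmf {x \<in> nm ` D. \<not> halted M (\<sigma> x)} [] (\<lambda>x. pmf_of_set {bs. length bs = length (velems (eval (coins M) [\<sigma> x]))})"
proof -
  let ?A = "PiE_dflt {..<m} [] (\<lambda>P. {bs :: bool list. length bs = length (tags I M \<sigma> P)})"
  let ?X = "{x \<in> nm ` D. \<not> halted M (\<sigma> x)}"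
  let ?B = "PiE_dflt ?X [] (\<lambda>x. {bs :: bool list. length bs = length (velems (eval (coins M) [\<sigma> x]))})"
  have vc: "vertex_coins M \<sigma> x = (if halted M (\<sigma> x) then 0 else length (velems (eval (coins M) [\<sigma> x])))" for x
    by (simp add: vertex_coins_def)
  have own_div: "x div r = P" if "x \<in> set (map nm (own I P))" "P < m" for x P
    using that set_own nm_div_mod by auto
  have nmD: "x \<in> nm ` D" if "x \<in> set (map nm (own I P))" "P < m" for x P
    using that set_own by auto
  have D_own: "x \<in> set (map nm (own I (x div r)))" "x div r < m" if "x \<in> nm ` D" for x
    using that set_own nm_div_mod D_bounds by fastforce+
  have "bij_betw (split_coins M \<sigma>) ?A ?B"
  proof (rule bij_betw_byWitness[where f' = merge_coins])
    show "\<forall>\<omega>\<in>?A. merge_coins (split_coins M \<sigma> \<omega>) = \<omega>"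
    proof
      fix \<omega> assume \<omega>: "\<omega> \<in> ?A"
      show "merge_coins (split_coins M \<sigma> \<omega>) = \<omega>"
      proof
        fix P
        show "merge_coins (split_coins M \<sigma> \<omega>) P = \<omega> P"
        proof (cases "P < m")
          case True
          have len: "length (\<omega> P) = length (tags I M \<sigma> P)" using \<omega> True by (auto simp: PiE_dflt_def)
          have "split_coins M \<sigma> \<omega> x = chunk (tags I M \<sigma> P) (\<omega> P) x" if x: "x \<in> set (map nm (own I P))" for x
          proof (cases "halted M (\<sigma> x)")
            case h: True
            then have "length (chunk (tags I M \<sigma> P) (\<omega> P) x) = 0"
              using length_chunk[OF distinct_own[OF True] x, of "\<omega> P" "vertex_coins M \<sigma>"] len vc by (simp add: tags_eq)
            with h show ?thesis by (simp add: split_coins_def)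
          next
            case False
            then show ?thesis using own_div[OF x True] nmD[OF x True] by (simp add: split_coins_def)
          qed
          then have eq: "map (split_coins M \<sigma> \<omega>) (map nm (own I P)) = map (chunk (tags I M \<sigma> P) (\<omega> P)) (map nm (own I P))"
            by (rule map_cong[OF refl])
          show ?thesis unfolding merge_coins_def if_P[OF True] eq tags_eq
            by (rule concat_chunk[OF distinct_own[OF True]]) (use len in \<open>simp only: tags_eq\<close>)
        next
          case False
          then show ?thesis using \<omega> by (simp add: merge_coins_def PiE_dflt_def)
        qed
      qed
    qed
    have Blen: "length (\<omega> x) = vertex_coins M \<sigma> x" if "\<omega> \<in> ?B" "x \<in> nm ` D" for \<omega> x
      using that vc by (cases "halted M (\<sigma> x)") (auto simp: PiE_dflt_def)
    show "\<forall>\<omega>\<in>?B. split_coins M \<sigma> (merge_coins \<omega>) = \<omega>"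
    proof
      fix \<omega> assume \<omega>: "\<omega> \<in> ?B"
      show "split_coins M \<sigma> (merge_coins \<omega>) = \<omega>"
      proof
        fix x
        show "split_coins M \<sigma> (merge_coins \<omega>) x = \<omega> x"
        proof (cases "x \<in> ?X")
          case True
          then have x: "x \<in> nm ` D" by simp
          have "chunk (tags I M \<sigma> (x div r)) (merge_coins \<omega> (x div r)) x = \<omega> x"
            unfolding merge_coins_def if_P[OF D_own(2)[OF x]] tags_eq
            by (rule chunk_concat[OF distinct_own[OF D_own(2)[OF x]] _ D_own(1)[OF x]])
              (use Blen[OF \<omega>] nmD D_own(2)[OF x] in blast)
          with True show ?thesis by (simp add: split_coins_def)
        next
          case False
          then show ?thesis using \<omega> by (auto simp: split_coins_def PiE_dflt_def)
        qed
      qed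
    qed
    show "split_coins M \<sigma> ` ?A \<subseteq> ?B"
    proof
      fix w assume "w \<in> split_coins M \<sigma> ` ?A"
      then obtain \<omega> where \<omega>: "\<omega> \<in> ?A" "w = split_coins M \<sigma> \<omega>" by blast
      have "length (w x) = length (velems (eval (coins M) [\<sigma> x]))" if x: "x \<in> ?X" for x
      proof -
        have "x \<in> nm ` D" using x by simp
        note D_own[OF this]
        moreover from this have "length (\<omega> (x div r)) = length (tags I M \<sigma> (x div r))"
          using \<omega>(1) by (auto simp: PiE_dflt_def)
        ultimately show ?thesis
          using length_chunk[OF distinct_own, of "x div r" x "\<omega> (x div r)" "vertex_coins M \<sigma>"] x \<omega>(2) vc
          by (simp add: split_coins_def tags_eq)
      qed
      then show "w \<in> ?B" using \<omega>(2) by (auto simp: PiE_dflt_def split_coins_def)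
    qed
    show "merge_coins ` ?B \<subseteq> ?A"
    proof
      fix w assume "w \<in> merge_coins ` ?B"
      then obtain \<omega> where \<omega>: "\<omega> \<in> ?B" "w = merge_coins \<omega>" by blast
      have "length (w P) = length (tags I M \<sigma> P)" if P: "P < m" for P
      proof -
        have "length (w P) = sum_list (map (\<lambda>d. length (\<omega> (nm d))) (own I P))"
          by (simp add: P \<omega>(2) merge_coins_def length_concat comp_def)
        also have "map (\<lambda>d. length (\<omega> (nm d))) (own I P) = map (\<lambda>d. vertex_coins M \<sigma> (nm d)) (own I P)"
          using Blen[OF \<omega>(1)] set_own[OF P] by (intro map_cong) auto
        also have "sum_list \<dots> = length (tags I M \<sigma> P)" by (simp add: tags_eq length_concat comp_def)
        finally show ?thesis .
      qed
      then show "w \<in> ?A" using \<omega>(2) by (auto simp: PiE_dflt_def merge_coins_def)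
    qed
  qed
  moreover have "finite ?A" by (intro finite_PiE_dflt finite_bool_lists) simp
  moreover have "?A \<noteq> {}"
  proof -
    have "(\<lambda>P. if P < m then replicate (length (tags I M \<sigma> P)) True else []) \<in> ?A" by (auto simp: PiE_dflt_def)
    then show ?thesis by blast
  qed
  ultimately have "map_pmf (split_coins M \<sigma>) (pmf_of_set ?A) = pmf_of_set ?B"
    by (intro map_pmf_of_set_bij_betw)
  then show ?thesis
    by (subst (1 2) Pi_pmf_of_set) (simp_all only: finite_bool_lists not_False_eq_True finite_lessThan, use finite_D in simp)
qed

text \<open>A run never changes the states of nodes outside the network. They keep their initial
  value, which has to be spelled out since configurations are compared as total functions.\<close>

definition config :: "nat \<Rightarrow> val \<Rightarrow> (nat \<times> nat \<Rightarrow> real) \<Rightarrow> (nat \<times> nat \<Rightarrow> val) \<Rightarrow> (nat \<times> nat \<Rightarrow> val)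
      \<Rightarrow> (nat \<times> nat \<Rightarrow> val) \<Rightarrow> nat \<Rightarrow> val" where
  "config tm rg lh ms rd sl P =
     (if P < m then pstate I rg lh ms rd sl P else eval START [proc_input I tm P])"

lemma pstate_vstates: "pstate I rg lh ms rd sl P = VCons (vnat P) (VCons rg (vstates lh ms rd sl (own I P)))"
  by (simp add: pstate_def vstates_def)

lemma pstate_cong:
  assumes "P < m" "\<And>d. d \<in> D \<Longrightarrow> lh d = lh' d" "\<And>d. d \<in> D \<Longrightarrow> ms d = ms' d" "\<And>d. d \<in> D \<Longrightarrow> rd d = rd' d"
    "\<And>d. d \<in> D \<Longrightarrow> sl d = sl' d"
  shows "pstate I rg lh ms rd sl P = pstate I rg lh' ms' rd' sl' P"
  unfolding pstate_def using assms set_own by (auto intro!: map_cong)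

lemma config_cong:
  assumes "\<And>d. d \<in> D \<Longrightarrow> lh d = lh' d" "\<And>d. d \<in> D \<Longrightarrow> ms d = ms' d" "\<And>d. d \<in> D \<Longrightarrow> rd d = rd' d"
    "\<And>d. d \<in> D \<Longrightarrow> sl d = sl' d"
  shows "config tm rg lh ms rd sl = config tm rg lh' ms' rd' sl'"
  unfolding config_def using pstate_cong[OF _ assms] by (intro ext) auto

lemma proc_input_fields:
  "field_of 0 (proc_input I tm P) = vnat n" "field_of 1 (proc_input I tm P) = vnat m"
  "field_of 2 (proc_input I tm P) = vnat r" "field_of 3 (proc_input I tm P) = VNum (p_min I)"
  "field_of 4 (proc_input I tm P) = VNum (p_max I)" "field_of 5 (proc_input I tm P) = vnat tm"
  "field_of 6 (proc_input I tm P) = vnat P" "field_of 7 (proc_input I tm P) = vnat (source I P)"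
  "field_of 8 (proc_input I tm P) = vnat (target I P)" "field_of 9 (proc_input I tm P) = VNum (profit I P)"
  "field_of 10 (proc_input I tm P) = vlist (map (\<lambda>j. VCons (vnat j) (vtree I j)) (accessible I P))"
  unfolding proc_input_def accessible_def by (subst field_of_vlist; simp)+

lemma eval_START:
  assumes P: "P < m"
  shows "eval START [proc_input I tm P] = pstate I (registers I b tm 0 0 0 0) (\<lambda>_. 0) (\<lambda>_. VNil) (\<lambda>_. VNil) (\<lambda>_. VNil) P"
proof -
  let ?in = "proc_input I tm P"
  let ?B = "Bind (BUILD (Tail (Var 0))) (Bind (ROUTE (Var 0) (FIELD 7 (Var 2)) (FIELD 8 (Var 2)))
      (LIST [Arith Plus (Arith Times (FIELD 6 (Var 3)) (FIELD 2 (Var 3))) (Head (Var 2)),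
        FIELD 6 (Var 3), Head (Var 2), FIELD 9 (Var 3), LAYER (Var 1) (Var 0), Var 0, CRITICAL (Var 1) (Var 0),
        Numeral 0, Empty, Empty, Empty]))"
  have body: "eval ?B [VCons (vnat j) (vtree I j), ?in] = irecord I 0 VNil VNil VNil (P, j)" if j: "j \<in> set (accessible I P)" for j
  proof -
    have jr: "j < r" using j by (simp add: accessible_def)
    interpret tree_table "itable I j" n by (rule tree_table[OF jr])
    let ?t = "VCons (vnat j) (vtree I j)"
    have 1: "eval (BUILD (Tail (Var 0))) [?t, ?in] = vpairs (itable I j)"
      unfolding itable_def by (rule eval_BUILD) (simp add: vtree_eq)
    have 2: "eval (ROUTE (Var 0) (FIELD 7 (Var 2)) (FIELD 8 (Var 2))) [vpairs (itable I j), ?t, ?in] = vpairs (iroute I (P, j))"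
      unfolding iroute_def fst_conv snd_conv by (rule eval_ROUTE) (simp_all add: proc_input_fields)
    have sub: "set (iroute I (P, j)) \<subseteq> set (itable I j)" by (auto simp: iroute_def route_def)
    have 3: "eval (LAYER (Var 1) (Var 0)) [vpairs (iroute I (P, j)), vpairs (itable I j), ?t, ?in] = vnat (ilayer I (P, j))"
      unfolding ilayer_def snd_conv by (rule eval_LAYER[OF _ _ sub]) simp_all
    have 4: "eval (CRITICAL (Var 1) (Var 0)) [vpairs (iroute I (P, j)), vpairs (itable I j), ?t, ?in] = vpairs (icritical I (P, j))"
      unfolding icritical_def snd_conv by (rule eval_CRITICAL[OF _ _ sub]) simp_all
    show ?thesis unfolding eval.simps(11) 1 2 eval_LIST list.map 3 4
      by (simp add: irecord_def varith_def iname_def iprofit_def proc_input_fields)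
  qed
  have rat: "of_rat (14 / 15) = (14 / 15 :: real)" by (simp add: of_rat_divide)
  have regs: "eval (LIST [Numeral 0, Numeral 0, Numeral 0, Numeral 1, Numeral 1, Numeral (14 / 15), FIELD 3 (Var 0),
       FIELD 5 (Var 0), FIELD 3 (Var 0), FIELD 4 (Var 0), SQUARE (FIELD 0 (Var 0)),
       Arith Times (FIELD 1 (Var 0)) (FIELD 2 (Var 0))]) [?in] = registers I b tm 0 0 0 0"
    using b_pos L_pos
    by (simp add: registers_def proc_input_fields[unfolded One_nat_def] varith_def SQUARE_def rat epoch_def threshold_def power2_eq_square)
  have "velems (eval (FIELD 10 (Var 0)) [?in]) = map (\<lambda>j. VCons (vnat j) (vtree I j)) (accessible I P)"
    by (simp add: proc_input_fields)
  then have "eval (MAP (FIELD 10 (Var 0)) ?B) [?in] = vlist (map (\<lambda>d. irecord I 0 VNil VNil VNil d) (own I P))"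
    unfolding eval_MAP own_def by (simp only: map_map comp_def) (intro arg_cong[of _ _ vlist] map_cong[OF refl] body)
  then show ?thesis unfolding START_def pstate_def eval.simps(4)
    by (simp only: regs) (simp only: eval_FIELD_of eval.simps(1), simp add: proc_input_fields)
qed

section \<open>One round of the scheduler on a configuration\<close>

context
  fixes M :: dist_alg and tm :: nat
begin

abbreviation "A \<equiv> scheduler M b"

lemma halted_scheduler: "halted A (pstate I (registers I b tm ph t s e) lh ms rd sl P) \<longleftrightarrow> ph = 2"
  by (simp add: halted_def scheduler_def DECIDE_def REGS_def pstate_def)

lemma inbox_config: "ph \<noteq> 2 \<Longrightarrow> P < m \<Longrightarrow>
  inbox m (communicate I) A (config tm (registers I b tm ph t s e) lh ms rd sl) P
    = messages (registers I b tm ph t s e) lh ms rd sl P"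
  unfolding inbox_def messages_def
proof -
  assume ph: "ph \<noteq> 2"
  have "send A = Var 0" by (simp add: scheduler_def)
  moreover have "filter (\<lambda>q. communicate I q P \<and> \<not> halted A (config tm (registers I b tm ph t s e) lh ms rd sl q)) [0..<m]
     = filter (\<lambda>q. communicate I q P) [0..<m]"
    by (rule filter_cong) (use ph in \<open>auto simp: config_def halted_scheduler\<close>)
  ultimately show "vlist (map (\<lambda>q. VCons (vnat q) (eval (send A) [config tm (registers I b tm ph t s e) lh ms rd sl q, vnat P]))
      (filter (\<lambda>q. communicate I q P \<and> \<not> halted A (config tm (registers I b tm ph t s e) lh ms rd sl q)) [0..<m]))
    = vlist (map (\<lambda>q. VCons (vnat q) (pstate I (registers I b tm ph t s e) lh ms rd sl q)) (filter (\<lambda>q. communicate I q P) [0..<m]))"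
    by (simp add: config_def)
qed

lemma advance_config:
  assumes "ph \<noteq> 2"
    and "\<And>P. P < m \<Longrightarrow> eval (RECV M b) [pstate I (registers I b tm ph t s e) lh ms rd sl P,
       messages (registers I b tm ph t s e) lh ms rd sl P, vcoins (\<omega> P)] = pstate I rg' lh' ms' rd' sl' P"
  shows "advance m (communicate I) A (config tm (registers I b tm ph t s e) lh ms rd sl) \<omega> = config tm rg' lh' ms' rd' sl'"
proof
  fix P
  show "advance m (communicate I) A (config tm (registers I b tm ph t s e) lh ms rd sl) \<omega> P = config tm rg' lh' ms' rd' sl' P"
  proof (cases "P < m")
    case True
    then have "config tm rg lh ms rd sl P = pstate I rg lh ms rd sl P" for rg lh ms rd sl by (simp add: config_def)
    moreover have "recv A = RECV M b" by (simp add: scheduler_def)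
    ultimately show ?thesis
      using True assms inbox_config[OF assms(1) True] by (simp add: advance_def halted_scheduler)
  qed (simp add: advance_def config_def)
qed

lemma eval_RECV:
  assumes "P < m" and S: "S = pstate I (registers I b tm ph t s e) lh ms rd sl P"
    and body: "eval (Pair N (B)) [vstates lh ms rd sl (visible I P), S, messages (registers I b tm ph t s e) lh ms rd sl P, cs]
        = VCons rg' (vstates lh' ms' rd' sl' (own I P))"
    and mode: "N = NEXT_ROUND (REGS (Var 1)) \<and> B = SETUP M \<and> ph = 0 \<and> t = 0
      \<or> N = NEXT_STEP b (REGS (Var 1)) \<and> B = RAISE M \<and> ph = 0 \<and> tm < t
      \<or> N = NEXT_ROUND (REGS (Var 1)) \<and> B = SIMULATE M \<and> ph = 0 \<and> 0 < t \<and> t \<le> tm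
      \<or> N = NEXT_SELECT (REGS (Var 1)) \<and> B = SELECT \<and> ph \<noteq> 0"
  shows "eval (RECV M b) [S, messages (registers I b tm ph t s e) lh ms rd sl P, cs] = pstate I rg' lh' ms' rd' sl' P"
proof -
  let ?env = "[vstates lh ms rd sl (visible I P), S, messages (registers I b tm ph t s e) lh ms rd sl P, cs]"
  have V: "eval VISIBLE [S, messages (registers I b tm ph t s e) lh ms rd sl P, cs] = vstates lh ms rd sl (visible I P)"
    unfolding S by (rule eval_VISIBLE[OF assms(1)])
  have R: "eval (REGS (Var 1)) ?env = registers I b tm ph t s e" "eval (PROC (Var 1)) ?env = vnat P"
    unfolding S by simp_all
  have c: "eval (Equal (FIELD 0 (REGS (Var 1))) (Numeral 0)) ?env = vbool (ph = 0)"
    "eval (Equal (FIELD 1 (REGS (Var 1))) (Numeral 0)) ?env = vbool (t = 0)"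
    "eval (Less (FIELD 7 (REGS (Var 1))) (FIELD 1 (REGS (Var 1)))) ?env = vbool (tm < t)"
    by (simp_all only: eval.simps eval_FIELD_of R) (simp_all add: vless_def)
  have main: "eval (Cond (Equal (FIELD 0 (REGS (Var 1))) (Numeral 0))
       (Cond (Equal (FIELD 1 (REGS (Var 1))) (Numeral 0)) (Pair (NEXT_ROUND (REGS (Var 1))) (SETUP M))
         (Cond (Less (FIELD 7 (REGS (Var 1))) (FIELD 1 (REGS (Var 1))))
           (Pair (NEXT_STEP b (REGS (Var 1))) (RAISE M))
           (Pair (NEXT_ROUND (REGS (Var 1))) (SIMULATE M))))
       (Pair (NEXT_SELECT (REGS (Var 1))) SELECT)) ?env
    = (if ph = 0 then if t = 0 then eval (Pair (NEXT_ROUND (REGS (Var 1))) (SETUP M)) ?env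
         else if tm < t then eval (Pair (NEXT_STEP b (REGS (Var 1))) (RAISE M)) ?env
         else eval (Pair (NEXT_ROUND (REGS (Var 1))) (SIMULATE M)) ?env
       else eval (Pair (NEXT_SELECT (REGS (Var 1))) SELECT) ?env)"
    unfolding eval.simps(10) c vbool_eq_VNil not_not by (rule refl)
  have "eval (RECV M b) [S, messages (registers I b tm ph t s e) lh ms rd sl P, cs]
      = VCons (vnat P) (eval (Pair N B) ?env)"
    unfolding RECV_def eval.simps(11) V unfolding eval.simps(4)[of "PROC (Var 1)"] R(2) main
    using mode by (elim disjE conjE) (simp_all only: if_True if_False simp_thms(6) not_less_eq_eq[symmetric], simp_all)
  then show ?thesis unfolding body pstate_vstates .
qed

lemma advance_setup:
  "advance m (communicate I) A (config tm (registers I b tm 0 0 s e) lh ms rd sl) \<omega>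
   = config tm (registers I b tm 0 1 s e) lh (\<lambda>d. eval (start M) [mis_input (m * r) (cgraph e lh) (nm d)]) rd sl"
proof (rule advance_config)
  fix P assume P: "P < m"
  show "eval (RECV M b) [pstate I (registers I b tm 0 0 s e) lh ms rd sl P, messages (registers I b tm 0 0 s e) lh ms rd sl P, vcoins (\<omega> P)]
    = pstate I (registers I b tm 0 1 s e) lh (\<lambda>d. eval (start M) [mis_input (m * r) (cgraph e lh) (nm d)]) rd sl P"
    by (rule eval_RECV[OF P refl, where N = "NEXT_ROUND (REGS (Var 1))" and B = "SETUP M"])
      (simp_all only: eval.simps(4) eval_SETUP[OF P], simp_all add: eval_NEXT_ROUND[where ph = 0 and t = 0 and s = s and e = e])
qed simp

lemma advance_simulate:
  assumes "0 < t" "t \<le> tm" and \<omega>: "\<And>P. P < m \<Longrightarrow> length (\<omega> P) = length (tags I M \<sigma> P)"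
  shows "advance m (communicate I) A (config tm (registers I b tm 0 t s e) lh (\<lambda>d. \<sigma> (nm d)) rd sl) \<omega>
   = config tm (registers I b tm 0 (Suc t) s e) lh
      (\<lambda>d. advance (m * r) (cgraph e lh) M \<sigma> (split_coins M \<sigma> \<omega>) (nm d)) rd sl"
proof (rule advance_config)
  fix P assume P: "P < m"
  let ?S = "pstate I (registers I b tm 0 t s e) lh (\<lambda>d. \<sigma> (nm d)) rd sl P"
  let ?ms = "\<lambda>d. if halted M (\<sigma> (nm d)) then \<sigma> (nm d) else eval (recv M)
        [\<sigma> (nm d), inbox (m * r) (cgraph e lh) M \<sigma> (nm d), vcoins (chunk (tags I M \<sigma> P) (\<omega> P) (nm d))]"
  have "eval (RECV M b) [?S, messages (registers I b tm 0 t s e) lh (\<lambda>d. \<sigma> (nm d)) rd sl P, vcoins (\<omega> P)]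
    = pstate I (registers I b tm 0 (Suc t) s e) lh ?ms rd sl P"
    by (rule eval_RECV[OF P refl, where N = "NEXT_ROUND (REGS (Var 1))" and B = "SIMULATE M"])
      (simp_all only: eval.simps(4) eval_SIMULATE[OF P \<omega>[OF P]],
        use assms in \<open>simp_all add: eval_NEXT_ROUND[where ph = 0 and t = t and s = s and e = e]\<close>)
  also have "vstates lh ?ms rd sl (own I P)
     = vstates lh (\<lambda>d. advance (m * r) (cgraph e lh) M \<sigma> (split_coins M \<sigma> \<omega>) (nm d)) rd sl (own I P)"
  proof -
    have "?ms d = advance (m * r) (cgraph e lh) M \<sigma> (split_coins M \<sigma> \<omega>) (nm d)" if "d \<in> set (own I P)" for d
    proof -
      have "d \<in> D" "nm d div r = P" using that set_own[OF P] nm_div_mod by auto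
      then show ?thesis using nm_less by (auto simp: advance_def split_coins_def)
    qed
    then show ?thesis unfolding vstates_def by (intro arg_cong[of _ _ vlist] map_cong) simp_all
  qed
  then have "pstate I (registers I b tm 0 (Suc t) s e) lh ?ms rd sl P = pstate I (registers I b tm 0 (Suc t) s e) lh
      (\<lambda>d. advance (m * r) (cgraph e lh) M \<sigma> (split_coins M \<sigma> \<omega>) (nm d)) rd sl P"
    by (simp only: pstate_vstates)
  finally show "eval (RECV M b) [?S, messages (registers I b tm 0 t s e) lh (\<lambda>d. \<sigma> (nm d)) rd sl P, vcoins (\<omega> P)]
    = pstate I (registers I b tm 0 (Suc t) s e) lh
      (\<lambda>d. advance (m * r) (cgraph e lh) M \<sigma> (split_coins M \<sigma> \<omega>) (nm d)) rd sl P" .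
qed simp

lemma advance_raise:
  assumes "e < K"
  shows "advance m (communicate I) A (config tm (registers I b tm 0 (Suc tm) s e) lh (\<lambda>d. \<sigma> (nm d)) rd sl) \<omega>
   = config tm (registers I b tm (if Suc e = K then 1 else 0) 0 (Suc s) (Suc e))
      (raise (iprofit I) (iweight I) (chosen M e lh \<sigma>) lh) (\<lambda>_. VNil)
      (\<lambda>d. if d \<in> chosen M e lh \<sigma> then vnat s else rd d) sl"
proof (rule advance_config)
  fix P assume P: "P < m"
  show "eval (RECV M b) [pstate I (registers I b tm 0 (Suc tm) s e) lh (\<lambda>d. \<sigma> (nm d)) rd sl P,
      messages (registers I b tm 0 (Suc tm) s e) lh (\<lambda>d. \<sigma> (nm d)) rd sl P, vcoins (\<omega> P)]
    = pstate I (registers I b tm (if Suc e = K then 1 else 0) 0 (Suc s) (Suc e))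
      (raise (iprofit I) (iweight I) (chosen M e lh \<sigma>) lh) (\<lambda>_. VNil)
      (\<lambda>d. if d \<in> chosen M e lh \<sigma> then vnat s else rd d) sl P"
    by (rule eval_RECV[OF P refl, where N = "NEXT_STEP b (REGS (Var 1))" and B = "RAISE M"])
      (simp_all only: eval.simps(4) eval_RAISE[OF P],
        use assms in \<open>simp_all add: eval_NEXT_STEP[where ph = 0 and t = "Suc tm" and s = s and e = e and tm = tm]\<close>)
qed simp

lemma advance_select:
  assumes "S \<subseteq> D"
  shows "advance m (communicate I) A (config tm (registers I b tm 1 t (Suc s) e) lh ms rd (\<lambda>d. vbool (d \<in> S))) \<omega>
   = config tm (registers I b tm (if s = 0 then 2 else 1) t s e) lh ms rd
      (\<lambda>d. vbool (d \<in> S \<union> {d \<in> D. rd d = vnat s \<and> (\<forall>d'\<in>S. \<not> iconflict I d d')}))"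
proof (rule advance_config)
  fix P assume P: "P < m"
  show "eval (RECV M b) [pstate I (registers I b tm 1 t (Suc s) e) lh ms rd (\<lambda>d. vbool (d \<in> S)) P,
      messages (registers I b tm 1 t (Suc s) e) lh ms rd (\<lambda>d. vbool (d \<in> S)) P, vcoins (\<omega> P)]
    = pstate I (registers I b tm (if s = 0 then 2 else 1) t s e) lh ms rd
      (\<lambda>d. vbool (d \<in> S \<union> {d \<in> D. rd d = vnat s \<and> (\<forall>d'\<in>S. \<not> iconflict I d d')})) P"
    by (rule eval_RECV[OF P refl, where N = "NEXT_SELECT (REGS (Var 1))" and B = "SELECT"])
      (simp_all only: eval.simps(4) eval_SELECT[OF P assms],
        simp_all add: eval_NEXT_SELECT[where ph = 1 and t = t and s = s and e = e and tm = tm])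
qed simp

end

end

lemma select_cong:
  "(\<And>s. s < K \<Longrightarrow> I s = J s) \<Longrightarrow> n \<le> K \<Longrightarrow> select cf I K n = select cf J K n"
  by (induction n) auto

lemma sum_length_filter_le:
  assumes "finite S" "\<And>x e f. x \<in> set xs \<Longrightarrow> e \<in> S \<Longrightarrow> f \<in> S \<Longrightarrow> x \<in> R e \<Longrightarrow> x \<in> R f \<Longrightarrow> e = f"
  shows "(\<Sum>e\<in>S. length (filter (\<lambda>x. x \<in> R e) xs)) \<le> length xs"
  using assms
proof (induction xs)
  case (Cons x xs)
  have "(\<Sum>e\<in>S. length (filter (\<lambda>x. x \<in> R e) (x # xs)))
     = (\<Sum>e\<in>S. (if x \<in> R e then 1 else 0) + length (filter (\<lambda>x. x \<in> R e) xs))"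
    by (intro sum.cong) auto
  also have "\<dots> = card {e \<in> S. x \<in> R e} + (\<Sum>e\<in>S. length (filter (\<lambda>x. x \<in> R e) xs))"
    using Cons.prems(1) by (simp add: sum.distrib sum.If_cases Int_def)
  also have "card {e \<in> S. x \<in> R e} \<le> Suc 0"
    using Cons.prems by (intro card_le_Suc0_iff_eq[THEN iffD2]) auto
  finally have "(\<Sum>e\<in>S. length (filter (\<lambda>x. x \<in> R e) (x # xs)))
      \<le> Suc 0 + (\<Sum>e\<in>S. length (filter (\<lambda>x. x \<in> R e) xs))" by simp
  moreover have "(\<Sum>e\<in>S. length (filter (\<lambda>x. x \<in> R e) xs)) \<le> length xs"
    by (rule Cons.IH[OF Cons.prems(1)], rule Cons.prems(2)) simp_all
  ultimately show ?case unfolding length_Cons by linarith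
qed simp

text \<open>Union bound for two consecutive experiments: either the first one fails, or the second
  one fails after a success of the first.\<close>

lemma prob_bind_ge:
  assumes A: "measure_pmf.prob p A \<ge> 1 - a" and B: "\<And>x. x \<in> A \<Longrightarrow> x \<in> set_pmf p \<Longrightarrow> measure_pmf.prob (f x) B \<ge> 1 - c"
    and "0 \<le> c"
  shows "measure_pmf.prob (bind_pmf p f) B \<ge> 1 - (a + c)"
proof -
  have comp: "measure_pmf.prob q (- X) = 1 - measure_pmf.prob q X" for q :: "'c pmf" and X
    using measure_pmf.prob_compl[of X q] by (simp add: Compl_eq_Diff_UNIV)
  have "ennreal (measure_pmf.prob (bind_pmf p f) (- B)) = (\<integral>\<^sup>+x. ennreal (measure_pmf.prob (f x) (- B)) \<partial>p)"
    by (simp add: emeasure_bind_pmf flip: measure_pmf.emeasure_eq_measure)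
  also have "\<dots> \<le> (\<integral>\<^sup>+x. indicator (- A) x + ennreal c \<partial>p)"
  proof (rule nn_integral_mono_AE, subst AE_measure_pmf_iff, intro ballI)
    fix x assume x: "x \<in> set_pmf p"
    show "ennreal (measure_pmf.prob (f x) (- B)) \<le> indicator (- A) x + ennreal c"
    proof (cases "x \<in> A")
      case True
      have "measure_pmf.prob (f x) (- B) \<le> c"
        using B[OF True x] measure_pmf.prob_compl[of B "f x"] by (simp add: Compl_eq_Diff_UNIV)
      with True show ?thesis by (simp add: ennreal_leI)
    next
      case False
      have "ennreal (measure_pmf.prob (f x) (- B)) \<le> 1" by simp
      with False show ?thesis by (simp add: add_increasing2)
    qed
  qed
  also have "\<dots> = emeasure p (- A) + ennreal c"
    by (subst nn_integral_add) (simp_all add: measure_pmf.emeasure_space_1)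
  also have "\<dots> = ennreal (measure_pmf.prob p (- A) + c)"
    using \<open>0 \<le> c\<close> by (simp add: measure_pmf.emeasure_eq_measure)
  finally have "measure_pmf.prob (bind_pmf p f) (- B) \<le> measure_pmf.prob p (- A) + c"
    by (subst (asm) ennreal_le_iff) (use \<open>0 \<le> c\<close> in simp_all)
  then show ?thesis
    using A measure_pmf.prob_compl[of B "bind_pmf p f"] measure_pmf.prob_compl[of A p]
    by (simp add: Compl_eq_Diff_UNIV)
qed

section \<open>The layered decomposition as an instance of the primal-dual scheme\<close>

context setting
begin

lemma icritical_sub: "set (icritical I d) \<subseteq> set (iroute I d)"
  by (auto simp: icritical_def critical_def Let_def)

lemma route_ends:
  assumes "d \<in> D"
  shows "source I (fst d) \<in> insert 0 (fst ` set (itable I (snd d)))" "target I (fst d) \<in> insert 0 (fst ` set (itable I (snd d)))"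
  using rooted(2)[of "snd d"] D_bounds[OF assms] proc[of "fst d"] by auto

lemma length_icritical: "d \<in> D \<Longrightarrow> length (icritical I d) \<le> 6"
  unfolding icritical_def iroute_def
  using rooted_tree.length_critical[OF rooted(1) route_ends] D_bounds by blast

lemma icritical_meets:
  assumes "d \<in> D" "e \<in> D" "snd d = snd e" "set (iroute I d) \<inter> set (iroute I e) \<noteq> {}" "ilayer I d \<le> ilayer I e"
  shows "set (icritical I d) \<inter> set (iroute I e) \<noteq> {}"
proof -
  interpret rooted_tree "itable I (snd d)" using rooted(1) D_bounds assms(1) by blast
  show ?thesis
    using critical_meets[OF route_ends[OF assms(1)] route_ends[OF assms(2), folded assms(3)]] assms(4,5)
    unfolding icritical_def ilayer_def iroute_def assms(3) by blast
qed

lemma ilayer_power: "d \<in> D \<Longrightarrow> \<exists>k<E. ilayer I d = 2 ^ k"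
proof -
  assume d: "d \<in> D"
  interpret tree_table "itable I (snd d)" n using tree_table D_bounds d by blast
  obtain k where k: "ilayer I d = 2 ^ k"
    using lay_power[OF route_ends[OF d]] layer_of_route[OF route_ends[OF d]] by (auto simp: ilayer_def iroute_def)
  have "Suc (length (itable I (snd d))) = n" using n_eq by (simp add: tree_vertices_def)
  then have "ilayer I d \<le> n\<^sup>2"
    using lay_bound[OF route_ends[OF d]] layer_of_route[OF route_ends[OF d]] by (simp add: ilayer_def iroute_def)
  with k E_spec have "(2 :: nat) ^ k < 2 ^ E" by linarith
  then have "k < E" by simp
  with k show ?thesis by blast
qed

text \<open>The constant 7 is 1 + 6. An independent set contains at most one instance of the demand
  of \<open>d\<close>, and each of the at most six critical edges of \<open>d\<close> lies on the
  path of at most one of its members.\<close>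

lemma primal_dual: "primal_dual D (iprofit I) (iconflict I) (iweight I) (ilayer I)"
proof
  show "finite D" by (rule finite_D)
  show "0 < iprofit I d" if "d \<in> D" for d using proc(3) D_bounds that by (simp add: iprofit_def)
  show "iconflict I d d" for d by (simp add: iconflict_def)
  show "iconflict I e d" if "iconflict I d e" for d e using that iconflict_sym by blast
  show "0 \<le> iweight I d e" for d e by (simp add: iweight_def)
  show "iweight I d d \<le> 7" if "d \<in> D" for d using length_icritical[OF that] by (simp add: iweight_self)
  show "1 \<le> iweight I d e" if h: "d \<in> D" "e \<in> D" "iconflict I d e" "ilayer I d \<le> ilayer I e" for d e
  proof (cases "fst d = fst e")
    case False
    then have s: "snd d = snd e" "set (iroute I d) \<inter> set (iroute I e) \<noteq> {}" using that by (auto simp: iconflict_def)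
    obtain x where "x \<in> set (icritical I d)" "x \<in> set (iroute I e)" using icritical_meets[OF h(1,2) s h(4)] by blast
    then have "filter (\<lambda>x. x \<in> set (iroute I e)) (icritical I d) \<noteq> []" by (auto simp: filter_empty_conv)
    then have "1 \<le> length (filter (\<lambda>x. x \<in> set (iroute I e)) (icritical I d))" by (simp add: Suc_le_eq)
    with s False show ?thesis by (simp add: iweight_def)
  qed (simp add: iweight_def)
  show "iweight I d e = 0" if "\<not> iconflict I d e" for d e
  proof -
    have "filter (\<lambda>x. x \<in> set (iroute I e)) (icritical I d) = []" if "snd d = snd e"
      using that \<open>\<not> iconflict I d e\<close> icritical_sub[of d] by (auto simp: iconflict_def filter_empty_conv)
    with that show ?thesis by (auto simp: iweight_def iconflict_def)
  qed
  show "(\<Sum>e\<in>S. iweight I d e) \<le> 7"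
    if S: "S \<subseteq> D" "\<forall>d\<in>S. \<forall>e\<in>S. d \<noteq> e \<longrightarrow> \<not> iconflict I d e" and d: "d \<in> D" for S d
  proof -
    have fin: "finite S" using S finite_D finite_subset by blast
    have "e = f" if "e \<in> {e \<in> S. fst d = fst e}" "f \<in> {e \<in> S. fst d = fst e}" for e f
    proof (rule ccontr)
      assume "e \<noteq> f"
      moreover have "e \<in> S" "f \<in> S" "fst e = fst f" using that by simp_all
      ultimately show False using S(2) unfolding iconflict_def by blast
    qed
    then have "card {e \<in> S. fst d = fst e} \<le> Suc 0"
      using fin by (intro card_le_Suc0_iff_eq[THEN iffD2]) simp_all
    then have 1: "(\<Sum>e\<in>S. if fst d = fst e then 1 else 0 :: real) \<le> 1"
      using fin by (simp add: sum.If_cases Int_def)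
    have "(\<Sum>e\<in>{e \<in> S. snd d = snd e}. length (filter (\<lambda>x. x \<in> set (iroute I e)) (icritical I d))) \<le> length (icritical I d)"
    proof (rule sum_length_filter_le)
      fix x e f assume h: "e \<in> {e \<in> S. snd d = snd e}" "f \<in> {e \<in> S. snd d = snd e}"
        "x \<in> set (iroute I e)" "x \<in> set (iroute I f)"
      show "e = f"
      proof (rule ccontr)
        assume "e \<noteq> f"
        moreover have "e \<in> S" "f \<in> S" "snd e = snd f" using h by simp_all
        ultimately show False using S(2) h(3,4) unfolding iconflict_def by blast
      qed
    qed (use fin in simp)
    also have "\<dots> \<le> 6" by (rule length_icritical[OF d])
    finally have "(\<Sum>e\<in>{e \<in> S. snd d = snd e}. real (length (filter (\<lambda>x. x \<in> set (iroute I e)) (icritical I d)))) \<le> 6"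
      by (simp only: of_nat_sum[symmetric] of_nat_le_numeral_iff)
    then have "(\<Sum>e\<in>S. if snd d = snd e then real (length (filter (\<lambda>x. x \<in> set (iroute I e)) (icritical I d))) else 0) \<le> 6"
      using fin by (simp add: sum.If_cases Int_def)
    with 1 show ?thesis unfolding iweight_def sum.distrib by simp
  qed
qed

section \<open>The run as a random process on dual solutions\<close>

context
  fixes M :: dist_alg and tm :: nat
begin

abbreviation "RUN \<equiv> run m (communicate I) (proc_input I tm) (scheduler M b)"
abbreviation "mrun e lh \<equiv> run (m * r) (cgraph e lh) (mis_input (m * r) (cgraph e lh)) M"

lemma step_constant: "(\<And>\<omega>. advance k adj B \<sigma> \<omega> = c) \<Longrightarrow> map_pmf (advance k adj B \<sigma>) (toss k B \<sigma>) = return_pmf c"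
  by (simp add: map_pmf_const ext[of "advance k adj B \<sigma>" "\<lambda>_. c"])

text \<open>The given algorithm also tosses coins at names without an instance, which no processor
  simulates. These coins do not influence the visible part of the configuration and are integrated
  out.\<close>

lemma step_simulate:
  assumes t: "0 < t" "t \<le> tm"
    and c_def: "c = config tm (registers I b tm 0 t s e) lh (\<lambda>d. \<sigma> (nm d)) rd sl"
  shows "map_pmf (advance m (communicate I) (scheduler M b) c) (toss m (scheduler M b) c)
    = map_pmf (\<lambda>\<sigma>'. config tm (registers I b tm 0 (Suc t) s e) lh (\<lambda>d. \<sigma>' (nm d)) rd sl)
        (map_pmf (advance (m * r) (cgraph e lh) M \<sigma>) (toss (m * r) M \<sigma>))"
proof -
  let ?X = "{x \<in> nm ` D. \<not> halted M (\<sigma> x)}"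
  let ?P = "Pi_pmf {..<m} [] (\<lambda>P. pmf_of_set {bs :: bool list. length bs = length (tags I M \<sigma> P)})"
  let ?G = "\<lambda>\<omega>. config tm (registers I b tm 0 (Suc t) s e) lh (\<lambda>d. advance (m * r) (cgraph e lh) M \<sigma> \<omega> (nm d)) rd sl"
  have 1: "toss m (scheduler M b) c = ?P"
    unfolding toss_def
  proof (rule Pi_pmf_cong)
    fix P assume "P \<in> {..<m}"
    then have "eval (coins (scheduler M b)) [c P] = vnats (tags I M \<sigma> P)"
      unfolding c_def config_def using t eval_COINS[of t tm M s e lh \<sigma> rd sl P] by (simp add: scheduler_def)
    then show "pmf_of_set {bs :: bool list. length bs = length (velems (eval (coins (scheduler M b)) [c P]))} =
         pmf_of_set {bs. length bs = length (tags I M \<sigma> P)}" by simp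
  qed simp_all
  have 2: "map_pmf (advance m (communicate I) (scheduler M b) c) ?P = map_pmf (\<lambda>\<omega>. ?G (split_coins M \<sigma> \<omega>)) ?P"
  proof (rule map_pmf_cong[OF refl])
    fix \<omega> assume "\<omega> \<in> set_pmf ?P"
    moreover have "set_pmf (pmf_of_set {bs :: bool list. length bs = k}) = {bs. length bs = k}" for k
      by (rule set_pmf_of_set) (rule finite_bool_lists)+
    ultimately have "length (\<omega> P) = length (tags I M \<sigma> P)" if "P < m" for P
      using that by (auto simp: set_Pi_pmf PiE_dflt_def)
    then show "advance m (communicate I) (scheduler M b) c \<omega> = ?G (split_coins M \<sigma> \<omega>)"
      unfolding c_def by (rule advance_simulate[OF t])
  qed
  have 3: "map_pmf (\<lambda>\<omega>. ?G (split_coins M \<sigma> \<omega>)) ?P = map_pmf ?G (map_pmf (split_coins M \<sigma>) ?P)"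
    by (simp add: pmf.map_comp comp_def)
  have 4: "map_pmf ?G (toss (m * r) M \<sigma>) = map_pmf ?G (map_pmf (\<lambda>\<omega> x. if x \<in> ?X then \<omega> x else []) (toss (m * r) M \<sigma>))"
  proof -
    have "?G \<omega> = ?G (\<lambda>x. if x \<in> ?X then \<omega> x else [])" for \<omega>
      by (rule config_cong) (auto simp: advance_def)
    then show ?thesis by (simp add: pmf.map_comp comp_def)
  qed
  \<comment> \<open>Restricting a product distribution to some coordinates gives the product over
    these coordinates.\<close>
  have 5: "map_pmf (\<lambda>\<omega> x. if x \<in> ?X then \<omega> x else []) (toss (m * r) M \<sigma>)
     = Pi_pmf ?X [] (\<lambda>x. pmf_of_set {bs. length bs = length (velems (eval (coins M) [\<sigma> x]))})"
    unfolding toss_def by (rule Pi_pmf_subset[symmetric]) (auto simp: nm_less)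
  have 6: "map_pmf (\<lambda>\<sigma>'. config tm (registers I b tm 0 (Suc t) s e) lh (\<lambda>d. \<sigma>' (nm d)) rd sl)
        (map_pmf (advance (m * r) (cgraph e lh) M \<sigma>) (toss (m * r) M \<sigma>)) = map_pmf ?G (toss (m * r) M \<sigma>)"
    by (simp add: pmf.map_comp comp_def)
  show ?thesis unfolding 1 2 3 6 4 5 toss_split ..
qed

definition proc_update :: "nat \<Rightarrow> (nat \<times> nat \<Rightarrow> real) \<times> (nat \<times> nat \<Rightarrow> val) \<Rightarrow> (nat \<Rightarrow> val) \<Rightarrow>
    (nat \<times> nat \<Rightarrow> real) \<times> (nat \<times> nat \<Rightarrow> val)" where
  "proc_update e G \<sigma> = (raise (iprofit I) (iweight I) (chosen M e (fst G) \<sigma>) (fst G),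
     \<lambda>d. if d \<in> chosen M e (fst G) \<sigma> then vnat e else snd G d)"

text \<open>One transition per step, in which the given algorithm runs on the entire conflict graph.
  Only the left-hand sides and the recorded steps survive a step, since vertex states are erased by
  raising.\<close>

primrec process :: "nat \<Rightarrow> ((nat \<times> nat \<Rightarrow> real) \<times> (nat \<times> nat \<Rightarrow> val)) pmf" where
  "process 0 = return_pmf (\<lambda>_. 0, \<lambda>_. VNil)"
| "process (Suc e) = bind_pmf (process e) (\<lambda>G. map_pmf (proc_update e G) (mrun e (fst G) tm))"

definition start_config :: "nat \<Rightarrow> (nat \<times> nat \<Rightarrow> real) \<times> (nat \<times> nat \<Rightarrow> val) \<Rightarrow> nat \<Rightarrow> val" where
  "start_config e G = config tm (registers I b tm (if e = K then 1 else 0) 0 e e) (fst G) (\<lambda>_. VNil) (snd G) (\<lambda>_. VNil)"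

text \<open>The round register is one ahead of the simulated time because round 0 served for the
  setup.\<close>

definition mis_config :: "nat \<Rightarrow> (nat \<times> nat \<Rightarrow> real) \<times> (nat \<times> nat \<Rightarrow> val) \<Rightarrow> nat \<Rightarrow> (nat \<Rightarrow> val) \<Rightarrow> nat \<Rightarrow> val" where
  "mis_config e G t \<sigma> = config tm (registers I b tm 0 (Suc t) e e) (fst G) (\<lambda>d. \<sigma> (nm d)) (snd G) (\<lambda>_. VNil)"

definition selected :: "(nat \<times> nat \<Rightarrow> real) \<times> (nat \<times> nat \<Rightarrow> val) \<Rightarrow> nat \<Rightarrow> (nat \<times> nat) set" where
  "selected G i = select (iconflict I) (\<lambda>s. {d \<in> D. snd G d = vnat s}) K i"

definition select_config :: "nat \<Rightarrow> (nat \<times> nat \<Rightarrow> real) \<times> (nat \<times> nat \<Rightarrow> val) \<Rightarrow> nat \<Rightarrow> val" where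
  "select_config i G = config tm (registers I b tm (if i = K then 2 else 1) 0 (K - i) K) (fst G) (\<lambda>_. VNil) (snd G)
     (\<lambda>d. vbool (d \<in> selected G i))"

lemma run_mis:
  assumes "RUN (e * (tm + 2)) = map_pmf (start_config e) p" "e < K" "t \<le> tm"
  shows "RUN (e * (tm + 2) + Suc t) = bind_pmf p (\<lambda>G. map_pmf (mis_config e G t) (mrun e (fst G) t))"
  using assms(3)
proof (induction t)
  case 0
  have "map_pmf (advance m (communicate I) (scheduler M b) (start_config e G)) (toss m (scheduler M b) (start_config e G))
     = return_pmf (mis_config e G 0 (\<lambda>x. eval (start M) [mis_input (m * r) (cgraph e (fst G)) x]))" for G
    by (rule step_constant) (use assms(2) in \<open>simp add: start_config_def mis_config_def advance_setup\<close>)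
  then show ?case by (simp add: assms(1) bind_map_pmf)
next
  case (Suc t)
  have "map_pmf (advance m (communicate I) (scheduler M b) (mis_config e G t \<sigma>)) (toss m (scheduler M b) (mis_config e G t \<sigma>))
     = map_pmf (mis_config e G (Suc t)) (map_pmf (advance (m * r) (cgraph e (fst G)) M \<sigma>) (toss (m * r) M \<sigma>))" for G \<sigma>
    unfolding mis_config_def by (rule step_simulate[OF _ _ refl]) (use Suc.prems in auto)
  with Suc show ?case
    by (simp add: bind_map_pmf bind_assoc_pmf map_bind_pmf)
qed

lemma run_step:
  assumes "RUN (e * (tm + 2)) = map_pmf (start_config e) (process e)" "e < K"
  shows "RUN (Suc e * (tm + 2)) = map_pmf (start_config (Suc e)) (process (Suc e))"
proof -
  have "map_pmf (advance m (communicate I) (scheduler M b) (mis_config e G tm \<sigma>)) (toss m (scheduler M b) (mis_config e G tm \<sigma>))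
     = return_pmf (start_config (Suc e) (proc_update e G \<sigma>))" for G \<sigma>
    by (rule step_constant) (simp add: start_config_def mis_config_def proc_update_def advance_raise[OF assms(2)])
  note S = this
  have e: "Suc e * (tm + 2) = Suc (e * (tm + 2) + Suc tm)" by simp
  show ?thesis
    unfolding e run.simps(2) run_mis[OF assms order_refl] bind_assoc_pmf bind_map_pmf S process.simps map_bind_pmf
    by (simp add: map_pmf_def bind_assoc_pmf bind_return_pmf)
qed

lemma run_process: "e \<le> K \<Longrightarrow> RUN (e * (tm + 2)) = map_pmf (start_config e) (process e)"
proof (induction e)
  case 0
  have "(\<lambda>P. eval START [proc_input I tm P]) = start_config 0 (\<lambda>_. 0, \<lambda>_. VNil)"
    using K_pos by (auto simp: start_config_def config_def eval_START)
  then show ?case by (simp add: scheduler_def)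
next
  case (Suc e)
  then show ?case using run_step[of e] by simp
qed

lemma selected_D: "selected G i \<subseteq> D"
  unfolding selected_def by (induction i) auto

lemma run_select: "i \<le> K \<Longrightarrow> RUN (K * (tm + 2) + i) = map_pmf (select_config i) (process K)"
proof (induction i)
  case 0
  have "start_config K = select_config 0"
    using K_pos by (auto simp: fun_eq_iff start_config_def select_config_def selected_def)
  with run_process[of K] show ?case by simp
next
  case (Suc i)
  have "map_pmf (advance m (communicate I) (scheduler M b) (select_config i G)) (toss m (scheduler M b) (select_config i G))
     = return_pmf (select_config (Suc i) G)" for G
  proof (rule step_constant)
    fix \<omega>
    have Ki: "K - i = Suc (K - Suc i)" "i \<noteq> K" "K - Suc i = 0 \<longleftrightarrow> Suc i = K" using Suc.prems by auto
    have "selected G (Suc i) = selected G i \<union> {d \<in> D. snd G d = vnat (K - Suc i) \<and> (\<forall>d'\<in>selected G i. \<not> iconflict I d d')}"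
      by (auto simp: selected_def)
    then show "advance m (communicate I) (scheduler M b) (select_config i G) \<omega> = select_config (Suc i) G"
      unfolding select_config_def Ki(1) using advance_select[OF selected_D[of G i], of M tm 0 "K - Suc i" K "fst G" "\<lambda>_. VNil" "snd G" \<omega>]
      using Ki by simp
  qed
  with Suc show ?case by (simp add: bind_map_pmf) (simp add: map_pmf_def)
qed

lemma run_total: "RUN (K * (tm + 3)) = map_pmf (select_config K) (process K)"
proof -
  have "K * (tm + 3) = K * (tm + 2) + K" by (simp add: algebra_simps)
  with run_select[of K] show ?thesis by simp
qed

lemma halted_final: "\<sigma> \<in> set_pmf (RUN (K * (tm + 3))) \<Longrightarrow> P < m \<Longrightarrow> halted (scheduler M b) (\<sigma> P)"
  unfolding run_total by (auto simp: select_config_def config_def halted_scheduler)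

lemma solution_final: "solution_of I (scheduler M b) (select_config K G) = selected G K"
proof -
  have out: "vnat j \<in> set (velems (output_of (scheduler M b) (select_config K G P))) \<longleftrightarrow> (P, j) \<in> selected G K"
    if P: "P < m" for P j
  proof -
    have "output_of (scheduler M b) (select_config K G P)
      = vnats (map snd (filter (\<lambda>d. d \<in> selected G K) (own I P)))"
      using P by (simp add: output_of_def scheduler_def DECIDE_def select_config_def config_def filter_map comp_def
          REGS_def RECS_def pstate_def)
    then have "vnat j \<in> set (velems (output_of (scheduler M b) (select_config K G P))) \<longleftrightarrow>
        (\<exists>d\<in>set (own I P). d \<in> selected G K \<and> j = snd d)" by auto
    also have "\<dots> \<longleftrightarrow> (P, j) \<in> selected G K" using set_own[OF P] selected_D[of G K] by force
    finally show ?thesis .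
  qed
  show ?thesis
  proof (intro set_eqI iffI)
    fix x assume "x \<in> solution_of I (scheduler M b) (select_config K G)"
    then show "x \<in> selected G K" using out by (auto simp: solution_of_def)
  next
    fix x assume x: "x \<in> selected G K"
    then have "fst x < m" using selected_D D_bounds by blast
    with x show "x \<in> solution_of I (scheduler M b) (select_config K G)" using out[of "fst x" "snd x"] by (auto simp: solution_of_def)
  qed
qed

text \<open>The process keeps only the current left-hand sides and, for each instance, the step in
  which it was raised. A state is good if some successful history leads to it and the sets raised in
  that history can be read off from the records.\<close>

definition good :: "nat \<Rightarrow> (nat \<times> nat \<Rightarrow> real) \<times> (nat \<times> nat \<Rightarrow> val) \<Rightarrow> bool" where
  "good e G \<longleftrightarrow> (\<exists>lhs J. raising D (iprofit I) (iconflict I) (iweight I) (ilayer I) lhs J b L e \<and> lhs e = fst G \<and>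
     (\<forall>d\<in>D. \<forall>s. snd G d = vnat s \<longleftrightarrow> s < e \<and> d \<in> J s))"

lemma good_0: "good 0 (\<lambda>_. 0, \<lambda>_. VNil)"
proof -
  interpret primal_dual D "iprofit I" "iconflict I" "iweight I" "ilayer I" by (rule primal_dual)
  have "raising D (iprofit I) (iconflict I) (iweight I) (ilayer I) (\<lambda>_ _. 0) (\<lambda>_. {}) b L 0"
    by unfold_locales (simp_all add: b_pos L_pos)
  then show ?thesis unfolding good_def by (intro exI[of _ "\<lambda>_ _. 0"] exI[of _ "\<lambda>_. {}"]) auto
qed

lemma good_Suc:
  assumes G: "good e G" and \<sigma>: "mis_success (m * r) (cgraph e (fst G)) M \<sigma>"
  shows "good (Suc e) (proc_update e G \<sigma>)"
proof -
  let ?C = "chosen M e (fst G) \<sigma>"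
  from G obtain lhs J where R: "raising D (iprofit I) (iconflict I) (iweight I) (ilayer I) lhs J b L e"
    and lhs: "lhs e = fst G" and J: "\<And>d s. d \<in> D \<Longrightarrow> snd G d = vnat s \<longleftrightarrow> s < e \<and> d \<in> J s"
    unfolding good_def by blast
  interpret raising D "iprofit I" "iconflict I" "iweight I" "ilayer I" lhs J b L e by (rule R)
  let ?lhs = "lhs(Suc e := raise (iprofit I) (iweight I) ?C (lhs e))" and ?J = "J(e := ?C)"
  let ?X = "{x. x < m * r \<and> output_of M (\<sigma> x) \<noteq> VNil}"
  have mis: "maximal_independent_set (m * r) (cgraph e (fst G)) ?X" and h: "\<And>x. x < m * r \<Longrightarrow> halted M (\<sigma> x)"
    using \<sigma> by (auto simp: mis_success_def)
  have C: "d \<in> ?C \<longleftrightarrow> d \<in> U e (fst G) \<and> nm d \<in> ?X" for d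
  proof -
    have "d \<in> U e (fst G) \<Longrightarrow> nm d < m * r" using nm_less U_D by blast
    then show ?thesis using h by (auto simp: chosen_def)
  qed
  have Ue: "unsatisfied D (ilayer I) (iprofit I) (epoch b L e) (threshold b L e) (fst G) = U e (fst G)"
    by (simp add: U_def)
  have indep: "\<not> iconflict I d d'" if "d \<in> ?C" "d' \<in> ?C" "d \<noteq> d'" for d d'
  proof
    assume "iconflict I d d'"
    then have "cgraph e (fst G) (nm d) (nm d')" using that C unfolding cgraph_def by blast
    with mis that C show False by (auto simp: maximal_independent_set_def)
  qed
  have maxi: "\<exists>d'\<in>?C. iconflict I d' d" if d: "d \<in> U e (fst G)" "d \<notin> ?C" for d
  proof -
    have "nm d < m * r" by (rule nm_less[OF subsetD[OF U_D d(1)]])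
    moreover have "nm d \<notin> ?X" using C[of d] d by blast
    ultimately obtain x where x: "x \<in> ?X" "cgraph e (fst G) x (nm d)"
      using mis unfolding maximal_independent_set_def by blast
    then obtain d1 d2 where d12: "d1 \<in> U e (fst G)" "d2 \<in> U e (fst G)" "nm d1 = x" "nm d2 = nm d" "iconflict I d1 d2"
      unfolding cgraph_def by blast
    then have "d2 = d" using nm_inj d U_D by blast
    with d12 x C show ?thesis by blast
  qed
  have R': "raising D (iprofit I) (iconflict I) (iweight I) (ilayer I) ?lhs ?J b L (Suc e)"
  proof
    show "?lhs 0 d = 0" for d by (simp add: lhs_0)
    show "?lhs (Suc s) d = raise (iprofit I) (iweight I) (?J s) (?lhs s) d" if "s < Suc e" "d \<in> D" for s d
      using that(1) lhs_Suc[OF _ that(2)] by (cases "s = e") (simp_all add: less_Suc_eq)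
    show "?J s \<subseteq> unsatisfied D (ilayer I) (iprofit I) (epoch b L s) (threshold b L s) (?lhs s)" if "s < Suc e" for s
    proof (cases "s = e")
      case True
      then show ?thesis using chosen_U by (simp add: lhs Ue)
    next
      case False
      then show ?thesis using that I_sub[of s] by (simp add: less_Suc_eq)
    qed
    show "\<not> iconflict I d d'" if "s < Suc e" "d \<in> ?J s" "d' \<in> ?J s" "d \<noteq> d'" for s d d'
    proof (cases "s = e")
      case True
      then show ?thesis using that indep[of d d'] by simp
    next
      case False
      then show ?thesis using that I_indep[of s d d'] by (simp add: less_Suc_eq)
    qed
    show "\<exists>d'\<in>?J s. iconflict I d' d" if "s < Suc e"
        "d \<in> unsatisfied D (ilayer I) (iprofit I) (epoch b L s) (threshold b L s) (?lhs s)" "d \<notin> ?J s" for s d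
    proof (cases "s = e")
      case True
      then show ?thesis using that maxi[of d] by (simp add: lhs Ue)
    next
      case False
      then show ?thesis using that I_max[of s d] by (simp add: less_Suc_eq)
    qed
  qed (simp_all add: b_pos L_pos)
  have "snd (proc_update e G \<sigma>) d = vnat s \<longleftrightarrow> s < Suc e \<and> d \<in> ?J s" if "d \<in> D" for d s
  proof (cases "d \<in> ?C")
    case True
    \<comment> \<open>Recording a step must not overwrite an earlier one. \<open>raised_once\<close>
      is applied to the prolonged history, in which \<open>d\<close> is raised at step
      \<open>e\<close>.\<close>
    have "d \<notin> J s" if "s < e" for s
      using raising.raised_once[OF R', of s e d] that True by auto
    with True show ?thesis by (auto simp: proc_update_def less_Suc_eq)
  next
    case False
    with J[OF that] show ?thesis by (auto simp: proc_update_def less_Suc_eq)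
  qed
  moreover have "?lhs (Suc e) = fst (proc_update e G \<sigma>)" by (simp add: proc_update_def lhs)
  ultimately show ?thesis unfolding good_def using R' by blast
qed

lemma prob_good:
  assumes mis: "\<And>adj. simple_graph (m * r) adj \<Longrightarrow>
      measure_pmf.prob (run (m * r) adj (mis_input (m * r) adj) M tm) {\<sigma>. mis_success (m * r) adj M \<sigma>} \<ge> 1 - \<delta>"
    and "0 \<le> \<delta>"
  shows "measure_pmf.prob (process e) {G. good e G} \<ge> 1 - real e * \<delta>"
proof (induction e)
  case 0
  then show ?case by (simp add: good_0)
next
  case (Suc e)
  have "measure_pmf.prob (process (Suc e)) {G. good (Suc e) G} \<ge> 1 - (real e * \<delta> + \<delta>)"
    unfolding process.simps
  proof (rule prob_bind_ge[OF Suc])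
    fix G assume "G \<in> {G. good e G}"
    then have "{\<sigma>. mis_success (m * r) (cgraph e (fst G)) M \<sigma>} \<subseteq> proc_update e G -` {G. good (Suc e) G}"
      using good_Suc[of e G] by blast
    then have "measure_pmf.prob (mrun e (fst G) tm) {\<sigma>. mis_success (m * r) (cgraph e (fst G)) M \<sigma>}
       \<le> measure_pmf.prob (mrun e (fst G) tm) (proc_update e G -` {G. good (Suc e) G})"
      by (intro measure_pmf.finite_measure_mono) auto
    with mis[OF cgraph_simple, of e "fst G"]
    show "1 - \<delta> \<le> measure_pmf.prob (map_pmf (proc_update e G) (mrun e (fst G) tm)) {G. good (Suc e) G}" by simp
  qed (rule \<open>0 \<le> \<delta>\<close>)
  then show ?case by (simp add: algebra_simps)
qed

lemma good_success:
  assumes G: "good K G"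
  shows "feasible I (selected G K)"
    "(1 - (14 / 15) ^ b) * opt_profit I \<le> 7 * total_profit I (selected G K)"
proof -
  from G obtain lhs J where R: "raising D (iprofit I) (iconflict I) (iweight I) (ilayer I) lhs J b L K"
    and J: "\<And>d s. d \<in> D \<Longrightarrow> snd G d = vnat s \<longleftrightarrow> s < K \<and> d \<in> J s"
    unfolding good_def by blast
  interpret raising D "iprofit I" "iconflict I" "iweight I" "ilayer I" lhs J b L K by (rule R)
  have sel: "selected G K = select (iconflict I) J K K"
    unfolding selected_def by (rule select_cong) (use J I_D in auto)
  have conf: "conflict I d d' \<longleftrightarrow> iconflict I d d'" if "d \<in> D" "d' \<in> D" for d d'
    using overlap_iff that by blast
  show "feasible I (selected G K)"
    unfolding feasible_def using selected_D[of G K] select_indep[of K] sel conf by blast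
  obtain Opt where Opt: "feasible I Opt" "total_profit I Opt = opt_profit I"
    using opt_profit_attained(1)[OF valid] by blast
  have "Opt \<subseteq> D" "\<forall>d\<in>Opt. \<forall>e\<in>Opt. d \<noteq> e \<longrightarrow> \<not> iconflict I d e"
    using Opt(1) conf unfolding feasible_def by blast+
  moreover have "p_min I \<le> iprofit I d" "iprofit I d < p_min I * 2 ^ L" if "d \<in> D" for d
    using p_min[of "fst d"] D_bounds[OF that] L_spec by (auto simp: iprofit_def)
  ultimately have "(1 - (14 / 15) ^ b) * (\<Sum>d\<in>Opt. iprofit I d) \<le> 7 * (\<Sum>d\<in>select (iconflict I) J K K. iprofit I d)"
    by (intro approximation[OF K_def ilayer_power]) auto
  then show "(1 - (14 / 15) ^ b) * opt_profit I \<le> 7 * total_profit I (selected G K)"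
    using Opt(2) by (simp add: total_profit_def iprofit_def sel)
qed

end

end

section \<open>Local computations\<close>

lemma polyp_accessors [intro]: "polyp S \<Longrightarrow> polyp (PROC S)" "polyp S \<Longrightarrow> polyp (REGS S)" "polyp S \<Longrightarrow> polyp (RECS S)"
  by (auto simp: PROC_def REGS_def RECS_def)

lemma polyp_UPDATE:
  assumes "polyp a" "\<And>k e. f k = Some e \<Longrightarrow> polyp e" shows "polyp (UPDATE a f)"
  unfolding UPDATE_def by (rule polyp_LIST) (use assms in \<open>auto split: option.split\<close>)

lemma polyon_UPDATE:
  assumes "psz X" "polyp a" "\<And>k e. f k = Some e \<Longrightarrow> polyon X e" shows "polyon X (UPDATE a f)"
proof -
  have "polyon X (LIST es)" if "\<forall>e\<in>set es. polyon X e" for es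
    using that by (induction es) (auto simp: LIST_def intro: polyon_Pair polyon_Empty)
  note L = this
  have "polyon X (FIELD k a)" for k by (rule polypD[OF polyp_FIELD[OF assms(2)] assms(1)])
  then show ?thesis
    unfolding UPDATE_def by (intro L ballI) (use assms(3) in \<open>auto split: option.split\<close>)
qed

lemmas polyp_intros = polyp_Var polyp_Numeral polyp_Empty polyp_Pair polyp_Head polyp_Tail polyp_ops polyp_Cond
  polyp_Bind polyp_lift polyp_REV polyp_APP polyp_FLATMAP polyp_MAP polyp_FILTER polyp_SUMP polyp_COUNT polyp_EXISTS
  polyp_bool polyp_MEM polyp_IS_PAIR polyp_FIELD polyp_LIST_Nil polyp_LIST_Cons polyp_ZIP polyp_SQUARE polyp_ROUTE
  polyp_LAYER polyp_CRITICAL polyp_BUILD polyp_accessors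

lemma polyp_START: "polyp START"
  unfolding START_def by (intro polyp_intros)

lemma polyp_NEXT_STEP: "polyp R \<Longrightarrow> polyp (NEXT_STEP b R)"
  unfolding NEXT_STEP_def Let_def by (intro polyp_intros)

lemma polyp_NEXT_ROUND: "polyp R \<Longrightarrow> polyp (NEXT_ROUND R)"
  unfolding NEXT_ROUND_def by (intro polyp_intros)

lemma polyp_NEXT_SELECT: "polyp R \<Longrightarrow> polyp (NEXT_SELECT R)"
  unfolding NEXT_SELECT_def by (intro polyp_intros)

lemma polyp_UNSAT: "polyp R \<Longrightarrow> polyp a \<Longrightarrow> polyp (UNSAT R a)"
  unfolding UNSAT_def by (intro polyp_intros)

lemma polyp_CONFLICT: "polyp a \<Longrightarrow> polyp c \<Longrightarrow> polyp (CONFLICT a c)"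
  unfolding CONFLICT_def by (intro polyp_intros)

lemma polyp_ADJACENT: "polyp R \<Longrightarrow> polyp a \<Longrightarrow> polyp c \<Longrightarrow> polyp (ADJACENT R a c)"
  unfolding ADJACENT_def by (intro polyp_intros polyp_UNSAT polyp_CONFLICT)

lemma polyp_VISIBLE: "polyp VISIBLE"
  unfolding VISIBLE_def by (intro polyp_intros)

lemma polyp_SETUP_INPUT: "polyp SETUP_INPUT"
  by (intro polyp_intros polyp_ADJACENT)

lemma polyp_CHUNK: "polyp z \<Longrightarrow> polyp a \<Longrightarrow> polyp (CHUNK z a)"
  unfolding CHUNK_def by (intro polyp_intros)

lemma polyp_CHOSEN: "polyp R \<Longrightarrow> polyp a \<Longrightarrow> polyp (CHOSEN R a)"
  unfolding CHOSEN_def by (intro polyp_intros polyp_UNSAT)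

lemma polyp_WEIGHT: "polyp a \<Longrightarrow> polyp c \<Longrightarrow> polyp (WEIGHT a c)"
  unfolding WEIGHT_def by (intro polyp_intros)

lemma polyp_SELECT: "polyp SELECT"
  unfolding SELECT_def
  by (intro polyp_MAP polyp_accessors polyp_Var polyp_UPDATE)
    (simp split: if_splits, hypsubst, intro polyp_intros polyp_CONFLICT)

lemma polyp_DECIDE: "polyp DECIDE"
  unfolding DECIDE_def by (intro polyp_intros)

lemma pbd_le_pair: "pbd X h \<Longrightarrow> (\<And>s env. (s, env) \<in> X \<Longrightarrow> f (s, env) \<le> h (s, env)) \<Longrightarrow> pbd X f"
  by (erule pbd_le) auto

definition poly_fun :: "(nat \<Rightarrow> nat) \<Rightarrow> bool" where
  "poly_fun B \<longleftrightarrow> (\<exists>k. \<forall>s. B s \<le> (s + 2) ^ k)"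

lemma poly_funD: "poly_fun B \<Longrightarrow> pbd X (\<lambda>x. B (fst x))"
  by (auto simp: poly_fun_def pbd_def)

lemma psz_le:
  assumes "poly_fun B" "\<And>s env. (s, env) \<in> X \<Longrightarrow> sum_list (map vsize env) \<le> B s" shows "psz X"
  unfolding psz_def by (rule pbd_le_pair[OF poly_funD[OF assms(1)]]) (simp add: assms(2))

lemma poly_fun_intros:
  "poly_fun (\<lambda>_. c)" "poly_fun (\<lambda>s. s)" "poly_fun f \<Longrightarrow> poly_fun g \<Longrightarrow> poly_fun (\<lambda>s. f s + g s)"
  "poly_fun f \<Longrightarrow> poly_fun g \<Longrightarrow> poly_fun (\<lambda>s. f s * g s)" "poly_fun f \<Longrightarrow> poly_fun (\<lambda>s. f s ^ k)"
proof -
  have *: "poly_fun f \<longleftrightarrow> pbd (UNIV :: (nat \<times> nat) set) (\<lambda>x. f (fst x))" for f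
    by (auto simp: poly_fun_def pbd_def)
  show "poly_fun (\<lambda>_. c)" "poly_fun (\<lambda>s. s)" unfolding * by (simp_all add: eta_contract_eq)
  show "poly_fun f \<Longrightarrow> poly_fun g \<Longrightarrow> poly_fun (\<lambda>s. f s + g s)" unfolding * by (rule pbd_add)
  show "poly_fun f \<Longrightarrow> poly_fun g \<Longrightarrow> poly_fun (\<lambda>s. f s * g s)" unfolding * by (rule pbd_mult)
  show "poly_fun f \<Longrightarrow> poly_fun (\<lambda>s. f s ^ k)" unfolding * by (rule pbd_power)
qed

text \<open>
  The programs of \<open>M\<close> are cheap only on the values that occur in its runs. The predicates below
  collect, for an environment of a caller, the calls of \<open>M\<close> whose cost has to be bounded.
\<close>

locale bounded_calls =
  fixes M :: dist_alg and B :: "nat \<Rightarrow> nat"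
  assumes B: "poly_fun B"
begin

lemmas pbd_B = poly_funD[OF B]

definition decided_ok :: "nat \<Rightarrow> val \<Rightarrow> bool" where
  "decided_ok s v \<longleftrightarrow> (\<forall>x\<in>set (velems v). cost (decide M) [field_of 8 x] \<le> B s)"

definition coins_ok :: "nat \<Rightarrow> val \<Rightarrow> bool" where
  "coins_ok s v \<longleftrightarrow> (\<forall>x\<in>set (velems v). (\<nexists>a b. vhd x = VCons a b) \<longrightarrow> cost (coins M) [field_of 8 (vtl x)] \<le> B s)"

definition setup_ok :: "nat \<Rightarrow> val list \<Rightarrow> bool" where
  "setup_ok s env \<longleftrightarrow> (\<forall>x\<in>set (velems (eval (RECS (Var 1)) env)). cost (start M) [eval SETUP_INPUT (x # env)] \<le> B s)"

definition raise_ok :: "nat \<Rightarrow> val list \<Rightarrow> bool" where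
  "raise_ok s env \<longleftrightarrow> decided_ok s (eval (Var 0) env) \<and> decided_ok s (eval (RECS (Var 1)) env)"

definition inbox_ok :: "nat \<Rightarrow> prog \<Rightarrow> prog \<Rightarrow> prog \<Rightarrow> val list \<Rightarrow> bool" where
  "inbox_ok s R l a env \<longleftrightarrow> (\<forall>y\<in>set (velems (eval l env)). (\<nexists>a b. vhd y = VCons a b) \<longrightarrow>
     eval (ADJACENT (up R) (Tail (Var 0)) (up a)) (y # env) \<noteq> VNil \<longrightarrow>
     cost (send M) [field_of 8 (vtl y), field_of 0 (eval a env)] \<le> B s)"

definition simulate_ok :: "nat \<Rightarrow> val list \<Rightarrow> bool" where
  "simulate_ok s env \<longleftrightarrow> raise_ok s env \<and> (let DV = eval (DECIDED M (Var 0)) env;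
     DO = eval (DECIDED M (RECS (Var 2))) (DV # env);
     Z = eval (ZIP (TAGS M (Var 0)) (Var 5)) (DO # DV # env) in coins_ok s DO \<and>
     (\<forall>x\<in>set (velems DO). (\<nexists>a b. vhd x = VCons a b) \<longrightarrow>
       inbox_ok s (REGS (Var 5)) (Var 3) (Tail (Var 0)) (x # Z # DO # DV # env) \<and>
       cost (recv M) [field_of 8 (vtl x),
         eval (INBOX M (REGS (Var 5)) (Var 3) (Tail (Var 0))) (x # Z # DO # DV # env),
         eval (CHUNK (Var 1) (Tail (Var 0))) (x # Z # DO # DV # env)] \<le> B s))"

definition recv_ok :: "nat \<Rightarrow> val list \<Rightarrow> bool" where
  "recv_ok s env \<longleftrightarrow> (let env' = eval VISIBLE env # env in
     eval (Equal (FIELD 0 (REGS (Var 1))) (Numeral 0)) env' \<noteq> VNil \<longrightarrow>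
       (if eval (Equal (FIELD 1 (REGS (Var 1))) (Numeral 0)) env' \<noteq> VNil then setup_ok s env'
        else if eval (Less (FIELD 7 (REGS (Var 1))) (FIELD 1 (REGS (Var 1)))) env' \<noteq> VNil then raise_ok s env'
        else simulate_ok s env'))"

lemma polyon_DECIDED:
  assumes "psz X" "polyon X l" "\<And>s env. (s, env) \<in> X \<Longrightarrow> decided_ok s (eval l env)"
  shows "polyon X (DECIDED M l)"
  unfolding DECIDED_def
proof (intro polyon_MAP assms(1,2) polyon_Pair polyon_call1)
  have Y: "psz (extend X (\<lambda>env. set (velems (eval l env))))" by (rule psz_elems[OF assms(1,2)])
  show "polyon (extend X (\<lambda>env. set (velems (eval l env)))) (FIELD 8 (Var 0))"
    by (rule polypD[OF _ Y]) (intro polyp_intros)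
  show "polyon (extend X (\<lambda>env. set (velems (eval l env)))) (Var 0)" by (rule polyon_Var[OF Y])
  show "pbd (extend X (\<lambda>env. set (velems (eval l env)))) (\<lambda>x. cost (decide M) [eval (FIELD 8 (Var 0)) (snd x)])"
    by (rule pbd_le_pair[OF pbd_B]) (use assms(3) in \<open>auto simp: extend_def decided_ok_def\<close>)
qed

lemma polyon_TAGS:
  assumes "psz X" "polyon X l" "\<And>s env. (s, env) \<in> X \<Longrightarrow> coins_ok s (eval l env)"
  shows "polyon X (TAGS M l)"
proof -
  let ?Y = "extend X (\<lambda>env. set (velems (eval l env)))"
  let ?Z = "{x \<in> ?Y. eval (IS_PAIR (Head (Var 0))) (snd x) = VNil}"
  have Y: "psz ?Y" by (rule psz_elems[OF assms(1,2)])
  then have Z: "psz ?Z" by (rule psz_mono) blast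
  have c: "polyon ?Z (call1 (coins M) (FIELD 8 (Tail (Var 0))))"
  proof (rule polyon_call1)
    show "polyon ?Z (FIELD 8 (Tail (Var 0)))" by (rule polypD[OF _ Z]) (intro polyp_intros)
    show "pbd ?Z (\<lambda>x. cost (coins M) [eval (FIELD 8 (Tail (Var 0))) (snd x)])"
      by (rule pbd_le_pair[OF pbd_B]) (use assms(3) in \<open>auto simp: extend_def coins_ok_def\<close>)
  qed
  show ?thesis unfolding TAGS_def
  proof (intro polyon_FLATMAP assms(1,2) polyon_Cond polyon_MAP[OF Z c])
    show "polyon ?Y (IS_PAIR (Head (Var 0)))" by (rule polypD[OF _ Y]) (intro polyp_intros)
    show "polyon (extend ?Z (\<lambda>env. set (velems (eval (call1 (coins M) (FIELD 8 (Tail (Var 0)))) env))))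
      (FIELD 0 (Tail (Var 1)))"
      by (rule polypD[OF _ psz_elems[OF Z c]]) (intro polyp_intros)
  qed (rule polyon_Empty)
qed

lemma polyon_INBOX:
  assumes "psz X" "polyp R" "polyp l" "polyp a" "\<And>s env. (s, env) \<in> X \<Longrightarrow> inbox_ok s R l a env"
  shows "polyon X (INBOX M R l a)"
proof -
  have l: "polyon X l" by (rule polypD[OF assms(3,1)])
  let ?c = "AND (NOT (IS_PAIR (Head (Var 0)))) (ADJACENT (up R) (Tail (Var 0)) (up a))"
  let ?Y = "extend X (\<lambda>env. set (velems (eval l env)))"
  let ?Z = "{x \<in> ?Y. eval ?c (snd x) \<noteq> VNil}"
  have Y: "psz ?Y" by (rule psz_elems[OF assms(1) l])
  then have Z: "psz ?Z" by (rule psz_mono) blast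
  show ?thesis unfolding INBOX_def
  proof (intro polyon_FLATMAP assms(1) l polyon_Cond polyon_Pair polyon_call2 polyon_Empty)
    show "polyon ?Y ?c" by (rule polypD[OF _ Y]) (intro polyp_intros polyp_ADJACENT assms)
    show "polyon ?Z (FIELD 0 (Tail (Var 0)))" "polyon ?Z (FIELD 8 (Tail (Var 0)))" "polyon ?Z (FIELD 0 (up a))"
      by (rule polypD[OF _ Z], intro polyp_intros assms)+
    show "pbd ?Z (\<lambda>x. cost (send M) [eval (FIELD 8 (Tail (Var 0))) (snd x), eval (FIELD 0 (up a)) (snd x)])"
      by (rule pbd_le_pair[OF pbd_B])
        (use assms(5) in \<open>auto simp: extend_def inbox_ok_def split: if_splits\<close>)
  qed
qed

lemma polyon_SETUP:
  assumes "psz X" "\<And>s env. (s, env) \<in> X \<Longrightarrow> setup_ok s env"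
  shows "polyon X (SETUP M)"
proof -
  let ?Y = "extend X (\<lambda>env. set (velems (eval (RECS (Var 1)) env)))"
  have l: "polyon X (RECS (Var 1))" by (rule polypD[OF _ assms(1)]) (intro polyp_intros)
  have Y: "psz ?Y" by (rule psz_elems[OF assms(1) l])
  have "polyon ?Y (call1 (start M) SETUP_INPUT)"
  proof (rule polyon_call1[OF polypD[OF polyp_SETUP_INPUT Y]])
    show "pbd ?Y (\<lambda>x. cost (start M) [eval SETUP_INPUT (snd x)])"
      by (rule pbd_le_pair[OF pbd_B]) (use assms(2) in \<open>fastforce simp: extend_def setup_ok_def simp del: eval_LIST\<close>)
  qed
  then show ?thesis unfolding SETUP_def
    by (intro polyon_MAP assms(1) l polyon_UPDATE Y polyp_Var) (simp split: if_splits)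
qed

lemma psz_decided:
  assumes "psz X" "\<And>s env. (s, env) \<in> X \<Longrightarrow> raise_ok s env"
  shows "polyon X (DECIDED M (Var 0))"
    "polyon (extend X (\<lambda>env. {eval (DECIDED M (Var 0)) env})) (DECIDED M (RECS (Var 2)))"
proof -
  show *: "polyon X (DECIDED M (Var 0))"
    by (rule polyon_DECIDED[OF assms(1) polyon_Var[OF assms(1)]]) (use assms(2) in \<open>simp add: raise_ok_def\<close>)
  have Y: "psz (extend X (\<lambda>env. {eval (DECIDED M (Var 0)) env}))" by (rule psz_bind[OF assms(1) *])
  show "polyon (extend X (\<lambda>env. {eval (DECIDED M (Var 0)) env})) (DECIDED M (RECS (Var 2)))"
  proof (rule polyon_DECIDED[OF Y])
    show "polyon (extend X (\<lambda>env. {eval (DECIDED M (Var 0)) env})) (RECS (Var 2))"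
      by (rule polypD[OF _ Y]) (intro polyp_intros)
    fix s env' assume "(s, env') \<in> extend X (\<lambda>env. {eval (DECIDED M (Var 0)) env})"
    then obtain v env where e: "(s, env) \<in> X" "env' = v # env" by (auto simp: extend_def)
    have "eval (RECS (Var 2)) env' = eval (RECS (Var 1)) env" by (simp add: e(2) RECS_def numeral_2_eq_2)
    with assms(2)[OF e(1)] show "decided_ok s (eval (RECS (Var 2)) env')"
      by (simp only: raise_ok_def)
  qed
qed

lemma polyon_RAISE:
  assumes "psz X" "\<And>s env. (s, env) \<in> X \<Longrightarrow> raise_ok s env"
  shows "polyon X (RAISE M)"
proof -
  have D: "polyon X (DECIDED M (Var 0))"
    "polyon (extend X (\<lambda>env. {eval (DECIDED M (Var 0)) env})) (DECIDED M (RECS (Var 2)))"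
    by (rule psz_decided[OF assms(1)], rule assms(2), assumption)+
  note Y = psz_bind[OF assms(1) D(1)]
  show ?thesis unfolding RAISE_def
  proof (rule polyon_Bind[OF D(1)], rule polyon_MAP[OF Y D(2)], rule polypD[OF _ psz_elems[OF Y D(2)]], rule polyp_UPDATE)
    show "polyp (Tail (Var 0))" by (intro polyp_intros)
  qed (simp split: if_splits; hypsubst; intro polyp_intros polyp_CHOSEN polyp_WEIGHT)
qed

lemma polyon_SIMULATE:
  assumes "psz X" "\<And>s env. (s, env) \<in> X \<Longrightarrow> simulate_ok s env"
  shows "polyon X (SIMULATE M)"
proof -
  have r: "\<And>s env. (s, env) \<in> X \<Longrightarrow> raise_ok s env" using assms(2) by (simp add: simulate_ok_def)
  let ?DV = "\<lambda>env. eval (DECIDED M (Var 0)) env"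
  let ?DO = "\<lambda>env. eval (DECIDED M (RECS (Var 2))) env"
  let ?Z = "\<lambda>env. eval (ZIP (TAGS M (Var 0)) (Var 5)) env"
  have D1: "polyon X (DECIDED M (Var 0))" by (rule psz_decided(1)[OF assms(1)], rule r, assumption)
  let ?X1 = "extend X (\<lambda>env. {?DV env})"
  have X1: "psz ?X1" by (rule psz_bind[OF assms(1) D1])
  have D2: "polyon ?X1 (DECIDED M (RECS (Var 2)))" by (rule psz_decided(2)[OF assms(1)], rule r, assumption)
  let ?X2 = "extend ?X1 (\<lambda>env. {?DO env})"
  have X2: "psz ?X2" by (rule psz_bind[OF X1 D2])
  have T: "polyon ?X2 (TAGS M (Var 0))"
  proof (rule polyon_TAGS[OF X2 polyon_Var[OF X2]])
    fix s env assume "(s, env) \<in> ?X2"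
    then obtain e0 where "(s, e0) \<in> X" "env = ?DO (?DV e0 # e0) # ?DV e0 # e0" by (auto simp: extend_def)
    with assms(2)[of s e0] show "coins_ok s (eval (Var 0) env)" by (simp add: simulate_ok_def Let_def)
  qed
  have Z: "polyon ?X2 (ZIP (TAGS M (Var 0)) (Var 5))" by (rule polyon_ZIP[OF X2 T polyon_Var[OF X2]])
  let ?X3 = "extend ?X2 (\<lambda>env. {?Z env})"
  have X3: "psz ?X3" by (rule psz_bind[OF X2 Z])
  let ?X4 = "extend ?X3 (\<lambda>env. set (velems (eval (Var 1) env)))"
  have X4: "psz ?X4" by (rule psz_elems[OF X3 polyon_Var[OF X3]])
  let ?X5 = "{x \<in> ?X4. eval (IS_PAIR (Head (Var 0))) (snd x) = VNil}"
  have X5: "psz ?X5" by (rule psz_mono[OF X4]) blast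
  have ok: "inbox_ok s (REGS (Var 5)) (Var 3) (Tail (Var 0)) env \<and> cost (recv M) [eval (FIELD 8 (Tail (Var 0))) env,
         eval (INBOX M (REGS (Var 5)) (Var 3) (Tail (Var 0))) env,
         eval (CHUNK (Var 1) (Tail (Var 0))) env] \<le> B s" if h: "(s, env) \<in> ?X5" for s env
  proof -
    from h obtain e0 x where e0: "(s, e0) \<in> X" "env = x # ?Z (?DO (?DV e0 # e0) # ?DV e0 # e0) # ?DO (?DV e0 # e0) # ?DV e0 # e0"
      "x \<in> set (velems (?DO (?DV e0 # e0)))" "\<nexists>a b. vhd x = VCons a b" by (auto simp: extend_def)
    have f: "eval (FIELD 8 (Tail (Var 0))) env = field_of 8 (vtl x)" by (simp add: e0(2))
    from assms(2)[OF e0(1)] e0(3,4) show ?thesis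
      unfolding f unfolding simulate_ok_def Let_def e0(2) by blast
  qed
  have I: "polyon ?X5 (INBOX M (REGS (Var 5)) (Var 3) (Tail (Var 0)))"
    by (rule polyon_INBOX[OF X5]) ((intro polyp_intros)+, use ok in blast)
  show ?thesis unfolding SIMULATE_def
  proof (intro polyon_Bind D1 D2 Z polyon_MAP X3 polyon_Cond polyon_UPDATE X5)
    show "polyon ?X3 (Var 1)" by (rule polyon_Var[OF X3])
    show "polyon ?X4 (IS_PAIR (Head (Var 0)))" by (rule polypD[OF _ X4]) (intro polyp_intros)
    show "polyon {x \<in> ?X4. eval (IS_PAIR (Head (Var 0))) (snd x) \<noteq> VNil} (Tail (Var 0))"
      by (rule polyon_mono[OF polypD[OF _ X4]]) (intro polyp_intros, blast)
    show "polyp (Tail (Var 0))" by (intro polyp_intros)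
    let ?call = "call3 (recv M) (FIELD 8 (Tail (Var 0)))
        (INBOX M (REGS (Var 5)) (Var 3) (Tail (Var 0))) (CHUNK (Var 1) (Tail (Var 0)))"
    have c: "polyon ?X5 (call3 (recv M) (FIELD 8 (Tail (Var 0)))
        (INBOX M (REGS (Var 5)) (Var 3) (Tail (Var 0))) (CHUNK (Var 1) (Tail (Var 0))))"
    proof (intro polyon_call3 I)
      show "polyon ?X5 (FIELD 8 (Tail (Var 0)))" "polyon ?X5 (CHUNK (Var 1) (Tail (Var 0)))"
        by (rule polypD[OF _ X5], intro polyp_intros polyp_CHUNK)+
      show "pbd ?X5 (\<lambda>x. cost (recv M) [eval (FIELD 8 (Tail (Var 0))) (snd x),
         eval (INBOX M (REGS (Var 5)) (Var 3) (Tail (Var 0))) (snd x),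
         eval (CHUNK (Var 1) (Tail (Var 0))) (snd x)])"
        by (rule pbd_le_pair[OF pbd_B]) (unfold snd_conv fst_conv, use ok in blast)
    qed
    show "polyon ?X5 e" if h: "[8 \<mapsto> ?call] k = Some e" for k :: nat and e
    proof -
      have "e = ?call" using h by (simp split: if_splits)
      with c show ?thesis by (simp only:)
    qed
  qed
qed

lemma polyon_RECV:
  assumes "psz X" "\<And>s env. (s, env) \<in> X \<Longrightarrow> recv_ok s env"
  shows "polyon X (RECV M b)"
proof -
  have V: "polyon X VISIBLE" by (rule polypD[OF polyp_VISIBLE assms(1)])
  let ?W = "extend X (\<lambda>env. {eval VISIBLE env})"
  have Y: "psz ?W" by (rule psz_bind[OF assms(1) V])
  let ?A = "Equal (FIELD 0 (REGS (Var 1))) (Numeral 0)" and ?B = "Equal (FIELD 1 (REGS (Var 1))) (Numeral 0)"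
    and ?C = "Less (FIELD 7 (REGS (Var 1))) (FIELD 1 (REGS (Var 1)))"
  let ?Q = "{x \<in> ?W. eval ?A (snd x) = VNil}"
  let ?Y1 = "{x \<in> ?W. eval ?A (snd x) \<noteq> VNil}"
  let ?Y2 = "{x \<in> ?Y1. eval ?B (snd x) \<noteq> VNil}"
  let ?Y3 = "{x \<in> ?Y1. eval ?B (snd x) = VNil}"
  let ?Y4 = "{x \<in> ?Y3. eval ?C (snd x) \<noteq> VNil}"
  let ?Y5 = "{x \<in> ?Y3. eval ?C (snd x) = VNil}"
  have p: "psz ?Q" "psz ?Y1" "psz ?Y2" "psz ?Y3" "psz ?Y4" "psz ?Y5" by (rule psz_mono[OF Y], blast)+
  have ok: "eval ?A env' \<noteq> VNil \<longrightarrow>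
       (if eval ?B env' \<noteq> VNil then setup_ok s env'
        else if eval ?C env' \<noteq> VNil then raise_ok s env' else simulate_ok s env')" if h: "(s, env') \<in> ?W" for s env'
  proof -
    from h obtain env where "(s, env) \<in> X" "env' = eval VISIBLE env # env" by (auto simp: extend_def)
    with assms(2)[of s env] show ?thesis unfolding recv_ok_def Let_def by simp
  qed
  have R: "polyp (REGS (Var 1))" by (intro polyp_intros)
  show ?thesis unfolding RECV_def
  proof (intro polyon_Bind V polyon_Pair polyon_Cond)
    show "polyon ?W (PROC (Var 1))" by (rule polypD[OF _ Y]) (intro polyp_intros)
    show "polyon ?W ?A" by (rule polypD[OF _ Y]) (intro polyp_intros)
    show "polyon ?Y1 ?B" by (rule polypD[OF _ p(2)]) (intro polyp_intros)
    show "polyon ?Y3 ?C" by (rule polypD[OF _ p(4)]) (intro polyp_intros)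
    show "polyon ?Y2 (NEXT_ROUND (REGS (Var 1)))" by (rule polypD[OF polyp_NEXT_ROUND[OF R] p(3)])
    show "polyon ?Y5 (NEXT_ROUND (REGS (Var 1)))" by (rule polypD[OF polyp_NEXT_ROUND[OF R] p(6)])
    show "polyon ?Y4 (NEXT_STEP b (REGS (Var 1)))" by (rule polypD[OF polyp_NEXT_STEP[OF R] p(5)])
    show "polyon ?Q (NEXT_SELECT (REGS (Var 1)))" by (rule polypD[OF polyp_NEXT_SELECT[OF R] p(1)])
    show "polyon ?Q SELECT" by (rule polypD[OF polyp_SELECT p(1)])
    show "polyon ?Y2 (SETUP M)"
    proof (rule polyon_SETUP[OF p(3)])
      fix s env assume "(s, env) \<in> ?Y2"
      then have "(s, env) \<in> ?W" "eval ?A env \<noteq> VNil" "eval ?B env \<noteq> VNil" unfolding mem_Collect_eq snd_conv by blast+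
      with ok[of s env] show "setup_ok s env" by argo
    qed
    show "polyon ?Y4 (RAISE M)"
    proof (rule polyon_RAISE[OF p(5)])
      fix s env assume "(s, env) \<in> ?Y4"
      then have "(s, env) \<in> ?W" "eval ?A env \<noteq> VNil" "eval ?B env = VNil" "eval ?C env \<noteq> VNil" unfolding mem_Collect_eq snd_conv by blast+
      with ok[of s env] show "raise_ok s env" by argo
    qed
    show "polyon ?Y5 (SIMULATE M)"
    proof (rule polyon_SIMULATE[OF p(6)])
      fix s env assume "(s, env) \<in> ?Y5"
      then have "(s, env) \<in> ?W" "eval ?A env \<noteq> VNil" "eval ?B env = VNil" "eval ?C env = VNil" unfolding mem_Collect_eq snd_conv by blast+
      with ok[of s env] show "simulate_ok s env" by argo
    qed
  qed
qed

lemma polyon_COINS: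
  assumes "psz X"
    and "\<And>s env. (s, env) \<in> X \<Longrightarrow> eval SIMULATING env \<noteq> VNil \<Longrightarrow>
       decided_ok s (eval (RECS (Var 0)) env) \<and> coins_ok s (eval (DECIDED M (RECS (Var 0))) env)"
  shows "polyon X (COINS M)"
proof -
  let ?A = "SIMULATING"
  let ?Y = "{x \<in> X. eval ?A (snd x) \<noteq> VNil}"
  have Y: "psz ?Y" by (rule psz_mono[OF assms(1)]) blast
  have D: "polyon ?Y (DECIDED M (RECS (Var 0)))"
  proof (rule polyon_DECIDED[OF Y polypD[OF _ Y]])
    show "decided_ok s (eval (RECS (Var 0)) env)" if h: "(s, env) \<in> ?Y" for s env
    proof -
      from h have "(s, env) \<in> X" "eval ?A env \<noteq> VNil" unfolding mem_Collect_eq snd_conv by blast+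
      with assms(2) show ?thesis by blast
    qed
  qed (intro polyp_intros)
  show ?thesis unfolding COINS_def
  proof (intro polyon_Cond polyon_TAGS Y D polyon_Empty)
    show "polyon X ?A" by (rule polypD[OF _ assms(1)]) (intro polyp_intros)
    show "coins_ok s (eval (DECIDED M (RECS (Var 0))) env)" if h: "(s, env) \<in> ?Y" for s env
    proof -
      from h have "(s, env) \<in> X" "eval ?A env \<noteq> VNil" unfolding mem_Collect_eq snd_conv by blast+
      with assms(2) show ?thesis by blast
    qed
  qed
qed

end

lemma local_cost_bounded_mono:
  assumes "local_cost_bounded k adj inp A R B" "B \<le> B'" shows "local_cost_bounded k adj inp A R B'"
proof -
  have "x \<le> B \<Longrightarrow> x \<le> B'" for x using assms(2) by simp
  then show ?thesis using assms(1) unfolding local_cost_bounded_def by simp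
qed

lemma set_toss: "set_pmf (toss k A \<sigma>) =
    PiE_dflt {..<k} [] (\<lambda>p. {bs. length bs = length (velems (eval (coins A) [\<sigma> p]))})"
proof -
  have *: "set_pmf (pmf_of_set {bs :: bool list. length bs = j}) = {bs. length bs = j}" for j
    by (rule set_pmf_of_set) (rule finite_bool_lists)+
  show ?thesis unfolding toss_def by (subst set_Pi_pmf) (simp_all add: comp_def *)
qed

lemma sum_list_le_length: "(\<And>x. x \<in> set xs \<Longrightarrow> f x \<le> (c :: nat)) \<Longrightarrow> (\<Sum>x\<leftarrow>xs. f x) \<le> length xs * c"
proof (induction xs)
  case (Cons x xs)
  then have "(\<Sum>x\<leftarrow>xs. f x) \<le> length xs * c" "f x \<le> c" by simp_all
  then show ?case by simp
qed simp

lemma vsize_vlist_map_le: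
  assumes "\<And>x. x \<in> set xs \<Longrightarrow> vsize (f x) \<le> c" "length xs \<le> k"
  shows "vsize (vlist (map f xs)) \<le> 1 + k * (1 + c)"
proof -
  have "(\<Sum>x\<leftarrow>xs. 1 + vsize (f x)) \<le> length xs * (1 + c)"
    by (rule sum_list_le_length) (use assms(1) in simp)
  also have "\<dots> \<le> k * (1 + c)" by (rule mult_le_mono1[OF assms(2)])
  finally show ?thesis unfolding vsize_vlist map_map comp_def by simp
qed

section \<open>Sizes and costs along reachable configurations\<close>

locale costed = setting I b + bounded_calls M B for I b M B +
  fixes tm :: nat
  assumes cost: "\<And>adj. simple_graph (num_procs I * num_trees I) adj \<Longrightarrow>
    local_cost_bounded (num_procs I * num_trees I) adj (mis_input (num_procs I * num_trees I) adj) M tm (B (problem_size I))"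
begin

abbreviation "s0 \<equiv> problem_size I"
abbreviation "simulation e lh \<equiv> run (m * r) (cgraph e lh) (mis_input (m * r) (cgraph e lh)) M"
abbreviation "scheduled \<equiv> run m (communicate I) (proc_input I tm) (scheduler M b)"

lemmas mis_cost = cost[OF cgraph_simple, unfolded local_cost_bounded_def]
lemmas mis_cost_rounds = mis_cost[THEN conjunct2, THEN conjunct2, rule_format]

lemma mis_start: "x < m * r \<Longrightarrow> cost (start M) [mis_input (m * r) (cgraph e lh) x] \<le> B s0"
  by (rule mis_cost[THEN conjunct1, rule_format])

lemma mis_decide: "t \<le> tm \<Longrightarrow> \<sigma> \<in> set_pmf (simulation e lh t) \<Longrightarrow> x < m * r \<Longrightarrow> cost (decide M) [\<sigma> x] \<le> B s0"
  by (rule mis_cost[THEN conjunct2, THEN conjunct1, rule_format])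

lemma mis_round:
  assumes "t < tm" "\<sigma> \<in> set_pmf (simulation e lh t)" "x < m * r" "\<not> halted M (\<sigma> x)"
  shows "cost (coins M) [\<sigma> x] \<le> B s0" "y < m * r \<Longrightarrow> cgraph e lh x y \<Longrightarrow> cost (send M) [\<sigma> x, vnat y] \<le> B s0"
    "\<omega> \<in> set_pmf (toss (m * r) M \<sigma>) \<Longrightarrow>
      cost (recv M) [\<sigma> x, inbox (m * r) (cgraph e lh) M \<sigma> x, vcoins (\<omega> x)] \<le> B s0"
  by (rule mis_cost_rounds[OF assms, THEN conjunct1],
      rule mis_cost_rounds[OF assms, THEN conjunct2, THEN conjunct1, rule_format], assumption+,
      rule mis_cost_rounds[OF assms, THEN conjunct2, THEN conjunct2, rule_format], assumption)

text \<open>Every state has been computed by a program of bounded cost, and the size of a value is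
  at most the cost of computing it.\<close>

lemma mis_state:
  "t \<le> tm \<Longrightarrow> \<sigma> \<in> set_pmf (simulation e lh t) \<Longrightarrow> x < m * r \<Longrightarrow> vsize (\<sigma> x) \<le> B s0"
proof (induction t arbitrary: \<sigma>)
  case 0
  then show ?case using order_trans[OF vsize_eval_le_cost mis_start] by simp
next
  case (Suc t)
  then obtain \<sigma>' \<omega> where *: "\<sigma>' \<in> set_pmf (simulation e lh t)" "\<omega> \<in> set_pmf (toss (m * r) M \<sigma>')"
    "\<sigma> = advance (m * r) (cgraph e lh) M \<sigma>' \<omega>" by auto
  show ?case
  proof (cases "halted M (\<sigma>' x)")
    case True
    with * Suc show ?thesis by (simp add: advance_def)
  next
    case False
    have "cost (recv M) [\<sigma>' x, inbox (m * r) (cgraph e lh) M \<sigma>' x, vcoins (\<omega> x)] \<le> B s0"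
      by (rule mis_round(3)[OF _ *(1) _ False *(2)]) (use Suc.prems in auto)
    with order_trans[OF vsize_eval_le_cost this] False Suc.prems(3) show ?thesis by (simp add: *(3) advance_def)
  qed
qed

text \<open>The invariant of reachable configurations: while a step is being simulated, the vertex
  states come from a genuine run on the current conflict graph. The summand 1 provides for the empty
  state between two simulations.\<close>

definition shape :: "nat \<Rightarrow> nat \<Rightarrow> nat \<Rightarrow> (nat \<times> nat \<Rightarrow> real) \<Rightarrow> (nat \<Rightarrow> val) \<Rightarrow> (nat \<times> nat \<Rightarrow> val)
    \<Rightarrow> (nat \<times> nat \<Rightarrow> val) \<Rightarrow> bool" where
  "shape ph t e lh \<sigma> rd sl \<longleftrightarrow> (\<forall>d. vsize (rd d) \<le> 1 \<and> vsize (sl d) \<le> 1) \<and> (\<forall>d\<in>D. vsize (\<sigma> (nm d)) \<le> B s0 + 1) \<and>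
     (ph = 0 \<and> t \<noteq> 0 \<longrightarrow> t \<le> Suc tm \<and> \<sigma> \<in> set_pmf (simulation e lh (t - 1)))"

lemma process_rd: "G \<in> set_pmf (process M tm e) \<Longrightarrow> vsize (snd G d) \<le> 1"
  by (induction e arbitrary: G) (auto simp: proc_update_def)

definition shaped :: "(nat \<Rightarrow> val) \<Rightarrow> bool" where
  "shaped c \<longleftrightarrow> (\<exists>ph t s e lh \<sigma> rd sl. c = config tm (registers I b tm ph t s e) lh (\<lambda>d. \<sigma> (nm d)) rd sl \<and> shape ph t e lh \<sigma> rd sl)"

lemma shapedI: "shape ph t e lh \<sigma> rd sl \<Longrightarrow> c = config tm (registers I b tm ph t s e) lh (\<lambda>d. \<sigma> (nm d)) rd sl \<Longrightarrow> shaped c"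
  unfolding shaped_def by blast

text \<open>Dividing the time by \<open>tm + 2\<close> gives the step and the round within it; the
  last \<open>K\<close> rounds are those of the selection.\<close>

lemma reachable:
  assumes "t \<le> K * (tm + 3)" "c \<in> set_pmf (scheduled t)"
  shows "shaped c"
proof (cases "t < K * (tm + 2)")
  case True
  define e where "e = t div (tm + 2)"
  have e: "e < K" using True unfolding e_def by (simp add: less_mult_imp_div_less)
  have te: "t = e * (tm + 2) + t mod (tm + 2)" unfolding e_def by (rule div_mult_mod_eq[symmetric])
  show ?thesis
  proof (cases "t mod (tm + 2)")
    case 0
    then have "c \<in> set_pmf (map_pmf (start_config tm e) (process M tm e))"
      using run_process[where e = e and M = M and tm = tm] e te assms(2) by simp
    then obtain G where G: "G \<in> set_pmf (process M tm e)" "c = start_config tm e G" by auto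
    have "shape (if e = K then 1 else 0) 0 e (fst G) (\<lambda>_. VNil) (snd G) (\<lambda>_. VNil)"
      using process_rd[OF G(1)] by (simp add: shape_def)
    then show ?thesis by (rule shapedI) (simp only: G(2) start_config_def)
  next
    case (Suc t')
    have t': "t' \<le> tm" using Suc mod_less_divisor[of "tm + 2" t] by simp
    have "c \<in> set_pmf (bind_pmf (process M tm e) (\<lambda>G. map_pmf (mis_config tm e G t') (simulation e (fst G) t')))"
      using run_mis[OF run_process[where M = M and tm = tm] e t'] e te Suc assms(2) by simp
    then obtain G \<sigma> where G: "G \<in> set_pmf (process M tm e)" "\<sigma> \<in> set_pmf (simulation e (fst G) t')"
      "c = mis_config tm e G t' \<sigma>" by auto
    have "shape 0 (Suc t') e (fst G) \<sigma> (snd G) (\<lambda>_. VNil)"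
      using process_rd[OF G(1)] G(2) t' mis_state[OF t' G(2) nm_less] by (auto simp: shape_def le_SucI)
    then show ?thesis by (rule shapedI) (simp only: G(3) mis_config_def)
  qed
next
  case False
  define i where "i = t - K * (tm + 2)"
  have i: "t = K * (tm + 2) + i" "i \<le> K" using False assms(1) by (simp_all add: i_def algebra_simps)
  then have "c \<in> set_pmf (map_pmf (select_config tm i) (process M tm K))"
    using run_select[where i = i and M = M and tm = tm] assms(2) by simp
  then obtain G where G: "G \<in> set_pmf (process M tm K)" "c = select_config tm i G" by auto
  have "shape (if i = K then 2 else 1) 0 K (fst G) (\<lambda>_. VNil) (snd G) (\<lambda>d. vbool (d \<in> selected G i))"
    using process_rd[OF G(1)] by (simp add: shape_def)
  then show ?thesis by (rule shapedI) (simp only: G(2) select_config_def)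
qed

lemma size_bounds: "n \<le> s0" "m \<le> s0" "r \<le> s0"
  by (simp_all add: problem_size_def)

lemma length_own: "length (own I P) \<le> s0"
proof -
  have "length (own I P) \<le> r" using length_filter_le[of _ "[0..<r]"] by (simp add: own_def accessible_def)
  with size_bounds show ?thesis by linarith
qed

text \<open>The number 29 accounts for name, registers and list ends. A record costs 4 per edge of
  its route, at most 24 for six critical edges, and \<open>B s\<close> for the vertex state.\<close>

definition state_bound :: "nat \<Rightarrow> nat" where
  "state_bound s = 29 + s * (48 + 4 * s + B s)"

lemma vsize_state:
  assumes P: "P < m" and sh: "shape ph t e lh \<sigma> rd sl"
  shows "vsize (pstate I (registers I b tm ph t' s' e') lh (\<lambda>d. \<sigma> (nm d)) rd sl P) \<le> state_bound s0"
proof -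
  have "vsize (irecord I (lh d) (\<sigma> (nm d)) (rd d) (sl d) d) \<le> 47 + 4 * s0 + B s0" if "d \<in> set (own I P)" for d
  proof -
    have d: "d \<in> D" using that set_own P by blast
    interpret tree_table "itable I (snd d)" n using tree_table D_bounds d by blast
    have "Suc (length (itable I (snd d))) = n" using n_eq by (simp add: tree_vertices_def)
    moreover have "length (iroute I d) \<le> length (itable I (snd d))"
      unfolding iroute_def route_def by (rule length_filter_le)
    ultimately have "length (iroute I d) \<le> s0" using size_bounds(1) by linarith
    then have "vsize (vpairs (iroute I d)) \<le> 1 + s0 * (1 + 3)"
      by (intro vsize_vlist_map_le) (simp_all add: vpair_def)
    moreover have "vsize (vpairs (icritical I d)) \<le> 1 + 6 * (1 + 3)"
      using length_icritical[OF d] by (intro vsize_vlist_map_le) (simp_all add: vpair_def)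
    moreover have "vsize (\<sigma> (nm d)) \<le> B s0 + 1" "vsize (rd d) \<le> 1" "vsize (sl d) \<le> 1"
      using sh d unfolding shape_def by blast+
    ultimately show ?thesis by (simp add: irecord_def)
  qed
  then have "vsize (vlist (map (\<lambda>d. irecord I (lh d) (\<sigma> (nm d)) (rd d) (sl d) d) (own I P)))
      \<le> 1 + s0 * (1 + (47 + 4 * s0 + B s0))"
    by (rule vsize_vlist_map_le[OF _ length_own])
  then show ?thesis by (simp add: pstate_def registers_def state_bound_def add.assoc)
qed

lemma decided_vstates:
  assumes "t \<le> tm" "\<sigma> \<in> set_pmf (simulation e lh t)" "set ds \<subseteq> D"
  shows "decided_ok s0 (vstates lh (\<lambda>d. \<sigma> (nm d)) rd sl ds)"
  using mis_decide[OF assms(1,2) nm_less] assms(3) by (auto simp: decided_ok_def vstates_def)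

lemma coins_decided:
  assumes "t < tm" "\<sigma> \<in> set_pmf (simulation e lh t)" "set ds \<subseteq> D"
  shows "coins_ok s0 (vlist (map (\<lambda>d. VCons (eval (decide M) [\<sigma> (nm d)])
    (irecord I (lh d) (\<sigma> (nm d)) (rd d) (sl d) d)) ds))"
  using mis_round(1)[OF assms(1,2) nm_less] assms(3) by (auto simp: coins_ok_def halted_def)

lemma simulate_ok:
  assumes P: "P < m" and t: "t < tm" and \<sigma>: "\<sigma> \<in> set_pmf (simulation e lh t)" and bs: "length bs = length (tags I M \<sigma> P)"
  shows "simulate_ok s0 [vstates lh (\<lambda>d. \<sigma> (nm d)) rd sl (visible I P),
      pstate I (registers I b tm ph t' s e) lh (\<lambda>d. \<sigma> (nm d)) rd sl P, inb, vcoins bs]"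
proof -
  let ?rec = "\<lambda>d. irecord I (lh d) (\<sigma> (nm d)) (rd d) (sl d) d"
  let ?dec = "\<lambda>d. VCons (eval (decide M) [\<sigma> (nm d)]) (?rec d)"
  let ?V = "vstates lh (\<lambda>d. \<sigma> (nm d)) rd sl (visible I P)"
  let ?S = "pstate I (registers I b tm ph t' s e) lh (\<lambda>d. \<sigma> (nm d)) rd sl P"
  let ?env = "[?V, ?S, inb, vcoins bs]"
  let ?DV = "vlist (map ?dec (visible I P))" and ?DO = "vlist (map ?dec (own I P))"
  let ?Z = "vlist (map2 VCons (map vnat (tags I M \<sigma> P)) (map vbool bs))"
  have own: "set (own I P) \<subseteq> D" and vis: "set (visible I P) \<subseteq> D" using set_own[OF P] set_visible by auto
  have 1: "eval (DECIDED M (Var 0)) ?env = ?DV" by (rule eval_DECIDED) simp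
  have 2: "eval (DECIDED M (RECS (Var 2))) (?DV # ?env) = ?DO" by (rule eval_DECIDED[OF RECS_vstates]) simp
  have 3: "eval (ZIP (TAGS M (Var 0)) (Var 5)) (?DO # ?DV # ?env) = ?Z"
  proof -
    have t: "eval (TAGS M (Var 0)) (?DO # ?DV # ?env) = vnats (tags I M \<sigma> P)"
      by (rule eval_TAGS[where lh = lh and rd = rd and sl = sl]) simp
    show ?thesis by (subst eval_ZIP) (simp_all add: t bs)
  qed
  have r: "raise_ok s0 ?env"
    unfolding raise_ok_def using decided_vstates[OF less_imp_le[OF t] \<sigma> vis] decided_vstates[OF less_imp_le[OF t] \<sigma> own]
    by (simp add: vstates_def)
  have main: "inbox_ok s0 (REGS (Var 5)) (Var 3) (Tail (Var 0)) (?dec d # ?Z # ?DO # ?DV # ?env) \<and>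
     cost (recv M) [field_of 8 (vtl (?dec d)),
       eval (INBOX M (REGS (Var 5)) (Var 3) (Tail (Var 0))) (?dec d # ?Z # ?DO # ?DV # ?env),
       eval (CHUNK (Var 1) (Tail (Var 0))) (?dec d # ?Z # ?DO # ?DV # ?env)] \<le> B s0"
    if d: "d \<in> set (own I P)" and nh: "\<nexists>a b. vhd (?dec d) = VCons a b" for d
  proof
    let ?env' = "?dec d # ?Z # ?DO # ?DV # ?env"
    have dD: "d \<in> D" using d own by blast
    have nh': "\<not> halted M (\<sigma> (nm d))" using nh by (simp add: halted_def)
    show "inbox_ok s0 (REGS (Var 5)) (Var 3) (Tail (Var 0)) ?env'"
      unfolding inbox_ok_def
    proof (intro ballI impI)
      fix y assume y: "y \<in> set (velems (eval (Var 3) ?env'))" "\<nexists>a b. vhd y = VCons a b"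
        "eval (ADJACENT (up (REGS (Var 5))) (Tail (Var 0)) (up (Tail (Var 0)))) (y # ?env') \<noteq> VNil"
      then obtain d' where d': "d' \<in> set (visible I P)" "y = ?dec d'" by auto
      have "eval (ADJACENT (up (REGS (Var 5))) (Tail (Var 0)) (up (Tail (Var 0)))) (y # ?env') = vbool (cgraph e lh (nm d') (nm d))"
        unfolding d'(2) by (rule inbox_message[where lh = lh, OF P d _ _ d'(1)]) simp_all
      with y(3) have "cgraph e lh (nm d') (nm d)" by simp
      moreover have "\<not> halted M (\<sigma> (nm d'))" using y(2) d'(2) by (simp add: halted_def)
      moreover have "nm d' < m * r" "nm d < m * r" using d' vis dD nm_less by blast+
      ultimately have "cost (send M) [\<sigma> (nm d'), vnat (nm d)] \<le> B s0" using mis_round(2)[OF t \<sigma>] by blast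
      then show "cost (send M) [field_of 8 (vtl y), field_of 0 (eval (Tail (Var 0)) ?env')] \<le> B s0"
        by (simp add: d'(2))
    qed
    have inb: "eval (INBOX M (REGS (Var 5)) (Var 3) (Tail (Var 0))) ?env' = inbox (m * r) (cgraph e lh) M \<sigma> (nm d)"
      by (rule eval_INBOX[where lh = lh and rd = rd and sl = sl, OF P d]) simp_all
    have ch: "eval (CHUNK (Var 1) (Tail (Var 0))) ?env' = vcoins (chunk (tags I M \<sigma> P) bs (nm d))"
      by (rule eval_CHUNK) simp_all
    \<comment> \<open>The cost bound speaks of outcomes of a toss for the whole graph. The coins of
      the one vertex \<open>d\<close> are extended to such an outcome, with arbitrary coins of the
      right number elsewhere.\<close>
    define \<omega> where "\<omega> x = (if x < m * r then if x = nm d then chunk (tags I M \<sigma> P) bs (nm d)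
      else replicate (length (velems (eval (coins M) [\<sigma> x]))) True else [])" for x
    have "length (chunk (tags I M \<sigma> P) bs (nm d)) = length (velems (eval (coins M) [\<sigma> (nm d)]))"
      using length_chunk[OF distinct_own[OF P], of "nm d" bs "vertex_coins M \<sigma>"] d bs nh'
      by (simp add: tags_eq vertex_coins_def)
    then have "\<omega> \<in> set_pmf (toss (m * r) M \<sigma>)"
      unfolding set_toss by (auto simp: PiE_dflt_def \<omega>_def)
    from mis_round(3)[OF t \<sigma> nm_less[OF dD] nh' this] nm_less[OF dD]
    show "cost (recv M) [field_of 8 (vtl (?dec d)), eval (INBOX M (REGS (Var 5)) (Var 3) (Tail (Var 0))) ?env',
       eval (CHUNK (Var 1) (Tail (Var 0))) ?env'] \<le> B s0"
      unfolding inb ch by (simp add: \<omega>_def)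
  qed
  show ?thesis
    unfolding simulate_ok_def Let_def 1 2 3
    using r coins_decided[OF t \<sigma> own] main by (auto simp del: eval_IS_PAIR)
qed

lemma recv_ok:
  assumes P: "P < m" and sh: "shape ph t e lh \<sigma> rd sl" and bs: "ph = 0 \<Longrightarrow> 0 < t \<Longrightarrow> t \<le> tm \<Longrightarrow> length bs = length (tags I M \<sigma> P)"
  shows "recv_ok s0 [pstate I (registers I b tm ph t s e) lh (\<lambda>d. \<sigma> (nm d)) rd sl P,
    messages (registers I b tm ph t s e) lh (\<lambda>d. \<sigma> (nm d)) rd sl P, vcoins bs]"
proof -
  let ?S = "pstate I (registers I b tm ph t s e) lh (\<lambda>d. \<sigma> (nm d)) rd sl P"
  let ?mg = "messages (registers I b tm ph t s e) lh (\<lambda>d. \<sigma> (nm d)) rd sl P"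
  let ?V = "vstates lh (\<lambda>d. \<sigma> (nm d)) rd sl (visible I P)"
  let ?env = "[?V, ?S, ?mg, vcoins bs]"
  have own: "set (own I P) \<subseteq> D" and vis: "set (visible I P) \<subseteq> D" using set_own[OF P] set_visible by auto
  have V: "eval VISIBLE [?S, ?mg, vcoins bs] = ?V" by (rule eval_VISIBLE[OF P])
  have R: "eval (REGS (Var 1)) ?env = registers I b tm ph t s e" by simp
  have c: "eval (Equal (FIELD 0 (REGS (Var 1))) (Numeral 0)) ?env = vbool (ph = 0)"
    "eval (Equal (FIELD 1 (REGS (Var 1))) (Numeral 0)) ?env = vbool (t = 0)"
    "eval (Less (FIELD 7 (REGS (Var 1))) (FIELD 1 (REGS (Var 1)))) ?env = vbool (tm < t)"
    by (simp_all only: eval.simps eval_FIELD_of R) (simp_all add: vless_def)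
  have "setup_ok s0 ?env"
    unfolding setup_ok_def
  proof
    fix x assume "x \<in> set (velems (eval (RECS (Var 1)) ?env))"
    then obtain d where d: "d \<in> set (own I P)" "x = irecord I (lh d) (\<sigma> (nm d)) (rd d) (sl d) d" by auto
    have "nm d < m * r" using d(1) own nm_less by blast
    from mis_start[OF this] show "cost (start M) [eval SETUP_INPUT (x # ?env)] \<le> B s0"
      unfolding d(2) setup_input[OF P d(1), where ms = "\<lambda>d. \<sigma> (nm d)"] .
  qed
  moreover have "raise_ok s0 ?env" if h: "ph = 0" "tm < t"
  proof -
    have "t - 1 \<le> tm" "\<sigma> \<in> set_pmf (simulation e lh (t - 1))" using sh h by (auto simp: shape_def)
    from decided_vstates[OF this vis] decided_vstates[OF this own] show ?thesis
      unfolding raise_ok_def by (simp add: vstates_def)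
  qed
  moreover have "simulate_ok s0 ?env" if h: "ph = 0" "0 < t" "t \<le> tm"
  proof -
    have "t - 1 < tm" "\<sigma> \<in> set_pmf (simulation e lh (t - 1))" using sh h by (auto simp: shape_def)
    then show ?thesis by (rule simulate_ok[OF P _ _ bs[OF h]])
  qed
  ultimately show ?thesis unfolding recv_ok_def Let_def V c by auto
qed

lemma coins_scheduler:
  assumes P: "P < m" and sh: "shape ph t e lh \<sigma> rd sl"
    and c: "eval SIMULATING [pstate I (registers I b tm ph t s e) lh (\<lambda>d. \<sigma> (nm d)) rd sl P] \<noteq> VNil"
  shows "decided_ok s0 (eval (RECS (Var 0)) [pstate I (registers I b tm ph t s e) lh (\<lambda>d. \<sigma> (nm d)) rd sl P])"
    "coins_ok s0 (eval (DECIDED M (RECS (Var 0))) [pstate I (registers I b tm ph t s e) lh (\<lambda>d. \<sigma> (nm d)) rd sl P])"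
proof -
  let ?S = "pstate I (registers I b tm ph t s e) lh (\<lambda>d. \<sigma> (nm d)) rd sl P"
  have own: "set (own I P) \<subseteq> D" using set_own[OF P] by auto
  have "ph = 0" "0 < t" "t \<le> tm" using c by (auto simp: vless_def split: if_splits)
  then have t: "t - 1 < tm" and \<sigma>: "\<sigma> \<in> set_pmf (simulation e lh (t - 1))" using sh by (auto simp: shape_def)
  show "decided_ok s0 (eval (RECS (Var 0)) [?S])"
    using decided_vstates[OF less_imp_le[OF t] \<sigma> own] by (simp add: vstates_def)
  have "eval (DECIDED M (RECS (Var 0))) [?S] = vlist (map (\<lambda>d. VCons (eval (decide M) [\<sigma> (nm d)])
    (irecord I (lh d) (\<sigma> (nm d)) (rd d) (sl d) d)) (own I P))"
    by (rule eval_DECIDED[OF RECS_vstates]) simp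
  with coins_decided[OF t \<sigma> own] show "coins_ok s0 (eval (DECIDED M (RECS (Var 0))) [?S])" by simp
qed

text \<open>The number of coins of a vertex is the length of a list that was computed at bounded
  cost.\<close>

lemma length_coins:
  assumes P: "P < m" and sh: "shape ph t e lh \<sigma> rd sl"
    and bs: "length bs = length (velems (eval (COINS M) [pstate I (registers I b tm ph t s e) lh (\<lambda>d. \<sigma> (nm d)) rd sl P]))"
  shows "ph = 0 \<Longrightarrow> 0 < t \<Longrightarrow> t \<le> tm \<Longrightarrow> length bs = length (tags I M \<sigma> P)" "length bs \<le> s0 * B s0"
proof -
  show 1: "length bs = length (tags I M \<sigma> P)" if h: "ph = 0" "0 < t" "t \<le> tm"
    unfolding bs h(1) using h eval_COINS[of t tm M s e lh \<sigma> rd sl P] by simp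
  show "length bs \<le> s0 * B s0"
  proof (cases "ph \<noteq> 0 \<or> t = 0 \<or> tm < t")
    case True
    then show ?thesis unfolding bs using eval_COINS_Nil[OF True] by simp
  next
    case False
    then have t: "t - 1 < tm" and \<sigma>: "\<sigma> \<in> set_pmf (simulation e lh (t - 1))" using sh by (auto simp: shape_def)
    have "vertex_coins M \<sigma> (nm d) \<le> B s0" if "d \<in> set (own I P)" for d
    proof (cases "halted M (\<sigma> (nm d))")
      case nh: False
      have "nm d < m * r" using that set_own[OF P] nm_less by blast
      from mis_round(1)[OF t \<sigma> this nh] show ?thesis
        using order_trans[OF length_velems vsize_eval_le_cost[of "coins M" "[\<sigma> (nm d)]"]] by (simp add: vertex_coins_def)
    qed (simp add: vertex_coins_def)
    then have "(\<Sum>d\<leftarrow>own I P. vertex_coins M \<sigma> (nm d)) \<le> length (own I P) * B s0" by (rule sum_list_le_length)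
    also have "\<dots> \<le> s0 * B s0" by (rule mult_le_mono1[OF length_own])
    finally have "length (tags I M \<sigma> P) \<le> s0 * B s0" by (simp add: tags_def length_concat comp_def)
    then show ?thesis using 1 False by simp
  qed
qed

definition recv_bound :: "nat \<Rightarrow> nat" where
  "recv_bound s = state_bound s + (1 + s * (1 + (2 + state_bound s))) + (1 + s * B s * (1 + 1))"

lemma reachable_state:
  assumes "t \<le> K * (tm + 3)" "c \<in> set_pmf (scheduled t)" "P < m"
  shows "vsize (c P) \<le> state_bound s0"
    "eval SIMULATING [c P] \<noteq> VNil \<Longrightarrow>
     decided_ok s0 (eval (RECS (Var 0)) [c P]) \<and> coins_ok s0 (eval (DECIDED M (RECS (Var 0))) [c P])"
proof -
  obtain ph t s e lh \<sigma> rd sl where c: "c = config tm (registers I b tm ph t s e) lh (\<lambda>d. \<sigma> (nm d)) rd sl"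
    and sh: "shape ph t e lh \<sigma> rd sl" using reachable[OF assms(1,2)] unfolding shaped_def by blast
  have cP: "c P = pstate I (registers I b tm ph t s e) lh (\<lambda>d. \<sigma> (nm d)) rd sl P" using assms(3) by (simp add: c config_def)
  show "vsize (c P) \<le> state_bound s0" unfolding cP by (rule vsize_state[OF assms(3) sh])
  show "eval SIMULATING [c P] \<noteq> VNil \<Longrightarrow>
     decided_ok s0 (eval (RECS (Var 0)) [c P]) \<and> coins_ok s0 (eval (DECIDED M (RECS (Var 0))) [c P])"
    unfolding cP using coins_scheduler[OF assms(3) sh] by blast
qed

lemma reachable_recv:
  assumes "t \<le> K * (tm + 3)" "c \<in> set_pmf (scheduled t)" "P < m" "\<not> halted (scheduler M b) (c P)"
    and \<omega>: "\<omega> \<in> set_pmf (toss m (scheduler M b) c)"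
  shows "sum_list (map vsize [c P, inbox m (communicate I) (scheduler M b) c P, vcoins (\<omega> P)]) \<le> recv_bound s0"
    "recv_ok s0 [c P, inbox m (communicate I) (scheduler M b) c P, vcoins (\<omega> P)]"
proof -
  obtain ph t s e lh \<sigma> rd sl where c: "c = config tm (registers I b tm ph t s e) lh (\<lambda>d. \<sigma> (nm d)) rd sl"
    and sh: "shape ph t e lh \<sigma> rd sl" using reachable[OF assms(1,2)] unfolding shaped_def by blast
  have cP: "c Q = pstate I (registers I b tm ph t s e) lh (\<lambda>d. \<sigma> (nm d)) rd sl Q" if "Q < m" for Q
    using that by (simp add: c config_def)
  have "ph \<noteq> 2" using assms(3,4) by (simp add: cP halted_scheduler)
  then have mg: "inbox m (communicate I) (scheduler M b) c P = messages (registers I b tm ph t s e) lh (\<lambda>d. \<sigma> (nm d)) rd sl P"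
    unfolding c by (rule inbox_config[OF _ assms(3)])
  have "length (\<omega> P) = length (velems (eval (coins (scheduler M b)) [c P]))"
    using \<omega> assms(3) unfolding set_toss by (auto simp: PiE_dflt_def)
  then have "length (\<omega> P) = length (velems (eval (COINS M) [pstate I (registers I b tm ph t s e) lh (\<lambda>d. \<sigma> (nm d)) rd sl P]))"
    by (simp add: cP[OF assms(3)] scheduler_def)
  note bs = length_coins[OF assms(3) sh this]
  show "recv_ok s0 [c P, inbox m (communicate I) (scheduler M b) c P, vcoins (\<omega> P)]"
    unfolding mg cP[OF assms(3)] by (rule recv_ok[OF assms(3) sh bs(1)])
  have "vsize (c P) \<le> state_bound s0" by (rule reachable_state[OF assms(1-3)])
  moreover have "vsize (messages (registers I b tm ph t s e) lh (\<lambda>d. \<sigma> (nm d)) rd sl P) \<le> 1 + s0 * (1 + (2 + state_bound s0))"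
    unfolding messages_def
  proof (rule vsize_vlist_map_le)
    have "length (filter (\<lambda>q. communicate I q P) [0..<m]) \<le> m" using length_filter_le[of _ "[0..<m]"] by simp
    then show "length (filter (\<lambda>q. communicate I q P) [0..<m]) \<le> s0" using size_bounds(2) by linarith
    fix q assume "q \<in> set (filter (\<lambda>q. communicate I q P) [0..<m])"
    then show "vsize (VCons (vnat q) (pstate I (registers I b tm ph t s e) lh (\<lambda>d. \<sigma> (nm d)) rd sl q)) \<le> 2 + state_bound s0"
      using vsize_state[OF _ sh, of q] by simp
  qed
  moreover have "vsize (vcoins (\<omega> P)) \<le> 1 + s0 * B s0 * (1 + 1)"
    by (rule vsize_vlist_map_le) (use bs(2) in simp_all)
  ultimately show "sum_list (map vsize [c P, inbox m (communicate I) (scheduler M b) c P, vcoins (\<omega> P)]) \<le> recv_bound s0"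
    unfolding mg by (simp add: recv_bound_def)
qed

lemma vsize_proc_input: "vsize (proc_input I tm P) \<le> 40 + s0 * (10 + s0 * (s0 * 4))"
proof -
  have "vsize (vtree I j) \<le> 1 + s0 * s0 * (1 + 3)" for j
  proof -
    have "length (edge_list I j) \<le> n * n"
    proof -
      have "length (concat (map (\<lambda>v. if u < v \<and> {u, v} \<in> tree_edges I j then [(u, v)] else []) [0..<n])) \<le> length [0..<n] * 1" for u
        unfolding length_concat map_map comp_def by (rule sum_list_le_length) simp
      then have "length (edge_list I j) \<le> length [0..<n] * n"
        unfolding edge_list_def length_concat map_map comp_def by (intro sum_list_le_length) simp
      then show ?thesis by simp
    qed
    also have "n * n \<le> s0 * s0" by (intro mult_le_mono size_bounds)
    finally show ?thesis unfolding vtree_eq by (intro vsize_vlist_map_le) (simp_all add: vpair_def)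
  qed
  then have "vsize (vlist (map (\<lambda>j. VCons (vnat j) (vtree I j)) (filter (\<lambda>j. j \<in> Acc I P) [0..<r])))
    \<le> 1 + s0 * (1 + (3 + s0 * s0 * (1 + 3)))"
  proof (intro vsize_vlist_map_le)
    have "length (filter (\<lambda>j. j \<in> Acc I P) [0..<r]) \<le> r" using length_filter_le[of _ "[0..<r]"] by simp
    then show "length (filter (\<lambda>j. j \<in> Acc I P) [0..<r]) \<le> s0" using size_bounds(3) by linarith
  qed simp
  then show ?thesis by (simp add: proc_input_def algebra_simps)
qed

end

text \<open>Every valid problem has a vertex and a processor, hence size at least 2, which allows s
  + 2 to be replaced by 2 s. Taking c as \<open>2 ^ k\<close> makes it large enough both as a factor
  and as an exponent.\<close>

lemma poly_fun_bound: assumes "poly_fun f" shows "\<exists>c. \<forall>s\<ge>2. f s \<le> c * s ^ c + c"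
proof -
  obtain k where k: "\<And>s. f s \<le> (s + 2) ^ k" using assms by (auto simp: poly_fun_def)
  have "f s \<le> 2 ^ k * s ^ (2 ^ k) + 2 ^ k" if "s \<ge> 2" for s
  proof -
    have "f s \<le> (s + 2) ^ k" by (rule k)
    also have "\<dots> \<le> (2 * s) ^ k" using that by (intro power_mono) auto
    also have "\<dots> = 2 ^ k * s ^ k" by (rule power_mult_distrib)
    also have "\<dots> \<le> 2 ^ k * s ^ (2 ^ k)"
      using that less_exp[of k] by (intro mult_le_mono2 power_increasing) auto
    finally show ?thesis by simp
  qed
  then show ?thesis by blast
qed

lemma polyon_bound: "polyon X e \<Longrightarrow> \<exists>k. \<forall>s env. (s, env) \<in> X \<longrightarrow> cost e env \<le> (s + 2) ^ k"
  unfolding polyon_def pbd_def by fastforce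

text \<open>The environments of all valid problems are collected in common sets before a bound is
  extracted, so the resulting constant is the same for all of them.\<close>

theorem scheduler_cost:
  assumes c0: "\<And>N adj. simple_graph N adj \<Longrightarrow> local_cost_bounded N adj (mis_input N adj) M (T N) (c0 * N ^ c0 + c0)"
    and b: "0 < b"
  shows "\<exists>c. \<forall>I. valid_problem I \<longrightarrow> local_cost_bounded (num_procs I) (communicate I)
     (proc_input I (T (num_procs I * num_trees I))) (scheduler M b)
     (setting.K I b * (T (num_procs I * num_trees I) + 3)) (c * problem_size I ^ c + c)"
proof -
  \<comment> \<open>The simulated graph has m r vertices, at most the square of the problem
    size.\<close>
  define B where "B s = c0 * (s * s) ^ c0 + c0" for s :: nat
  have B: "poly_fun B" unfolding B_def by (intro poly_fun_intros)
  interpret bounded_calls M B by unfold_locales (rule B)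
  define tm where "tm I = T (num_procs I * num_trees I)" for I :: throughput_problem
  have costed: "costed I b M B (tm I)" if "valid_problem I" for I
  proof -
    have "num_procs I * num_trees I \<le> problem_size I * problem_size I"
      by (intro mult_le_mono) (simp_all add: problem_size_def)
    then have "c0 * (num_procs I * num_trees I) ^ c0 + c0 \<le> B (problem_size I)"
      unfolding B_def by (intro add_mono mult_le_mono2 power_mono) simp_all
    then show ?thesis
      by unfold_locales (use that b local_cost_bounded_mono[OF c0] in \<open>auto simp: tm_def\<close>)
  qed
  let ?run = "\<lambda>I. run (num_procs I) (communicate I) (proc_input I (tm I)) (scheduler M b)"
  let ?R = "\<lambda>I. setting.K I b * (tm I + 3)"
  define S where "S s = 29 + s * (48 + 4 * s + B s)" for s
  have S: "poly_fun S" unfolding S_def by (intro poly_fun_intros B)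
  define W where "W s = S s + (1 + s * (1 + (2 + S s))) + (1 + s * B s * (1 + 1))" for s
  have W: "poly_fun W" unfolding W_def by (intro poly_fun_intros B S)
  have SW: "costed.state_bound B s = S s" "costed.recv_bound B s = W s" if "costed I b M B (tm I)" for I s
    using costed.state_bound_def[OF that] costed.recv_bound_def[OF that] by (simp_all add: S_def W_def)
  \<comment> \<open>The environments of \<open>START\<close>, of \<open>DECIDE\<close> and
    \<open>COINS\<close>, and of \<open>RECV\<close>, in this order. Messages are plain states, so
    sending is covered by the size of states.\<close>
  define X1 where "X1 = {(problem_size I, [proc_input I (tm I) P]) | I P. valid_problem I \<and> P < num_procs I}"
  define X2 where "X2 = {(problem_size I, [\<sigma> P]) | I P t \<sigma>.
     valid_problem I \<and> P < num_procs I \<and> t \<le> ?R I \<and> \<sigma> \<in> set_pmf (?run I t)}"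
  define X3 where "X3 = {(problem_size I, [\<sigma> P, inbox (num_procs I) (communicate I) (scheduler M b) \<sigma> P, vcoins (\<omega> P)]) | I P t \<sigma> \<omega>.
     valid_problem I \<and> P < num_procs I \<and> t \<le> ?R I \<and> \<sigma> \<in> set_pmf (?run I t) \<and> \<not> halted (scheduler M b) (\<sigma> P) \<and>
     \<omega> \<in> set_pmf (toss (num_procs I) (scheduler M b) \<sigma>)}"
  have p1: "psz X1"
  proof (rule psz_le)
    show "poly_fun (\<lambda>s. 40 + s * (10 + s * (s * 4)))" by (intro poly_fun_intros)
  qed (use costed.vsize_proc_input[OF costed] in \<open>auto simp: X1_def\<close>)
  have p2: "psz X2"
  proof (rule psz_le[OF S])
    fix s env assume "(s, env) \<in> X2"
    then obtain I P t \<sigma> where *: "s = problem_size I" "env = [\<sigma> P]" "valid_problem I" "P < num_procs I" "t \<le> ?R I"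
      "\<sigma> \<in> set_pmf (?run I t)" unfolding X2_def by blast
    show "sum_list (map vsize env) \<le> S s"
      using costed.reachable_state(1)[OF costed[OF *(3)] *(5,6,4)] SW(1)[OF costed[OF *(3)]] by (simp add: *(1,2))
  qed
  have p3: "psz X3"
  proof (rule psz_le[OF W])
    fix s env assume "(s, env) \<in> X3"
    then obtain I P t \<sigma> \<omega> where *: "s = problem_size I" "valid_problem I" "P < num_procs I" "t \<le> ?R I"
      "env = [\<sigma> P, inbox (num_procs I) (communicate I) (scheduler M b) \<sigma> P, vcoins (\<omega> P)]"
      "\<sigma> \<in> set_pmf (?run I t)" "\<not> halted (scheduler M b) (\<sigma> P)" "\<omega> \<in> set_pmf (toss (num_procs I) (scheduler M b) \<sigma>)"
      unfolding X3_def by blast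
    show "sum_list (map vsize env) \<le> W s"
      using costed.reachable_recv(1)[OF costed[OF *(2)] *(4,6,3,7,8)] unfolding SW(2)[OF costed[OF *(2)]] *(1,5) .
  qed
  have "polyon X1 START" by (rule polypD[OF polyp_START p1])
  then obtain k1 where k1: "\<And>s env. (s, env) \<in> X1 \<Longrightarrow> cost START env \<le> (s + 2) ^ k1" using polyon_bound by blast
  have "polyon X2 DECIDE" by (rule polypD[OF polyp_DECIDE p2])
  then obtain k2 where k2: "\<And>s env. (s, env) \<in> X2 \<Longrightarrow> cost DECIDE env \<le> (s + 2) ^ k2" using polyon_bound by blast
  have "polyon X2 (COINS M)"
  proof (rule polyon_COINS[OF p2], goal_cases)
    case (1 s env)
    then obtain I P t \<sigma> where *: "s = problem_size I" "env = [\<sigma> P]" "valid_problem I" "P < num_procs I" "t \<le> ?R I"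
      "\<sigma> \<in> set_pmf (?run I t)" unfolding X2_def by blast
    show ?case using 1(2) unfolding *(1,2) by (rule costed.reachable_state(2)[OF costed[OF *(3)] *(5,6,4)])
  qed
  then obtain k3 where k3: "\<And>s env. (s, env) \<in> X2 \<Longrightarrow> cost (COINS M) env \<le> (s + 2) ^ k3" using polyon_bound by blast
  have "polyon X3 (RECV M b)"
  proof (rule polyon_RECV[OF p3])
    fix s env assume "(s, env) \<in> X3"
    then obtain I P t \<sigma> \<omega> where *: "s = problem_size I" "valid_problem I" "P < num_procs I" "t \<le> ?R I"
      "env = [\<sigma> P, inbox (num_procs I) (communicate I) (scheduler M b) \<sigma> P, vcoins (\<omega> P)]"
      "\<sigma> \<in> set_pmf (?run I t)" "\<not> halted (scheduler M b) (\<sigma> P)" "\<omega> \<in> set_pmf (toss (num_procs I) (scheduler M b) \<sigma>)"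
      unfolding X3_def by blast
    show "recv_ok s env" unfolding *(1,5) by (rule costed.reachable_recv(2)[OF costed[OF *(2)] *(4,6,3,7,8)])
  qed
  then obtain k4 where k4: "\<And>s env. (s, env) \<in> X3 \<Longrightarrow> cost (RECV M b) env \<le> (s + 2) ^ k4" using polyon_bound by blast
  let ?f = "\<lambda>s. (s + 2) ^ k1 + (s + 2) ^ k2 + (s + 2) ^ k3 + (s + 2) ^ k4 + S s"
  have "poly_fun ?f" by (intro poly_fun_intros S)
  from poly_fun_bound[OF this] obtain c where c: "\<And>s. s \<ge> 2 \<Longrightarrow> ?f s \<le> c * s ^ c + c" by blast
  show ?thesis
  proof (intro exI[of _ c] allI impI)
    fix I assume I: "valid_problem I"
    interpret costed I b M B "tm I" by (rule costed[OF I])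
    have "2 \<le> problem_size I" using n_pos m_pos by (simp add: problem_size_def)
    note c = c[OF this]
    have "local_cost_bounded (num_procs I) (communicate I) (proc_input I (tm I)) (scheduler M b) (?R I) (?f (problem_size I))"
      unfolding local_cost_bounded_def
    proof (intro conjI allI impI ballI)
      show "cost (start (scheduler M b)) [proc_input I (tm I) P] \<le> ?f (problem_size I)" if "P < m" for P
      proof -
        have "(problem_size I, [proc_input I (tm I) P]) \<in> X1" unfolding X1_def using I that by blast
        from k1[rule_format, OF this] show ?thesis by (simp add: scheduler_def)
      qed
      show "cost (decide (scheduler M b)) [\<sigma> P] \<le> ?f (problem_size I)"
        if "t \<le> ?R I" "\<sigma> \<in> set_pmf (?run I t)" "P < m" for t \<sigma> P
        proof -
        have "(problem_size I, [\<sigma> P]) \<in> X2" unfolding X2_def using I that by blast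
        from k2[rule_format, OF this] show ?thesis by (simp add: scheduler_def)
      qed
      fix t \<sigma> P assume t: "t < ?R I" "\<sigma> \<in> set_pmf (?run I t)" "P < m" "\<not> halted (scheduler M b) (\<sigma> P)"
      have "(problem_size I, [\<sigma> P]) \<in> X2" unfolding X2_def using I t(2,3) less_imp_le[OF t(1)] by blast
      from k3[rule_format, OF this] show "cost (coins (scheduler M b)) [\<sigma> P] \<le> ?f (problem_size I)" by (simp add: scheduler_def)
      show "cost (send (scheduler M b)) [\<sigma> P, vnat q] \<le> ?f (problem_size I)" for q
        using reachable_state(1)[OF less_imp_le[OF t(1)] t(2,3)] SW(1)[OF costed[OF I]] by (simp add: scheduler_def)
      show "cost (recv (scheduler M b)) [\<sigma> P, inbox m (communicate I) (scheduler M b) \<sigma> P, vcoins (\<omega> P)] \<le> ?f (problem_size I)"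
        if "\<omega> \<in> set_pmf (toss m (scheduler M b) \<sigma>)" for \<omega>
      proof -
        have "(problem_size I, [\<sigma> P, inbox m (communicate I) (scheduler M b) \<sigma> P, vcoins (\<omega> P)]) \<in> X3"
          unfolding X3_def using I t(2-4) less_imp_le[OF t(1)] that by blast
        from k4[rule_format, OF this] show ?thesis by (simp add: scheduler_def)
      qed
    qed
    from local_cost_bounded_mono[OF this c]
    show "local_cost_bounded (num_procs I) (communicate I) (proc_input I (T (num_procs I * num_trees I))) (scheduler M b)
     (setting.K I b * (T (num_procs I * num_trees I) + 3)) (c * problem_size I ^ c + c)" by (simp add: tm_def)
  qed
qed

section \<open>The approximation theorem\<close>

lemma log1_ge_1: "1 \<le> log1 x"
  by (simp add: log1_def)

definition stages :: "real \<Rightarrow> nat" where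
  "stages \<epsilon> = nat \<lceil>44 * log1 (1 / \<epsilon>)\<rceil>"

text \<open>The factor 44 is 11 times 4. Eleven stages halve the slack, as
  \<open>(14 / 15) ^ 11\<close> is below 1/2. With y the power of 2 to
  \<open>log1 (1 / \<epsilon>)\<close>, which is at least 2 and at least 1/\<epsilon>, four halvings
  per unit of \<open>log1\<close> leave a slack of at most 1 / y^4, and y^4 >= 8 y >= 1 +
  7/\<epsilon>.\<close>

lemma stages:
  assumes "0 < \<epsilon>"
  shows "0 < stages \<epsilon>" "real (stages \<epsilon>) \<le> 45 * log1 (1 / \<epsilon>)" "(14 / 15) ^ stages \<epsilon> \<le> \<epsilon> / (7 + \<epsilon>)"
proof -
  let ?l = "log1 (1 / \<epsilon>)"
  have l: "1 \<le> ?l" by (rule log1_ge_1)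
  have s: "44 * ?l \<le> real (stages \<epsilon>)" "real (stages \<epsilon>) \<le> 44 * ?l + 1"
    using l by (auto simp: stages_def real_nat_ceiling_ge of_nat_nat ceiling_le_iff)
  show "0 < stages \<epsilon>" using s(1) l by (cases "stages \<epsilon>") auto
  show "real (stages \<epsilon>) \<le> 45 * ?l" using s(2) l by linarith
  define y where "y = 2 powr ?l"
  have y: "2 \<le> y" "1 / \<epsilon> \<le> y"
  proof -
    have "2 powr 1 \<le> y" unfolding y_def using l by (intro powr_mono) auto
    then show "2 \<le> y" by simp
    have "2 powr log 2 (1 / \<epsilon>) \<le> y" unfolding y_def by (intro powr_mono) (auto simp: log1_def)
    then show "1 / \<epsilon> \<le> y" using assms by simp
  qed
  have "(14 / 15) ^ stages \<epsilon> = (14 / 15) powr real (stages \<epsilon>)" by (simp add: powr_realpow)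
  also have "\<dots> \<le> (14 / 15) powr (11 * (4 * ?l))" using s(1) by (intro powr_mono') auto
  also have "\<dots> = ((14 / 15) ^ 11) powr (4 * ?l)"
    using powr_powr[of "14 / 15" 11 "4 * ?l"] powr_realpow[of "14 / 15" 11] by simp
  also have "\<dots> \<le> (1 / 2) powr (4 * ?l)" using l by (intro powr_mono2) (auto simp: power_divide)
  also have "\<dots> = 1 / y ^ 4" 
  proof -
    have "(1 / 2) powr (4 * ?l) = 1 / 2 powr (?l * 4)" by (simp add: powr_divide mult.commute)
    also have "2 powr (?l * 4) = y powr 4" unfolding y_def by (rule powr_powr[symmetric])
    also have "y powr 4 = y ^ 4" using powr_realpow[of y 4] y(1) by simp
    finally show ?thesis .
  qed
  also have "\<dots> \<le> 1 / (1 + 7 / \<epsilon>)"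
  proof (rule divide_left_mono)
    have "1 + 7 / \<epsilon> \<le> 1 + 7 * y" using y(2) by simp
    also have "\<dots> \<le> 8 * y" using y(1) by simp
    also have "\<dots> \<le> y ^ 3 * y" using power_mono[OF y(1), of 3] y(1) by (intro mult_right_mono) auto
    finally show "1 + 7 / \<epsilon> \<le> y ^ 4" by (simp add: power_numeral_reduce mult.assoc)
    have "0 < y ^ 4" "0 < 1 + 7 / \<epsilon>" using y(1) assms by (auto intro: add_pos_pos)
    then show "0 < y ^ 4 * (1 + 7 / \<epsilon>)" by simp
  qed simp
  also have "\<dots> = \<epsilon> / (7 + \<epsilon>)" using assms by (simp add: field_simps)
  finally show "(14 / 15) ^ stages \<epsilon> \<le> \<epsilon> / (7 + \<epsilon>)" .
qed

section \<open>Counting steps and deriving the approximation ratio\<close>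

context setting
begin

lemma num_epochs_le: "real E \<le> 3 * log1 (real n)"
proof -
  have "2 ^ (E - 1) \<le> n\<^sup>2" using E_least[of "E - 1"] E_pos by simp
  then have "(2 :: real) ^ (E - 1) \<le> (real n)\<^sup>2" by (metis of_nat_le_iff of_nat_numeral of_nat_power)
  then have "log 2 (2 ^ (E - 1)) \<le> log 2 ((real n)\<^sup>2)" using n_pos by (intro log_mono) auto
  then have "real (E - 1) \<le> 2 * log 2 (real n)" using n_pos by (simp add: log_nat_power)
  moreover have "log 2 (real n) \<le> log1 (real n)" "1 \<le> log1 (real n)" by (simp_all add: log1_def)
  ultimately show ?thesis using E_pos by linarith
qed

lemma num_steps_le: "real L \<le> 2 * log1 (p_max I / p_min I)"
proof -
  have "p_min I * 2 ^ (L - 1) \<le> p_max I" using L_least[of "L - 1"] L_pos by simp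
  then have "2 ^ (L - 1) \<le> p_max I / p_min I" using p_min_pos by (simp add: field_simps)
  then have "log 2 (2 ^ (L - 1)) \<le> log 2 (p_max I / p_min I)" using p_min_pos p_min_le_max by (intro log_mono) auto
  then have "real (L - 1) \<le> log 2 (p_max I / p_min I)" by (simp add: log_nat_power)
  moreover have "log 2 (p_max I / p_min I) \<le> log1 (p_max I / p_min I)" "1 \<le> log1 (p_max I / p_min I)"
    by (simp_all add: log1_def)
  ultimately show ?thesis using L_pos by linarith
qed

text \<open>The factor 270 is 3 * 45 * 2, for epochs, stages and steps of a stage.\<close>

lemma K_le: assumes "real b \<le> 45 * log1 (1 / \<epsilon>)" shows "real K \<le> 270 * num_phases \<epsilon> I"
proof -
  have "real K = real E * real b * real L" by (simp add: K_def)
  also have "\<dots> \<le> (3 * log1 (real n)) * (45 * log1 (1 / \<epsilon>)) * (2 * log1 (p_max I / p_min I))"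
    using num_epochs_le num_steps_le assms log1_ge_1[of "real n"] log1_ge_1[of "1 / \<epsilon>"]
    by (intro mult_mono) auto
  finally show ?thesis by (simp add: num_phases_def algebra_simps)
qed

lemma good_ratio:
  assumes "good K G" "0 < \<epsilon>" "(14 / 15) ^ b \<le> \<epsilon> / (7 + \<epsilon>)"
  shows "opt_profit I / (7 + \<epsilon>) \<le> total_profit I (selected G K)"
proof -
  have "feasible I {}" by (simp add: feasible_def)
  from opt_profit_attained(2)[OF valid this] have opt: "0 \<le> opt_profit I" by (simp add: total_profit_def)
  have "7 / (7 + \<epsilon>) = 1 - \<epsilon> / (7 + \<epsilon>)" using assms(2) by (simp add: field_simps)
  also have "\<dots> \<le> 1 - (14 / 15) ^ b" using assms(3) by simp
  finally have "7 / (7 + \<epsilon>) * opt_profit I \<le> (1 - (14 / 15) ^ b) * opt_profit I"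
    by (rule mult_right_mono) (rule opt)
  also have "\<dots> \<le> 7 * total_profit I (selected G K)" by (rule good_success(2)[OF assms(1)])
  finally show ?thesis by simp
qed

end

theorem theorem1:
  shows "\<exists>C>0. \<forall>\<epsilon>>0. \<forall>M T \<delta>. mis_algorithm M T \<delta> \<longrightarrow>
    (\<exists>A. (deterministic M \<longrightarrow> deterministic A) \<and>
      (\<exists>c. \<forall>I. valid_problem I \<longrightarrow> (let N = num_procs I * num_trees I in
        \<exists>R. real R \<le> C * real (max 1 (T N)) * num_phases \<epsilon> I \<and>
          local_cost_bounded (num_procs I) (communicate I) (proc_input I (T N)) A R
            (c * problem_size I ^ c + c) \<and>
          (\<forall>\<sigma>\<in>set_pmf (run_on I (T N) A R). \<forall>P<num_procs I. halted A (\<sigma> P)) \<and>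
          measure_pmf.prob (run_on I (T N) A R)
            {\<sigma>. feasible I (solution_of I A \<sigma>) \<and>
                 total_profit I (solution_of I A \<sigma>) \<ge> opt_profit I / (7 + \<epsilon>)}
            \<ge> 1 - C * num_phases \<epsilon> I * \<delta> N)))"
proof (intro exI[of _ "1080 :: real"] conjI allI impI)
  fix \<epsilon> :: real and M T \<delta>
  assume \<epsilon>: "0 < \<epsilon>" and M: "mis_algorithm M T \<delta>"
  let ?b = "stages \<epsilon>"
  let ?A = "scheduler M ?b"
  from M obtain c0 where c0: "\<And>N adj. simple_graph N adj \<Longrightarrow>
      local_cost_bounded N adj (mis_input N adj) M (T N) (c0 * N ^ c0 + c0)"
    unfolding mis_algorithm_def by blast
  obtain c where c: "\<And>I. valid_problem I \<Longrightarrow> local_cost_bounded (num_procs I) (communicate I)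
     (proc_input I (T (num_procs I * num_trees I))) ?A
     (setting.K I ?b * (T (num_procs I * num_trees I) + 3)) (c * problem_size I ^ c + c)"
    using scheduler_cost[OF c0 stages(1)[OF \<epsilon>]] by blast
  show "\<exists>A. (deterministic M \<longrightarrow> deterministic A) \<and>
      (\<exists>c. \<forall>I. valid_problem I \<longrightarrow> (let N = num_procs I * num_trees I in
        \<exists>R. real R \<le> 1080 * real (max 1 (T N)) * num_phases \<epsilon> I \<and>
          local_cost_bounded (num_procs I) (communicate I) (proc_input I (T N)) A R
            (c * problem_size I ^ c + c) \<and>
          (\<forall>\<sigma>\<in>set_pmf (run_on I (T N) A R). \<forall>P<num_procs I. halted A (\<sigma> P)) \<and>
          measure_pmf.prob (run_on I (T N) A R)
            {\<sigma>. feasible I (solution_of I A \<sigma>) \<and>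
                 total_profit I (solution_of I A \<sigma>) \<ge> opt_profit I / (7 + \<epsilon>)}
            \<ge> 1 - 1080 * num_phases \<epsilon> I * \<delta> N))"
    unfolding Let_def
  proof (rule exI[of _ ?A], rule conjI[OF impI], erule deterministic_scheduler, rule exI[of _ c], intro allI impI)
    fix I :: throughput_problem assume I: "valid_problem I"
    let ?N = "num_procs I * num_trees I"
    let ?t = "T ?N"
    interpret setting I ?b by unfold_locales (use I stages(1)[OF \<epsilon>] in auto)
    have phases: "0 \<le> num_phases \<epsilon> I"
      unfolding num_phases_def using order_trans[OF zero_le_one log1_ge_1] by (intro mult_nonneg_nonneg) auto
    have K: "real K \<le> 270 * num_phases \<epsilon> I" by (rule K_le[OF stages(2)[OF \<epsilon>]])
    have prob: "measure_pmf.prob (run ?N adj (mis_input ?N adj) M ?t) {\<sigma>. mis_success ?N adj M \<sigma>} \<ge> 1 - \<delta> ?N"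
      if "simple_graph ?N adj" for adj
      using M that unfolding mis_algorithm_def by blast
    \<comment> \<open>Nonnegativity is not part of the specification of \<delta>. It follows from
      the existence of a graph with \<open>?N\<close> vertices, because probabilities are at most
      1.\<close>
    have \<delta>: "0 \<le> \<delta> ?N"
    proof -
      have "simple_graph ?N (\<lambda>_ _. False)" by (simp add: simple_graph_def)
      from order_trans[OF prob[OF this] measure_pmf.prob_le_1] show ?thesis by simp
    qed
    show "\<exists>R. real R \<le> 1080 * real (max 1 ?t) * num_phases \<epsilon> I \<and>
          local_cost_bounded (num_procs I) (communicate I) (proc_input I ?t) ?A R
            (c * problem_size I ^ c + c) \<and>
          (\<forall>\<sigma>\<in>set_pmf (run_on I ?t ?A R). \<forall>P<num_procs I. halted ?A (\<sigma> P)) \<and>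
          measure_pmf.prob (run_on I ?t ?A R)
            {\<sigma>. feasible I (solution_of I ?A \<sigma>) \<and>
                 total_profit I (solution_of I ?A \<sigma>) \<ge> opt_profit I / (7 + \<epsilon>)}
            \<ge> 1 - 1080 * num_phases \<epsilon> I * \<delta> ?N"
    proof (intro exI[of _ "K * (?t + 3)"] conjI ballI allI impI)
      \<comment> \<open>Each of the \<open>K\<close> steps takes \<open>?t + 2\<close> rounds of
        raising and one of selection. As \<open>?t + 3\<close> is at most four times
        \<open>max 1 ?t\<close>, the constant is 4 * 270 = 1080.\<close>
      have "real (K * (?t + 3)) \<le> real K * (4 * real (max 1 ?t))"
        unfolding of_nat_mult by (intro mult_left_mono) auto
      also have "\<dots> \<le> (270 * num_phases \<epsilon> I) * (4 * real (max 1 ?t))"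
        by (intro mult_right_mono K) simp
      finally show "real (K * (?t + 3)) \<le> 1080 * real (max 1 ?t) * num_phases \<epsilon> I" by (simp add: algebra_simps)
      show "local_cost_bounded (num_procs I) (communicate I) (proc_input I ?t) ?A (K * (?t + 3)) (c * problem_size I ^ c + c)"
        by (rule c[OF I])
      show "halted ?A (\<sigma> P)" if "\<sigma> \<in> set_pmf (run_on I ?t ?A (K * (?t + 3)))" "P < m" for \<sigma> P
        by (rule halted_final[OF that])
      have "1 - 1080 * num_phases \<epsilon> I * \<delta> ?N \<le> 1 - real K * \<delta> ?N"
        using mult_right_mono[of "real K" "1080 * num_phases \<epsilon> I", OF _ \<delta>] K phases by simp
      also have "\<dots> \<le> measure_pmf.prob (process M ?t K) {G. good K G}"
        by (rule prob_good[OF prob \<delta>])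
      also have "\<dots> \<le> measure_pmf.prob (process M ?t K) (select_config ?t K -` {\<sigma>. feasible I (solution_of I ?A \<sigma>) \<and>
                 total_profit I (solution_of I ?A \<sigma>) \<ge> opt_profit I / (7 + \<epsilon>)})"
        using good_success(1) good_ratio[OF _ \<epsilon> stages(3)[OF \<epsilon>]]
        by (intro measure_pmf.finite_measure_mono) (auto simp: solution_final)
      finally show "measure_pmf.prob (run_on I ?t ?A (K * (?t + 3)))
            {\<sigma>. feasible I (solution_of I ?A \<sigma>) \<and>
                 total_profit I (solution_of I ?A \<sigma>) \<ge> opt_profit I / (7 + \<epsilon>)}
            \<ge> 1 - 1080 * num_phases \<epsilon> I * \<delta> ?N"
        unfolding run_total by simp
    qed
  qed
qed simp

end
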